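(* For points $\underline x=(\underline R,x)$ of the framed crystalline prismatization $\mathcal S_{\widetilde{\mathrm{cp}}}$ and sections $\tilde\beta\in\mathbb J_{\mathrm{BK}}(\underline x)$, the association $$\tilde\beta\longmapsto\tilde\beta^*(\varphi_{\underline x}):=\tilde\beta^{-1}\circ\varphi_{\underline x}\circ\varphi^*(\tilde\beta)\in\mathcal G(\mathfrak S_R[1/E])$$ defines a morphism $\xi^\sharp_{\mathrm{BK}}:\mathbb J_{\mathrm{BK}}\to\mathbf C^{\tilde\mu}_{\mathrm{BK}}$ of spaces over $W_{\mathrm{cp}}$, which is $\mathcal L^+_{\mathrm{BK}}\mathcal G$-equivariant and hence induces a morphism of stacks over $W_{\mathrm{cp}}$ $$\xi_{\mathrm{BK}}:\mathcal S_{\widetilde{\mathrm{cp}}}\longrightarrow[\mathbf C^{\tilde\mu}_{\mathrm{BK}}/\mathrm{Ad}_\varphi\mathcal L^+_{\mathrm{BK}}\mathcal G].$$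
   Context: **Shimura setup.** $p\ge3$ is a prime. $(\mathbf G,\mathbf X)$ is a Shimura datum of Hodge type, $\mathcal G$ a reductive group scheme over $\mathbb Z_p$ with generic fibre $\mathbf G_{\mathbb Q_p}$; an embedding $(\mathbf G,\mathbf X,\mathcal G)\to(\mathbf{GSp}(V_0),\mathbb H_g^\pm,\mathbf{GSp}(\Lambda_0))$ of unramified Shimura data is fixed. $\mathsf K=\mathcal G(\mathbb Z_p)\mathsf K^p$ is a neat level, $v\mid p$ a place of the reflex field with residue field $\kappa$; the completed ring of integers at $v$ is $W=W(\kappa)$. $\mathcal S$ is the Kisin–Vasiu integral model over $W$ of $\mathrm{Sh}_{\mathsf K}$, $\widehat{\mathcal S}$ its $p$-adic completion, $\mathcal A\to\mathcal S$ the pullback of the universal abelian scheme on the Siegel integral model. $\mathcal G$ also denotes $\mathcal G_W$; $\tilde\mu:\mathbb G_{m,W}\to\mathcal G$ is a minuscule cocharacter lifting a representative $\mu$ over $\kappa$ of the reduction of the Hodge conjugacy class. $\Lambda_0^*$ is the dual of $\Lambda_0$ and $\mathrm T_0\subseteq(\Lambda_0^* )^\otimes$ a set of tensors whose stabilizer in $\mathrm{GL}(\Lambda_0^* )$ is $\mathcal G$. **Prismatic torsor.** $\mathfrak M=\mathrm H^1_\Delta(\widehat{\mathcal A}/\widehat{\mathcal S})$ is the first relative prismatic cohomology, a prismatic crystal in vector bundles on the absolute prismatic site $\widehat{\mathcal S}_\Delta$, with Frobenius $\varphi^*\mathfrak M\to\mathfrak M$ that is an isomorphism after inverting the prism ideal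 $I$ and has cokernel killed by $I$. $\mathrm T_\Delta\subseteq\mathfrak M^\otimes$ are the Frobenius-invariant tensors corresponding, under the étale realization equivalence between analytic prismatic $F$-crystals on $\widehat{\mathcal S}$ and crystalline $\mathbb Z_p$-local systems on the rigid generic fibre $\widehat{\mathcal S}_\eta$, to the étale tensors on $\mathrm H^1_{\mathbb Z_p}(\widehat{\mathcal A}_\eta/\widehat{\mathcal S}_\eta)$ obtained from $\mathrm T_0$ (this local system is attached to $\Lambda_0^*$ by the pro-étale $\mathcal G(\mathbb Z_p)$-torsor $\varprojlim_{\mathsf K_p'}\mathrm{Sh}_{\mathsf K_p'\mathsf K^p}\to\mathrm{Sh}_{\mathsf K}$). It is known (Imai–Kato–Youcis) that $\mathbb J_\Delta=\underline{\mathrm{Isom}}((\Lambda_0^*\otimes\mathcal O_\Delta,\mathrm T_0\otimes1),(\mathfrak M,\mathrm T_\Delta))$ is a $\mathcal G$-torsor on $\widehat{\mathcal S}_\Delta$ of type $\tilde\mu$: every object has a flat cover $(A,(d))$ over which there is a trivialization such that the trivialized Frobenius is an element of $\mathcal G(A)\tilde\mu(d)\mathcal G(A)$. **Spaces.** $W_{\mathrm{cp}}$ is the site (flat topology) of crystalline prisms over $W$: $\underline R=(R,\varphi)$ with $R$ a $p$-torsion free, $p$-adically complete $W$-algebra and $\varphi$ a Frobenius lift compatible with that of $W$. $\mathcal S_{\widetilde{\mathrm{cp}}}$ is the site of pairs $(\underline R,x:\mathrm{Spf}\,R\to\widehat{\mathcal S})$, $\underline R\in W_{\mathrm{cp}}$,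 $x$ a morphism of $p$-adic formal schemes over $\mathrm{Spf}\,W$; it is a sheaf over $W_{\mathrm{cp}}$. For $\underline R\in W_{\mathrm{cp}}$ put $\mathfrak S_R=R[[t]]$ with $\varphi$ extended by $t\mapsto t^p$, and $E=t+p$; then $\underline{\mathfrak S_R}=(\mathfrak S_R,(E))$ is a prism with $\mathfrak S_R/E=R$, and $(\underline{\mathfrak S_R},x)\in\widehat{\mathcal S}_\Delta$. $\mathbb J_{\mathrm{BK}}$ is the sheaf on $\mathcal S_{\widetilde{\mathrm{cp}}}$ given by $\underline x=(\underline R,x)\mapsto\mathbb J_\Delta(\underline{\mathfrak S_R},x)=\mathrm{Isom}((\Lambda_0^*\otimes\mathfrak S_R,\mathrm T_0\otimes1),(\mathrm H^1_\Delta(\mathcal A_x/\underline{\mathfrak S_R}),\mathrm T_\Delta))$; it is a torsor over $\mathcal S_{\widetilde{\mathrm{cp}}}$ under $\mathcal L^+_{\mathrm{BK}}\mathcal G:\underline R\mapsto\mathcal G(\mathfrak S_R)$. $\varphi_{\underline x}:\varphi^*\mathrm H^1_\Delta(\mathcal A_x/\underline{\mathfrak S_R})\to\mathrm H^1_\Delta(\mathcal A_x/\underline{\mathfrak S_R})$ is the Frobenius, and $\varphi^*(\Lambda_0^*\otimes\mathfrak S_R)$ is identified with $\Lambda_0^*\otimes\mathfrak S_R$. $\mathbf C^{\tilde\mu}_{\mathrm{BK}}$ is the pullback along $W_{\mathrm{cp}}\to W_{\Delta_{\mathrm{BK}}}$, $\underline R\mapsto\underline{\mathfrak S_R}$, of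 the sheafification (flat topology) on the site $W_{\Delta_{\mathrm{BK}}}$ of prisms over $(W[[t]],(t+p))$ of $(A,EA)\mapsto\mathcal G(A)\tilde\mu(E)\mathcal G(A)\subseteq\mathcal G(A[1/E])$. $\mathcal L^+_{\mathrm{BK}}\mathcal G$ acts on it by $\varphi$-conjugation $h\cdot g=g^{-1}h\varphi(g)$, denoted $\mathrm{Ad}_\varphi$. *)

theory Defs
  imports "HOL-Algebra.Algebra" "HOL-Library.FuncSet"
begin

section \<open>Rings, completions, flat covers\<close>

text \<open>
  All rings are HOL-Algebra records. Prisms live on the type \<open>nat \<Rightarrow> 'a\<close> and their reductions
  \<open>A/I\<close>, as well as the rings underlying crystalline prisms, on \<open>'a\<close>; the type \<open>'a\<close> is
  arbitrary and plays the role of a universe. No prism is lost: a complete \<open>A\<close> embeds as a set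
  into sequences of elements of \<open>A/I\<close>. Ring homomorphisms used as arrows of a category are
  extensional, so that equality of arrows is equality of functions.
\<close>

definition Rhom :: "('a, 'k) ring_scheme \<Rightarrow> ('b, 'l) ring_scheme \<Rightarrow> ('a \<Rightarrow> 'b) set" where
  "Rhom A B = ring_hom A B \<inter> extensional (carrier A)"

definition rnat :: "('a, 'k) ring_scheme \<Rightarrow> nat \<Rightarrow> 'a" where
  "rnat A k = add_pow A k \<one>\<^bsub>A\<^esub>"

primrec ipow :: "('a, 'k) ring_scheme \<Rightarrow> 'a set \<Rightarrow> nat \<Rightarrow> 'a set" where
  "ipow A I 0 = carrier A"
| "ipow A I (Suc k) = ideal_prod A I (ipow A I k)"

text \<open>Bijectivity of \<open>A \<rightarrow> lim A/I^k\<close>.\<close>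

definition adic_complete :: "('a, 'k) ring_scheme \<Rightarrow> 'a set \<Rightarrow> bool" where
  "adic_complete A I \<longleftrightarrow>
     (\<forall>x. (\<forall>k. x k \<in> carrier A \<and> x (Suc k) \<ominus>\<^bsub>A\<^esub> x k \<in> ipow A I k) \<longrightarrow>
        (\<exists>!y. y \<in> carrier A \<and> (\<forall>k. y \<ominus>\<^bsub>A\<^esub> x k \<in> ipow A I k)))"

definition p_ideal :: "nat \<Rightarrow> ('a, 'k) ring_scheme \<Rightarrow> 'a set" where
  "p_ideal p A = PIdl\<^bsub>A\<^esub> (rnat A p)"

definition p_torsion_free :: "nat \<Rightarrow> ('a, 'k) ring_scheme \<Rightarrow> bool" where
  "p_torsion_free p A \<longleftrightarrow> (\<forall>a\<in>carrier A. rnat A p \<otimes>\<^bsub>A\<^esub> a = \<zero>\<^bsub>A\<^esub> \<longrightarrow> a = \<zero>\<^bsub>A\<^esub>)"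

text \<open>The free \<open>A\<close>-module on the type \<open>'a\<close>: finitely supported functions.\<close>

definition free_mod :: "('a, 'k) ring_scheme \<Rightarrow> ('a \<Rightarrow> 'a) set" where
  "free_mod A = {v. range v \<subseteq> carrier A \<and> finite {i. v i \<noteq> \<zero>\<^bsub>A\<^esub>}}"

definition free_endo :: "('a, 'k) ring_scheme \<Rightarrow> (('a \<Rightarrow> 'a) \<Rightarrow> ('a \<Rightarrow> 'a)) \<Rightarrow> bool" where
  "free_endo A d \<longleftrightarrow> d \<in> free_mod A \<rightarrow> free_mod A \<and>
     (\<forall>v\<in>free_mod A. \<forall>w\<in>free_mod A. \<forall>a\<in>carrier A.
        d (\<lambda>i. (a \<otimes>\<^bsub>A\<^esub> v i) \<oplus>\<^bsub>A\<^esub> w i) = (\<lambda>i. (a \<otimes>\<^bsub>A\<^esub> d v i) \<oplus>\<^bsub>A\<^esub> d w i))"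

text \<open>
  \<open>B\<close> is \<open>J\<close>-completely flat over \<open>A\<close>: the derived tensor product of \<open>B\<close> with \<open>A/J\<close> is
  concentrated in degree 0 and flat over \<open>A/J\<close>. Both parts together say that
  \<open>Tor_i(B, A/\<aa>) = 0\<close> for all \<open>i \<ge> 1\<close> and all ideals \<open>\<aa> \<supseteq> J\<close> (take \<open>\<aa> = J\<close>, and use that flatness
  over \<open>A/J\<close> is tested on its cyclic modules), which is expressed through a free resolution
  \<open>\<dots> \<rightarrow> d 1 \<rightarrow> d 0 \<rightarrow> e \<rightarrow> B\<close>.
\<close>

definition completely_flat ::
  "('a, 'k) ring_scheme \<Rightarrow> 'a set \<Rightarrow> ('a \<Rightarrow> 'a) \<Rightarrow> ('a, 'l) ring_scheme \<Rightarrow> bool" where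
  "completely_flat A J f B \<longleftrightarrow>
     (\<exists>e d. e ` free_mod A = carrier B \<and>
        (\<forall>v\<in>free_mod A. \<forall>w\<in>free_mod A. \<forall>a\<in>carrier A.
           e (\<lambda>i. (a \<otimes>\<^bsub>A\<^esub> v i) \<oplus>\<^bsub>A\<^esub> w i) = (f a \<otimes>\<^bsub>B\<^esub> e v) \<oplus>\<^bsub>B\<^esub> e w) \<and>
        (\<forall>k::nat. free_endo A (d k)) \<and>
        {v \<in> free_mod A. e v = \<zero>\<^bsub>B\<^esub>} = d 0 ` free_mod A \<and>
        (\<forall>k. {v \<in> free_mod A. d k v = (\<lambda>_. \<zero>\<^bsub>A\<^esub>)} = d (Suc k) ` free_mod A) \<and>
        (\<forall>\<aa>. ideal \<aa> A \<and> J \<subseteq> \<aa> \<longrightarrow>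
           (\<forall>k. \<forall>v\<in>free_mod A. range (d k v) \<subseteq> \<aa> \<longrightarrow>
              (\<exists>w\<in>free_mod A. \<forall>i. d (Suc k) w i \<ominus>\<^bsub>A\<^esub> v i \<in> \<aa>))))"

definition completely_faithfully_flat ::
  "('a, 'k) ring_scheme \<Rightarrow> 'a set \<Rightarrow> ('a \<Rightarrow> 'a) \<Rightarrow> ('a, 'l) ring_scheme \<Rightarrow> bool" where
  "completely_faithfully_flat A J f B \<longleftrightarrow>
     completely_flat A J f B \<and>
     (\<forall>\<aa>. ideal \<aa> A \<and> J \<subseteq> \<aa> \<and> \<aa> \<noteq> carrier A \<longrightarrow> genideal B (f ` \<aa>) \<noteq> carrier B)"


text \<open>\<open>A[1/E]\<close>; the fraction \<open>a/E^k\<close> is the set of all pairs \<open>(b, m)\<close> with \<open>b/E^m = a/E^k\<close>.\<close>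

definition frac :: "('b, 'k) ring_scheme \<Rightarrow> 'b \<Rightarrow> 'b \<Rightarrow> nat \<Rightarrow> ('b \<times> nat) set" where
  "frac A E a k = {(b, m). b \<in> carrier A \<and>
     (\<exists>l::nat. (E [^]\<^bsub>A\<^esub> (l + k)) \<otimes>\<^bsub>A\<^esub> b = (E [^]\<^bsub>A\<^esub> (l + m)) \<otimes>\<^bsub>A\<^esub> a)}"

definition loc :: "('b, 'k) ring_scheme \<Rightarrow> 'b \<Rightarrow> ('b \<times> nat) set ring" where
  "loc A E = \<lparr>carrier = {frac A E a k | a k. a \<in> carrier A},
     monoid.mult = (\<lambda>x y. \<Union>(a, k)\<in>x. \<Union>(b, m)\<in>y. frac A E (a \<otimes>\<^bsub>A\<^esub> b) (k + m)),
     monoid.one = frac A E \<one>\<^bsub>A\<^esub> 0,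
     ring.zero = frac A E \<zero>\<^bsub>A\<^esub> 0,
     ring.add = (\<lambda>x y. \<Union>(a, k)\<in>x. \<Union>(b, m)\<in>y.
       frac A E ((a \<otimes>\<^bsub>A\<^esub> (E [^]\<^bsub>A\<^esub> m)) \<oplus>\<^bsub>A\<^esub> (b \<otimes>\<^bsub>A\<^esub> (E [^]\<^bsub>A\<^esub> k))) (k + m))\<rparr>"

definition loc_in :: "('b, 'k) ring_scheme \<Rightarrow> 'b \<Rightarrow> 'b \<Rightarrow> ('b \<times> nat) set" where
  "loc_in A E a = frac A E a 0"

definition loc_map :: "('b, 'k) ring_scheme \<Rightarrow> 'b \<Rightarrow> ('b \<Rightarrow> 'b) \<Rightarrow> ('b \<times> nat) set \<Rightarrow> ('b \<times> nat) set" where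
  "loc_map B E f x = (\<Union>(a, k)\<in>x. frac B E (f a) k)"

text \<open>\<open>A[z, 1/z]\<close> and \<open>A[\<epsilon>]/\<epsilon>\<^sup>2\<close>.\<close>

definition laurent :: "('b, 'k) ring_scheme \<Rightarrow> (int \<Rightarrow> 'b) ring" where
  "laurent A = \<lparr>carrier = {f. range f \<subseteq> carrier A \<and> finite {k. f k \<noteq> \<zero>\<^bsub>A\<^esub>}},
     monoid.mult = (\<lambda>f g k. finsum A (\<lambda>l. f l \<otimes>\<^bsub>A\<^esub> g (k - l)) {l. f l \<noteq> \<zero>\<^bsub>A\<^esub>}),
     monoid.one = (\<lambda>k. if k = 0 then \<one>\<^bsub>A\<^esub> else \<zero>\<^bsub>A\<^esub>),
     ring.zero = (\<lambda>k. \<zero>\<^bsub>A\<^esub>),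
     ring.add = (\<lambda>f g k. f k \<oplus>\<^bsub>A\<^esub> g k)\<rparr>"

definition dual_numbers :: "('b, 'k) ring_scheme \<Rightarrow> ('b \<times> 'b) ring" where
  "dual_numbers A = \<lparr>carrier = carrier A \<times> carrier A,
     monoid.mult = (\<lambda>(a, b) (c, d). (a \<otimes>\<^bsub>A\<^esub> c, (a \<otimes>\<^bsub>A\<^esub> d) \<oplus>\<^bsub>A\<^esub> (b \<otimes>\<^bsub>A\<^esub> c))),
     monoid.one = (\<one>\<^bsub>A\<^esub>, \<zero>\<^bsub>A\<^esub>),
     ring.zero = (\<zero>\<^bsub>A\<^esub>, \<zero>\<^bsub>A\<^esub>),
     ring.add = (\<lambda>(a, b) (c, d). (a \<oplus>\<^bsub>A\<^esub> c, b \<oplus>\<^bsub>A\<^esub> d))\<rparr>"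


section \<open>Matrices and the reductive group scheme\<close>

definition mats :: "nat \<Rightarrow> ('b, 'k) ring_scheme \<Rightarrow> (nat \<times> nat \<Rightarrow> 'b) set" where
  "mats n A = ({..<n} \<times> {..<n}) \<rightarrow>\<^sub>E carrier A"

definition mmul ::
  "nat \<Rightarrow> ('b, 'k) ring_scheme \<Rightarrow> (nat \<times> nat \<Rightarrow> 'b) \<Rightarrow> (nat \<times> nat \<Rightarrow> 'b) \<Rightarrow> nat \<times> nat \<Rightarrow> 'b" where
  "mmul n A g h = (\<lambda>(i, j) \<in> {..<n} \<times> {..<n}. finsum A (\<lambda>l. g (i, l) \<otimes>\<^bsub>A\<^esub> h (l, j)) {..<n})"

definition mone :: "nat \<Rightarrow> ('b, 'k) ring_scheme \<Rightarrow> nat \<times> nat \<Rightarrow> 'b" where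
  "mone n A = (\<lambda>(i, j) \<in> {..<n} \<times> {..<n}. if i = j then \<one>\<^bsub>A\<^esub> else \<zero>\<^bsub>A\<^esub>)"

definition mmap :: "nat \<Rightarrow> ('b \<Rightarrow> 'c) \<Rightarrow> (nat \<times> nat \<Rightarrow> 'b) \<Rightarrow> nat \<times> nat \<Rightarrow> 'c" where
  "mmap n f g = (\<lambda>ij \<in> {..<n} \<times> {..<n}. f (g ij))"

definition GL :: "nat \<Rightarrow> ('b, 'k) ring_scheme \<Rightarrow> (nat \<times> nat \<Rightarrow> 'b) set" where
  "GL n A = {g \<in> mats n A. \<exists>h\<in>mats n A. mmul n A g h = mone n A \<and> mmul n A h g = mone n A}"

definition minv :: "nat \<Rightarrow> ('b, 'k) ring_scheme \<Rightarrow> (nat \<times> nat \<Rightarrow> 'b) \<Rightarrow> nat \<times> nat \<Rightarrow> 'b" where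
  "minv n A g = (THE h. h \<in> mats n A \<and> mmul n A g h = mone n A \<and> mmul n A h g = mone n A)"

text \<open>
  \<open>BW\<close> is \<open>W = W(\<kappa>)\<close> with Frobenius \<open>sg\<close>. A \<open>\<int>\<^sub>p\<close>-basis of \<open>\<Lambda>\<^sub>0\<^sup>*\<close> with \<open>rk\<close> elements is
  chosen. \<open>(T0 i)\<^sub>i\<^sub>\<in>\<^sub>T\<^sub>I\<close> are the tensors: the coefficient \<open>T0 i is js\<close> is the coordinate of the
  component in \<open>(\<Lambda>\<^sub>0\<^sup>*)\<^sup>\<otimes>\<^sup>a \<otimes> (\<Lambda>\<^sub>0)\<^sup>\<otimes>\<^sup>b\<close>, \<open>a = length is\<close>, \<open>b = length js\<close>. \<open>mu\<close> is the matrix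
  over \<open>W[z, 1/z]\<close> of the cocharacter.
\<close>

record ('w, 'i) group_datum =
  BW :: "'w ring"
  pp :: nat
  sg :: "'w \<Rightarrow> 'w"
  rk :: nat
  TI :: "'i set"
  T0 :: "'i \<Rightarrow> nat list \<Rightarrow> nat list \<Rightarrow> 'w"
  mu :: "nat \<times> nat \<Rightarrow> int \<Rightarrow> 'w"

text \<open>This determines \<open>W\<close> as the ring of Witt vectors of the finite field \<open>W/p\<close>.\<close>

definition witt_base :: "('w, 'i) group_datum \<Rightarrow> bool" where
  "witt_base D \<longleftrightarrow> cring (BW D) \<and>
     p_torsion_free (pp D) (BW D) \<and> adic_complete (BW D) (p_ideal (pp D) (BW D)) \<and>
     field (BW D Quot p_ideal (pp D) (BW D)) \<and>
     finite (carrier (BW D Quot p_ideal (pp D) (BW D))) \<and>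
     sg D \<in> Rhom (BW D) (BW D) \<and>
     (\<forall>w\<in>carrier (BW D). sg D w \<ominus>\<^bsub>BW D\<^esub> (w [^]\<^bsub>BW D\<^esub> pp D) \<in> p_ideal (pp D) (BW D))"

text \<open>\<open>\<int>\<^sub>p\<close> as the closure of \<open>\<int>\<close> in \<open>W\<close>.\<close>

definition Zp :: "('w, 'i) group_datum \<Rightarrow> 'w ring" where
  "Zp D = BW D\<lparr>carrier := {w \<in> carrier (BW D).
     \<forall>k. \<exists>m::int. w \<ominus>\<^bsub>BW D\<^esub> add_pow (BW D) m \<one>\<^bsub>BW D\<^esub> \<in> ipow (BW D) (p_ideal (pp D) (BW D)) k}\<rparr>"

definition idxs :: "nat \<Rightarrow> nat \<Rightarrow> nat list set" where
  "idxs n k = {ks. set ks \<subseteq> {..<n} \<and> length ks = k}"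

text \<open>
  \<open>\<G>(A)\<close> for a ring \<open>A\<close> with structure map \<open>s\<close>. The displayed equation is \<open>g \<cdot> T0 i = T0 i\<close>
  in \<open>(\<Lambda>\<^sub>0\<^sup>* \<otimes> A)\<^sup>\<otimes>\<close>, with the inverses of \<open>g\<close> (which occur on the dual factors) moved to the
  other side.
\<close>

definition grp :: "('w, 'i) group_datum \<Rightarrow> ('b, 'k) ring_scheme \<Rightarrow> ('w \<Rightarrow> 'b) \<Rightarrow> (nat \<times> nat \<Rightarrow> 'b) set" where
  "grp D A s = {g \<in> GL (rk D) A. \<forall>t\<in>TI D. \<forall>is js.
     set is \<subseteq> {..<rk D} \<and> set js \<subseteq> {..<rk D} \<longrightarrow>
     finsum A (\<lambda>ks. s (T0 D t is ks) \<otimes>\<^bsub>A\<^esub> finprod A (\<lambda>r. g (ks ! r, js ! r)) {..<length js})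
       (idxs (rk D) (length js))
   = finsum A (\<lambda>ks. finprod A (\<lambda>r. g (is ! r, ks ! r)) {..<length is} \<otimes>\<^bsub>A\<^esub> s (T0 D t ks js))
       (idxs (rk D) (length is))}"

definition integral_tensors :: "('w, 'i) group_datum \<Rightarrow> bool" where
  "integral_tensors D \<longleftrightarrow> (\<forall>t\<in>TI D.
     (\<forall>is js. T0 D t is js \<in> carrier (Zp D)) \<and>
     finite {(is, js). T0 D t is js \<noteq> \<zero>\<^bsub>BW D\<^esub>} \<and>
     (\<forall>is js. T0 D t is js \<noteq> \<zero>\<^bsub>BW D\<^esub> \<longrightarrow> set is \<subseteq> {..<rk D} \<and> set js \<subseteq> {..<rk D}))"


text \<open>
  Reductivity of \<open>\<G>\<close>: smooth over \<open>\<int>\<^sub>p\<close> with connected reductive geometric fibres. For smooth \<open>\<G>\<close>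
  the fibre over an algebraically closed field \<open>K\<close> is the linear algebraic group \<open>\<G>(K)\<close>, to
  which the classical definitions apply. Test rings have their carriers in the type \<open>'b\<close>.
\<close>

inductive_set poly_funs :: "nat \<Rightarrow> ('b, 'k) ring_scheme \<Rightarrow> ((nat \<times> nat \<Rightarrow> 'b) \<Rightarrow> 'b) set"
  for n K where
  const: "a \<in> carrier K \<Longrightarrow> (\<lambda>_. a) \<in> poly_funs n K"
| coord: "i < n \<Longrightarrow> j < n \<Longrightarrow> (\<lambda>g. g (i, j)) \<in> poly_funs n K"
| add: "u \<in> poly_funs n K \<Longrightarrow> v \<in> poly_funs n K \<Longrightarrow> (\<lambda>g. u g \<oplus>\<^bsub>K\<^esub> v g) \<in> poly_funs n K"
| mult: "u \<in> poly_funs n K \<Longrightarrow> v \<in> poly_funs n K \<Longrightarrow> (\<lambda>g. u g \<otimes>\<^bsub>K\<^esub> v g) \<in> poly_funs n K"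

definition zariski_closed :: "nat \<Rightarrow> ('b, 'k) ring_scheme \<Rightarrow> (nat \<times> nat \<Rightarrow> 'b) set \<Rightarrow> bool" where
  "zariski_closed n K Z \<longleftrightarrow>
     (\<exists>F \<subseteq> poly_funs n K. Z = {g \<in> mats n K. \<forall>u\<in>F. u g = \<zero>\<^bsub>K\<^esub>})"

definition zariski_connected :: "nat \<Rightarrow> ('b, 'k) ring_scheme \<Rightarrow> (nat \<times> nat \<Rightarrow> 'b) set \<Rightarrow> bool" where
  "zariski_connected n K H \<longleftrightarrow>
     \<not> (\<exists>Y Z. zariski_closed n K Y \<and> zariski_closed n K Z \<and> H \<subseteq> Y \<union> Z \<and>
          H \<inter> Y \<inter> Z = {} \<and> H \<inter> Y \<noteq> {} \<and> H \<inter> Z \<noteq> {})"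

definition unipotent :: "nat \<Rightarrow> ('b, 'k) ring_scheme \<Rightarrow> (nat \<times> nat \<Rightarrow> 'b) \<Rightarrow> bool" where
  "unipotent n K g \<longleftrightarrow>
     (let u = (\<lambda>ij \<in> {..<n} \<times> {..<n}. g ij \<ominus>\<^bsub>K\<^esub> mone n K ij)
      in (mmul n K u ^^ n) (mone n K) = (\<lambda>ij \<in> {..<n} \<times> {..<n}. \<zero>\<^bsub>K\<^esub>))"

definition normal_closed_subgroup ::
  "nat \<Rightarrow> ('b, 'k) ring_scheme \<Rightarrow> (nat \<times> nat \<Rightarrow> 'b) set \<Rightarrow> (nat \<times> nat \<Rightarrow> 'b) set \<Rightarrow> bool" where
  "normal_closed_subgroup n K U H \<longleftrightarrow>
     (\<exists>Z. zariski_closed n K Z \<and> U = H \<inter> Z) \<and> mone n K \<in> U \<and>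
     (\<forall>g\<in>U. minv n K g \<in> U \<and> (\<forall>h\<in>U. mmul n K g h \<in> U)) \<and>
     (\<forall>h\<in>H. \<forall>g\<in>U. mmul n K (mmul n K h g) (minv n K h) \<in> U)"

definition connected_reductive :: "nat \<Rightarrow> ('b, 'k) ring_scheme \<Rightarrow> (nat \<times> nat \<Rightarrow> 'b) set \<Rightarrow> bool" where
  "connected_reductive n K H \<longleftrightarrow> zariski_connected n K H \<and>
     (\<forall>U. normal_closed_subgroup n K U H \<and> zariski_connected n K U \<and> (\<forall>g\<in>U. unipotent n K g)
        \<longrightarrow> U = {mone n K})"

definition reductive_over_Zp :: "'b itself \<Rightarrow> ('w, 'i) group_datum \<Rightarrow> bool" where
  "reductive_over_Zp TYPE('b) D \<longleftrightarrow>
     (\<forall>(B :: 'b ring) s J. cring B \<and> s \<in> ring_hom (Zp D) B \<and> ideal J B \<and>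
        ideal_prod B J J = {\<zero>\<^bsub>B\<^esub>} \<longrightarrow>
        mmap (rk D) (\<lambda>b. J +>\<^bsub>B\<^esub> b) ` grp D B s = grp D (B Quot J) (\<lambda>w. J +>\<^bsub>B\<^esub> s w)) \<and>
     (\<forall>(K :: 'b ring) s. algebraically_closed K \<and> s \<in> ring_hom (Zp D) K \<longrightarrow>
        connected_reductive (rk D) K (grp D K s))"

text \<open>\<open>\<G> \<subseteq> GSp\<close> for a perfect alternating form \<open>\<psi>\<close> over \<open>\<int>\<^sub>p\<close>.\<close>

definition in_GSp :: "'b itself \<Rightarrow> ('w, 'i) group_datum \<Rightarrow> bool" where
  "in_GSp TYPE('b) D \<longleftrightarrow> (\<exists>\<psi>\<in>GL (rk D) (Zp D).
     (\<forall>i<rk D. \<psi> (i, i) = \<zero>\<^bsub>BW D\<^esub> \<and> (\<forall>j<rk D. \<psi> (j, i) = \<ominus>\<^bsub>BW D\<^esub> \<psi> (i, j))) \<and>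
     (\<forall>(A :: 'b ring) s. cring A \<and> s \<in> ring_hom (Zp D) A \<longrightarrow>
        (\<forall>g\<in>grp D A s. \<exists>c\<in>Units A.
           mmul (rk D) A (\<lambda>(i, j) \<in> {..<rk D} \<times> {..<rk D}. g (j, i))
             (mmul (rk D) A (mmap (rk D) s \<psi>) g)
         = (\<lambda>ij \<in> {..<rk D} \<times> {..<rk D}. c \<otimes>\<^bsub>A\<^esub> s (\<psi> ij)))))"

text \<open>
  A cocharacter is a \<open>W[z, 1/z]\<close>-valued point of \<open>\<G>\<close>; comparing coefficients of \<open>z^k y^l\<close> in
  \<open>\<mu>(z) \<mu>(y) = \<mu>(z y)\<close> gives the second clause.
\<close>

definition cocharacter :: "('w, 'i) group_datum \<Rightarrow> bool" where
  "cocharacter D \<longleftrightarrow>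
     mu D \<in> grp D (laurent (BW D)) (\<lambda>w k. if k = 0 then w else \<zero>\<^bsub>BW D\<^esub>) \<and>
     (\<forall>i<rk D. \<forall>j<rk D. \<forall>k l.
        finsum (BW D) (\<lambda>r. mu D (i, r) k \<otimes>\<^bsub>BW D\<^esub> mu D (r, j) l) {..<rk D}
      = (if k = l then mu D (i, j) k else \<zero>\<^bsub>BW D\<^esub>))"

definition lie_alg :: "('w, 'i) group_datum \<Rightarrow> (nat \<times> nat \<Rightarrow> 'w) set" where
  "lie_alg D = {N \<in> mats (rk D) (BW D).
     (\<lambda>ij \<in> {..<rk D} \<times> {..<rk D}. (mone (rk D) (BW D) ij, N ij))
       \<in> grp D (dual_numbers (BW D)) (\<lambda>w. (w, \<zero>\<^bsub>BW D\<^esub>))}"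

definition mu_weights :: "('w, 'i) group_datum \<Rightarrow> int set" where
  "mu_weights D = {k. \<exists>i<rk D. \<exists>j<rk D. mu D (i, j) k \<noteq> \<zero>\<^bsub>BW D\<^esub>}"

definition mu_coeff :: "('w, 'i) group_datum \<Rightarrow> int \<Rightarrow> nat \<times> nat \<Rightarrow> 'w" where
  "mu_coeff D k = (\<lambda>ij \<in> {..<rk D} \<times> {..<rk D}. mu D ij k)"

text \<open>The weights of \<open>Ad \<circ> \<mu>\<close> on the Lie algebra are in \<open>{-1, 0, 1}\<close>; the sum is the component
  of \<open>N\<close> of weight \<open>k\<close>.\<close>

definition minuscule :: "('w, 'i) group_datum \<Rightarrow> bool" where
  "minuscule D \<longleftrightarrow> (\<forall>N\<in>lie_alg D. \<forall>k. \<bar>k\<bar> > 1 \<longrightarrow> (\<forall>i<rk D. \<forall>j<rk D.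
     finsum (BW D) (\<lambda>l. mmul (rk D) (BW D)
        (mmul (rk D) (BW D) (mu_coeff D (l + k)) N) (mu_coeff D l) (i, j)) (mu_weights D)
     = \<zero>\<^bsub>BW D\<^esub>))"

text \<open>\<open>\<mu>(u)\<close> for a unit \<open>u\<close> of a \<open>W\<close>-algebra.\<close>

definition mu_at :: "('w, 'i) group_datum \<Rightarrow> ('b, 'k) ring_scheme \<Rightarrow> ('w \<Rightarrow> 'b) \<Rightarrow> 'b \<Rightarrow> nat \<times> nat \<Rightarrow> 'b" where
  "mu_at D A s u = (\<lambda>ij \<in> {..<rk D} \<times> {..<rk D}.
     finsum A (\<lambda>k. s (mu D ij k) \<otimes>\<^bsub>A\<^esub> (u [^]\<^bsub>A\<^esub> k)) {k. mu D ij k \<noteq> \<zero>\<^bsub>BW D\<^esub>})"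

definition admissible_datum :: "'b itself \<Rightarrow> ('w, 'i) group_datum \<Rightarrow> bool" where
  "admissible_datum TYPE('b) D \<longleftrightarrow> Factorial_Ring.prime (pp D) \<and> pp D \<ge> 3 \<and> witt_base D \<and>
     integral_tensors D \<and> reductive_over_Zp TYPE('b) D \<and> in_GSp TYPE('b) D \<and>
     cocharacter D \<and> minuscule D"


section \<open>Formal schemes\<close>

record ('b, 'w) walg = "'b ring" +
  strc :: "'w \<Rightarrow> 'b"

definition is_walg :: "('w, 'i) group_datum \<Rightarrow> ('b, 'w, 'k) walg_scheme \<Rightarrow> bool" where
  "is_walg D R \<longleftrightarrow> cring R \<and> strc R \<in> ring_hom (BW D) R"

definition complete_walg :: "('w, 'i) group_datum \<Rightarrow> ('b, 'w, 'k) walg_scheme \<Rightarrow> bool" where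
  "complete_walg D R \<longleftrightarrow> is_walg D R \<and> adic_complete R (p_ideal (pp D) R)"

definition walg_hom ::
  "('w, 'i) group_datum \<Rightarrow> ('b, 'w, 'k) walg_scheme \<Rightarrow> ('c, 'w, 'l) walg_scheme \<Rightarrow> ('b \<Rightarrow> 'c) set" where
  "walg_hom D R S = {f \<in> Rhom R S. \<forall>w\<in>carrier (BW D). f (strc R w) = strc S w}"

text \<open>
  \<open>p\<close>-adic formal schemes over \<open>Spf W\<close> are given by their functor of points:
  \<open>pts Xf R\<close> is the set of morphisms \<open>Spf R \<rightarrow> Xf\<close> over \<open>Spf W\<close>, for \<open>p\<close>-adically complete \<open>R\<close>.
\<close>

record ('a, 'w, 'x) space =
  pts :: "('a, 'w) walg \<Rightarrow> 'x set"
  pull :: "('a, 'w) walg \<Rightarrow> ('a, 'w) walg \<Rightarrow> ('a \<Rightarrow> 'a) \<Rightarrow> 'x \<Rightarrow> 'x"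

definition is_functor :: "('w, 'i) group_datum \<Rightarrow> ('a, 'w, 'x) space \<Rightarrow> bool" where
  "is_functor D Xf \<longleftrightarrow>
     (\<forall>R S f x. complete_walg D R \<and> complete_walg D S \<and> f \<in> walg_hom D R S \<and> x \<in> pts Xf R \<longrightarrow>
        pull Xf R S f x \<in> pts Xf S) \<and>
     (\<forall>R x. complete_walg D R \<and> x \<in> pts Xf R \<longrightarrow> pull Xf R R (restrict id (carrier R)) x = x) \<and>
     (\<forall>R S T f g x. complete_walg D R \<and> complete_walg D S \<and> complete_walg D T \<and>
        f \<in> walg_hom D R S \<and> g \<in> walg_hom D S T \<and> x \<in> pts Xf R \<longrightarrow>
        pull Xf R T (compose (carrier R) g f) x = pull Xf S T g (pull Xf R S f x))"

definition flat_family ::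
  "('w, 'i) group_datum \<Rightarrow> ('a, 'w) walg \<Rightarrow> nat \<Rightarrow> (nat \<Rightarrow> ('a, 'w) walg) \<Rightarrow> (nat \<Rightarrow> 'a \<Rightarrow> 'a) \<Rightarrow> bool" where
  "flat_family D R n S f \<longleftrightarrow>
     (\<forall>i<n. complete_walg D (S i) \<and> f i \<in> walg_hom D R (S i) \<and>
        completely_flat R (p_ideal (pp D) R) (f i) (S i)) \<and>
     (\<forall>\<aa>. ideal \<aa> R \<and> p_ideal (pp D) R \<subseteq> \<aa> \<and> \<aa> \<noteq> carrier R \<longrightarrow>
        (\<exists>i<n. genideal (S i) (f i ` \<aa>) \<noteq> carrier (S i)))"

text \<open>
  Sheaf condition for the flat topology. Compatibility is required over every common target, which is the
  same as over the completed tensor products.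
\<close>

definition is_flat_sheaf :: "('w, 'i) group_datum \<Rightarrow> ('a, 'w, 'x) space \<Rightarrow> bool" where
  "is_flat_sheaf D Xf \<longleftrightarrow> is_functor D Xf \<and>
     (\<forall>R n S f x. complete_walg D R \<and> flat_family D R n S f \<and> (\<forall>i<n. x i \<in> pts Xf (S i)) \<and>
        (\<forall>i<n. \<forall>j<n. \<forall>T g h. complete_walg D T \<and> g \<in> walg_hom D (S i) T \<and> h \<in> walg_hom D (S j) T \<and>
           compose (carrier R) g (f i) = compose (carrier R) h (f j) \<longrightarrow>
           pull Xf (S i) T g (x i) = pull Xf (S j) T h (x j)) \<longrightarrow>
        (\<exists>!y. y \<in> pts Xf R \<and> (\<forall>i<n. pull Xf R (S i) (f i) y = x i)))"

text \<open>
  An open subfunctor \<open>U\<close> is one whose pullback to \<open>Spf R\<close> is the complement of a closed subset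
  \<open>V(\<aa>)\<close>, for all \<open>Spf R \<rightarrow> Xf\<close>. A formal scheme is a sheaf with an open cover by
  subfunctors represented by \<open>Spf B\<close>.
\<close>

definition open_locus ::
  "('w, 'i) group_datum \<Rightarrow> ('a, 'w, 'x) space \<Rightarrow> (('a, 'w) walg \<Rightarrow> 'x set) \<Rightarrow> ('a, 'w) walg \<Rightarrow> 'x \<Rightarrow> 'a set \<Rightarrow> bool" where
  "open_locus D Xf U R x \<aa> \<longleftrightarrow> ideal \<aa> R \<and>
     (\<forall>S f. complete_walg D S \<and> f \<in> walg_hom D R S \<longrightarrow>
        (pull Xf R S f x \<in> U S \<longleftrightarrow> genideal S (f ` \<aa>) = carrier S))"

definition affine_formal ::
  "('w, 'i) group_datum \<Rightarrow> ('a, 'w, 'x) space \<Rightarrow> (('a, 'w) walg \<Rightarrow> 'x set) \<Rightarrow> bool" where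
  "affine_formal D Xf U \<longleftrightarrow> (\<exists>B u. complete_walg D B \<and> u \<in> U B \<and>
     (\<forall>R. complete_walg D R \<longrightarrow> U R \<subseteq> pts Xf R \<and>
        bij_betw (\<lambda>f. pull Xf B R f u) (walg_hom D B R) (U R)))"

definition formal_scheme :: "('w, 'i) group_datum \<Rightarrow> ('a, 'w, 'x) space \<Rightarrow> bool" where
  "formal_scheme D Xf \<longleftrightarrow> is_flat_sheaf D Xf \<and>
     (\<exists>\<U>. (\<forall>U\<in>\<U>. affine_formal D Xf U) \<and>
        (\<forall>R x. complete_walg D R \<and> x \<in> pts Xf R \<longrightarrow>
           (\<exists>\<aa>. (\<forall>U\<in>\<U>. open_locus D Xf U R x (\<aa> U)) \<and>
                genideal R (\<Union>U\<in>\<U>. \<aa> U) = carrier R)))"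

definition space_map ::
  "('w, 'i) group_datum \<Rightarrow> ('a, 'w, 'y) space \<Rightarrow> ('a, 'w, 'x) space \<Rightarrow> (('a, 'w) walg \<Rightarrow> 'y \<Rightarrow> 'x) \<Rightarrow> bool" where
  "space_map D Y Xf q \<longleftrightarrow>
     (\<forall>R. complete_walg D R \<longrightarrow> q R \<in> pts Y R \<rightarrow> pts Xf R) \<and>
     (\<forall>R S f y. complete_walg D R \<and> complete_walg D S \<and> f \<in> walg_hom D R S \<and> y \<in> pts Y R \<longrightarrow>
        q S (pull Y R S f y) = pull Xf R S f (q R y))"


section \<open>Prisms and the absolute prismatic site\<close>

definition delta_ring :: "nat \<Rightarrow> ('b, 'k) ring_scheme \<Rightarrow> ('b \<Rightarrow> 'b) \<Rightarrow> bool" where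
  "delta_ring p A \<delta> \<longleftrightarrow> \<delta> \<in> carrier A \<rightarrow> carrier A \<and> \<delta> \<zero>\<^bsub>A\<^esub> = \<zero>\<^bsub>A\<^esub> \<and> \<delta> \<one>\<^bsub>A\<^esub> = \<zero>\<^bsub>A\<^esub> \<and>
     (\<forall>x\<in>carrier A. \<forall>y\<in>carrier A.
        \<delta> (x \<otimes>\<^bsub>A\<^esub> y) = ((x [^]\<^bsub>A\<^esub> p) \<otimes>\<^bsub>A\<^esub> \<delta> y) \<oplus>\<^bsub>A\<^esub> ((y [^]\<^bsub>A\<^esub> p) \<otimes>\<^bsub>A\<^esub> \<delta> x)
          \<oplus>\<^bsub>A\<^esub> add_pow A p (\<delta> x \<otimes>\<^bsub>A\<^esub> \<delta> y) \<and>
        \<delta> (x \<oplus>\<^bsub>A\<^esub> y) = (\<delta> x \<oplus>\<^bsub>A\<^esub> \<delta> y) \<ominus>\<^bsub>A\<^esub>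
          finsum A (\<lambda>i. add_pow A ((p choose i) div p) ((x [^]\<^bsub>A\<^esub> i) \<otimes>\<^bsub>A\<^esub> (y [^]\<^bsub>A\<^esub> (p - i)))) {1..<p})"

text \<open>The field \<open>proj : A \<rightarrow> rbar\<close> presents \<open>A/I\<close>, so \<open>I\<close> is the kernel of \<open>proj\<close>.\<close>

record ('b, 'w, 'a) prism = "('b, 'w) walg" +
  dl :: "'b \<Rightarrow> 'b"
  rbar :: "('a, 'w) walg"
  proj :: "'b \<Rightarrow> 'a"

definition pI :: "('b, 'w, 'a) prism \<Rightarrow> 'b set" where
  "pI A = {a \<in> carrier A. proj A a = \<zero>\<^bsub>rbar A\<^esub>}"

definition phi :: "nat \<Rightarrow> ('b, 'w, 'a) prism \<Rightarrow> 'b \<Rightarrow> 'b" where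
  "phi p A a = (a [^]\<^bsub>A\<^esub> p) \<oplus>\<^bsub>A\<^esub> add_pow A p (dl A a)"

definition pI_max :: "nat \<Rightarrow> ('b, 'w, 'a) prism \<Rightarrow> 'b set" where
  "pI_max p A = genideal A (insert (rnat A p) (pI A))"

text \<open>
  \<open>I\<close> is locally, on a Zariski cover by the loci \<open>s \<noteq> 0\<close> for \<open>s \<in> S\<close>, generated by a
  nonzerodivisor \<open>d\<close>.
\<close>

definition cartier :: "('b, 'k) ring_scheme \<Rightarrow> 'b set \<Rightarrow> bool" where
  "cartier A I \<longleftrightarrow> (\<exists>S. finite S \<and> S \<subseteq> carrier A \<and> genideal A S = carrier A \<and>
     (\<forall>s\<in>S. \<exists>d\<in>I. (\<forall>x\<in>I. \<exists>k::nat. (s [^]\<^bsub>A\<^esub> k) \<otimes>\<^bsub>A\<^esub> x \<in> PIdl\<^bsub>A\<^esub> d) \<and>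
        (\<forall>a\<in>carrier A. d \<otimes>\<^bsub>A\<^esub> a = \<zero>\<^bsub>A\<^esub> \<longrightarrow> (\<exists>k::nat. (s [^]\<^bsub>A\<^esub> k) \<otimes>\<^bsub>A\<^esub> a = \<zero>\<^bsub>A\<^esub>))))"

text \<open>
  Bounded prisms over \<open>W\<close>; for these derived \<open>(p, I)\<close>-completeness is the same as classical
  completeness, and \<open>A/I\<close> is automatically \<open>p\<close>-adically complete. The \<open>W\<close>-structure of \<open>A\<close> is the
  unique lift of that of \<open>A/I\<close>.
\<close>

definition is_prism :: "('w, 'i) group_datum \<Rightarrow> ('b, 'w, 'a) prism \<Rightarrow> bool" where
  "is_prism D A \<longleftrightarrow> is_walg D A \<and> complete_walg D (rbar A) \<and> delta_ring (pp D) A (dl A) \<and>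
     (\<forall>w\<in>carrier (BW D). phi (pp D) A (strc A w) = strc A (sg D w)) \<and>
     proj A \<in> walg_hom D A (rbar A) \<and> proj A ` carrier A = carrier (rbar A) \<and>
     cartier A (pI A) \<and> adic_complete A (pI_max (pp D) A) \<and>
     rnat A (pp D) \<in> genideal A (pI A \<union> phi (pp D) A ` pI A) \<and>
     (\<exists>m::nat. \<forall>x\<in>carrier (rbar A). \<forall>k::nat.
        add_pow (rbar A) (pp D ^ k) x = \<zero>\<^bsub>rbar A\<^esub> \<longrightarrow> add_pow (rbar A) (pp D ^ m) x = \<zero>\<^bsub>rbar A\<^esub>)"

text \<open>By rigidity, maps \<open>(A, I) \<rightarrow> (B, J)\<close> of prisms satisfy \<open>J = I B\<close>.\<close>

definition phom :: "('w, 'i) group_datum \<Rightarrow> ('b, 'w, 'a) prism \<Rightarrow> ('b, 'w, 'a) prism \<Rightarrow> ('b \<Rightarrow> 'b) set" where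
  "phom D A B = {f \<in> walg_hom D A B.
     (\<forall>a\<in>carrier A. f (dl A a) = dl B (f a)) \<and> genideal B (f ` pI A) = pI B}"

definition rmap :: "('b, 'w, 'a) prism \<Rightarrow> ('b, 'w, 'a) prism \<Rightarrow> ('b \<Rightarrow> 'b) \<Rightarrow> 'a \<Rightarrow> 'a" where
  "rmap A B f = (\<lambda>y \<in> carrier (rbar A). THE z. \<exists>a\<in>carrier A. proj A a = y \<and> z = proj B (f a))"

definition flat_cover :: "('w, 'i) group_datum \<Rightarrow> ('b, 'w, 'a) prism \<Rightarrow> ('b, 'w, 'a) prism \<Rightarrow> ('b \<Rightarrow> 'b) \<Rightarrow> bool" where
  "flat_cover D A B f \<longleftrightarrow> is_prism D A \<and> is_prism D B \<and> f \<in> phom D A B \<and>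
     completely_faithfully_flat A (pI_max (pp D) A) f B"

text \<open>Objects and arrows of \<open>(Xf)\<^sub>\<Delta>\<close>. Arrows point in the direction of ring maps.\<close>

definition psite :: "('w, 'i) group_datum \<Rightarrow> ('a, 'w, 'x) space \<Rightarrow> (('b, 'w, 'a) prism \<times> 'x) set" where
  "psite D Xf = {(A, x). is_prism D A \<and> x \<in> pts Xf (rbar A)}"

definition ppull :: "('a, 'w, 'x) space \<Rightarrow> ('b, 'w, 'a) prism \<Rightarrow> ('b, 'w, 'a) prism \<Rightarrow> ('b \<Rightarrow> 'b) \<Rightarrow> 'x \<Rightarrow> 'x" where
  "ppull Xf A B f x = pull Xf (rbar A) (rbar B) (rmap A B f) x"


section \<open>Prismatic crystals and tensors\<close>

definition semilinear ::
  "('b, 'k) ring_scheme \<Rightarrow> ('b \<Rightarrow> 'b) \<Rightarrow> ('b, 'm) module \<Rightarrow> ('b, 'm) module \<Rightarrow> ('m \<Rightarrow> 'm) \<Rightarrow> bool" where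
  "semilinear A f M N r \<longleftrightarrow> r \<in> carrier M \<rightarrow> carrier N \<and>
     (\<forall>u\<in>carrier M. \<forall>v\<in>carrier M. r (u \<oplus>\<^bsub>M\<^esub> v) = r u \<oplus>\<^bsub>N\<^esub> r v) \<and>
     (\<forall>a\<in>carrier A. \<forall>u\<in>carrier M. r (a \<odot>\<^bsub>M\<^esub> u) = f a \<odot>\<^bsub>N\<^esub> r u)"

definition mdual :: "('b, 'k) ring_scheme \<Rightarrow> ('b, 'm) module \<Rightarrow> ('m \<Rightarrow> 'b) set" where
  "mdual A M = {l \<in> carrier M \<rightarrow>\<^sub>E carrier A.
     (\<forall>u\<in>carrier M. \<forall>v\<in>carrier M. l (u \<oplus>\<^bsub>M\<^esub> v) = l u \<oplus>\<^bsub>A\<^esub> l v) \<and>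
     (\<forall>a\<in>carrier A. \<forall>u\<in>carrier M. l (a \<odot>\<^bsub>M\<^esub> u) = a \<otimes>\<^bsub>A\<^esub> l u)}"

definition dual_basis ::
  "('b, 'k) ring_scheme \<Rightarrow> ('b, 'm) module \<Rightarrow> nat \<Rightarrow> (nat \<Rightarrow> 'm) \<Rightarrow> (nat \<Rightarrow> 'm \<Rightarrow> 'b) \<Rightarrow> bool" where
  "dual_basis A M r e l \<longleftrightarrow> (\<forall>k<r. e k \<in> carrier M \<and> l k \<in> mdual A M) \<and>
     (\<forall>u\<in>carrier M. u = finsum M (\<lambda>k. l k u \<odot>\<^bsub>M\<^esub> e k) {..<r})"

text \<open>\<open>\<Sum> b\<^sub>i \<otimes> m\<^sub>i = 0\<close> in \<open>B \<otimes>\<^sub>A M\<close> (\<open>B\<close> an \<open>A\<close>-algebra via \<open>f\<close>), by the equational criterion for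
  vanishing of tensors.\<close>

definition tensor_zero ::
  "('b, 'k) ring_scheme \<Rightarrow> ('b \<Rightarrow> 'b) \<Rightarrow> ('b, 'l) ring_scheme \<Rightarrow> ('b, 'm) module \<Rightarrow>
   nat \<Rightarrow> (nat \<Rightarrow> 'b) \<Rightarrow> (nat \<Rightarrow> 'm) \<Rightarrow> bool" where
  "tensor_zero A f B M k b m \<longleftrightarrow> (\<exists>l a e.
     (\<forall>j<l. e j \<in> carrier M) \<and> (\<forall>i<k. \<forall>j<l. a i j \<in> carrier A) \<and>
     (\<forall>i<k. m i = finsum M (\<lambda>j. a i j \<odot>\<^bsub>M\<^esub> e j) {..<(l::nat)}) \<and>
     (\<forall>j<l. finsum B (\<lambda>i. b i \<otimes>\<^bsub>B\<^esub> f (a i j)) {..<k} = \<zero>\<^bsub>B\<^esub>))"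

text \<open>The linearization \<open>B \<otimes>\<^sub>A M \<rightarrow> N\<close> of the semilinear map \<open>r\<close> is bijective.\<close>

definition base_change ::
  "('b, 'k) ring_scheme \<Rightarrow> ('b \<Rightarrow> 'b) \<Rightarrow> ('b, 'l) ring_scheme \<Rightarrow> ('b, 'm) module \<Rightarrow> ('b, 'm) module \<Rightarrow>
   ('m \<Rightarrow> 'm) \<Rightarrow> bool" where
  "base_change A f B M N r \<longleftrightarrow> semilinear A f M N r \<and>
     (\<forall>u\<in>carrier N. \<exists>k b m. (\<forall>i<k. b i \<in> carrier B \<and> m i \<in> carrier M) \<and>
        u = finsum N (\<lambda>i. b i \<odot>\<^bsub>N\<^esub> r (m i)) {..<(k::nat)}) \<and>
     (\<forall>k b m. (\<forall>i<k. b i \<in> carrier B \<and> m i \<in> carrier M) \<and>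
        finsum N (\<lambda>i. b i \<odot>\<^bsub>N\<^esub> r (m i)) {..<k} = \<zero>\<^bsub>N\<^esub> \<longrightarrow> tensor_zero A f B M k b m)"

text \<open>
  The linearization \<open>\<phi>\<^sup>*M \<rightarrow> M\<close> of \<open>F\<close> becomes an isomorphism after inverting \<open>I\<close> and has
  cokernel killed by \<open>I\<close>; the first condition reduces to its kernel being \<open>I\<close>-power torsion.
\<close>

definition frobenius_structure :: "nat \<Rightarrow> ('b, 'w, 'a) prism \<Rightarrow> ('b, 'm) module \<Rightarrow> ('m \<Rightarrow> 'm) \<Rightarrow> bool" where
  "frobenius_structure p A M F \<longleftrightarrow> semilinear A (phi p A) M M F \<and>
     (\<forall>x\<in>pI A. \<forall>u\<in>carrier M. \<exists>k b m. (\<forall>i<k. b i \<in> carrier A \<and> m i \<in> carrier M) \<and>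
        x \<odot>\<^bsub>M\<^esub> u = finsum M (\<lambda>i. b i \<odot>\<^bsub>M\<^esub> F (m i)) {..<(k::nat)}) \<and>
     (\<forall>k b m. (\<forall>i<k. b i \<in> carrier A \<and> m i \<in> carrier M) \<and>
        finsum M (\<lambda>i. b i \<odot>\<^bsub>M\<^esub> F (m i)) {..<k} = \<zero>\<^bsub>M\<^esub> \<longrightarrow>
        (\<forall>x\<in>pI A. \<exists>l::nat. tensor_zero A (phi p A) A M k (\<lambda>i. (x [^]\<^bsub>A\<^esub> l) \<otimes>\<^bsub>A\<^esub> b i) m))"

record ('b, 'w, 'a, 'x, 'm) crystal =
  Mdl :: "('b, 'w, 'a) prism \<Rightarrow> 'x \<Rightarrow> ('b, 'm) module"
  bc :: "('b, 'w, 'a) prism \<Rightarrow> 'x \<Rightarrow> ('b, 'w, 'a) prism \<Rightarrow> ('b \<Rightarrow> 'b) \<Rightarrow> 'm \<Rightarrow> 'm"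
  Frob :: "('b, 'w, 'a) prism \<Rightarrow> 'x \<Rightarrow> 'm \<Rightarrow> 'm"

definition prismatic_F_crystal ::
  "('w, 'i) group_datum \<Rightarrow> ('a, 'w, 'x) space \<Rightarrow> ('b, 'w, 'a, 'x, 'm) crystal \<Rightarrow> bool" where
  "prismatic_F_crystal D Xf M \<longleftrightarrow>
     (\<forall>(A, x) \<in> psite D Xf. module A (Mdl M A x) \<and> (\<exists>r e l. dual_basis A (Mdl M A x) r e l) \<and>
        frobenius_structure (pp D) A (Mdl M A x) (Frob M A x) \<and>
        (\<forall>u\<in>carrier (Mdl M A x). bc M A x A (restrict id (carrier A)) u = u)) \<and>
     (\<forall>(A, x) \<in> psite D Xf. \<forall>B f. is_prism D B \<and> f \<in> phom D A B \<longrightarrow>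
        base_change A f B (Mdl M A x) (Mdl M B (ppull Xf A B f x)) (bc M A x B f) \<and>
        (\<forall>u\<in>carrier (Mdl M A x).
           bc M A x B f (Frob M A x u) = Frob M B (ppull Xf A B f x) (bc M A x B f u))) \<and>
     (\<forall>(A, x) \<in> psite D Xf. \<forall>B C f g. is_prism D B \<and> is_prism D C \<and> f \<in> phom D A B \<and> g \<in> phom D B C \<longrightarrow>
        (\<forall>u\<in>carrier (Mdl M A x).
           bc M A x C (compose (carrier A) g f) u = bc M B (ppull Xf A B f x) C g (bc M A x B f u)))"

text \<open>
  For \<open>M\<close> finite projective, an element of the direct sum \<open>M\<^sup>\<otimes>\<close> of all
  \<open>M\<^sup>\<otimes>\<^sup>a \<otimes> (M\<^sup>\<or>)\<^sup>\<otimes>\<^sup>b\<close> is a finite family of \<open>A\<close>-multilinear forms on \<open>(M\<^sup>\<or>)\<^sup>a \<times> M\<^sup>b\<close>.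
\<close>

definition mixed_tensor ::
  "('b, 'k) ring_scheme \<Rightarrow> ('b, 'm) module \<Rightarrow> (('m \<Rightarrow> 'b) list \<Rightarrow> 'm list \<Rightarrow> 'b) \<Rightarrow> bool" where
  "mixed_tensor A M \<tau> \<longleftrightarrow>
     (\<forall>ls\<in>lists (mdual A M). \<forall>ms\<in>lists (carrier M). \<tau> ls ms \<in> carrier A \<and>
        (\<forall>i<length ms. \<forall>u\<in>carrier M. \<forall>v\<in>carrier M. \<forall>a\<in>carrier A.
           \<tau> ls (ms[i := (a \<odot>\<^bsub>M\<^esub> u) \<oplus>\<^bsub>M\<^esub> v])
         = (a \<otimes>\<^bsub>A\<^esub> \<tau> ls (ms[i := u])) \<oplus>\<^bsub>A\<^esub> \<tau> ls (ms[i := v])) \<and>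
        (\<forall>i<length ls. \<forall>u\<in>mdual A M. \<forall>v\<in>mdual A M. \<forall>a\<in>carrier A.
           \<tau> (ls[i := (\<lambda>m\<in>carrier M. (a \<otimes>\<^bsub>A\<^esub> u m) \<oplus>\<^bsub>A\<^esub> v m)]) ms
         = (a \<otimes>\<^bsub>A\<^esub> \<tau> (ls[i := u]) ms) \<oplus>\<^bsub>A\<^esub> \<tau> (ls[i := v]) ms)) \<and>
     (\<exists>k. \<forall>ls\<in>lists (mdual A M). \<forall>ms\<in>lists (carrier M).
        length ls + length ms > k \<longrightarrow> \<tau> ls ms = \<zero>\<^bsub>A\<^esub>)"

text \<open>
  \<open>F(\<phi>\<^sup>*\<tau>) = \<tau>\<close> in \<open>M\<^sup>\<otimes>[1/I]\<close>, evaluated at functionals \<open>ls\<close> and at vectors in the image of \<open>F\<close> (which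
  span after inverting \<open>I\<close>). For a dual basis \<open>(e, l)\<close> of \<open>M\<close>, the functional \<open>h \<circ> F\<close> on
  \<open>\<phi>\<^sup>*M\<close> is \<open>\<Sum>\<^sub>k h (F (e k)) \<cdot> \<phi>\<^sup>*(l k)\<close>.
\<close>

definition frobenius_invariant ::
  "nat \<Rightarrow> ('b, 'w, 'a) prism \<Rightarrow> ('b, 'm) module \<Rightarrow> ('m \<Rightarrow> 'm) \<Rightarrow> (('m \<Rightarrow> 'b) list \<Rightarrow> 'm list \<Rightarrow> 'b) \<Rightarrow> bool" where
  "frobenius_invariant p A M F \<tau> \<longleftrightarrow>
     (\<forall>r e l. dual_basis A M r e l \<longrightarrow>
        (\<forall>ls\<in>lists (mdual A M). \<forall>ms\<in>lists (carrier M).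
           \<tau> ls (map F ms) =
           finsum A (\<lambda>ks. finprod A (\<lambda>q. (ls ! q) (F (e (ks ! q)))) {..<length ls} \<otimes>\<^bsub>A\<^esub>
                phi p A (\<tau> (map l ks) ms)) (idxs r (length ls))))"

text \<open>A family of Frobenius invariant global sections of \<open>M\<^sup>\<otimes>\<close> indexed like \<open>T0\<close>.\<close>

definition crystal_tensors ::
  "('w, 'i) group_datum \<Rightarrow> ('a, 'w, 'x) space \<Rightarrow> ('b, 'w, 'a, 'x, 'm) crystal \<Rightarrow>
   ('i \<Rightarrow> ('b, 'w, 'a) prism \<Rightarrow> 'x \<Rightarrow> ('m \<Rightarrow> 'b) list \<Rightarrow> 'm list \<Rightarrow> 'b) \<Rightarrow> bool" where
  "crystal_tensors D Xf M T \<longleftrightarrow> (\<forall>t\<in>TI D. \<forall>(A, x) \<in> psite D Xf.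
     mixed_tensor A (Mdl M A x) (T t A x) \<and>
     frobenius_invariant (pp D) A (Mdl M A x) (Frob M A x) (T t A x) \<and>
     (\<forall>B f. is_prism D B \<and> f \<in> phom D A B \<longrightarrow>
        (\<forall>ls\<in>lists (mdual A (Mdl M A x)). \<forall>ls'\<in>lists (mdual B (Mdl M B (ppull Xf A B f x))).
         \<forall>ms\<in>lists (carrier (Mdl M A x)).
           list_all2 (\<lambda>l l'. \<forall>u\<in>carrier (Mdl M A x). l' (bc M A x B f u) = f (l u)) ls ls' \<longrightarrow>
           T t B (ppull Xf A B f x) ls' (map (bc M A x B f) ms) = f (T t A x ls ms))))"


section \<open>First relative prismatic cohomology\<close>

text \<open>
  For \<open>q : Y \<rightarrow> Xf\<close> and \<open>(A, x)\<close> in \<open>Xf\<^sub>\<Delta>\<close>, an object \<open>(B, f, y)\<close> of the relative prismatic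
  site \<open>(Y\<^sub>x/A)\<^sub>\<Delta>\<close> is a prism over \<open>A\<close> and a morphism \<open>Spf (B/IB) \<rightarrow> Y\<close> over \<open>x\<close>.
\<close>

type_synonym ('b, 'w, 'a, 'y) robj = "('b, 'w, 'a) prism \<times> ('b \<Rightarrow> 'b) \<times> 'y"

type_synonym ('b, 'w, 'a, 'y) cochain =
  "('b, 'w, 'a, 'y) robj \<Rightarrow> ('b \<Rightarrow> 'b) \<Rightarrow> ('b, 'w, 'a, 'y) robj \<Rightarrow> 'b"

type_synonym ('b, 'w, 'a, 'y) h1class =
  "(('b, 'w, 'a, 'y) robj set \<times> ('b, 'w, 'a, 'y) cochain) set"

definition rsite ::
  "('w, 'i) group_datum \<Rightarrow> ('a, 'w, 'x) space \<Rightarrow> ('a, 'w, 'y) space \<Rightarrow> (('a, 'w) walg \<Rightarrow> 'y \<Rightarrow> 'x) \<Rightarrow>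
   ('b, 'w, 'a) prism \<Rightarrow> 'x \<Rightarrow> ('b, 'w, 'a, 'y) robj set" where
  "rsite D Xf Y q A x = {(B, f, y). is_prism D B \<and> f \<in> phom D A B \<and>
     y \<in> pts Y (rbar B) \<and> q (rbar B) y = ppull Xf A B f x}"

definition rarr ::
  "('w, 'i) group_datum \<Rightarrow> ('a, 'w, 'y) space \<Rightarrow> ('b, 'w, 'a) prism \<Rightarrow>
   ('b, 'w, 'a, 'y) robj \<Rightarrow> ('b, 'w, 'a, 'y) robj \<Rightarrow> ('b \<Rightarrow> 'b) set" where
  "rarr D Y A = (\<lambda>(B, f, y) (C, g, z). {h \<in> phom D B C. compose (carrier A) h f = g \<and> ppull Y B C h y = z})"

text \<open>
  \<open>H\<^sup>1\<close> of the structure sheaf \<open>(B, f, y) \<mapsto> B\<close> is the group of isomorphism classes of its torsors. A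
  torsor with chosen sections \<open>s\<close> over the objects of a covering sieve \<open>S\<close> of the final object amounts to
  the cocycle \<open>c = h(s) - s\<close> on the arrows \<open>h\<close> between objects of \<open>S\<close>. A class is the set of all
  pairs \<open>(S, c)\<close> describing the same torsor. (Sieves are closed under ring maps out of their members,
  since arrows point in the direction of ring maps.)
\<close>

definition covering_sieve ::
  "('w, 'i) group_datum \<Rightarrow> ('a, 'w, 'x) space \<Rightarrow> ('a, 'w, 'y) space \<Rightarrow> (('a, 'w) walg \<Rightarrow> 'y \<Rightarrow> 'x) \<Rightarrow>
   ('b, 'w, 'a) prism \<Rightarrow> 'x \<Rightarrow> ('b, 'w, 'a, 'y) robj set \<Rightarrow> bool" where
  "covering_sieve D Xf Y q A x S \<longleftrightarrow> S \<subseteq> rsite D Xf Y q A x \<and>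
     (\<forall>U\<in>S. \<forall>V\<in>rsite D Xf Y q A x. rarr D Y A U V \<noteq> {} \<longrightarrow> V \<in> S) \<and>
     (\<forall>U\<in>rsite D Xf Y q A x. \<exists>V\<in>S. \<exists>h\<in>rarr D Y A U V. flat_cover D (fst U) (fst V) h)"

definition cocycle ::
  "('w, 'i) group_datum \<Rightarrow> ('a, 'w, 'y) space \<Rightarrow> ('b, 'w, 'a) prism \<Rightarrow>
   ('b, 'w, 'a, 'y) robj set \<Rightarrow> ('b, 'w, 'a, 'y) cochain \<Rightarrow> bool" where
  "cocycle D Y A S c \<longleftrightarrow>
     (\<forall>U\<in>S. \<forall>V\<in>S. \<forall>h\<in>rarr D Y A U V. c U h V \<in> carrier (fst V)) \<and>
     (\<forall>U\<in>S. \<forall>V\<in>S. \<forall>Z\<in>S. \<forall>h\<in>rarr D Y A U V. \<forall>k\<in>rarr D Y A V Z.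
        c U (compose (carrier (fst U)) k h) Z = c V k Z \<oplus>\<^bsub>fst Z\<^esub> k (c U h V))"

definition h1cls ::
  "('w, 'i) group_datum \<Rightarrow> ('a, 'w, 'x) space \<Rightarrow> ('a, 'w, 'y) space \<Rightarrow> (('a, 'w) walg \<Rightarrow> 'y \<Rightarrow> 'x) \<Rightarrow>
   ('b, 'w, 'a) prism \<Rightarrow> 'x \<Rightarrow> ('b, 'w, 'a, 'y) robj set \<Rightarrow> ('b, 'w, 'a, 'y) cochain \<Rightarrow>
   ('b, 'w, 'a, 'y) h1class" where
  "h1cls D Xf Y q A x S c = {(S', c'). covering_sieve D Xf Y q A x S' \<and> cocycle D Y A S' c' \<and>
     (\<exists>S'' b. covering_sieve D Xf Y q A x S'' \<and> S'' \<subseteq> S \<inter> S' \<and> (\<forall>U\<in>S''. b U \<in> carrier (fst U)) \<and>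
        (\<forall>U\<in>S''. \<forall>V\<in>S''. \<forall>h\<in>rarr D Y A U V.
           c' U h V = (c U h V \<oplus>\<^bsub>fst V\<^esub> h (b U)) \<ominus>\<^bsub>fst V\<^esub> b V))}"

definition h1mod ::
  "('w, 'i) group_datum \<Rightarrow> ('a, 'w, 'x) space \<Rightarrow> ('a, 'w, 'y) space \<Rightarrow> (('a, 'w) walg \<Rightarrow> 'y \<Rightarrow> 'x) \<Rightarrow>
   ('b, 'w, 'a) prism \<Rightarrow> 'x \<Rightarrow> ('b, ('b, 'w, 'a, 'y) h1class) module" where
  "h1mod D Xf Y q A x = \<lparr>
     carrier = {h1cls D Xf Y q A x S c | S c. covering_sieve D Xf Y q A x S \<and> cocycle D Y A S c},
     monoid.mult = undefined, monoid.one = undefined,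
     ring.zero = h1cls D Xf Y q A x (rsite D Xf Y q A x) (\<lambda>U h V. \<zero>\<^bsub>fst V\<^esub>),
     ring.add = (\<lambda>u v. \<Union>(S, c)\<in>u. \<Union>(S', c')\<in>v.
       h1cls D Xf Y q A x (S \<inter> S') (\<lambda>U h V. c U h V \<oplus>\<^bsub>fst V\<^esub> c' U h V)),
     smult = (\<lambda>a u. \<Union>(S, c)\<in>u.
       h1cls D Xf Y q A x S (\<lambda>U h V. fst (snd V) a \<otimes>\<^bsub>fst V\<^esub> c U h V))\<rparr>"

definition H1_prismatic ::
  "('w, 'i) group_datum \<Rightarrow> ('a, 'w, 'x) space \<Rightarrow> ('a, 'w, 'y) space \<Rightarrow> (('a, 'w) walg \<Rightarrow> 'y \<Rightarrow> 'x) \<Rightarrow>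
   ('b, 'w, 'a, 'x, ('b, 'w, 'a, 'y) h1class) crystal" where
  "H1_prismatic D Xf Y q = \<lparr>
     Mdl = h1mod D Xf Y q,
     bc = (\<lambda>A x B f u.
       let x' = ppull Xf A B f x; \<iota> = (\<lambda>(C, g, y). (C, compose (carrier A) g f, y))
       in \<Union>(S, c)\<in>u. h1cls D Xf Y q B x' {U \<in> rsite D Xf Y q B x'. \<iota> U \<in> S} (\<lambda>U h V. c (\<iota> U) h (\<iota> V))),
     Frob = (\<lambda>A x u. \<Union>(S, c)\<in>u. h1cls D Xf Y q A x S (\<lambda>U h V. phi (pp D) (fst V) (c U h V)))\<rparr>"


section \<open>The torsor of trivializations\<close>

definition lincomb :: "nat \<Rightarrow> ('b, 'm) module \<Rightarrow> (nat \<Rightarrow> 'm) \<Rightarrow> (nat \<Rightarrow> 'b) \<Rightarrow> 'm" where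
  "lincomb n M \<beta> v = finsum M (\<lambda>i. v i \<odot>\<^bsub>M\<^esub> \<beta> i) {..<n}"

definition frame_coord :: "nat \<Rightarrow> ('b, 'k) ring_scheme \<Rightarrow> ('b, 'm) module \<Rightarrow> (nat \<Rightarrow> 'm) \<Rightarrow> nat \<Rightarrow> 'm \<Rightarrow> 'b" where
  "frame_coord n A M \<beta> i =
     (\<lambda>m\<in>carrier M. (THE v. v \<in> {..<n} \<rightarrow>\<^sub>E carrier A \<and> lincomb n M \<beta> v = m) i)"

text \<open>
  A linear isomorphism \<open>\<beta> : \<Lambda>\<^sub>0\<^sup>* \<otimes> A \<rightarrow> M\<close> is recorded by the images of the basis vectors, and
  \<open>frame_coord\<close> is \<open>\<beta>\<^sup>-\<^sup>1\<close>. The last condition says that \<open>\<beta>\<close> carries \<open>T0 t \<otimes> 1\<close> to \<open>T t\<close>, in coordinates.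
\<close>

definition isom_torsor ::
  "('w, 'i) group_datum \<Rightarrow> ('b, 'w, 'a, 'x, 'm) crystal \<Rightarrow>
   ('i \<Rightarrow> ('b, 'w, 'a) prism \<Rightarrow> 'x \<Rightarrow> ('m \<Rightarrow> 'b) list \<Rightarrow> 'm list \<Rightarrow> 'b) \<Rightarrow>
   ('b, 'w, 'a) prism \<Rightarrow> 'x \<Rightarrow> (nat \<Rightarrow> 'm) set" where
  "isom_torsor D M T A x = {\<beta> \<in> {..<rk D} \<rightarrow>\<^sub>E carrier (Mdl M A x).
     bij_betw (lincomb (rk D) (Mdl M A x) \<beta>) ({..<rk D} \<rightarrow>\<^sub>E carrier A) (carrier (Mdl M A x)) \<and>
     (\<forall>t\<in>TI D. \<forall>is js. set is \<subseteq> {..<rk D} \<and> set js \<subseteq> {..<rk D} \<longrightarrow>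
        T t A x (map (frame_coord (rk D) A (Mdl M A x) \<beta>) is) (map \<beta> js) = strc A (T0 D t is js))}"

definition frame_pull ::
  "('w, 'i) group_datum \<Rightarrow> ('b, 'w, 'a, 'x, 'm) crystal \<Rightarrow> ('b, 'w, 'a) prism \<Rightarrow> 'x \<Rightarrow> ('b, 'w, 'a) prism \<Rightarrow>
   ('b \<Rightarrow> 'b) \<Rightarrow> (nat \<Rightarrow> 'm) \<Rightarrow> nat \<Rightarrow> 'm" where
  "frame_pull D M A x B f \<beta> = (\<lambda>i\<in>{..<rk D}. bc M A x B f (\<beta> i))"

text \<open>The right action \<open>\<beta> \<mapsto> \<beta> \<circ> g\<close>.\<close>

definition frame_act ::
  "('w, 'i) group_datum \<Rightarrow> ('b, 'm) module \<Rightarrow> (nat \<Rightarrow> 'm) \<Rightarrow> (nat \<times> nat \<Rightarrow> 'b) \<Rightarrow> nat \<Rightarrow> 'm" where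
  "frame_act D M \<beta> g = (\<lambda>j\<in>{..<rk D}. lincomb (rk D) M \<beta> (\<lambda>i. g (i, j)))"

text \<open>
  The matrix of \<open>\<beta>\<^sup>-\<^sup>1 \<circ> F \<circ> \<phi>\<^sup>*(\<beta>)\<close>, which has entries in \<open>A\<close> and is viewed over \<open>A[1/E]\<close>: the
  \<open>j\<close>-th basis vector is sent by \<open>\<phi>\<^sup>*(\<beta>)\<close> to \<open>1 \<otimes> \<beta> j\<close>, and then to \<open>F (\<beta> j)\<close>.
\<close>

definition trivialized_frobenius ::
  "('w, 'i) group_datum \<Rightarrow> ('b, 'w, 'a, 'x, 'm) crystal \<Rightarrow> ('b, 'w, 'a) prism \<Rightarrow> 'x \<Rightarrow> 'b \<Rightarrow>
   (nat \<Rightarrow> 'm) \<Rightarrow> nat \<times> nat \<Rightarrow> ('b \<times> nat) set" where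
  "trivialized_frobenius D M A x E \<beta> = (\<lambda>(i, j) \<in> {..<rk D} \<times> {..<rk D}.
     loc_in A E (frame_coord (rk D) A (Mdl M A x) \<beta> i (Frob M A x (\<beta> j))))"

text \<open>\<open>\<G>(A) \<mu>(E) \<G>(A)\<close> as a subset of \<open>\<G>(A[1/E])\<close>.\<close>

definition double_coset ::
  "('w, 'i) group_datum \<Rightarrow> ('b, 'w, 'k) walg_scheme \<Rightarrow> 'b \<Rightarrow> (nat \<times> nat \<Rightarrow> ('b \<times> nat) set) set" where
  "double_coset D A E =
     {mmul (rk D) (loc A E)
        (mmul (rk D) (loc A E) (mmap (rk D) (loc_in A E) g)
           (mu_at D (loc A E) (\<lambda>w. loc_in A E (strc A w)) (loc_in A E E)))
        (mmap (rk D) (loc_in A E) h) | g h. g \<in> grp D A (strc A) \<and> h \<in> grp D A (strc A)}"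

definition prismatic_torsor_of_type_mu ::
  "('w, 'i) group_datum \<Rightarrow> ('a, 'w, 'x) space \<Rightarrow> ('b, 'w, 'a, 'x, 'm) crystal \<Rightarrow>
   ('i \<Rightarrow> ('b, 'w, 'a) prism \<Rightarrow> 'x \<Rightarrow> ('m \<Rightarrow> 'b) list \<Rightarrow> 'm list \<Rightarrow> 'b) \<Rightarrow> bool" where
  "prismatic_torsor_of_type_mu D Xf M T \<longleftrightarrow>
     (\<forall>(A, x) \<in> psite D Xf. \<forall>\<beta>\<in>isom_torsor D M T A x.
        bij_betw (frame_act D (Mdl M A x) \<beta>) (grp D A (strc A)) (isom_torsor D M T A x)) \<and>
     (\<forall>(A, x) \<in> psite D Xf. \<exists>B f d. flat_cover D A B f \<and> d \<in> carrier B \<and> pI B = PIdl\<^bsub>B\<^esub> d \<and>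
        (\<exists>\<beta>\<in>isom_torsor D M T B (ppull Xf A B f x).
           trivialized_frobenius D M B (ppull Xf A B f x) d \<beta> \<in> double_coset D B d))"


section \<open>Crystalline prisms and Breuil--Kisin prisms\<close>

record ('a, 'w) cprism = "('a, 'w) walg" +
  fr :: "'a \<Rightarrow> 'a"

definition is_cprism :: "('w, 'i) group_datum \<Rightarrow> ('a, 'w) cprism \<Rightarrow> bool" where
  "is_cprism D R \<longleftrightarrow> complete_walg D R \<and> p_torsion_free (pp D) R \<and> fr R \<in> Rhom R R \<and>
     (\<forall>a\<in>carrier R. fr R a \<ominus>\<^bsub>R\<^esub> (a [^]\<^bsub>R\<^esub> pp D) \<in> p_ideal (pp D) R) \<and>
     (\<forall>w\<in>carrier (BW D). fr R (strc R w) = strc R (sg D w))"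

definition cp_hom :: "('w, 'i) group_datum \<Rightarrow> ('a, 'w) cprism \<Rightarrow> ('a, 'w) cprism \<Rightarrow> ('a \<Rightarrow> 'a) set" where
  "cp_hom D R S = {f \<in> walg_hom D R S. \<forall>a\<in>carrier R. f (fr R a) = fr S (f a)}"

definition cp_cover :: "('w, 'i) group_datum \<Rightarrow> ('a, 'w) cprism \<Rightarrow> ('a, 'w) cprism \<Rightarrow> ('a \<Rightarrow> 'a) \<Rightarrow> bool" where
  "cp_cover D R S f \<longleftrightarrow> is_cprism D R \<and> is_cprism D S \<and> f \<in> cp_hom D R S \<and>
     completely_faithfully_flat R (p_ideal (pp D) R) f S"

definition pow_ser :: "('a, 'k) ring_scheme \<Rightarrow> (nat \<Rightarrow> 'a) ring" where
  "pow_ser R = \<lparr>carrier = {g. range g \<subseteq> carrier R},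
     monoid.mult = (\<lambda>g h k. finsum R (\<lambda>l. g l \<otimes>\<^bsub>R\<^esub> h (k - l)) {..k}),
     monoid.one = (\<lambda>k. if k = 0 then \<one>\<^bsub>R\<^esub> else \<zero>\<^bsub>R\<^esub>),
     ring.zero = (\<lambda>k. \<zero>\<^bsub>R\<^esub>),
     ring.add = (\<lambda>g h k. g k \<oplus>\<^bsub>R\<^esub> h k)\<rparr>"

definition bk_frob :: "('w, 'i) group_datum \<Rightarrow> ('a, 'w) cprism \<Rightarrow> (nat \<Rightarrow> 'a) \<Rightarrow> nat \<Rightarrow> 'a" where
  "bk_frob D R g = (\<lambda>k. if pp D dvd k then fr R (g (k div pp D)) else \<zero>\<^bsub>R\<^esub>)"

text \<open>\<open>E = t + p\<close>.\<close>

definition bk_E :: "('w, 'i) group_datum \<Rightarrow> ('a, 'w) cprism \<Rightarrow> nat \<Rightarrow> 'a" where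
  "bk_E D R = (\<lambda>k. if k = 0 then rnat R (pp D) else if k = 1 then \<one>\<^bsub>R\<^esub> else \<zero>\<^bsub>R\<^esub>)"

text \<open>
  The prism \<open>(R[[t]], (t + p))\<close>. The \<open>\<delta>\<close>-structure is \<open>(\<phi>(g) - g\<^sup>p)/p\<close>, and the reduction
  \<open>R[[t]] \<rightarrow> R\<close> is evaluation at \<open>t = -p\<close>.
\<close>

definition BK :: "('w, 'i) group_datum \<Rightarrow> ('a, 'w) cprism \<Rightarrow> (nat \<Rightarrow> 'a, 'w, 'a) prism" where
  "BK D R = \<lparr>carrier = carrier (pow_ser R), monoid.mult = monoid.mult (pow_ser R), monoid.one = \<one>\<^bsub>pow_ser R\<^esub>,
     ring.zero = \<zero>\<^bsub>pow_ser R\<^esub>, ring.add = ring.add (pow_ser R),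
     strc = (\<lambda>w k. if k = 0 then strc R w else \<zero>\<^bsub>R\<^esub>),
     dl = (\<lambda>g. THE d. d \<in> carrier (pow_ser R) \<and>
        add_pow (pow_ser R) (pp D) d = bk_frob D R g \<ominus>\<^bsub>pow_ser R\<^esub> (g [^]\<^bsub>pow_ser R\<^esub> pp D)),
     rbar = walg.truncate R,
     proj = (\<lambda>g\<in>carrier (pow_ser R). THE r. r \<in> carrier R \<and>
        (\<forall>m::nat. r \<ominus>\<^bsub>R\<^esub> finsum R (\<lambda>k. g k \<otimes>\<^bsub>R\<^esub> ((\<ominus>\<^bsub>R\<^esub> rnat R (pp D)) [^]\<^bsub>R\<^esub> k)) {..<m}
           \<in> ipow R (p_ideal (pp D) R) m))\<rparr>"

definition BK_map :: "('a, 'w) cprism \<Rightarrow> ('a \<Rightarrow> 'a) \<Rightarrow> (nat \<Rightarrow> 'a) \<Rightarrow> nat \<Rightarrow> 'a" where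
  "BK_map R f = (\<lambda>g\<in>carrier (pow_ser R). \<lambda>k. f (g k))"

text \<open>The group \<open>L\<^sup>+\<^sub>B\<^sub>K \<G>\<close>.\<close>

definition LG :: "('w, 'i) group_datum \<Rightarrow> ('a, 'w) cprism \<Rightarrow> (nat \<times> nat \<Rightarrow> nat \<Rightarrow> 'a) set" where
  "LG D R = grp D (BK D R) (strc (BK D R))"

text \<open>
  The space \<open>\<^bold>C\<close>: since \<open>A \<mapsto> \<G>(A[1/E])\<close> is a sheaf, the sheafification of
  \<open>A \<mapsto> \<G>(A) \<mu>(E) \<G>(A)\<close> consists of the sections of \<open>\<G>(A[1/E])\<close> that are flat locally in
  this double coset. It is evaluated at \<open>A = R[[t]]\<close>.
\<close>

abbreviation bk_loc :: "('w, 'i) group_datum \<Rightarrow> ('a, 'w) cprism \<Rightarrow> ((nat \<Rightarrow> 'a) \<times> nat) set ring" where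
  "bk_loc D R \<equiv> loc (BK D R) (bk_E D R)"

abbreviation bk_in :: "('w, 'i) group_datum \<Rightarrow> ('a, 'w) cprism \<Rightarrow> (nat \<Rightarrow> 'a) \<Rightarrow> ((nat \<Rightarrow> 'a) \<times> nat) set" where
  "bk_in D R \<equiv> loc_in (BK D R) (bk_E D R)"

definition C_BK :: "('w, 'i) group_datum \<Rightarrow> ('a, 'w) cprism \<Rightarrow> (nat \<times> nat \<Rightarrow> ((nat \<Rightarrow> 'a) \<times> nat) set) set" where
  "C_BK D R = {h \<in> grp D (bk_loc D R) (\<lambda>w. bk_in D R (strc (BK D R) w)).
     \<exists>B f. flat_cover D (BK D R) B f \<and>
       mmap (rk D) (loc_map B (f (bk_E D R)) f) h \<in> double_coset D B (f (bk_E D R))}"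

definition C_map ::
  "('w, 'i) group_datum \<Rightarrow> ('a, 'w) cprism \<Rightarrow> ('a, 'w) cprism \<Rightarrow> ('a \<Rightarrow> 'a) \<Rightarrow>
   (nat \<times> nat \<Rightarrow> ((nat \<Rightarrow> 'a) \<times> nat) set) \<Rightarrow> nat \<times> nat \<Rightarrow> ((nat \<Rightarrow> 'a) \<times> nat) set" where
  "C_map D R S f = mmap (rk D) (loc_map (BK D S) (bk_E D S) (BK_map R f))"

text \<open>\<open>\<phi>\<close>-conjugation \<open>h \<cdot> g = g\<^sup>-\<^sup>1 h \<phi>(g)\<close>.\<close>

definition Ad_phi ::
  "('w, 'i) group_datum \<Rightarrow> ('a, 'w) cprism \<Rightarrow> (nat \<times> nat \<Rightarrow> ((nat \<Rightarrow> 'a) \<times> nat) set) \<Rightarrow>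
   (nat \<times> nat \<Rightarrow> nat \<Rightarrow> 'a) \<Rightarrow> nat \<times> nat \<Rightarrow> ((nat \<Rightarrow> 'a) \<times> nat) set" where
  "Ad_phi D R h g =
     mmul (rk D) (bk_loc D R)
       (mmul (rk D) (bk_loc D R) (mmap (rk D) (bk_in D R) (minv (rk D) (BK D R) g)) h)
       (mmap (rk D) (bk_in D R) (mmap (rk D) (bk_frob D R) g))"


section \<open>Torsors and the quotient stack over crystalline prisms\<close>

record ('a, 'w, 'z) psh =
  el :: "('a, 'w) cprism \<Rightarrow> 'z set"
  tr :: "('a, 'w) cprism \<Rightarrow> ('a, 'w) cprism \<Rightarrow> ('a \<Rightarrow> 'a) \<Rightarrow> 'z \<Rightarrow> 'z"

definition S_cp :: "('a, 'w, 'x) space \<Rightarrow> ('a, 'w, 'x) psh" where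
  "S_cp Xf = \<lparr>el = (\<lambda>R. pts Xf (walg.truncate R)),
     tr = (\<lambda>R S f. pull Xf (walg.truncate R) (walg.truncate S) f)\<rparr>"

definition yoneda :: "('w, 'i) group_datum \<Rightarrow> ('a, 'w) cprism \<Rightarrow> ('a, 'w, 'a \<Rightarrow> 'a) psh" where
  "yoneda D R = \<lparr>el = (\<lambda>S. cp_hom D R S), tr = (\<lambda>S T g f. compose (carrier R) g f)\<rparr>"

text \<open>A presheaf over a presheaf \<open>F\<close>, with an action of \<open>L\<^sup>+\<^sub>B\<^sub>K \<G>\<close>; \<open>sec P R z\<close> is the fibre over
  \<open>z \<in> F(R)\<close>.\<close>

record ('a, 'w, 'z, 't) gsheaf =
  sec :: "('a, 'w) cprism \<Rightarrow> 'z \<Rightarrow> 't set"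
  res :: "('a, 'w) cprism \<Rightarrow> ('a, 'w) cprism \<Rightarrow> ('a \<Rightarrow> 'a) \<Rightarrow> 'z \<Rightarrow> 't \<Rightarrow> 't"
  act :: "('a, 'w) cprism \<Rightarrow> 'z \<Rightarrow> 't \<Rightarrow> (nat \<times> nat \<Rightarrow> nat \<Rightarrow> 'a) \<Rightarrow> 't"

definition gpresheaf ::
  "('w, 'i) group_datum \<Rightarrow> ('a, 'w, 'z) psh \<Rightarrow> ('a, 'w, 'z, 't, 'k) gsheaf_scheme \<Rightarrow> bool" where
  "gpresheaf D F P \<longleftrightarrow>
     (\<forall>R z s. is_cprism D R \<and> z \<in> el F R \<and> s \<in> sec P R z \<longrightarrow>
        res P R R (restrict id (carrier R)) z s = s \<and>
        act P R z s (mone (rk D) (BK D R)) = s \<and>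
        (\<forall>g\<in>LG D R. act P R z s g \<in> sec P R z \<and>
           (\<forall>h\<in>LG D R. act P R z (act P R z s g) h = act P R z s (mmul (rk D) (BK D R) g h)))) \<and>
     (\<forall>R S f z s. is_cprism D R \<and> is_cprism D S \<and> f \<in> cp_hom D R S \<and> z \<in> el F R \<and> s \<in> sec P R z \<longrightarrow>
        res P R S f z s \<in> sec P S (tr F R S f z) \<and>
        (\<forall>g\<in>LG D R. res P R S f z (act P R z s g)
            = act P S (tr F R S f z) (res P R S f z s) (mmap (rk D) (BK_map R f) g)) \<and>
        (\<forall>T f'. is_cprism D T \<and> f' \<in> cp_hom D S T \<longrightarrow>
           res P R T (compose (carrier R) f' f) z s
         = res P S T f' (tr F R S f z) (res P R S f z s)))"

definition torsor ::
  "('w, 'i) group_datum \<Rightarrow> ('a, 'w, 'z) psh \<Rightarrow> ('a, 'w, 'z, 't, 'k) gsheaf_scheme \<Rightarrow> bool" where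
  "torsor D F P \<longleftrightarrow> gpresheaf D F P \<and>
     (\<forall>R z s. is_cprism D R \<and> z \<in> el F R \<and> s \<in> sec P R z \<longrightarrow>
        bij_betw (act P R z s) (LG D R) (sec P R z)) \<and>
     (\<forall>R z. is_cprism D R \<and> z \<in> el F R \<longrightarrow>
        (\<exists>S f. cp_cover D R S f \<and> sec P S (tr F R S f z) \<noteq> {})) \<and>
     (\<forall>R z S f s. z \<in> el F R \<and> cp_cover D R S f \<and> s \<in> sec P S (tr F R S f z) \<and>
        (\<forall>T g h. is_cprism D T \<and> g \<in> cp_hom D S T \<and> h \<in> cp_hom D S T \<and>
           compose (carrier R) g f = compose (carrier R) h f \<longrightarrow>
           res P S T g (tr F R S f z) s = res P S T h (tr F R S f z) s) \<longrightarrow>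
        (\<exists>!s'. s' \<in> sec P R z \<and> res P R S f z s' = s))"

text \<open>
  An object of \<open>[\<^bold>C / Ad\<^sub>\<phi> L\<^sup>+\<^sub>B\<^sub>K \<G>]\<close> over \<open>R\<close> is a torsor over the site of crystalline prisms over \<open>R\<close>
  with an equivariant map \<open>alp\<close> to \<open>\<^bold>C\<close>; a morphism is an equivariant map over \<open>\<^bold>C\<close>.
\<close>

record ('a, 'w, 't) qob = "('a, 'w, 'a \<Rightarrow> 'a, 't) gsheaf" +
  alp :: "('a, 'w) cprism \<Rightarrow> ('a \<Rightarrow> 'a) \<Rightarrow> 't \<Rightarrow> nat \<times> nat \<Rightarrow> ((nat \<Rightarrow> 'a) \<times> nat) set"

definition quot_object :: "('w, 'i) group_datum \<Rightarrow> ('a, 'w) cprism \<Rightarrow> ('a, 'w, 't) qob \<Rightarrow> bool" where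
  "quot_object D R P \<longleftrightarrow> torsor D (yoneda D R) P \<and>
     (\<forall>S f s. is_cprism D S \<and> f \<in> cp_hom D R S \<and> s \<in> sec P S f \<longrightarrow>
        alp P S f s \<in> C_BK D S \<and>
        (\<forall>g\<in>LG D S. alp P S f (act P S f s g) = Ad_phi D S (alp P S f s) g) \<and>
        (\<forall>T g. is_cprism D T \<and> g \<in> cp_hom D S T \<longrightarrow>
           alp P T (compose (carrier R) g f) (res P S T g f s) = C_map D S T g (alp P S f s)))"

definition quot_morphism ::
  "('w, 'i) group_datum \<Rightarrow> ('a, 'w) cprism \<Rightarrow> ('a, 'w, 't) qob \<Rightarrow> ('a, 'w, 'u) qob \<Rightarrow>
   (('a, 'w) cprism \<Rightarrow> ('a \<Rightarrow> 'a) \<Rightarrow> 't \<Rightarrow> 'u) \<Rightarrow> bool" where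
  "quot_morphism D R P Q \<theta> \<longleftrightarrow>
     (\<forall>S f s. is_cprism D S \<and> f \<in> cp_hom D R S \<and> s \<in> sec P S f \<longrightarrow>
        \<theta> S f s \<in> sec Q S f \<and> alp Q S f (\<theta> S f s) = alp P S f s \<and>
        (\<forall>g\<in>LG D S. \<theta> S f (act P S f s g) = act Q S f (\<theta> S f s) g) \<and>
        (\<forall>T g. is_cprism D T \<and> g \<in> cp_hom D S T \<longrightarrow>
           \<theta> T (compose (carrier R) g f) (res P S T g f s) = res Q S T g f (\<theta> S f s)))"

definition quot_pull :: "('a, 'w) cprism \<Rightarrow> ('a \<Rightarrow> 'a) \<Rightarrow> ('a, 'w, 't) qob \<Rightarrow> ('a, 'w, 't) qob" where
  "quot_pull R f P = \<lparr>
     sec = (\<lambda>T g. sec P T (compose (carrier R) g f)),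
     res = (\<lambda>T U h g. res P T U h (compose (carrier R) g f)),
     act = (\<lambda>T g. act P T (compose (carrier R) g f)),
     alp = (\<lambda>T g. alp P T (compose (carrier R) g f))\<rparr>"

text \<open>
  A morphism of stacks from the sheaf \<open>F\<close> to the quotient stack: objects \<open>Ob R z\<close> over \<open>R\<close> for
  \<open>z \<in> F(R)\<close> and isomorphisms \<open>Mo R S f z\<close> of \<open>f\<^sup>*(Ob R z)\<close> with \<open>Ob S (f\<^sup>*z)\<close>, subject to
  the cocycle condition. (All morphisms of the quotient stack are isomorphisms.)
\<close>

definition stack_morphism ::
  "('w, 'i) group_datum \<Rightarrow> ('a, 'w, 'z) psh \<Rightarrow> (('a, 'w) cprism \<Rightarrow> 'z \<Rightarrow> ('a, 'w, 't) qob) \<Rightarrow>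
   (('a, 'w) cprism \<Rightarrow> ('a, 'w) cprism \<Rightarrow> ('a \<Rightarrow> 'a) \<Rightarrow> 'z \<Rightarrow> ('a, 'w) cprism \<Rightarrow> ('a \<Rightarrow> 'a) \<Rightarrow> 't \<Rightarrow> 't) \<Rightarrow> bool" where
  "stack_morphism D F Ob Mo \<longleftrightarrow>
     (\<forall>R z. is_cprism D R \<and> z \<in> el F R \<longrightarrow> quot_object D R (Ob R z)) \<and>
     (\<forall>R S f z. is_cprism D R \<and> is_cprism D S \<and> f \<in> cp_hom D R S \<and> z \<in> el F R \<longrightarrow>
        quot_morphism D S (quot_pull R f (Ob R z)) (Ob S (tr F R S f z)) (Mo R S f z)) \<and>
     (\<forall>R z S f s. is_cprism D R \<and> z \<in> el F R \<and> is_cprism D S \<and> f \<in> cp_hom D R S \<and>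
        s \<in> sec (Ob R z) S f \<longrightarrow> Mo R R (restrict id (carrier R)) z S f s = s) \<and>
     (\<forall>R S T f g z U h s. is_cprism D R \<and> is_cprism D S \<and> is_cprism D T \<and> is_cprism D U \<and>
        f \<in> cp_hom D R S \<and> g \<in> cp_hom D S T \<and> h \<in> cp_hom D T U \<and> z \<in> el F R \<and>
        s \<in> sec (Ob R z) U (compose (carrier R) h (compose (carrier R) g f)) \<longrightarrow>
        Mo R T (compose (carrier R) g f) z U h s =
        Mo S T g (tr F R S f z) U h (Mo R S f z U (compose (carrier S) h g) s))"

text \<open>The composite of a section \<open>h\<close> of \<open>\<^bold>C\<close> over \<open>R\<close> with \<open>\<^bold>C \<rightarrow> [\<^bold>C / Ad\<^sub>\<phi> L\<^sup>+\<^sub>B\<^sub>K \<G>]\<close>: the trivial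
  torsor with \<open>g \<mapsto> h \<cdot> g\<close>.\<close>

definition quot_proj ::
  "('w, 'i) group_datum \<Rightarrow> ('a, 'w) cprism \<Rightarrow> (nat \<times> nat \<Rightarrow> ((nat \<Rightarrow> 'a) \<times> nat) set) \<Rightarrow>
   ('a, 'w, nat \<times> nat \<Rightarrow> nat \<Rightarrow> 'a) qob" where
  "quot_proj D R h = \<lparr>
     sec = (\<lambda>S f. LG D S),
     res = (\<lambda>S T g f. mmap (rk D) (BK_map S g)),
     act = (\<lambda>S f. mmul (rk D) (BK D S)),
     alp = (\<lambda>S f. Ad_phi D S (C_map D R S f h))\<rparr>"


section \<open>The torsor \<open>J\<close> over crystalline prisms and the map \<open>\<xi>\<close>\<close>

definition J_BK ::
  "('w, 'i) group_datum \<Rightarrow> (nat \<Rightarrow> 'a, 'w, 'a, 'x, 'm) crystal \<Rightarrow>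
   ('i \<Rightarrow> (nat \<Rightarrow> 'a, 'w, 'a) prism \<Rightarrow> 'x \<Rightarrow> ('m \<Rightarrow> nat \<Rightarrow> 'a) list \<Rightarrow> 'm list \<Rightarrow> nat \<Rightarrow> 'a) \<Rightarrow>
   ('a, 'w, 'x, nat \<Rightarrow> 'm) gsheaf" where
  "J_BK D M T = \<lparr>
     sec = (\<lambda>R x. isom_torsor D M T (BK D R) x),
     res = (\<lambda>R S f x. frame_pull D M (BK D R) x (BK D S) (BK_map R f)),
     act = (\<lambda>R x. frame_act D (Mdl M (BK D R) x))\<rparr>"

definition xi_sharp ::
  "('w, 'i) group_datum \<Rightarrow> (nat \<Rightarrow> 'a, 'w, 'a, 'x, 'm) crystal \<Rightarrow> ('a, 'w) cprism \<Rightarrow> 'x \<Rightarrow>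
   (nat \<Rightarrow> 'm) \<Rightarrow> nat \<times> nat \<Rightarrow> ((nat \<Rightarrow> 'a) \<times> nat) set" where
  "xi_sharp D M R x \<beta> = trivialized_frobenius D M (BK D R) x (bk_E D R) \<beta>"

text \<open>The object \<open>(x\<^sup>*J, \<xi>\<^sup>\<sharp>)\<close> of the quotient stack.\<close>

definition xi_object ::
  "('w, 'i) group_datum \<Rightarrow> ('a, 'w, 'x) space \<Rightarrow> (nat \<Rightarrow> 'a, 'w, 'a, 'x, 'm) crystal \<Rightarrow>
   ('i \<Rightarrow> (nat \<Rightarrow> 'a, 'w, 'a) prism \<Rightarrow> 'x \<Rightarrow> ('m \<Rightarrow> nat \<Rightarrow> 'a) list \<Rightarrow> 'm list \<Rightarrow> nat \<Rightarrow> 'a) \<Rightarrow>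
   ('a, 'w) cprism \<Rightarrow> 'x \<Rightarrow> ('a, 'w, nat \<Rightarrow> 'm) qob" where
  "xi_object D Xf M T R x = \<lparr>
     sec = (\<lambda>S f. sec (J_BK D M T) S (tr (S_cp Xf) R S f x)),
     res = (\<lambda>S T' g f. res (J_BK D M T) S T' g (tr (S_cp Xf) R S f x)),
     act = (\<lambda>S f. act (J_BK D M T) S (tr (S_cp Xf) R S f x)),
     alp = (\<lambda>S f. xi_sharp D M S (tr (S_cp Xf) R S f x))\<rparr>"

end

theory Submission
  imports Defs
begin

text \<open>
  In a trivialization \<open>\<beta>\<close> the Frobenius is a matrix \<open>H\<close> over \<open>A\<close>. It is invertible over \<open>A[1/E]\<close> because \<open>\<phi>\<close> is an
  isomorphism up to \<open>E\<close>-power torsion and \<open>I\<close> kills its cokernel; it fixes the tensors \<open>T0\<close> because \<open>\<beta>\<close> carries them to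
  Frobenius-invariant tensors, and because their coordinates in \<open>\<int>\<^sub>p\<close> are fixed by \<open>\<sigma>\<close>. Hence \<open>H\<close> lies in
  \<open>\<G>(A[1/E])\<close>. On a flat cover the torsor has a second trivialization \<open>\<gamma>\<close> with Frobenius in \<open>\<G>(B) \<mu>(d) \<G>(B)\<close> for
  some generator \<open>d\<close> of the ideal; \<open>\<beta>\<close> and \<open>\<gamma>\<close> differ by an element of \<open>\<G>(B)\<close>, so \<open>\<phi>\<close>-conjugation leaves the
  double coset unchanged, and \<open>d\<close> may be replaced by \<open>E\<close> since the two generators differ by a unit \<open>u\<close> and
  \<open>\<mu>(u) \<in> \<G>(B)\<close>. Applied to \<open>A = R[[t]]\<close>, which is a prism with \<open>A/(t + p) = R\<close>, this yields the map to
  \<open>\<^bold>C\<close>; naturality and equivariance are the change-of-basis formula for semilinear maps, and the pullbacks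
  \<open>x\<^sup>*J\<close> with this map are the objects of the quotient stack.
\<close>

section \<open>Commutative rings\<close>

text \<open>The map \<phi> does not extend to A[1/E], because \<phi>(E) need not be a unit there.
  Frobenius computations are therefore done with matrices over A, and only their result is carried
  to A[1/E]; the Frobenius maps the pullback of M into M itself, so its matrix has no denominators.
  The tensor condition is used in a form suited to this: read as a matrix, a tensor is fixed by H
  when it intertwines two tensor powers of H, a relation that does not involve the inverse of H.

  For R[[t]] the work lies in the axioms of a prism. Division with remainder by E = t + p shows that
  evaluation at t = -p is multiplicative with kernel (E) and that p is a unit multiple of \<phi>(E)
  modulo E. Completeness for (p, E) = (p, t) is checked coefficient by coefficient. The
  \<delta>-structure is handled by cancelling p, a nonzerodivisor in R[[t]] because R is p-torsion
  free.

  The generator d that comes with a flat cover has no given relation to E; the quotient of the two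
  is a unit because generators of a Cartier ideal are nonzerodivisors.\<close>

lemma (in abelian_monoid) finsum_swap:
  assumes "finite A" "finite B" "\<And>i j. i \<in> A \<Longrightarrow> j \<in> B \<Longrightarrow> f i j \<in> carrier G"
  shows "(\<Oplus>i\<in>A. \<Oplus>j\<in>B. f i j) = (\<Oplus>j\<in>B. \<Oplus>i\<in>A. f i j)"
  using assms(1,3)
proof (induction A)
  case empty
  then show ?case by simp
next
  case (insert a A)
  then have "(\<Oplus>i\<in>insert a A. \<Oplus>j\<in>B. f i j) = (\<Oplus>j\<in>B. f a j) \<oplus> (\<Oplus>j\<in>B. \<Oplus>i\<in>A. f i j)"
    by (subst finsum_insert) auto
  also have "\<dots> = (\<Oplus>j\<in>B. f a j \<oplus> (\<Oplus>i\<in>A. f i j))"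
    by (rule finsum_addf[symmetric]) (use insert in auto)
  also have "\<dots> = (\<Oplus>j\<in>B. \<Oplus>i\<in>insert a A. f i j)"
    by (rule finsum_cong') (use insert in auto)
  finally show ?case .
qed

text \<open>Index sets may be enlarged by zero terms; this brings convolutions with different
  supports to a common range of summation.\<close>

lemma (in abelian_monoid) finsum_sub:
  assumes "finite B" "A \<subseteq> B" "\<And>i. i \<in> B - A \<Longrightarrow> f i = \<zero>" "\<And>i. i \<in> A \<Longrightarrow> f i \<in> carrier G"
  shows "finsum G f A = finsum G f B"
proof (rule add.finprod_mono_neutral_cong_left[OF assms(1,2)])
  show "f \<in> B \<rightarrow> carrier G" using assms(3,4) by (auto, metis DiffI zero_closed)
qed (use assms in auto)

lemma (in abelian_monoid) finsum_delta:
  assumes "finite A" "i \<in> A" "f i \<in> carrier G"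
  shows "(\<Oplus>j\<in>A. if j = i then f j else \<zero>) = f i"
proof -
  have "finsum G (\<lambda>j. if j = i then f j else \<zero>) {i} = (\<Oplus>j\<in>A. if j = i then f j else \<zero>)"
    by (rule finsum_sub) (use assms in auto)
  then show ?thesis using assms by simp
qed

lemma (in cring) finsum_if_mult_left:
  assumes "i < (n::nat)" "\<And>l. l < n \<Longrightarrow> x l \<in> carrier R"
  shows "(\<Oplus>l\<in>{..<n}. (if i = l then \<one> else \<zero>) \<otimes> x l) = x i"
proof -
  have "(\<Oplus>l\<in>{..<n}. (if i = l then \<one> else \<zero>) \<otimes> x l) = (\<Oplus>l\<in>{..<n::nat}. if l = i then x l else \<zero>)"
    by (rule finsum_cong') (use assms in auto)
  then show ?thesis using finsum_delta[of "{..<n}" i x] assms by simp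
qed

lemma (in cring) finsum_if_mult_right:
  assumes "i < (n::nat)" "\<And>l. l < n \<Longrightarrow> x l \<in> carrier R"
  shows "(\<Oplus>l\<in>{..<n}. x l \<otimes> (if l = i then \<one> else \<zero>)) = x i"
proof -
  have "(\<Oplus>l\<in>{..<n}. x l \<otimes> (if l = i then \<one> else \<zero>)) = (\<Oplus>l\<in>{..<n::nat}. if l = i then x l else \<zero>)"
    by (rule finsum_cong') (use assms in auto)
  then show ?thesis using finsum_delta[of "{..<n}" i x] assms by simp
qed

lemma (in abelian_group) minus_eq_zeroD:
  "x \<in> carrier G \<Longrightarrow> y \<in> carrier G \<Longrightarrow> x \<ominus> y = \<zero> \<Longrightarrow> x = y"
  by (metis a_minus_def add.inv_closed minus_equality minus_minus)

lemma (in abelian_group) minus_self: "x \<in> carrier G \<Longrightarrow> x \<ominus> x = \<zero>"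
  by (simp add: a_minus_def r_neg)

lemma (in abelian_group) add_minus_cancel:
  "x \<in> carrier G \<Longrightarrow> y \<in> carrier G \<Longrightarrow> (x \<oplus> y) \<ominus> y = x"
  by (simp add: a_minus_def a_assoc r_neg)

lemma (in abelian_group) minus_add_cancel:
  "x \<in> carrier G \<Longrightarrow> y \<in> carrier G \<Longrightarrow> y \<oplus> (x \<ominus> y) = x"
  by (metis a_comm a_inv_closed a_minus_def r_neg2)

text \<open>\<open>BK D R\<close> and \<open>walg.truncate R\<close> have other record types than
  the rings \<open>pow_ser R\<close> and \<open>R\<close> that they carry, so an equation of records
  cannot express that these are the same rings. This relation does, and everything that depends on
  the operations alone is transferred along it.\<close>

definition same_ops :: "('a, 'k) ring_scheme \<Rightarrow> ('a, 'l) ring_scheme \<Rightarrow> bool" where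
  "same_ops R S \<longleftrightarrow> carrier S = carrier R \<and> monoid.mult S = monoid.mult R \<and>
     \<one>\<^bsub>S\<^esub> = \<one>\<^bsub>R\<^esub> \<and> \<zero>\<^bsub>S\<^esub> = \<zero>\<^bsub>R\<^esub> \<and> ring.add S = ring.add R"

context
  fixes R :: "('a, 'k) ring_scheme" and S :: "('a, 'l) ring_scheme"
  assumes so: "same_ops R S"
begin

lemma same_ops_simps:
  "carrier S = carrier R" "monoid.mult S = monoid.mult R" "\<one>\<^bsub>S\<^esub> = \<one>\<^bsub>R\<^esub>" "\<zero>\<^bsub>S\<^esub> = \<zero>\<^bsub>R\<^esub>" "ring.add S = ring.add R"
  using so by (auto simp: same_ops_def)

lemma same_ops_a_inv: "a_inv S = a_inv R"
  by (auto simp: a_inv_def m_inv_def same_ops_simps)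

lemma same_ops_minus: "a_minus S = a_minus R"
  by (intro ext) (auto simp: a_minus_def same_ops_simps same_ops_a_inv)

lemma same_ops_pow: "x [^]\<^bsub>S\<^esub> (n::nat) = x [^]\<^bsub>R\<^esub> n"
  by (auto simp: nat_pow_def same_ops_simps)

lemma same_ops_add_pow: "add_pow S (n::nat) x = add_pow R n x"
  by (auto simp: add_pow_def nat_pow_def same_ops_simps)

lemma same_ops_rnat: "rnat S n = rnat R n"
  by (simp add: rnat_def same_ops_add_pow same_ops_simps)

lemma same_ops_cring: assumes "cring R" shows "cring S"
proof -
  interpret cring R by fact
  show ?thesis
  proof (rule cringI)
    show "abelian_group S"
      by (rule abelian_groupI) (auto simp: same_ops_simps a_ac intro!: bexI[of _ "\<ominus>\<^bsub>R\<^esub> x" for x] l_neg)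
    show "comm_monoid S"
      by (rule comm_monoidI) (auto simp: same_ops_simps m_ac)
  qed (auto simp: same_ops_simps l_distr)
qed

lemma same_ops_cgenideal: "PIdl\<^bsub>S\<^esub> a = PIdl\<^bsub>R\<^esub> a"
  by (auto simp: cgenideal_def same_ops_simps)

lemma same_ops_ideal_prod: "ideal_prod S I J = ideal_prod R I J"
proof (intro equalityI subsetI)
  show "x \<in> ideal_prod R I J" if "x \<in> ideal_prod S I J" for x
    using that by induction (auto simp: same_ops_simps intro: ideal_prod.intros)
  show "x \<in> ideal_prod S I J" if "x \<in> ideal_prod R I J" for x
    using that
  proof induction
    case (prod i j)
    then show ?case using ideal_prod.prod[of i I j J S] by (simp add: same_ops_simps)
  next
    case (sum a b)
    then show ?case using ideal_prod.sum[of a S I J b] by (simp add: same_ops_simps)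
  qed
qed

lemma same_ops_ipow: "ipow S I k = ipow R I k"
  by (induction k) (auto simp: same_ops_simps same_ops_ideal_prod)

lemma same_ops_adic_complete: "adic_complete S I = adic_complete R I"
  by (simp add: adic_complete_def same_ops_simps same_ops_minus same_ops_ipow)

lemma same_ops_p_ideal: "p_ideal p S = p_ideal p R"
  by (simp add: p_ideal_def same_ops_rnat same_ops_cgenideal)

end

section \<open>Multiples of one, powers of an ideal and the binomial formula\<close>

context cring begin

lemma rnat_closed [simp]: "rnat R k \<in> carrier R"
  by (simp add: rnat_def)

lemma rnat_0 [simp]: "rnat R 0 = \<zero>"
  by (simp add: rnat_def)

lemma rnat_1 [simp]: "rnat R (Suc 0) = \<one>"
  by (simp add: rnat_def)

lemma rnat_Suc: "rnat R (Suc k) = rnat R k \<oplus> \<one>"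
  by (simp add: rnat_def)

lemma rnat_add: "rnat R (k + l) = rnat R k \<oplus> rnat R l"
  by (simp add: rnat_def add.nat_pow_mult)

lemma rnat_mult: "rnat R (k * l) = rnat R k \<otimes> rnat R l"
  by (induction k) (simp_all add: rnat_add rnat_Suc l_distr a_comm)

lemma add_pow_rnat: "x \<in> carrier R \<Longrightarrow> add_pow R (k::nat) x = rnat R k \<otimes> x"
  by (simp add: rnat_def add_pow_ldistr)

lemma mem_PIdl: "x \<in> PIdl a \<longleftrightarrow> (\<exists>b\<in>carrier R. x = b \<otimes> a)"
  by (auto simp: cgenideal_def)

lemma PIdl_one [simp]: "PIdl \<one> = carrier R"
  by (metis cgenideal_eq_genideal genideal_one one_closed)

lemma ipow_ideal: "ideal I R \<Longrightarrow> ideal (ipow R I k) R"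
  by (induction k) (auto intro: ideal_prod_is_ideal oneideal)

lemma ideal_prod_PIdl:
  assumes [simp]: "a \<in> carrier R" "b \<in> carrier R"
  shows "ideal_prod R (PIdl a) (PIdl b) = PIdl (a \<otimes> b)"
proof (intro equalityI subsetI)
  show "x \<in> PIdl (a \<otimes> b)" if "x \<in> ideal_prod R (PIdl a) (PIdl b)" for x
    using that
  proof induction
    case (prod i j)
    then obtain r s where rs: "r \<in> carrier R" "s \<in> carrier R" "i = r \<otimes> a" "j = s \<otimes> b"
      by (auto simp: mem_PIdl)
    then show ?case unfolding mem_PIdl by (intro bexI[of _ "r \<otimes> s"]) (auto simp: m_ac)
  next
    case (sum s t)
    then show ?case by (auto simp: mem_PIdl l_distr[symmetric] simp del: l_distr)
  qed
  show "x \<in> ideal_prod R (PIdl a) (PIdl b)" if x: "x \<in> PIdl (a \<otimes> b)" for x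
  proof -
    obtain r where r: "r \<in> carrier R" "x = (r \<otimes> a) \<otimes> (\<one> \<otimes> b)" using x by (auto simp: mem_PIdl m_assoc)
    show ?thesis unfolding r(2) by (rule ideal_prod.prod) (auto simp: mem_PIdl intro: r bexI[of _ "\<one>"])
  qed
qed

lemma ipow_PIdl: "a \<in> carrier R \<Longrightarrow> ipow R (PIdl a) k = PIdl (a [^] k)"
  by (induction k) (simp_all add: ideal_prod_PIdl m_comm)

text \<open>This is the uniqueness half of \<open>adic_complete\<close>, applied to the constant
  sequence \<open>z\<close>, of which both \<open>y\<close> and \<open>z\<close> are limits.\<close>

lemma adic_separated:
  assumes "adic_complete R I" "ideal I R" "y \<in> carrier R" "z \<in> carrier R" "\<And>k. y \<ominus> z \<in> ipow R I k"
  shows "y = z"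
proof -
  have z: "\<zero> \<in> ipow R I k" for k
    using ipow_ideal[OF assms(2)] by (simp add: additive_subgroup.zero_closed ideal.axioms(1))
  have "\<exists>!y. y \<in> carrier R \<and> (\<forall>k. y \<ominus> z \<in> ipow R I k)"
    using assms(1)[unfolded adic_complete_def, rule_format, of "\<lambda>_. z"] assms(4) z by (simp add: minus_self)
  then show ?thesis using assms z by (metis minus_self)
qed

lemma binomial:
  assumes "x \<in> carrier R" "y \<in> carrier R"
  shows "(x \<oplus> y) [^] n = (\<Oplus>i\<in>{..n}. rnat R (n choose i) \<otimes> ((x [^] i) \<otimes> (y [^] (n - i))))"
proof (induction n)
  case 0
  then show ?case using assms by simp
next
  case (Suc n)
  let ?t = "\<lambda>i. (x [^] i) \<otimes> (y [^] (Suc n - i))"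
  note [simp] = assms
  have 1: "(\<Oplus>i\<in>{..n}. rnat R (n choose i) \<otimes> ((x [^] i) \<otimes> (y [^] (n - i)))) \<otimes> x
      = (\<Oplus>i\<in>{..n}. rnat R (n choose i) \<otimes> ?t (Suc i))"
    by (subst finsum_ldistr) (auto intro!: finsum_cong' simp: m_ac)
  have "(\<Oplus>i\<in>{..n}. rnat R (n choose i) \<otimes> ((x [^] i) \<otimes> (y [^] (n - i)))) \<otimes> y
      = (\<Oplus>i\<in>{..n}. rnat R (n choose i) \<otimes> ?t i)"
    by (subst finsum_ldistr) (auto intro!: finsum_cong' simp: m_ac Suc_diff_le)
  \<comment> \<open>The index \<open>Suc n\<close> may be added because its binomial coefficient
    vanishes. Splitting off index 0 afterwards aligns this sum with the first one, ready for
    Pascal's rule.\<close>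
  also have "\<dots> = (\<Oplus>i\<in>{..Suc n}. rnat R (n choose i) \<otimes> ?t i)"
    by (rule finsum_sub) (auto simp: not_le binomial_eq_0)
  also have "\<dots> = (\<Oplus>i\<in>{..n}. rnat R (n choose Suc i) \<otimes> ?t (Suc i)) \<oplus> rnat R (n choose 0) \<otimes> ?t 0"
    by (rule finsum_Suc2) auto
  finally have 2: "(\<Oplus>i\<in>{..n}. rnat R (n choose i) \<otimes> ((x [^] i) \<otimes> (y [^] (n - i)))) \<otimes> y
      = (\<Oplus>i\<in>{..n}. rnat R (n choose Suc i) \<otimes> ?t (Suc i)) \<oplus> rnat R (n choose 0) \<otimes> ?t 0" .
  have "(\<Oplus>i\<in>{..Suc n}. rnat R (Suc n choose i) \<otimes> ?t i)
     = (\<Oplus>i\<in>{..n}. rnat R (Suc n choose Suc i) \<otimes> ?t (Suc i)) \<oplus> rnat R (Suc n choose 0) \<otimes> ?t 0"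
    by (rule finsum_Suc2) auto
  also have "(\<Oplus>i\<in>{..n}. rnat R (Suc n choose Suc i) \<otimes> ?t (Suc i))
     = (\<Oplus>i\<in>{..n}. rnat R (n choose i) \<otimes> ?t (Suc i) \<oplus> rnat R (n choose Suc i) \<otimes> ?t (Suc i))"
    by (rule finsum_cong') (auto simp: rnat_add l_distr)
  also have "\<dots> = (\<Oplus>i\<in>{..n}. rnat R (n choose i) \<otimes> ?t (Suc i)) \<oplus>
       (\<Oplus>i\<in>{..n}. rnat R (n choose Suc i) \<otimes> ?t (Suc i))"
    by (rule finsum_addf) auto
  finally have 3: "(\<Oplus>i\<in>{..Suc n}. rnat R (Suc n choose i) \<otimes> ?t i) =
     (\<Oplus>i\<in>{..n}. rnat R (n choose i) \<otimes> ?t (Suc i)) \<oplus>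
       ((\<Oplus>i\<in>{..n}. rnat R (n choose Suc i) \<otimes> ?t (Suc i)) \<oplus> rnat R (n choose 0) \<otimes> ?t 0)"
    by (simp add: a_assoc del: finsum_Suc)
  have "(x \<oplus> y) [^] Suc n = (\<Oplus>i\<in>{..n}. rnat R (n choose i) \<otimes> ((x [^] i) \<otimes> (y [^] (n - i)))) \<otimes> (x \<oplus> y)"
    using Suc by simp
  also have "\<dots> = (\<Oplus>i\<in>{..n}. rnat R (n choose i) \<otimes> ((x [^] i) \<otimes> (y [^] (n - i)))) \<otimes> x \<oplus>
     (\<Oplus>i\<in>{..n}. rnat R (n choose i) \<otimes> ((x [^] i) \<otimes> (y [^] (n - i)))) \<otimes> y"
    by (rule r_distr) auto
  finally show ?case unfolding 1 2 3 .
qed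

text \<open>The terms with \<open>0 < i < p\<close> are divisible by \<open>p\<close>; the sum occurs in the axioms of \<open>\<delta>\<close>-rings.\<close>

definition delta_add_sum :: "nat \<Rightarrow> 'a \<Rightarrow> 'a \<Rightarrow> 'a" where
  "delta_add_sum p x y = finsum R (\<lambda>i. add_pow R ((p choose i) div p) ((x [^] i) \<otimes> (y [^] (p - i)))) {1..<p}"

lemma delta_add_sum_closed [simp]:
  "x \<in> carrier R \<Longrightarrow> y \<in> carrier R \<Longrightarrow> delta_add_sum p x y \<in> carrier R"
  unfolding delta_add_sum_def by (rule finsum_closed) auto

text \<open>This identity is the source of the additivity axiom for \<delta>. It is used in both
  directions: to verify that axiom for R[[t]], and to deduce that \<phi> is additive on an arbitrary
  prism.\<close>

lemma power_prime_add:
  assumes p: "Factorial_Ring.prime p" and [simp]: "x \<in> carrier R" "y \<in> carrier R"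
  shows "(x \<oplus> y) [^] p = ((x [^] p) \<oplus> (y [^] p)) \<oplus> rnat R p \<otimes> delta_add_sum p x y"
proof -
  let ?t = "\<lambda>i. rnat R (p choose i) \<otimes> ((x [^] i) \<otimes> (y [^] (p - i)))"
  have p0: "p > 0" using p by (simp add: prime_gt_0_nat)
  have set: "{..p} = insert 0 (insert p {1..<p})" using p0 by auto
  have "(x \<oplus> y) [^] p = finsum R ?t {..p}" by (rule binomial) auto
  also have "\<dots> = ?t 0 \<oplus> (?t p \<oplus> finsum R ?t {1..<p})"
    unfolding set using p0 by (subst finsum_insert | auto)+
  also have "finsum R ?t {1..<p} = (\<Oplus>i\<in>{1..<p}. rnat R p \<otimes> add_pow R ((p choose i) div p) ((x [^] i) \<otimes> (y [^] (p - i))))"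
  proof (rule finsum_cong')
    fix i assume i: "i \<in> {1..<p}"
    then have "p dvd (p choose i)" using p by (intro dvd_choose_prime) auto
    then have "rnat R (p choose i) = rnat R p \<otimes> rnat R ((p choose i) div p)"
      by (metis dvd_mult_div_cancel rnat_mult)
    then show "?t i = rnat R p \<otimes> add_pow R ((p choose i) div p) ((x [^] i) \<otimes> (y [^] (p - i)))"
      by (simp add: add_pow_rnat m_assoc)
  qed auto
  also have "\<dots> = rnat R p \<otimes> delta_add_sum p x y"
    unfolding delta_add_sum_def by (rule finsum_rdistr[symmetric]) auto
  finally show ?thesis by (simp add: a_ac)
qed

end

section \<open>Ring homomorphisms, units and integer exponents\<close>

lemma (in ring_hom_cring) hom_finsum': "f \<in> A \<rightarrow> carrier R \<Longrightarrow> h (finsum R f A) = finsum S (\<lambda>i. h (f i)) A"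
  by (simp add: comp_def)

lemma (in ring_hom_cring) hom_pow: "x \<in> carrier R \<Longrightarrow> h (x [^] (n::nat)) = h x [^]\<^bsub>S\<^esub> n"
  by (induction n) auto

lemma (in ring_hom_cring) hom_minus: "x \<in> carrier R \<Longrightarrow> y \<in> carrier R \<Longrightarrow> h (x \<ominus> y) = h x \<ominus>\<^bsub>S\<^esub> h y"
  by (simp add: a_minus_def)

lemma (in ring_hom_cring) hom_rnat: "h (rnat R n) = rnat S n"
  by (induction n) (auto simp: R.rnat_Suc S.rnat_Suc)

lemma (in ring_hom_cring) hom_add_pow: "x \<in> carrier R \<Longrightarrow> h (add_pow R (n::nat) x) = add_pow S n (h x)"
  by (simp add: R.add_pow_rnat S.add_pow_rnat hom_rnat)

lemma (in cring) UnitsI: "u \<in> carrier R \<Longrightarrow> v \<in> carrier R \<Longrightarrow> u \<otimes> v = \<one> \<Longrightarrow> u \<in> Units R"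
  using m_comm[of u v] by (auto simp: Units_def)

lemma (in ring_hom_cring) hom_Units_inv: "u \<in> Units R \<Longrightarrow> h u \<otimes>\<^bsub>S\<^esub> h (inv u) = \<one>\<^bsub>S\<^esub>"
  by (metis R.Units_closed R.Units_inv_closed R.Units_r_inv hom_mult hom_one)

lemma (in ring_hom_cring) hom_Units: "u \<in> Units R \<Longrightarrow> h u \<in> Units S"
  by (rule S.UnitsI[OF _ _ hom_Units_inv]) auto

lemma (in ring_hom_cring) hom_inv: "u \<in> Units R \<Longrightarrow> h (inv u) = inv\<^bsub>S\<^esub> (h u)"
  using hom_Units_inv by (intro S.comm_inv_char[symmetric]) auto

lemma int_pow_nonneg: "k \<ge> 0 \<Longrightarrow> u [^]\<^bsub>R\<^esub> (k::int) = u [^]\<^bsub>R\<^esub> nat k"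
  by (subst int_pow_def2) simp

lemma int_pow_negative: "k < 0 \<Longrightarrow> u [^]\<^bsub>R\<^esub> (k::int) = inv\<^bsub>R\<^esub> (u [^]\<^bsub>R\<^esub> nat (- k))"
  by (subst int_pow_def2) simp

lemma (in ring_hom_cring) hom_int_pow:
  assumes u: "u \<in> Units R" shows "h (u [^] (k::int)) = h u [^]\<^bsub>S\<^esub> k"
proof (cases "k \<ge> 0")
  case True
  show ?thesis unfolding int_pow_nonneg[OF True] using u by (simp only: hom_pow R.Units_closed)
next
  case False
  then have k: "k < 0" by simp
  show ?thesis unfolding int_pow_negative[OF k] hom_inv[OF R.Units_pow_closed[OF u]]
    using u by (simp only: hom_pow R.Units_closed)
qed

text \<open>Continuity for the adic topologies. Membership in the carrier is part of the conclusion
  because the induction over products of ideals has to apply \<open>h\<close> to both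
  factors.\<close>

lemma (in ring_hom_cring) hom_ipow:
  assumes "h ` I \<subseteq> J" "I \<subseteq> carrier R" "a \<in> ipow R I k"
  shows "a \<in> carrier R \<and> h a \<in> ipow S J k"
  using assms(3)
proof (induction k arbitrary: a)
  case (Suc k)
  then have "a \<in> ideal_prod R I (ipow R I k)" by simp
  then show ?case
  proof induction
    case (prod i j)
    then have "i \<in> carrier R" "h i \<in> J" "j \<in> carrier R" "h j \<in> ipow S J k" using Suc.IH assms by auto
    then show ?case by (auto intro: ideal_prod.prod)
  next
    case (sum x y)
    then show ?case by (auto intro!: ideal_prod.sum)
  qed
qed auto

lemma ring_hom_cringI:
  "cring A \<Longrightarrow> cring B \<Longrightarrow> f \<in> ring_hom A B \<Longrightarrow> ring_hom_cring A B f"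
  by (simp add: ring_hom_cring.intro ring_hom_cring_axioms.intro)

lemma Rhom_ring_hom: "f \<in> Rhom A B \<Longrightarrow> f \<in> ring_hom A B"
  by (simp add: Rhom_def)

context cring begin

lemma int_pow_unit_Units:
  assumes u: "u \<in> Units R" shows "u [^] (k::int) \<in> Units R"
proof (cases "k \<ge> 0")
  case True
  show ?thesis unfolding int_pow_nonneg[OF True] by (rule Units_pow_closed[OF u])
next
  case False
  then have k: "k < 0" by simp
  show ?thesis unfolding int_pow_negative[OF k] by (rule Units_inv_Units[OF Units_pow_closed[OF u]])
qed

text \<open>The laws for integer exponents hold in groups. Moving the powers of a unit into the
  group \<open>units_of R\<close> makes these laws available in the ring.\<close>

lemma int_pow_units_of:
  assumes u: "u \<in> Units R" shows "u [^] (k::int) = u [^]\<^bsub>units_of R\<^esub> k"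
proof -
  have n: "u [^] n = u [^]\<^bsub>units_of R\<^esub> n" for n :: nat
    by (induction n) (simp_all add: units_of_mult units_of_one)
  show ?thesis
  proof (cases "k \<ge> 0")
    case True
    show ?thesis unfolding int_pow_nonneg[OF True] by (rule n)
  next
    case False
    then have k: "k < 0" by simp
    show ?thesis unfolding int_pow_negative[OF k] n[symmetric]
      by (rule units_of_inv[OF Units_pow_closed[OF u], symmetric])
  qed
qed

lemma int_pow_unit_add:
  assumes u: "u \<in> Units R" shows "u [^] (k + l :: int) = (u [^] k) \<otimes> (u [^] l)"
proof -
  interpret U: group "units_of R" by (rule units_group)
  show ?thesis unfolding int_pow_units_of[OF u]
    using U.int_pow_mult[of u k l] u by (simp add: units_of_carrier units_of_mult)
qed

lemma int_pow_unit_distrib: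
  assumes u: "u \<in> Units R" and v: "v \<in> Units R"
  shows "(u \<otimes> v) [^] (k::int) = (u [^] k) \<otimes> (v [^] k)"
proof -
  interpret U: comm_group "units_of R" by (rule units_comm_group)
  show ?thesis
    unfolding int_pow_units_of[OF u] int_pow_units_of[OF v] int_pow_units_of[OF Units_m_closed[OF u v]]
    using U.int_pow_distrib[of u v k] u v by (simp add: units_of_carrier units_of_mult)
qed

end

section \<open>Localization at an element\<close>

locale localization = cring A for A :: "('b, 'k) ring_scheme" (structure) +
  fixes E
  assumes E_closed [simp]: "E \<in> carrier A"
begin

abbreviation "frc \<equiv> frac A E"

lemma E_pow_add: "E [^] (m + n :: nat) = (E [^] m) \<otimes> (E [^] n)"
  by (simp add: nat_pow_mult)

text \<open>E may be a zero divisor, so fractions are compared up to a further power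
  \<open>E^l\<close>. The hypothesis is symmetric in the two fractions, hence one inclusion
  suffices.\<close>

lemma frac_eqI:
  assumes a: "a \<in> carrier A" and b: "b \<in> carrier A"
    and eq: "(E [^] (l + k)) \<otimes> b = (E [^] (l + m)) \<otimes> a"
  shows "frc a k = frc b m"
proof -
  have sub: "frc a k \<subseteq> frc b m"
    if a: "a \<in> carrier A" and b: "b \<in> carrier A"
      and eq: "(E [^] (l + k)) \<otimes> b = (E [^] (l + m)) \<otimes> a" for a b l k m
  proof safe
    fix c n assume "(c, n) \<in> frc a k"
    then obtain i where c: "c \<in> carrier A" and i: "(E [^] (i + k)) \<otimes> c = (E [^] (i + n)) \<otimes> a"
      by (auto simp: frac_def)
    \<comment> \<open>Transitivity: the relation for \<open>c\<close> is multiplied by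
      \<open>E^(l + m)\<close>, which creates the term that the hypothesis replaces by a multiple of
      \<open>b\<close>. The new auxiliary exponent is \<open>l + i + k\<close>.\<close>
    have "(E [^] ((l + i + k) + m)) \<otimes> c = (E [^] (l + m)) \<otimes> ((E [^] (i + k)) \<otimes> c)"
      using c by (simp add: E_pow_add m_ac)
    also have "\<dots> = (E [^] (i + n)) \<otimes> ((E [^] (l + m)) \<otimes> a)"
      unfolding i using a by (simp add: m_ac)
    also have "\<dots> = (E [^] ((l + i + k) + n)) \<otimes> b"
      unfolding eq[symmetric] using b by (simp add: E_pow_add m_ac)
    finally show "(c, n) \<in> frc b m" using c by (auto simp: frac_def)
  qed
  show ?thesis
    using sub[OF a b eq] sub[OF b a eq[symmetric]] by blast
qed

lemma frac_self: "a \<in> carrier A \<Longrightarrow> (a, k) \<in> frc a k"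
  by (auto simp: frac_def)

lemma frac_memD:
  assumes "a \<in> carrier A" "(b, m) \<in> frc a k"
  shows "b \<in> carrier A" "frc b m = frc a k"
proof -
  obtain l where l: "b \<in> carrier A" "(E [^] (l + k)) \<otimes> b = (E [^] (l + m)) \<otimes> a"
    using assms by (auto simp: frac_def)
  show "b \<in> carrier A" "frc b m = frc a k" using l frac_eqI[OF assms(1) l] by auto
qed

lemma frac_cancel: "a \<in> carrier A \<Longrightarrow> frc (a \<otimes> (E [^] n)) (k + n) = frc a k"
  by (rule frac_eqI[of _ _ 0]) (auto simp: E_pow_add m_ac)

text \<open>\<open>loc\<close> defines its operations as unions over all representatives. If
  \<open>F\<close> takes the same value at every representative of a fraction, the union runs over a
  nonempty family of equal sets.\<close>

lemma frac_UN:
  assumes a: "a \<in> carrier A"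
    and F: "\<And>b m. b \<in> carrier A \<Longrightarrow> frc b m = frc a k \<Longrightarrow> F b m = F a k"
  shows "(\<Union>(b, m)\<in>frc a k. F b m) = F a k"
proof -
  have "F b m = F a k" if "(b, m) \<in> frc a k" for b m
    using frac_memD[OF a that] F by auto
  then have "(\<Union>x\<in>frc a k. case x of (b, m) \<Rightarrow> F b m) = (\<Union>x\<in>frc a k. F a k)"
    by (intro SUP_cong) auto
  moreover have "frc a k \<noteq> {}" using frac_self[OF a, of k] by blast
  ultimately show ?thesis by simp
qed

lemma frac_mult_cong:
  assumes "a \<in> carrier A" "a' \<in> carrier A" "b \<in> carrier A" "frc a' k' = frc a k"
  shows "frc (a' \<otimes> b) (k' + m) = frc (a \<otimes> b) (k + m)"
proof -
  have "(a', k') \<in> frc a k" using frac_self[OF assms(2), of k'] assms(4) by simp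
  then obtain l where l: "(E [^] (l + k)) \<otimes> a' = (E [^] (l + k')) \<otimes> a" by (auto simp: frac_def)
  have "(E [^] (l + (k + m))) \<otimes> (a' \<otimes> b) = ((E [^] (l + k)) \<otimes> a') \<otimes> ((E [^] m) \<otimes> b)"
    using assms by (simp add: E_pow_add m_ac)
  also have "\<dots> = (E [^] (l + (k' + m))) \<otimes> (a \<otimes> b)"
    unfolding l using assms by (simp add: E_pow_add m_ac)
  finally show ?thesis using assms by (intro frac_eqI[of _ _ l]) auto
qed

lemma frac_add_cong:
  assumes "a \<in> carrier A" "a' \<in> carrier A" "b \<in> carrier A" "frc a' k' = frc a k"
  shows "frc ((a' \<otimes> (E [^] m)) \<oplus> (b \<otimes> (E [^] k'))) (k' + m) = frc ((a \<otimes> (E [^] m)) \<oplus> (b \<otimes> (E [^] k))) (k + m)"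
proof -
  have "(a', k') \<in> frc a k" using frac_self[OF assms(2), of k'] assms(4) by simp
  then obtain l where l: "(E [^] (l + k)) \<otimes> a' = (E [^] (l + k')) \<otimes> a" by (auto simp: frac_def)
  have "(E [^] (l + (k + m))) \<otimes> ((a' \<otimes> (E [^] m)) \<oplus> (b \<otimes> (E [^] k')))
    = ((E [^] (l + k)) \<otimes> a') \<otimes> ((E [^] m) \<otimes> (E [^] m)) \<oplus> (E [^] (l + k + m)) \<otimes> (b \<otimes> (E [^] k'))"
    using assms by (simp add: E_pow_add r_distr m_ac)
  also have "\<dots> = (E [^] (l + (k' + m))) \<otimes> ((a \<otimes> (E [^] m)) \<oplus> (b \<otimes> (E [^] k)))"
    unfolding l using assms by (simp add: E_pow_add r_distr m_ac)
  finally show ?thesis using assms by (intro frac_eqI[of _ _ l]) auto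
qed

lemma loc_carrier: "x \<in> carrier (loc A E) \<longleftrightarrow> (\<exists>a k. a \<in> carrier A \<and> x = frc a k)"
  by (auto simp: loc_def)

lemma frac_in_loc [simp]: "a \<in> carrier A \<Longrightarrow> frc a k \<in> carrier (loc A E)"
  unfolding loc_carrier by blast

lemma loc_one: "\<one>\<^bsub>loc A E\<^esub> = frc \<one> 0" and loc_zero: "\<zero>\<^bsub>loc A E\<^esub> = frc \<zero> 0"
  by (simp_all add: loc_def)

lemma loc_mult:
  assumes [simp]: "a \<in> carrier A" "b \<in> carrier A"
  shows "frc a k \<otimes>\<^bsub>loc A E\<^esub> frc b m = frc (a \<otimes> b) (k + m)"
proof -
  have 1: "(\<Union>(b', m')\<in>frc b m. frc (a' \<otimes> b') (k' + m')) = frc (a' \<otimes> b) (k' + m)"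
    if [simp]: "a' \<in> carrier A" for a' k'
  proof (rule frac_UN)
    fix b' m' assume b': "b' \<in> carrier A" "frc b' m' = frc b m"
    show "frc (a' \<otimes> b') (k' + m') = frc (a' \<otimes> b) (k' + m)"
      using frac_mult_cong[of b b' a' m' m k'] b' by (simp add: m_comm add.commute)
  qed simp
  have "frc a k \<otimes>\<^bsub>loc A E\<^esub> frc b m = (\<Union>(a', k')\<in>frc a k. \<Union>(b', m')\<in>frc b m. frc (a' \<otimes> b') (k' + m'))"
    by (simp add: loc_def)
  also have "\<dots> = (\<Union>(a', k')\<in>frc a k. frc (a' \<otimes> b) (k' + m))"
  proof (rule SUP_cong[OF refl])
    fix x assume "x \<in> frc a k"
    then show "(case x of (a', k') \<Rightarrow> \<Union>(b', m')\<in>frc b m. frc (a' \<otimes> b') (k' + m')) = (case x of (a', k') \<Rightarrow> frc (a' \<otimes> b) (k' + m))"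
      using 1[OF frac_memD(1)[OF assms(1)]] by (cases x) (simp only: prod.case)
  qed
  also have "\<dots> = frc (a \<otimes> b) (k + m)"
    by (rule frac_UN[OF assms(1)]) (rule frac_mult_cong[OF assms(1) _ assms(2)])
  finally show ?thesis .
qed

lemma loc_add:
  assumes [simp]: "a \<in> carrier A" "b \<in> carrier A"
  shows "frc a k \<oplus>\<^bsub>loc A E\<^esub> frc b m = frc ((a \<otimes> (E [^] m)) \<oplus> (b \<otimes> (E [^] k))) (k + m)"
proof -
  have 1: "(\<Union>(b', m')\<in>frc b m. frc ((a' \<otimes> (E [^] m')) \<oplus> (b' \<otimes> (E [^] k'))) (k' + m'))
      = frc ((a' \<otimes> (E [^] m)) \<oplus> (b \<otimes> (E [^] k'))) (k' + m)"
    if [simp]: "a' \<in> carrier A" for a' k'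
  proof (rule frac_UN)
    fix b' m' assume b': "b' \<in> carrier A" "frc b' m' = frc b m"
    show "frc ((a' \<otimes> (E [^] m')) \<oplus> (b' \<otimes> (E [^] k'))) (k' + m') = frc ((a' \<otimes> (E [^] m)) \<oplus> (b \<otimes> (E [^] k'))) (k' + m)"
      using frac_add_cong[of b b' a' m' m k'] b' by (simp add: a_comm add.commute)
  qed simp
  have "frc a k \<oplus>\<^bsub>loc A E\<^esub> frc b m = (\<Union>(a', k')\<in>frc a k. \<Union>(b', m')\<in>frc b m. frc ((a' \<otimes> (E [^] m')) \<oplus> (b' \<otimes> (E [^] k'))) (k' + m'))"
    by (simp add: loc_def)
  also have "\<dots> = (\<Union>(a', k')\<in>frc a k. frc ((a' \<otimes> (E [^] m)) \<oplus> (b \<otimes> (E [^] k'))) (k' + m))"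
  proof (rule SUP_cong[OF refl])
    fix x assume "x \<in> frc a k"
    then show "(case x of (a', k') \<Rightarrow> \<Union>(b', m')\<in>frc b m. frc ((a' \<otimes> (E [^] m')) \<oplus> (b' \<otimes> (E [^] k'))) (k' + m')) = (case x of (a', k') \<Rightarrow> frc ((a' \<otimes> (E [^] m)) \<oplus> (b \<otimes> (E [^] k'))) (k' + m))"
      using 1[OF frac_memD(1)[OF assms(1)]] by (cases x) (simp only: prod.case)
  qed
  also have "\<dots> = frc ((a \<otimes> (E [^] m)) \<oplus> (b \<otimes> (E [^] k))) (k + m)"
    by (rule frac_UN[OF assms(1)]) (rule frac_add_cong[OF assms(1) _ assms(2)])
  finally show ?thesis .
qed

lemma frac_zero: "frc \<zero> k = frc \<zero> 0"
  by (rule frac_eqI[of _ _ 0]) auto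

lemma cring_loc: "cring (loc A E)"
proof (rule cringI)
  show "abelian_group (loc A E)"
  proof (rule abelian_groupI)
    fix x assume "x \<in> carrier (loc A E)"
    then obtain a k where a: "a \<in> carrier A" "x = frc a k" by (auto simp: loc_carrier)
    show "\<zero>\<^bsub>loc A E\<^esub> \<oplus>\<^bsub>loc A E\<^esub> x = x" using a by (simp add: loc_zero loc_add)
    have "frc (\<ominus> a) k \<oplus>\<^bsub>loc A E\<^esub> x = \<zero>\<^bsub>loc A E\<^esub>"
      using a by (simp add: loc_zero loc_add l_minus l_neg frac_zero[of "k + k"])
    then show "\<exists>y\<in>carrier (loc A E). y \<oplus>\<^bsub>loc A E\<^esub> x = \<zero>\<^bsub>loc A E\<^esub>"
      using a by (intro bexI[of _ "frc (\<ominus> a) k"]) auto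
  next
    fix x y assume "x \<in> carrier (loc A E)" "y \<in> carrier (loc A E)"
    then obtain a k b m where a: "a \<in> carrier A" "x = frc a k" "b \<in> carrier A" "y = frc b m"
      by (auto simp: loc_carrier)
    show "x \<oplus>\<^bsub>loc A E\<^esub> y \<in> carrier (loc A E)" using a by (simp add: loc_add)
    show "x \<oplus>\<^bsub>loc A E\<^esub> y = y \<oplus>\<^bsub>loc A E\<^esub> x" using a by (simp add: loc_add a_comm add.commute)
  next
    fix x y z assume "x \<in> carrier (loc A E)" "y \<in> carrier (loc A E)" "z \<in> carrier (loc A E)"
    then obtain a k b m c n where a: "a \<in> carrier A" "x = frc a k" "b \<in> carrier A" "y = frc b m"
       "c \<in> carrier A" "z = frc c n"
      unfolding loc_carrier by blast
    show "x \<oplus>\<^bsub>loc A E\<^esub> y \<oplus>\<^bsub>loc A E\<^esub> z = x \<oplus>\<^bsub>loc A E\<^esub> (y \<oplus>\<^bsub>loc A E\<^esub> z)"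
    proof -
      have eq: "((((a \<otimes> (E [^] m)) \<oplus> (b \<otimes> (E [^] k))) \<otimes> (E [^] n)) \<oplus> (c \<otimes> (E [^] (k + m)))) =
        ((a \<otimes> (E [^] (m + n))) \<oplus> (((b \<otimes> (E [^] n)) \<oplus> (c \<otimes> (E [^] m))) \<otimes> (E [^] k)))"
        using a by (simp add: l_distr E_pow_add m_assoc a_assoc) (simp add: m_ac)
      have "x \<oplus>\<^bsub>loc A E\<^esub> y \<oplus>\<^bsub>loc A E\<^esub> z = frc ((((a \<otimes> (E [^] m)) \<oplus> (b \<otimes> (E [^] k))) \<otimes> (E [^] n)) \<oplus> (c \<otimes> (E [^] (k + m)))) (k + m + n)"
        using a by (simp only: loc_add a_closed m_closed nat_pow_closed E_closed)
      also have "\<dots> = x \<oplus>\<^bsub>loc A E\<^esub> (y \<oplus>\<^bsub>loc A E\<^esub> z)"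
        unfolding eq using a by (simp only: loc_add a_closed m_closed nat_pow_closed E_closed Groups.add_ac)
      finally show ?thesis .
    qed
  qed (auto simp: loc_zero)
  show "comm_monoid (loc A E)"
  proof (rule comm_monoidI)
    fix x y z assume "x \<in> carrier (loc A E)" "y \<in> carrier (loc A E)" "z \<in> carrier (loc A E)"
    then obtain a k b m c n where a: "a \<in> carrier A" "x = frc a k" "b \<in> carrier A" "y = frc b m"
       "c \<in> carrier A" "z = frc c n"
      unfolding loc_carrier by blast
    show "x \<otimes>\<^bsub>loc A E\<^esub> y \<otimes>\<^bsub>loc A E\<^esub> z = x \<otimes>\<^bsub>loc A E\<^esub> (y \<otimes>\<^bsub>loc A E\<^esub> z)"
      using a by (simp add: loc_mult add.assoc m_assoc)
    next
    fix x y assume "x \<in> carrier (loc A E)" "y \<in> carrier (loc A E)"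
    then obtain a k b m where a: "a \<in> carrier A" "x = frc a k" "b \<in> carrier A" "y = frc b m"
      by (auto simp: loc_carrier)
    show "x \<otimes>\<^bsub>loc A E\<^esub> y \<in> carrier (loc A E)" using a by (simp add: loc_mult)
    show "x \<otimes>\<^bsub>loc A E\<^esub> y = y \<otimes>\<^bsub>loc A E\<^esub> x" using a by (simp add: loc_mult m_comm add.commute)
  next
    fix x assume "x \<in> carrier (loc A E)"
    then obtain a k where a: "a \<in> carrier A" "x = frc a k" by (auto simp: loc_carrier)
    show "\<one>\<^bsub>loc A E\<^esub> \<otimes>\<^bsub>loc A E\<^esub> x = x" using a by (simp add: loc_one loc_mult)
  qed (simp add: loc_one)
  fix x y z assume "x \<in> carrier (loc A E)" "y \<in> carrier (loc A E)" "z \<in> carrier (loc A E)"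
  then obtain a k b m c n where a: "a \<in> carrier A" "x = frc a k" "b \<in> carrier A" "y = frc b m"
     "c \<in> carrier A" "z = frc c n"
    unfolding loc_carrier by blast
  have "(x \<otimes>\<^bsub>loc A E\<^esub> z) \<oplus>\<^bsub>loc A E\<^esub> (y \<otimes>\<^bsub>loc A E\<^esub> z) =
      frc ((((a \<otimes> (E [^] m)) \<oplus> (b \<otimes> (E [^] k))) \<otimes> c) \<otimes> (E [^] n)) (k + m + n + n)"
    using a by (simp add: loc_mult loc_add E_pow_add l_distr r_distr m_ac ac_simps)
  \<comment> \<open>The common denominator of the two products has one factor \<open>E^n\<close> too
    many. The same factor stands in the numerator, so \<open>frac_cancel\<close> removes it.\<close>
  also have "\<dots> = (x \<oplus>\<^bsub>loc A E\<^esub> y) \<otimes>\<^bsub>loc A E\<^esub> z"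
    using a by (subst frac_cancel) (auto simp: loc_add loc_mult)
  finally show "(x \<oplus>\<^bsub>loc A E\<^esub> y) \<otimes>\<^bsub>loc A E\<^esub> z = (x \<otimes>\<^bsub>loc A E\<^esub> z) \<oplus>\<^bsub>loc A E\<^esub> (y \<otimes>\<^bsub>loc A E\<^esub> z)" by simp
qed

sublocale L: cring "loc A E" by (rule cring_loc)

lemma loc_in_hom: "loc_in A E \<in> ring_hom A (loc A E)"
  by (rule ring_hom_memI) (auto simp: loc_in_def loc_mult loc_add loc_one)

sublocale I: ring_hom_cring A "loc A E" "loc_in A E"
  by (rule ring_hom_cringI) (auto simp: is_cring L.is_cring loc_in_hom)

lemma loc_in_E_unit: "loc_in A E E \<in> Units (loc A E)"
  by (rule L.UnitsI[of _ "frc \<one> 1"]) (use frac_cancel[of \<one> 1 0] in \<open>auto simp: loc_in_def loc_mult loc_one\<close>)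

text \<open>The universal property of A[1/E], with a/E^k going to f(a) f(E)^-k. It serves to compare
  the localizations at two generators of the same ideal.\<close>

lemma loc_extend:
  assumes f: "ring_hom_cring A C f" and u: "f E \<in> Units C"
  obtains \<psi> where "\<psi> \<in> ring_hom (loc A E) C" "\<And>a. a \<in> carrier A \<Longrightarrow> \<psi> (loc_in A E a) = f a"
proof -
  interpret f: ring_hom_cring A C f by fact
  define v where "v = inv\<^bsub>C\<^esub> (f E)"
  have v [simp]: "v \<in> carrier C" and fv: "f E \<otimes>\<^bsub>C\<^esub> v = \<one>\<^bsub>C\<^esub>" using u by (auto simp: v_def f.S.Units_r_inv)
  have fvn: "(f E [^]\<^bsub>C\<^esub> n) \<otimes>\<^bsub>C\<^esub> (v [^]\<^bsub>C\<^esub> n) = \<one>\<^bsub>C\<^esub>" for n :: nat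
    using fv by (simp add: f.S.nat_pow_distrib[symmetric])
  define \<psi> where "\<psi> x = (THE c. \<exists>a k. a \<in> carrier A \<and> x = frc a k \<and> c = f a \<otimes>\<^bsub>C\<^esub> (v [^]\<^bsub>C\<^esub> k))" for x
  have \<psi>: "\<psi> (frc a k) = f a \<otimes>\<^bsub>C\<^esub> (v [^]\<^bsub>C\<^esub> k)" if a: "a \<in> carrier A" for a k
    unfolding \<psi>_def
  proof (rule the_equality)
    fix c assume "\<exists>b m. b \<in> carrier A \<and> frc a k = frc b m \<and> c = f b \<otimes>\<^bsub>C\<^esub> (v [^]\<^bsub>C\<^esub> m)"
    then obtain b m where b: "b \<in> carrier A" "frc a k = frc b m" "c = f b \<otimes>\<^bsub>C\<^esub> (v [^]\<^bsub>C\<^esub> m)" by blast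
    have "(b, m) \<in> frc a k" using frac_self[OF b(1), of m] b(2) by simp
    then obtain l where l: "(E [^] (l + k)) \<otimes> b = (E [^] (l + m)) \<otimes> a" by (auto simp: frac_def)
    have e: "(f E [^]\<^bsub>C\<^esub> (l + k)) \<otimes>\<^bsub>C\<^esub> f b = (f E [^]\<^bsub>C\<^esub> (l + m)) \<otimes>\<^bsub>C\<^esub> f a"
      using arg_cong[OF l, of f] a b by (simp add: f.hom_pow)
    \<comment> \<open>Inserting the product of \<open>f E\<close> and its inverse, raised to the
      power \<open>l + k\<close>, makes the relation \<open>e\<close> between the two numerators
      applicable.\<close>
    have "c = (((f E [^]\<^bsub>C\<^esub> (l + k)) \<otimes>\<^bsub>C\<^esub> (v [^]\<^bsub>C\<^esub> (l + k))) \<otimes>\<^bsub>C\<^esub> f b) \<otimes>\<^bsub>C\<^esub> (v [^]\<^bsub>C\<^esub> m)"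
      unfolding fvn b(3) using b by simp
    also have "\<dots> = ((f E [^]\<^bsub>C\<^esub> (l + k)) \<otimes>\<^bsub>C\<^esub> f b) \<otimes>\<^bsub>C\<^esub> (v [^]\<^bsub>C\<^esub> (l + k + m))"
      using b by (simp add: f.S.nat_pow_mult[symmetric] f.S.m_ac)
    also have "\<dots> = ((f E [^]\<^bsub>C\<^esub> (l + m)) \<otimes>\<^bsub>C\<^esub> (v [^]\<^bsub>C\<^esub> (l + m))) \<otimes>\<^bsub>C\<^esub> (f a \<otimes>\<^bsub>C\<^esub> (v [^]\<^bsub>C\<^esub> k))"
      unfolding e using a by (simp add: f.S.nat_pow_mult[symmetric] f.S.m_ac)
    also have "\<dots> = f a \<otimes>\<^bsub>C\<^esub> (v [^]\<^bsub>C\<^esub> k)"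
      unfolding fvn using a by simp
    finally show "c = f a \<otimes>\<^bsub>C\<^esub> (v [^]\<^bsub>C\<^esub> k)" .
  qed (use a in blast)
  have vE: "(v [^]\<^bsub>C\<^esub> (n + m)) \<otimes>\<^bsub>C\<^esub> (f E [^]\<^bsub>C\<^esub> n) = v [^]\<^bsub>C\<^esub> m" for n m :: nat
  proof -
    have "(v [^]\<^bsub>C\<^esub> (n + m)) \<otimes>\<^bsub>C\<^esub> (f E [^]\<^bsub>C\<^esub> n) = ((f E [^]\<^bsub>C\<^esub> n) \<otimes>\<^bsub>C\<^esub> (v [^]\<^bsub>C\<^esub> n)) \<otimes>\<^bsub>C\<^esub> (v [^]\<^bsub>C\<^esub> m)"
      by (simp add: f.S.nat_pow_mult[symmetric] f.S.m_ac)
    then show ?thesis unfolding fvn by simp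
  qed
  have hom: "\<psi> \<in> ring_hom (loc A E) C"
  proof (rule ring_hom_memI)
    fix x y assume "x \<in> carrier (loc A E)" "y \<in> carrier (loc A E)"
    then obtain a k b m where a: "a \<in> carrier A" "x = frc a k" "b \<in> carrier A" "y = frc b m"
      by (auto simp: loc_carrier)
    show "\<psi> (x \<otimes>\<^bsub>loc A E\<^esub> y) = \<psi> x \<otimes>\<^bsub>C\<^esub> \<psi> y"
      using a by (simp add: loc_mult \<psi> f.S.nat_pow_mult[symmetric] f.S.m_ac)
    have "\<psi> (x \<oplus>\<^bsub>loc A E\<^esub> y) = f a \<otimes>\<^bsub>C\<^esub> ((v [^]\<^bsub>C\<^esub> (m + k)) \<otimes>\<^bsub>C\<^esub> (f E [^]\<^bsub>C\<^esub> m))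
       \<oplus>\<^bsub>C\<^esub> f b \<otimes>\<^bsub>C\<^esub> ((v [^]\<^bsub>C\<^esub> (k + m)) \<otimes>\<^bsub>C\<^esub> (f E [^]\<^bsub>C\<^esub> k))"
      using a by (simp add: loc_add \<psi> f.hom_pow f.S.l_distr f.S.r_distr f.S.m_ac add.commute)
    then show "\<psi> (x \<oplus>\<^bsub>loc A E\<^esub> y) = \<psi> x \<oplus>\<^bsub>C\<^esub> \<psi> y"
      unfolding vE using a by (simp add: \<psi>)
  qed (auto simp: loc_carrier \<psi> loc_one)
  show thesis using that[OF hom] \<psi> by (simp add: loc_in_def)
qed

lemma loc_map_loc_in:
  assumes "ring_hom_cring A B f" and a: "a \<in> carrier A"
  shows "loc_map B (f E) f (loc_in A E a) = loc_in B (f E) (f a)"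
proof -
  interpret f: ring_hom_cring A B f by fact
  interpret B: localization B "f E" by unfold_locales auto
  have "loc_map B (f E) f (frc a 0) = frac B (f E) (f a) 0"
    unfolding loc_map_def
  proof (rule frac_UN)
    fix b m assume b: "b \<in> carrier A" "frc b m = frc a 0"
    then have "(b, m) \<in> frc a 0" using frac_self[OF b(1), of m] by simp
    then obtain l where l: "(E [^] (l + 0)) \<otimes> b = (E [^] (l + m)) \<otimes> a" unfolding frac_def by blast
    have "(f E [^]\<^bsub>B\<^esub> (l + 0)) \<otimes>\<^bsub>B\<^esub> f b = (f E [^]\<^bsub>B\<^esub> (l + m)) \<otimes>\<^bsub>B\<^esub> f a"
      using arg_cong[OF l, of f] a b by (simp add: f.hom_pow)
    then show "frac B (f E) (f b) m = frac B (f E) (f a) 0"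
      using a b by (intro B.frac_eqI[symmetric]) auto
  qed fact
  then show ?thesis by (simp add: loc_in_def)
qed

end

section \<open>Matrices, tensors and the group scheme\<close>

lemma mmap_cong: "(\<And>i j. i < n \<Longrightarrow> j < n \<Longrightarrow> f (g (i, j)) = f' (g' (i, j))) \<Longrightarrow> mmap n f g = mmap n f' g'"
  by (auto simp: mmap_def restrict_def fun_eq_iff)

lemma mmap_app: "i < n \<Longrightarrow> j < n \<Longrightarrow> mmap n f g (i, j) = f (g (i, j))"
  by (simp add: mmap_def)

lemma mmap_mmap: "mmap n f (mmap n f' g) = mmap n (\<lambda>x. f (f' x)) g"
  by (auto simp: mmap_def restrict_def fun_eq_iff)

lemma mats_app: "g \<in> mats n A \<Longrightarrow> i < n \<Longrightarrow> j < n \<Longrightarrow> g (i, j) \<in> carrier A"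
  by (auto simp: mats_def)

lemma mats_eqI:
  assumes "g \<in> mats n A" "h \<in> mats n A'" "\<And>i j. i < n \<Longrightarrow> j < n \<Longrightarrow> g (i, j) = h (i, j)"
  shows "g = h"
proof
  fix x show "g x = h x"
    using assms by (cases x; cases "x \<in> {..<n} \<times> {..<n}") (auto simp: mats_def PiE_def extensional_def)
qed

lemma matsI: "(\<And>i j. i < n \<Longrightarrow> j < n \<Longrightarrow> f (i, j) \<in> carrier A) \<Longrightarrow> f \<in> extensional ({..<n} \<times> {..<n}) \<Longrightarrow> f \<in> mats n A"
  by (auto simp: mats_def PiE_def)

text \<open>An entry of the tensor power of the matrix \<open>g\<close>, at the multi-indices
  \<open>ks\<close> and \<open>js\<close>. The recursion on lists fits inductions that split off the
  first tensor factor; \<open>finprod_tprod\<close> identifies it with the product over positions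
  that \<open>grp\<close> uses.\<close>

fun tprod :: "('b, 'k) ring_scheme \<Rightarrow> (nat \<times> nat \<Rightarrow> 'b) \<Rightarrow> nat list \<Rightarrow> nat list \<Rightarrow> 'b" where
  "tprod A g (k # ks) (j # js) = g (k, j) \<otimes>\<^bsub>A\<^esub> tprod A g ks js"
| "tprod A g _ _ = \<one>\<^bsub>A\<^esub>"

lemma idxs_0: "idxs n 0 = {[]}"
  by (auto simp: idxs_def)

lemma idxs_Suc: "idxs n (Suc k) = (\<Union>l\<in>{..<n}. (#) l ` idxs n k)"
  by (auto simp: idxs_def length_Suc_conv image_iff)

lemma finite_idxs [simp]: "finite (idxs n k)"
  by (induction k) (auto simp: idxs_0 idxs_Suc)

lemma idxs_SucE:
  assumes "ls \<in> idxs n (Suc k)" obtains j js where "ls = j # js" "j < n" "js \<in> idxs n k"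
  using assms by (auto simp: idxs_Suc)

lemma length_idxs: "ks \<in> idxs n k \<Longrightarrow> length ks = k"
  by (simp add: idxs_def)

context abelian_monoid begin

lemma finsum_idxs_Suc:
  assumes "\<And>ls. ls \<in> idxs n (Suc k) \<Longrightarrow> F ls \<in> carrier G"
  shows "finsum G F (idxs n (Suc k)) = (\<Oplus>l\<in>{..<n}. \<Oplus>ls\<in>idxs n k. F (l # ls))"
proof -
  have "finsum G F (idxs n (Suc k)) = (\<Oplus>l\<in>{..<n}. finsum G F ((#) l ` idxs n k))"
    unfolding idxs_Suc by (rule add.finprod_UN_disjoint) (use assms in \<open>auto simp: idxs_Suc pairwise_def disjnt_def\<close>)
  also have "\<dots> = (\<Oplus>l\<in>{..<n}. \<Oplus>ls\<in>idxs n k. F (l # ls))"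
    by (intro finsum_cong' finsum_reindex finsum_closed refl)
      (use assms in \<open>auto simp: idxs_Suc inj_on_def intro!: finsum_closed\<close>)
  finally show ?thesis .
qed

end

section \<open>Matrix algebra and tensor powers of matrices\<close>

context cring begin

lemma tprod_closed:
  "g \<in> mats n R \<Longrightarrow> ks \<in> idxs n k \<Longrightarrow> js \<in> idxs n k \<Longrightarrow> tprod R g ks js \<in> carrier R"
proof (induction k arbitrary: ks js)
  case (Suc k)
  then show ?case by (elim idxs_SucE) (auto simp: mats_app)
qed (auto simp: idxs_0)

lemma finprod_tprod:
  assumes g: "g \<in> mats n R"
  shows "ks \<in> idxs n k \<Longrightarrow> js \<in> idxs n k \<Longrightarrow> finprod R (\<lambda>r. g (ks ! r, js ! r)) {..<k} = tprod R g ks js"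
proof (induction k arbitrary: ks js)
  case (Suc k)
  then obtain a as b bs where ab: "ks = a # as" "js = b # bs" "a < n" "b < n" "as \<in> idxs n k" "bs \<in> idxs n k"
    by (elim idxs_SucE)
  have cl: "g (as ! r, bs ! r) \<in> carrier R" if "r < k" for r
    using ab that g by (intro mats_app[of _ n]) (auto simp: idxs_def subset_iff)
  have set: "{..<Suc k} = insert 0 (Suc ` {..<k})" by (auto simp: image_iff) (metis lessThan_iff not0_implies_Suc Suc_less_eq)
  have "finprod R (\<lambda>r. g (ks ! r, js ! r)) {..<Suc k} = g (a, b) \<otimes> finprod R (\<lambda>r. g (ks ! r, js ! r)) (Suc ` {..<k})"
    unfolding set using ab cl g by (subst finprod_insert) (auto simp: mats_app)
  also have "finprod R (\<lambda>r. g (ks ! r, js ! r)) (Suc ` {..<k}) = finprod R (\<lambda>r. g (as ! r, bs ! r)) {..<k}"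
    using ab cl by (subst finprod_reindex) auto
  finally show ?case using Suc.IH[OF ab(5,6)] ab by simp
qed (auto simp: idxs_0)

lemma mmul_app: "i < n \<Longrightarrow> j < n \<Longrightarrow> mmul n R g h (i, j) = (\<Oplus>l\<in>{..<n}. g (i, l) \<otimes> h (l, j))"
  by (simp add: mmul_def)

lemma mone_app: "i < n \<Longrightarrow> j < n \<Longrightarrow> mone n R (i, j) = (if i = j then \<one> else \<zero>)"
  by (simp add: mone_def)

lemma mmul_closed [simp]:
  assumes "g \<in> mats n R" "h \<in> mats n R" shows "mmul n R g h \<in> mats n R"
  using assms by (intro matsI) (auto simp: mmul_app mats_app intro!: finsum_closed, simp add: mmul_def)

lemma mone_closed [simp]: "mone n R \<in> mats n R"
  by (intro matsI) (auto simp: mone_app, simp add: mone_def)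

lemma mmul_one_left: "g \<in> mats n R \<Longrightarrow> mmul n R (mone n R) g = g"
proof (rule mats_eqI[of _ n R _ R])
  fix i j assume g: "g \<in> mats n R" and ij: "i < n" "j < n"
  have "(\<Oplus>l\<in>{..<n}. mone n R (i, l) \<otimes> g (l, j)) = (\<Oplus>l\<in>{..<n}. (if i = l then \<one> else \<zero>) \<otimes> g (l, j))"
    using ij g by (intro finsum_cong') (auto simp: mone_app mats_app)
  also have "\<dots> = g (i, j)" using ij g by (intro finsum_if_mult_left) (auto simp: mats_app)
  finally show "mmul n R (mone n R) g (i, j) = g (i, j)" using ij by (simp add: mmul_app)
qed auto

lemma mmul_one_right: "g \<in> mats n R \<Longrightarrow> mmul n R g (mone n R) = g"
proof (rule mats_eqI[of _ n R _ R])
  fix i j assume g: "g \<in> mats n R" and ij: "i < n" "j < n"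
  have "(\<Oplus>l\<in>{..<n}. g (i, l) \<otimes> mone n R (l, j)) = (\<Oplus>l\<in>{..<n}. g (i, l) \<otimes> (if l = j then \<one> else \<zero>))"
    using ij g by (intro finsum_cong') (auto simp: mone_app mats_app)
  also have "\<dots> = g (i, j)" using ij g by (intro finsum_if_mult_right) (auto simp: mats_app)
  finally show "mmul n R g (mone n R) (i, j) = g (i, j)" using ij by (simp add: mmul_app)
qed auto

text \<open>The interchange of sums behind every associativity statement here: for matrices, power
  series and Laurent polynomials as well as for the contraction of tensors.\<close>

lemma finsum_mult_assoc:
  assumes "finite I" "finite J" "\<And>i. i \<in> I \<Longrightarrow> x i \<in> carrier R" "\<And>i j. i \<in> I \<Longrightarrow> j \<in> J \<Longrightarrow> y i j \<in> carrier R"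
    "\<And>j. j \<in> J \<Longrightarrow> z j \<in> carrier R"
  shows "(\<Oplus>j\<in>J. (\<Oplus>i\<in>I. x i \<otimes> y i j) \<otimes> z j) = (\<Oplus>i\<in>I. x i \<otimes> (\<Oplus>j\<in>J. y i j \<otimes> z j))"
proof -
  have "(\<Oplus>j\<in>J. (\<Oplus>i\<in>I. x i \<otimes> y i j) \<otimes> z j) = (\<Oplus>j\<in>J. \<Oplus>i\<in>I. x i \<otimes> y i j \<otimes> z j)"
    using assms by (intro finsum_cong' finsum_ldistr) (auto intro!: finsum_closed)
  also have "\<dots> = (\<Oplus>i\<in>I. \<Oplus>j\<in>J. x i \<otimes> y i j \<otimes> z j)"
    using assms by (intro finsum_swap) auto
  also have "\<dots> = (\<Oplus>i\<in>I. \<Oplus>j\<in>J. x i \<otimes> (y i j \<otimes> z j))"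
    using assms by (intro finsum_cong') (auto simp: m_assoc intro!: finsum_closed)
  also have "\<dots> = (\<Oplus>i\<in>I. x i \<otimes> (\<Oplus>j\<in>J. y i j \<otimes> z j))"
    using assms by (intro finsum_cong' finsum_rdistr[symmetric]) (auto intro!: finsum_closed)
  finally show ?thesis .
qed

lemma mmul_assoc:
  assumes "g \<in> mats n R" "h \<in> mats n R" "k \<in> mats n R"
  shows "mmul n R (mmul n R g h) k = mmul n R g (mmul n R h k)"
proof (rule mats_eqI[of _ n R _ R])
  fix i j assume ij: "i < n" "j < n"
  have "(\<Oplus>l\<in>{..<n}. mmul n R g h (i, l) \<otimes> k (l, j)) = (\<Oplus>l\<in>{..<n}. (\<Oplus>m\<in>{..<n}. g (i, m) \<otimes> h (m, l)) \<otimes> k (l, j))"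
    using assms ij by (intro finsum_cong') (auto simp: mmul_app mats_app intro!: finsum_closed)
  also have "\<dots> = (\<Oplus>m\<in>{..<n}. g (i, m) \<otimes> (\<Oplus>l\<in>{..<n}. h (m, l) \<otimes> k (l, j)))"
    using assms ij by (intro finsum_mult_assoc) (auto simp: mats_app)
  also have "\<dots> = (\<Oplus>m\<in>{..<n}. g (i, m) \<otimes> mmul n R h k (m, j))"
    using assms ij by (intro finsum_cong') (auto simp: mmul_app mats_app intro!: finsum_closed)
  finally show "mmul n R (mmul n R g h) k (i, j) = mmul n R g (mmul n R h k) (i, j)"
    using ij by (simp add: mmul_app)
qed (use assms in auto)

lemma GL_mats: "g \<in> GL n R \<Longrightarrow> g \<in> mats n R"
  by (simp add: GL_def)

lemma GLI: "g \<in> mats n R \<Longrightarrow> h \<in> mats n R \<Longrightarrow> mmul n R g h = mone n R \<Longrightarrow> mmul n R h g = mone n R \<Longrightarrow> g \<in> GL n R"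
  by (auto simp: GL_def)

lemma minv_unique:
  assumes "g \<in> mats n R" "h \<in> mats n R" "mmul n R g h = mone n R" "mmul n R h g = mone n R"
  shows "minv n R g = h"
  unfolding minv_def
proof (rule the_equality)
  fix k assume k: "k \<in> mats n R \<and> mmul n R g k = mone n R \<and> mmul n R k g = mone n R"
  have "k = mmul n R (mmul n R h g) k" unfolding assms(4) using k by (simp add: mmul_one_left)
  also have "\<dots> = mmul n R h (mmul n R g k)" using assms(1,2) k by (intro mmul_assoc) auto
  also have "\<dots> = h" using assms(2) by (simp only: conjunct1[OF conjunct2[OF k]] mmul_one_right)
  finally show "k = h" .
qed (use assms in auto)

lemma minv:
  assumes "g \<in> GL n R"
  shows "minv n R g \<in> mats n R" "mmul n R g (minv n R g) = mone n R" "mmul n R (minv n R g) g = mone n R"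
proof -
  obtain h where h: "g \<in> mats n R" "h \<in> mats n R" "mmul n R g h = mone n R" "mmul n R h g = mone n R"
    using assms by (auto simp: GL_def)
  show "minv n R g \<in> mats n R" "mmul n R g (minv n R g) = mone n R" "mmul n R (minv n R g) g = mone n R"
    using h minv_unique[OF h] by auto
qed

lemma minv_GL: "g \<in> GL n R \<Longrightarrow> minv n R g \<in> GL n R"
  using minv GL_mats by (intro GLI[of _ _ g]) auto

lemma mmul_GL:
  assumes g: "g \<in> GL n R" and h: "h \<in> GL n R" shows "mmul n R g h \<in> GL n R"
proof (rule GLI[of _ _ "mmul n R (minv n R h) (minv n R g)"])
  note [simp] = GL_mats[OF g] GL_mats[OF h] minv(1)[OF g] minv(1)[OF h]
  have "mmul n R (mmul n R g h) (mmul n R (minv n R h) (minv n R g)) = mmul n R g (mmul n R (mmul n R h (minv n R h)) (minv n R g))"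
    by (simp add: mmul_assoc)
  then show "mmul n R (mmul n R g h) (mmul n R (minv n R h) (minv n R g)) = mone n R"
    by (simp add: mmul_one_left minv(2)[OF g] minv(2)[OF h])
  have "mmul n R (mmul n R (minv n R h) (minv n R g)) (mmul n R g h) = mmul n R (minv n R h) (mmul n R (mmul n R (minv n R g) g) h)"
    by (simp add: mmul_assoc)
  then show "mmul n R (mmul n R (minv n R h) (minv n R g)) (mmul n R g h) = mone n R"
    by (simp add: mmul_one_left minv(3)[OF g] minv(3)[OF h])
qed (use assms GL_mats minv in auto)

lemma tprod_mone:
  "ks \<in> idxs n k \<Longrightarrow> js \<in> idxs n k \<Longrightarrow> tprod R (mone n R) ks js = (if ks = js then \<one> else \<zero>)"
proof (induction k arbitrary: ks js)
  case (Suc k)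
  then show ?case by (elim idxs_SucE) (auto simp: mone_app)
qed (auto simp: idxs_0)

text \<open>Tensor powers are functorial in the matrix. The induction splits off the first factor;
  the product of its sum with the sum for the remaining factors is one sum over longer
  multi-indices.\<close>

lemma tprod_mmul:
  assumes g: "g \<in> mats n R" and h: "h \<in> mats n R"
  shows "ks \<in> idxs n k \<Longrightarrow> js \<in> idxs n k \<Longrightarrow>
     tprod R (mmul n R g h) ks js = (\<Oplus>ls\<in>idxs n k. tprod R g ks ls \<otimes> tprod R h ls js)"
proof (induction k arbitrary: ks js)
  case (Suc k)
  then obtain a as b bs where ab: "ks = a # as" "js = b # bs" "a < n" "b < n" "as \<in> idxs n k" "bs \<in> idxs n k"
    by (elim idxs_SucE)
  note [simp] = tprod_closed[OF g, of _ k] tprod_closed[OF h, of _ k] mats_app[OF g] mats_app[OF h] ab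
  have "tprod R (mmul n R g h) ks js =
     (\<Oplus>l\<in>{..<n}. g (a, l) \<otimes> h (l, b)) \<otimes> (\<Oplus>ls\<in>idxs n k. tprod R g as ls \<otimes> tprod R h ls bs)"
    using Suc.IH[OF ab(5,6)] by (simp add: mmul_app)
  also have "\<dots> = (\<Oplus>l\<in>{..<n}. g (a, l) \<otimes> h (l, b) \<otimes> (\<Oplus>ls\<in>idxs n k. tprod R g as ls \<otimes> tprod R h ls bs))"
    by (rule finsum_ldistr) (auto intro!: finsum_closed)
  also have "\<dots> = (\<Oplus>l\<in>{..<n}. \<Oplus>ls\<in>idxs n k. tprod R g ks (l # ls) \<otimes> tprod R h (l # ls) js)"
  proof (rule finsum_cong')
    fix l assume l: "l \<in> {..<n}"
    have "g (a, l) \<otimes> h (l, b) \<otimes> (\<Oplus>ls\<in>idxs n k. tprod R g as ls \<otimes> tprod R h ls bs)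
       = (\<Oplus>ls\<in>idxs n k. g (a, l) \<otimes> h (l, b) \<otimes> (tprod R g as ls \<otimes> tprod R h ls bs))"
      using l by (intro finsum_rdistr) (auto intro!: finsum_closed)
    also have "\<dots> = (\<Oplus>ls\<in>idxs n k. tprod R g ks (l # ls) \<otimes> tprod R h (l # ls) js)"
      using l by (intro finsum_cong') (auto simp: m_ac)
    finally show "g (a, l) \<otimes> h (l, b) \<otimes> (\<Oplus>ls\<in>idxs n k. tprod R g as ls \<otimes> tprod R h ls bs)
       = (\<Oplus>ls\<in>idxs n k. tprod R g ks (l # ls) \<otimes> tprod R h (l # ls) js)" .
  qed (auto intro!: finsum_closed)
  also have "\<dots> = (\<Oplus>ls\<in>idxs n (Suc k). tprod R g ks ls \<otimes> tprod R h ls js)"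
    by (rule finsum_idxs_Suc[symmetric]) (auto simp: idxs_Suc)
  finally show ?case .
qed (auto simp: idxs_0)

end

text \<open>The equation \<open>g \<cdot> \<tau> = \<tau>\<close> in \<open>\<Lambda>\<^sup>\<otimes>\<^sup>a \<otimes> (\<Lambda>\<^sup>\<or>)\<^sup>\<otimes>\<^sup>b\<close>, with the action of \<open>g\<close> on the dual factors moved to
  the left-hand side.\<close>

definition fixes_tensor ::
  "nat \<Rightarrow> ('b, 'k) ring_scheme \<Rightarrow> (nat list \<Rightarrow> nat list \<Rightarrow> 'b) \<Rightarrow> (nat \<times> nat \<Rightarrow> 'b) \<Rightarrow> nat \<Rightarrow> nat \<Rightarrow> bool" where
  "fixes_tensor n A \<tau> g a b \<longleftrightarrow> (\<forall>is\<in>idxs n a. \<forall>js\<in>idxs n b.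
     finsum A (\<lambda>ks. \<tau> is ks \<otimes>\<^bsub>A\<^esub> tprod A g ks js) (idxs n b) = finsum A (\<lambda>ks. tprod A g is ks \<otimes>\<^bsub>A\<^esub> \<tau> ks js) (idxs n a))"

text \<open>Reading \<open>\<tau>\<close> as a matrix from b-fold to a-fold tensors, the condition
  says that \<open>\<tau>\<close> intertwines the two tensor powers of the group element. With the
  exponents suppressed, \<open>\<tau> g h = g \<tau> h = g h \<tau>\<close>.\<close>

lemma (in cring) fixes_tensor_mmul:
  assumes g: "g \<in> mats n R" "fixes_tensor n R \<tau> g a b" and h: "h \<in> mats n R" "fixes_tensor n R \<tau> h a b"
    and \<tau>: "\<And>is js. \<tau> is js \<in> carrier R"
  shows "fixes_tensor n R \<tau> (mmul n R g h) a b"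
  unfolding fixes_tensor_def
proof safe
  fix "is" js assume ij: "is \<in> idxs n a" "js \<in> idxs n b"
  note [simp] = tprod_closed[OF g(1), of _ a] tprod_closed[OF h(1), of _ a] tprod_closed[OF g(1), of _ b] tprod_closed[OF h(1), of _ b] \<tau> ij
  have "(\<Oplus>ks\<in>idxs n b. \<tau> is ks \<otimes> tprod R (mmul n R g h) ks js)
     = (\<Oplus>ks\<in>idxs n b. \<tau> is ks \<otimes> (\<Oplus>ls\<in>idxs n b. tprod R g ks ls \<otimes> tprod R h ls js))"
    by (intro finsum_cong') (auto simp: tprod_mmul[OF g(1) h(1), of _ a] tprod_mmul[OF g(1) h(1), of _ b] intro!: finsum_closed)
  also have "\<dots> = (\<Oplus>ls\<in>idxs n b. (\<Oplus>ks\<in>idxs n b. \<tau> is ks \<otimes> tprod R g ks ls) \<otimes> tprod R h ls js)"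
    by (intro finsum_mult_assoc[symmetric]) auto
  also have "\<dots> = (\<Oplus>ls\<in>idxs n b. (\<Oplus>ks\<in>idxs n a. tprod R g is ks \<otimes> \<tau> ks ls) \<otimes> tprod R h ls js)"
    using g(2) by (intro finsum_cong') (auto simp: fixes_tensor_def intro!: finsum_closed)
  also have "\<dots> = (\<Oplus>ks\<in>idxs n a. tprod R g is ks \<otimes> (\<Oplus>ls\<in>idxs n b. \<tau> ks ls \<otimes> tprod R h ls js))"
    by (intro finsum_mult_assoc) auto
  also have "\<dots> = (\<Oplus>ks\<in>idxs n a. tprod R g is ks \<otimes> (\<Oplus>ls\<in>idxs n a. tprod R h ks ls \<otimes> \<tau> ls js))"
    using h(2) by (intro finsum_cong') (auto simp: fixes_tensor_def intro!: finsum_closed)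
  also have "\<dots> = (\<Oplus>ls\<in>idxs n a. (\<Oplus>ks\<in>idxs n a. tprod R g is ks \<otimes> tprod R h ks ls) \<otimes> \<tau> ls js)"
    by (intro finsum_mult_assoc[symmetric]) auto
  also have "\<dots> = (\<Oplus>ls\<in>idxs n a. tprod R (mmul n R g h) is ls \<otimes> \<tau> ls js)"
    by (intro finsum_cong') (auto simp: tprod_mmul[OF g(1) h(1), of _ a] tprod_mmul[OF g(1) h(1), of _ b] intro!: finsum_closed)
  finally show "(\<Oplus>ks\<in>idxs n b. \<tau> is ks \<otimes> tprod R (mmul n R g h) ks js) =
     (\<Oplus>ks\<in>idxs n a. tprod R (mmul n R g h) is ks \<otimes> \<tau> ks js)" .
qed

lemma (in cring) finsum_tprod_mone_left:
  assumes "is \<in> idxs n a" "\<And>ks. ks \<in> idxs n a \<Longrightarrow> x ks \<in> carrier R"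
  shows "(\<Oplus>ks\<in>idxs n a. tprod R (mone n R) is ks \<otimes> x ks) = x is"
proof -
  have "(\<Oplus>ks\<in>idxs n a. tprod R (mone n R) is ks \<otimes> x ks) = (\<Oplus>ks\<in>idxs n a. if ks = is then x ks else \<zero>)"
    using assms by (intro finsum_cong') (auto simp: tprod_mone)
  then show ?thesis using assms by (simp add: finsum_delta)
qed

lemma (in cring) finsum_tprod_mone_right:
  assumes "js \<in> idxs n a" "\<And>ks. ks \<in> idxs n a \<Longrightarrow> x ks \<in> carrier R"
  shows "(\<Oplus>ks\<in>idxs n a. x ks \<otimes> tprod R (mone n R) ks js) = x js"
proof -
  have "(\<Oplus>ks\<in>idxs n a. x ks \<otimes> tprod R (mone n R) ks js) = (\<Oplus>ks\<in>idxs n a. if ks = js then x ks else \<zero>)"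
    using assms by (intro finsum_cong') (auto simp: tprod_mone)
  then show ?thesis using assms by (simp add: finsum_delta)
qed

text \<open>In the notation of intertwiners,
  \<open>h \<tau> = h \<tau> (g h) = h (g \<tau>) h = \<tau> h\<close>. The proof inserts
  \<open>g h\<close> by contracting \<open>\<tau>\<close> with the identity matrix.\<close>

lemma (in cring) fixes_tensor_inverse:
  assumes g: "g \<in> mats n R" "fixes_tensor n R \<tau> g a b" and h: "h \<in> mats n R"
    and gh: "mmul n R g h = mone n R" "mmul n R h g = mone n R"
    and \<tau>: "\<And>is js. \<tau> is js \<in> carrier R"
  shows "fixes_tensor n R \<tau> h a b"
  unfolding fixes_tensor_def
proof safe
  fix "is" js assume ij: "is \<in> idxs n a" "js \<in> idxs n b"
  note [simp] = tprod_closed[OF g(1), of _ a] tprod_closed[OF h(1), of _ a] tprod_closed[OF g(1), of _ b] tprod_closed[OF h(1), of _ b] \<tau> ij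
  have gb: "(\<Oplus>ls\<in>idxs n b. \<tau> ks ls \<otimes> tprod R g ls ms) = (\<Oplus>ls\<in>idxs n a. tprod R g ks ls \<otimes> \<tau> ls ms)"
    if "ks \<in> idxs n a" "ms \<in> idxs n b" for ks ms
    using g(2) that by (simp add: fixes_tensor_def)
  have "(\<Oplus>ks\<in>idxs n a. tprod R h is ks \<otimes> \<tau> ks js)
     = (\<Oplus>ks\<in>idxs n a. tprod R h is ks \<otimes> (\<Oplus>ls\<in>idxs n b. \<tau> ks ls \<otimes> tprod R (mone n R) ls js))"
    by (intro finsum_cong') (auto simp: finsum_tprod_mone_right)
  also have "\<dots> = (\<Oplus>ks\<in>idxs n a. tprod R h is ks \<otimes> (\<Oplus>ls\<in>idxs n b. \<tau> ks ls \<otimes> (\<Oplus>ms\<in>idxs n b. tprod R g ls ms \<otimes> tprod R h ms js)))"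
    unfolding gh(1)[symmetric] by (intro finsum_cong' refl arg_cong2[where f = "monoid.mult R"])
      (auto simp: tprod_mmul[OF g(1) h(1), of _ b] intro!: finsum_closed)
  also have "\<dots> = (\<Oplus>ks\<in>idxs n a. tprod R h is ks \<otimes> (\<Oplus>ms\<in>idxs n b. (\<Oplus>ls\<in>idxs n b. \<tau> ks ls \<otimes> tprod R g ls ms) \<otimes> tprod R h ms js))"
    by (intro finsum_cong' refl arg_cong2[where f = "monoid.mult R"] finsum_mult_assoc[symmetric]) (auto intro!: finsum_closed)
  also have "\<dots> = (\<Oplus>ks\<in>idxs n a. tprod R h is ks \<otimes> (\<Oplus>ms\<in>idxs n b. (\<Oplus>ls\<in>idxs n a. tprod R g ks ls \<otimes> \<tau> ls ms) \<otimes> tprod R h ms js))"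
    by (intro finsum_cong'[OF refl] arg_cong2[where f = "monoid.mult R", OF refl]) (auto simp: gb intro!: finsum_closed)
  also have "\<dots> = (\<Oplus>ks\<in>idxs n a. tprod R h is ks \<otimes> (\<Oplus>ls\<in>idxs n a. tprod R g ks ls \<otimes> (\<Oplus>ms\<in>idxs n b. \<tau> ls ms \<otimes> tprod R h ms js)))"
    by (intro finsum_cong' refl arg_cong2[where f = "monoid.mult R"] finsum_mult_assoc) (auto intro!: finsum_closed)
  also have "\<dots> = (\<Oplus>ls\<in>idxs n a. (\<Oplus>ks\<in>idxs n a. tprod R h is ks \<otimes> tprod R g ks ls) \<otimes> (\<Oplus>ms\<in>idxs n b. \<tau> ls ms \<otimes> tprod R h ms js))"
    by (intro finsum_mult_assoc[symmetric]) (auto intro!: finsum_closed)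
  also have "\<dots> = (\<Oplus>ls\<in>idxs n a. tprod R (mone n R) is ls \<otimes> (\<Oplus>ms\<in>idxs n b. \<tau> ls ms \<otimes> tprod R h ms js))"
    unfolding gh(2)[symmetric] by (intro finsum_cong') (auto simp: tprod_mmul[OF h(1) g(1), of _ a] intro!: finsum_closed)
  also have "\<dots> = (\<Oplus>ms\<in>idxs n b. \<tau> is ms \<otimes> tprod R h ms js)"
    by (rule finsum_tprod_mone_left) (auto intro!: finsum_closed)
  finally show "(\<Oplus>ks\<in>idxs n b. \<tau> is ks \<otimes> tprod R h ks js) = (\<Oplus>ks\<in>idxs n a. tprod R h is ks \<otimes> \<tau> ks js)" by simp
qed

section \<open>Matrices and fixed tensors under a change of rings\<close>

context ring_hom_cring begin

lemma mmap_closed: "g \<in> mats n R \<Longrightarrow> mmap n h g \<in> mats n S"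
  by (intro matsI) (auto simp: mmap_app mats_app, simp add: mmap_def)

lemma mmap_mone: "mmap n h (mone n R) = mone n S"
  by (rule mats_eqI[of _ n S _ S]) (auto simp: mmap_closed mmap_app R.mone_app S.mone_app)

lemma mmap_mmul:
  assumes "g \<in> mats n R" "k \<in> mats n R"
  shows "mmap n h (mmul n R g k) = mmul n S (mmap n h g) (mmap n h k)"
  by (rule mats_eqI[of _ n S _ S])
    (use assms in \<open>auto simp: mmap_closed mmap_app R.mmul_app S.mmul_app mats_app hom_finsum' simp del: hom_finsum intro!: S.finsum_cong'\<close>)

lemma mmap_GL: "g \<in> GL n R \<Longrightarrow> mmap n h g \<in> GL n S"
  using R.minv R.GL_mats
  by (intro S.GLI[of _ _ "mmap n h (minv n R g)"]) (auto simp: mmap_closed mmap_mmul[symmetric] mmap_mone)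

lemma hom_tprod:
  "g \<in> mats n R \<Longrightarrow> ks \<in> idxs n k \<Longrightarrow> js \<in> idxs n k \<Longrightarrow> h (tprod R g ks js) = tprod S (mmap n h g) ks js"
proof (induction k arbitrary: ks js)
  case (Suc k)
  then show ?case by (elim idxs_SucE) (auto simp: mats_app R.tprod_closed mmap_app)
qed (auto simp: idxs_0)

lemma hom_fixes_tensor:
  assumes g: "g \<in> mats n R" "fixes_tensor n R \<tau> g a b" and \<tau>: "\<And>is js. \<tau> is js \<in> carrier R"
  shows "fixes_tensor n S (\<lambda>is js. h (\<tau> is js)) (mmap n h g) a b"
  unfolding fixes_tensor_def
proof safe
  fix "is" js assume ij: "is \<in> idxs n a" "js \<in> idxs n b"
  note [simp] = R.tprod_closed[OF g(1), of _ a] R.tprod_closed[OF g(1), of _ b] \<tau> ij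
    S.tprod_closed[OF mmap_closed[OF g(1)], of _ a] S.tprod_closed[OF mmap_closed[OF g(1)], of _ b]
  have "h (\<Oplus>ks\<in>idxs n b. \<tau> is ks \<otimes> tprod R g ks js) = h (\<Oplus>ks\<in>idxs n a. tprod R g is ks \<otimes> \<tau> ks js)"
    using g(2) by (auto simp: fixes_tensor_def)
  also have "h (\<Oplus>ks\<in>idxs n b. \<tau> is ks \<otimes> tprod R g ks js) = (\<Oplus>\<^bsub>S\<^esub>ks\<in>idxs n b. h (\<tau> is ks) \<otimes>\<^bsub>S\<^esub> tprod S (mmap n h g) ks js)"
    by (subst hom_finsum') (auto intro!: S.finsum_cong' simp: hom_tprod[OF g(1), of _ b])
  also have "h (\<Oplus>ks\<in>idxs n a. tprod R g is ks \<otimes> \<tau> ks js) = (\<Oplus>\<^bsub>S\<^esub>ks\<in>idxs n a. tprod S (mmap n h g) is ks \<otimes>\<^bsub>S\<^esub> h (\<tau> ks js))"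
    by (subst hom_finsum') (auto intro!: S.finsum_cong' simp: hom_tprod[OF g(1), of _ a])
  finally show "(\<Oplus>\<^bsub>S\<^esub>ks\<in>idxs n b. h (\<tau> is ks) \<otimes>\<^bsub>S\<^esub> tprod S (mmap n h g) ks js)
     = (\<Oplus>\<^bsub>S\<^esub>ks\<in>idxs n a. tprod S (mmap n h g) is ks \<otimes>\<^bsub>S\<^esub> h (\<tau> ks js))" .
qed

end

lemma all_idxs:
  "(\<forall>is js. set is \<subseteq> {..<n} \<and> set js \<subseteq> {..<n} \<longrightarrow> P is js) \<longleftrightarrow> (\<forall>a b. \<forall>is\<in>idxs n a. \<forall>js\<in>idxs n b. P is js)"
  by (auto simp: idxs_def)

text \<open>Rewrites the stabilizer condition of \<open>grp\<close> through \<open>tprod\<close> and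
  sorts it by the lengths \<open>a\<close> and \<open>b\<close> of the multi-indices, so that each
  component of the tensor space can be treated on its own.\<close>

lemma grp_iff:
  assumes "cring A" and s: "\<And>t is js. t \<in> TI D \<Longrightarrow> s (T0 D t is js) \<in> carrier A"
  shows "g \<in> grp D A s \<longleftrightarrow> g \<in> GL (rk D) A \<and>
    (\<forall>t\<in>TI D. \<forall>a b. fixes_tensor (rk D) A (\<lambda>is js. s (T0 D t is js)) g a b)"
proof -
  interpret cring A by fact
  have *: "(finsum A (\<lambda>ks. s (T0 D t is ks) \<otimes>\<^bsub>A\<^esub> finprod A (\<lambda>r. g (ks ! r, js ! r)) {..<length js}) (idxs (rk D) (length js))
   = finsum A (\<lambda>ks. finprod A (\<lambda>r. g (is ! r, ks ! r)) {..<length is} \<otimes>\<^bsub>A\<^esub> s (T0 D t ks js)) (idxs (rk D) (length is)))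
   \<longleftrightarrow> (finsum A (\<lambda>ks. s (T0 D t is ks) \<otimes>\<^bsub>A\<^esub> tprod A g ks js) (idxs (rk D) b)
     = finsum A (\<lambda>ks. tprod A g is ks \<otimes>\<^bsub>A\<^esub> s (T0 D t ks js)) (idxs (rk D) a))"
    if g: "g \<in> mats (rk D) A" and t: "t \<in> TI D" and ij: "is \<in> idxs (rk D) a" "js \<in> idxs (rk D) b" for t "is" js a b
  proof -
    have "finsum A (\<lambda>ks. s (T0 D t is ks) \<otimes>\<^bsub>A\<^esub> finprod A (\<lambda>r. g (ks ! r, js ! r)) {..<length js}) (idxs (rk D) (length js))
      = finsum A (\<lambda>ks. s (T0 D t is ks) \<otimes>\<^bsub>A\<^esub> tprod A g ks js) (idxs (rk D) b)"
      using ij length_idxs[OF ij(2)] s[OF t] by (intro finsum_cong') (auto simp: finprod_tprod[OF g] tprod_closed[OF g])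
    moreover have "finsum A (\<lambda>ks. finprod A (\<lambda>r. g (is ! r, ks ! r)) {..<length is} \<otimes>\<^bsub>A\<^esub> s (T0 D t ks js)) (idxs (rk D) (length is))
      = finsum A (\<lambda>ks. tprod A g is ks \<otimes>\<^bsub>A\<^esub> s (T0 D t ks js)) (idxs (rk D) a)"
      using ij length_idxs[OF ij(1)] s[OF t] by (intro finsum_cong') (auto simp: finprod_tprod[OF g] tprod_closed[OF g])
    ultimately show ?thesis by simp
  qed
  show ?thesis
  proof (cases "g \<in> GL (rk D) A")
    case True
    then have g: "g \<in> mats (rk D) A" by (rule GL_mats)
    show ?thesis
      unfolding grp_def mem_Collect_eq all_idxs fixes_tensor_def
      by (intro conj_cong refl ball_cong arg_cong[where f = All] ext *[OF g])
  qed (auto simp: grp_def)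
qed

section \<open>Group laws and functoriality of the group scheme\<close>

context
  fixes D :: "('w, 'i) group_datum" and A :: "('b, 'k) ring_scheme" and s
  assumes A: "cring A" and s: "\<And>t is js. t \<in> TI D \<Longrightarrow> s (T0 D t is js) \<in> carrier A"
begin

interpretation cring A by (rule A)

private lemma grp_iff':
  "g \<in> grp D A s \<longleftrightarrow> g \<in> GL (rk D) A \<and>
    (\<forall>t\<in>TI D. \<forall>a b. fixes_tensor (rk D) A (\<lambda>is js. s (T0 D t is js)) g a b)"
  using grp_iff[OF A, of D s g] s by blast

lemma grp_mmul:
  assumes g: "g \<in> grp D A s" and h: "h \<in> grp D A s"
  shows "mmul (rk D) A g h \<in> grp D A s"
proof -
  have G: "g \<in> GL (rk D) A" "h \<in> GL (rk D) A" using g h by (simp_all add: grp_iff')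
  have "fixes_tensor (rk D) A (\<lambda>is js. s (T0 D t is js)) (mmul (rk D) A g h) a b" if t: "t \<in> TI D" for t a b
    using g h t by (intro fixes_tensor_mmul GL_mats G s) (simp_all add: grp_iff')
  then show ?thesis using mmul_GL[OF G] by (simp add: grp_iff')
qed

lemma grp_minv:
  assumes g: "g \<in> grp D A s" shows "minv (rk D) A g \<in> grp D A s"
proof -
  have G: "g \<in> GL (rk D) A" using g by (simp add: grp_iff')
  have "fixes_tensor (rk D) A (\<lambda>is js. s (T0 D t is js)) (minv (rk D) A g) a b" if t: "t \<in> TI D" for t a b
    using g t by (intro fixes_tensor_inverse[OF GL_mats[OF G] _ minv[OF G]] s) (simp_all add: grp_iff')
  then show ?thesis using minv_GL[OF G] by (simp add: grp_iff')
qed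

text \<open>Asking only that \<open>f\<close> matches the coordinates of the tensors covers the
  Frobenius of a prism, which is merely \<sigma>-linear over W but fixes these coordinates, as well
  as the evaluation of Laurent polynomials.\<close>

lemma grp_mmap:
  assumes f: "ring_hom_cring A C f" and fs: "\<And>t is js. t \<in> TI D \<Longrightarrow> f (s (T0 D t is js)) = s' (T0 D t is js)"
    and g: "g \<in> grp D A s"
  shows "mmap (rk D) f g \<in> grp D C s'"
proof -
  interpret f: ring_hom_cring A C f by fact
  have s': "s' (T0 D t is js) \<in> carrier C" if "t \<in> TI D" for t "is" js
    using fs[OF that] s[OF that] by (metis f.hom_closed)
  have "fixes_tensor (rk D) C (\<lambda>is js. s' (T0 D t is js)) (mmap (rk D) f g) a b" if t: "t \<in> TI D" for t a b
    using f.hom_fixes_tensor[of g "rk D" "\<lambda>is js. s (T0 D t is js)" a b] g s[OF t] t GL_mats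
    by (auto simp: grp_iff' fs)
  moreover have "mmap (rk D) f g \<in> grp D C s' \<longleftrightarrow> mmap (rk D) f g \<in> GL (rk D) C \<and>
    (\<forall>t\<in>TI D. \<forall>a b. fixes_tensor (rk D) C (\<lambda>is js. s' (T0 D t is js)) (mmap (rk D) f g) a b)"
    using grp_iff[OF f.S.is_cring, of D s'] s' by blast
  ultimately show ?thesis
    using g by (auto simp: grp_iff' f.mmap_GL)
qed

end

section \<open>Laurent polynomials and the cocharacter\<close>

context cring begin

lemma laurent_carrier: "f \<in> carrier (laurent R) \<longleftrightarrow> (\<forall>k. f k \<in> carrier R) \<and> finite {k. f k \<noteq> \<zero>}"
  by (auto simp: laurent_def)

lemma laurent_closed: "f \<in> carrier (laurent R) \<Longrightarrow> f k \<in> carrier R"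
  by (simp add: laurent_carrier)

lemma laurent_add: "f \<oplus>\<^bsub>laurent R\<^esub> g = (\<lambda>k. f k \<oplus> g k)"
  and laurent_zero: "\<zero>\<^bsub>laurent R\<^esub> = (\<lambda>k. \<zero>)"
  and laurent_one: "\<one>\<^bsub>laurent R\<^esub> = (\<lambda>k. if k = 0 then \<one> else \<zero>)"
  by (simp_all add: laurent_def)

text \<open>\<open>laurent\<close> sums over the support of the first factor. Allowing any finite
  set that contains it lets several products be compared over one index set.\<close>

lemma laurent_mult_eq:
  assumes f: "f \<in> carrier (laurent R)" and g: "g \<in> carrier (laurent R)"
    and I: "finite I" "{k. f k \<noteq> \<zero>} \<subseteq> I"
  shows "(f \<otimes>\<^bsub>laurent R\<^esub> g) k = (\<Oplus>l\<in>I. f l \<otimes> g (k - l))"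
  unfolding laurent_def using I f g
  by (auto simp: laurent_closed intro!: finsum_sub)

lemma laurent_supports:
  assumes "f \<in> carrier (laurent R)" "g \<in> carrier (laurent R)"
  obtains I where "finite I" "{k. f k \<noteq> \<zero>} \<subseteq> I" "{k. g k \<noteq> \<zero>} \<subseteq> I"
  using assms that[of "{k. f k \<noteq> \<zero>} \<union> {k. g k \<noteq> \<zero>}"] by (auto simp: laurent_carrier)

lemma laurent_mult_support:
  assumes f: "f \<in> carrier (laurent R)" and g: "g \<in> carrier (laurent R)"
    and I: "finite I" "{k. f k \<noteq> \<zero>} \<subseteq> I" and J: "{k. g k \<noteq> \<zero>} \<subseteq> J"
  shows "{k. (f \<otimes>\<^bsub>laurent R\<^esub> g) k \<noteq> \<zero>} \<subseteq> (\<lambda>(i, j). i + j) ` (I \<times> J)"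
proof
  fix k assume "k \<in> {k. (f \<otimes>\<^bsub>laurent R\<^esub> g) k \<noteq> \<zero>}"
  then have "(\<Oplus>l\<in>I. f l \<otimes> g (k - l)) \<noteq> \<zero>" using laurent_mult_eq[OF f g I] by simp
  then obtain l where "l \<in> I" "f l \<otimes> g (k - l) \<noteq> \<zero>" using add.finprod_one_eqI[of I "\<lambda>l. f l \<otimes> g (k - l)"]
    unfolding finsum_def by auto
  then have "l \<in> I" "k - l \<in> J" using f J laurent_closed[OF f] by auto
  then show "k \<in> (\<lambda>(i, j). i + j) ` (I \<times> J)" by (intro image_eqI[of _ _ "(l, k - l)"]) auto
qed

lemma laurent_mult_closed:
  assumes f: "f \<in> carrier (laurent R)" and g: "g \<in> carrier (laurent R)"
  shows "f \<otimes>\<^bsub>laurent R\<^esub> g \<in> carrier (laurent R)"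
proof -
  obtain I where I: "finite I" "{k. f k \<noteq> \<zero>} \<subseteq> I" "{k. g k \<noteq> \<zero>} \<subseteq> I" using laurent_supports[OF f g] .
  have "finite {k. (f \<otimes>\<^bsub>laurent R\<^esub> g) k \<noteq> \<zero>}"
    using laurent_mult_support[OF f g I] I(1) by (auto intro: finite_subset)
  then show ?thesis using f g I
    by (auto simp: laurent_carrier laurent_mult_eq[OF f g I(1,2)])
qed

lemma laurent_mult_comm:
  assumes f: "f \<in> carrier (laurent R)" and g: "g \<in> carrier (laurent R)"
  shows "f \<otimes>\<^bsub>laurent R\<^esub> g = g \<otimes>\<^bsub>laurent R\<^esub> f"
proof
  fix k
  obtain I where I: "finite I" "{k. f k \<noteq> \<zero>} \<subseteq> I" "{k. g k \<noteq> \<zero>} \<subseteq> I" using laurent_supports[OF f g] .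
  \<comment> \<open>\<open>I \<union> ?J\<close> contains the supports of both factors and is stable
    under the substitution of \<open>k - l\<close> for \<open>l\<close>, which exchanges the
    factors.\<close>
  let ?J = "(\<lambda>l. k - l) ` I"
  have "(f \<otimes>\<^bsub>laurent R\<^esub> g) k = (\<Oplus>l\<in>I \<union> ?J. f l \<otimes> g (k - l))"
    using I by (intro laurent_mult_eq f g) auto
  also have "I \<union> ?J = (\<lambda>l. k - l) ` (I \<union> ?J)" by (auto simp: image_Un image_image)
  also have "(\<Oplus>l\<in>(\<lambda>l. k - l) ` (I \<union> ?J). f l \<otimes> g (k - l)) = (\<Oplus>l\<in>I \<union> ?J. f (k - l) \<otimes> g (k - (k - l)))"
    using f g by (intro finsum_reindex) (auto simp: inj_on_def laurent_closed)
  also have "\<dots> = (\<Oplus>l\<in>I \<union> ?J. g l \<otimes> f (k - l))"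
    using f g by (intro finsum_cong') (auto simp: laurent_closed m_comm)
  also have "\<dots> = (g \<otimes>\<^bsub>laurent R\<^esub> f) k"
    using I by (intro laurent_mult_eq[symmetric] f g) auto
  finally show "(f \<otimes>\<^bsub>laurent R\<^esub> g) k = (g \<otimes>\<^bsub>laurent R\<^esub> f) k" .
qed

lemma laurent_mult_assoc:
  assumes f: "f \<in> carrier (laurent R)" and g: "g \<in> carrier (laurent R)" and h: "h \<in> carrier (laurent R)"
  shows "f \<otimes>\<^bsub>laurent R\<^esub> g \<otimes>\<^bsub>laurent R\<^esub> h = f \<otimes>\<^bsub>laurent R\<^esub> (g \<otimes>\<^bsub>laurent R\<^esub> h)"
proof
  fix k
  obtain I where I: "finite I" "{k. f k \<noteq> \<zero>} \<subseteq> I" "{k. g k \<noteq> \<zero>} \<subseteq> I" using laurent_supports[OF f g] .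
  \<comment> \<open>The product of \<open>f\<close> and \<open>g\<close> is supported in this
    sumset. It also contains the translates of \<open>I\<close> by elements of \<open>I\<close>,
    over which the inner sums run after the interchange.\<close>
  let ?J = "(\<lambda>(i, j). i + j) ` (I \<times> I)"
  have J: "finite ?J" using I by auto
  note [simp] = laurent_closed[OF f] laurent_closed[OF g] laurent_closed[OF h]
  have "(f \<otimes>\<^bsub>laurent R\<^esub> g \<otimes>\<^bsub>laurent R\<^esub> h) k = (\<Oplus>m\<in>?J. (f \<otimes>\<^bsub>laurent R\<^esub> g) m \<otimes> h (k - m))"
    using laurent_mult_support[OF f g I] J by (intro laurent_mult_eq laurent_mult_closed f g h)
  also have "\<dots> = (\<Oplus>m\<in>?J. (\<Oplus>l\<in>I. f l \<otimes> g (m - l)) \<otimes> h (k - m))"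
    by (intro finsum_cong') (auto simp: laurent_mult_eq[OF f g I(1,2)])
  also have "\<dots> = (\<Oplus>l\<in>I. f l \<otimes> (\<Oplus>m\<in>?J. g (m - l) \<otimes> h (k - m)))"
    using I J by (intro finsum_mult_assoc) auto
  also have "\<dots> = (\<Oplus>l\<in>I. f l \<otimes> (g \<otimes>\<^bsub>laurent R\<^esub> h) (k - l))"
  proof (rule finsum_cong')
    fix l assume l: "l \<in> I"
    have "(\<Oplus>m\<in>?J. g (m - l) \<otimes> h (k - m)) = (\<Oplus>m\<in>(\<lambda>n. l + n) ` I. g (m - l) \<otimes> h (k - m))"
    proof (rule finsum_sub[symmetric])
      fix m assume "m \<in> ?J - (\<lambda>n. l + n) ` I"
      then have "m \<notin> (\<lambda>n. l + n) ` I" by blast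
      moreover have "m = l + (m - l)" by simp
      ultimately have "m - l \<notin> I" by (metis image_eqI)
      then have "g (m - l) = \<zero>" using I by auto
      then show "g (m - l) \<otimes> h (k - m) = \<zero>" by simp
    qed (use l J in auto)
    also have "\<dots> = (\<Oplus>n\<in>I. g (l + n - l) \<otimes> h (k - (l + n)))"
      by (intro finsum_reindex) auto
    also have "\<dots> = (\<Oplus>n\<in>I. g n \<otimes> h (k - l - n))"
      by (intro finsum_cong') (auto simp: algebra_simps)
    also have "\<dots> = (g \<otimes>\<^bsub>laurent R\<^esub> h) (k - l)"
      using I by (intro laurent_mult_eq[symmetric] g h) auto
    finally show "f l \<otimes> (\<Oplus>m\<in>?J. g (m - l) \<otimes> h (k - m)) = f l \<otimes> (g \<otimes>\<^bsub>laurent R\<^esub> h) (k - l)" by simp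
  qed (use laurent_closed[OF laurent_mult_closed[OF g h]] in auto)
  also have "\<dots> = (f \<otimes>\<^bsub>laurent R\<^esub> (g \<otimes>\<^bsub>laurent R\<^esub> h)) k"
    using I by (intro laurent_mult_eq[symmetric] laurent_mult_closed f g h) auto
  finally show "(f \<otimes>\<^bsub>laurent R\<^esub> g \<otimes>\<^bsub>laurent R\<^esub> h) k = (f \<otimes>\<^bsub>laurent R\<^esub> (g \<otimes>\<^bsub>laurent R\<^esub> h)) k" .
qed

lemma cring_laurent: "cring (laurent R)"
proof (rule cringI)
  have add_closed: "f \<oplus>\<^bsub>laurent R\<^esub> g \<in> carrier (laurent R)"
    if f: "f \<in> carrier (laurent R)" and g: "g \<in> carrier (laurent R)" for f g
  proof -
    have "{k. f k \<oplus> g k \<noteq> \<zero>} \<subseteq> {k. f k \<noteq> \<zero>} \<union> {k. g k \<noteq> \<zero>}" by auto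
    then show ?thesis using f g by (auto simp: laurent_carrier laurent_add intro: finite_subset)
  qed
  show "abelian_group (laurent R)"
  proof (rule abelian_groupI)
    fix f assume f: "f \<in> carrier (laurent R)"
    have "{k. \<ominus> f k \<noteq> \<zero>} \<subseteq> {k. f k \<noteq> \<zero>}" by auto
    then have "(\<lambda>k. \<ominus> f k) \<in> carrier (laurent R)" using f by (auto simp: laurent_carrier intro: finite_subset)
    moreover have "(\<lambda>k. \<ominus> f k) \<oplus>\<^bsub>laurent R\<^esub> f = \<zero>\<^bsub>laurent R\<^esub>"
      using f by (auto simp: laurent_add laurent_zero laurent_closed l_neg)
    ultimately show "\<exists>y\<in>carrier (laurent R). y \<oplus>\<^bsub>laurent R\<^esub> f = \<zero>\<^bsub>laurent R\<^esub>" by blast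
  qed (auto simp: add_closed, auto simp: laurent_add laurent_closed laurent_zero a_ac laurent_carrier)
  have one: "\<one>\<^bsub>laurent R\<^esub> \<in> carrier (laurent R)"
    by (auto simp: laurent_carrier laurent_one intro: finite_subset[of _ "{0}"])
  show "comm_monoid (laurent R)"
  proof (rule comm_monoidI)
    fix f assume f: "f \<in> carrier (laurent R)"
    have "(\<one>\<^bsub>laurent R\<^esub> \<otimes>\<^bsub>laurent R\<^esub> f) k = f k" for k
      using f by (subst laurent_mult_eq[of _ _ "{0}"]) (auto simp: one laurent_closed, auto simp: laurent_one laurent_closed split: if_splits)
    then show "\<one>\<^bsub>laurent R\<^esub> \<otimes>\<^bsub>laurent R\<^esub> f = f" by auto
  qed (auto simp: one laurent_mult_closed laurent_mult_assoc intro: laurent_mult_comm)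
  fix f g h assume fgh: "f \<in> carrier (laurent R)" "g \<in> carrier (laurent R)" "h \<in> carrier (laurent R)"
  obtain I where I: "finite I" "{k. f k \<noteq> \<zero>} \<subseteq> I" "{k. g k \<noteq> \<zero>} \<subseteq> I" using laurent_supports[OF fgh(1,2)] .
  note [simp] = laurent_closed[OF fgh(1)] laurent_closed[OF fgh(2)] laurent_closed[OF fgh(3)]
  show "(f \<oplus>\<^bsub>laurent R\<^esub> g) \<otimes>\<^bsub>laurent R\<^esub> h = (f \<otimes>\<^bsub>laurent R\<^esub> h) \<oplus>\<^bsub>laurent R\<^esub> (g \<otimes>\<^bsub>laurent R\<^esub> h)"
  proof
    fix k
    have "((f \<oplus>\<^bsub>laurent R\<^esub> g) \<otimes>\<^bsub>laurent R\<^esub> h) k = (\<Oplus>l\<in>I. (f \<oplus>\<^bsub>laurent R\<^esub> g) l \<otimes> h (k - l))"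
      using I by (intro laurent_mult_eq add_closed fgh) (auto simp: laurent_add, metis (mono_tags, lifting) l_zero mem_Collect_eq subsetD zero_closed)
    also have "\<dots> = (\<Oplus>l\<in>I. f l \<otimes> h (k - l) \<oplus> g l \<otimes> h (k - l))"
      by (intro finsum_cong') (auto simp: laurent_add l_distr)
    also have "\<dots> = (\<Oplus>l\<in>I. f l \<otimes> h (k - l)) \<oplus> (\<Oplus>l\<in>I. g l \<otimes> h (k - l))"
      by (intro finsum_addf) auto
    also have "\<dots> = ((f \<otimes>\<^bsub>laurent R\<^esub> h) \<oplus>\<^bsub>laurent R\<^esub> (g \<otimes>\<^bsub>laurent R\<^esub> h)) k"
      using laurent_mult_eq[OF fgh(1,3) I(1,2)] laurent_mult_eq[OF fgh(2,3) I(1,3)] by (simp add: laurent_add)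
    finally show "((f \<oplus>\<^bsub>laurent R\<^esub> g) \<otimes>\<^bsub>laurent R\<^esub> h) k = ((f \<otimes>\<^bsub>laurent R\<^esub> h) \<oplus>\<^bsub>laurent R\<^esub> (g \<otimes>\<^bsub>laurent R\<^esub> h)) k" .
  qed
qed

end

text \<open>Substitution of \<open>u\<close> for the variable. As in \<open>mu_at\<close>, the sum
  runs over the support of \<open>f\<close> before coefficients are mapped by \<open>s\<close>, so
  \<open>mu_at\<close> is this evaluation applied to every entry.\<close>

definition laurent_eval ::
  "('w, 'k) ring_scheme \<Rightarrow> ('b, 'l) ring_scheme \<Rightarrow> ('w \<Rightarrow> 'b) \<Rightarrow> 'b \<Rightarrow> (int \<Rightarrow> 'w) \<Rightarrow> 'b" where
  "laurent_eval W A s u f = finsum A (\<lambda>k. s (f k) \<otimes>\<^bsub>A\<^esub> (u [^]\<^bsub>A\<^esub> k)) {k. f k \<noteq> \<zero>\<^bsub>W\<^esub>}"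

context ring_hom_cring begin

context
  fixes u assumes u: "u \<in> Units S"
begin

lemma u_pow_closed [simp]: "u [^]\<^bsub>S\<^esub> (k::int) \<in> carrier S"
  using S.int_pow_unit_Units[OF u] by (rule S.Units_closed)

lemma laurent_eval_eq:
  assumes f: "f \<in> carrier (laurent R)" and I: "finite I" "{k. f k \<noteq> \<zero>} \<subseteq> I"
  shows "laurent_eval R S h u f = (\<Oplus>\<^bsub>S\<^esub>k\<in>I. h (f k) \<otimes>\<^bsub>S\<^esub> (u [^]\<^bsub>S\<^esub> k))"
  unfolding laurent_eval_def using I R.laurent_closed[OF f] by (intro S.finsum_sub) auto

text \<open>The universal property of Laurent polynomials. For multiplicativity the product is
  evaluated over a sumset of exponents; after the interchange of sums, the inner sum is shifted by
  \<open>l\<close> and the power \<open>u^l\<close> is taken out.\<close>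

lemma laurent_eval_hom: "ring_hom_cring (laurent R) S (laurent_eval R S h u)"
proof (rule ring_hom_cringI[OF R.cring_laurent S.is_cring], rule ring_hom_memI)
  interpret L: cring "laurent R" by (rule R.cring_laurent)
  fix f assume f: "f \<in> carrier (laurent R)"
  show "laurent_eval R S h u f \<in> carrier S"
    unfolding laurent_eval_def using R.laurent_closed[OF f] by (intro S.finsum_closed) auto
  fix g assume g: "g \<in> carrier (laurent R)"
  note [simp] = R.laurent_closed[OF f] R.laurent_closed[OF g]
  obtain I where I: "finite I" "{k. f k \<noteq> \<zero>} \<subseteq> I" "{k. g k \<noteq> \<zero>} \<subseteq> I" using R.laurent_supports[OF f g] .
  have "laurent_eval R S h u (f \<oplus>\<^bsub>laurent R\<^esub> g) = (\<Oplus>\<^bsub>S\<^esub>k\<in>I. h ((f \<oplus>\<^bsub>laurent R\<^esub> g) k) \<otimes>\<^bsub>S\<^esub> (u [^]\<^bsub>S\<^esub> k))"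
    using I f g by (intro laurent_eval_eq L.a_closed)
      (auto simp: R.laurent_add, metis (mono_tags, lifting) R.l_zero mem_Collect_eq subsetD R.zero_closed)
  also have "\<dots> = (\<Oplus>\<^bsub>S\<^esub>k\<in>I. h (f k) \<otimes>\<^bsub>S\<^esub> (u [^]\<^bsub>S\<^esub> k) \<oplus>\<^bsub>S\<^esub> h (g k) \<otimes>\<^bsub>S\<^esub> (u [^]\<^bsub>S\<^esub> k))"
    by (intro S.finsum_cong') (auto simp: R.laurent_add S.l_distr)
  also have "\<dots> = laurent_eval R S h u f \<oplus>\<^bsub>S\<^esub> laurent_eval R S h u g"
    unfolding laurent_eval_eq[OF f I(1,2)] laurent_eval_eq[OF g I(1,3)] by (intro S.finsum_addf) auto
  finally show "laurent_eval R S h u (f \<oplus>\<^bsub>laurent R\<^esub> g) = laurent_eval R S h u f \<oplus>\<^bsub>S\<^esub> laurent_eval R S h u g" .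
  have hm: "h ((f \<otimes>\<^bsub>laurent R\<^esub> g) k) = (\<Oplus>\<^bsub>S\<^esub>l\<in>I. h (f l) \<otimes>\<^bsub>S\<^esub> h (g (k - l)))" for k
    unfolding R.laurent_mult_eq[OF f g I(1,2)] by (subst hom_finsum') (auto intro!: S.finsum_cong')
  let ?J = "(\<lambda>(i, j). i + j) ` (I \<times> I)"
  have J: "finite ?J" using I by auto
  have "laurent_eval R S h u (f \<otimes>\<^bsub>laurent R\<^esub> g) = (\<Oplus>\<^bsub>S\<^esub>k\<in>?J. h ((f \<otimes>\<^bsub>laurent R\<^esub> g) k) \<otimes>\<^bsub>S\<^esub> (u [^]\<^bsub>S\<^esub> k))"
    using I f g J R.laurent_mult_support[OF f g I] by (intro laurent_eval_eq L.m_closed) auto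
  also have "\<dots> = (\<Oplus>\<^bsub>S\<^esub>k\<in>?J. (\<Oplus>\<^bsub>S\<^esub>l\<in>I. h (f l) \<otimes>\<^bsub>S\<^esub> h (g (k - l))) \<otimes>\<^bsub>S\<^esub> (u [^]\<^bsub>S\<^esub> k))"
    by (intro S.finsum_cong') (auto simp only: hm intro!: S.finsum_closed S.m_closed u_pow_closed hom_closed R.laurent_closed f g)
  also have "\<dots> = (\<Oplus>\<^bsub>S\<^esub>l\<in>I. h (f l) \<otimes>\<^bsub>S\<^esub> (\<Oplus>\<^bsub>S\<^esub>k\<in>?J. h (g (k - l)) \<otimes>\<^bsub>S\<^esub> (u [^]\<^bsub>S\<^esub> k)))"
    using I J by (intro S.finsum_mult_assoc) auto
  also have "\<dots> = (\<Oplus>\<^bsub>S\<^esub>l\<in>I. (h (f l) \<otimes>\<^bsub>S\<^esub> (u [^]\<^bsub>S\<^esub> l)) \<otimes>\<^bsub>S\<^esub> laurent_eval R S h u g)"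
  proof (rule S.finsum_cong')
    fix l assume l: "l \<in> I"
    have "(\<Oplus>\<^bsub>S\<^esub>k\<in>?J. h (g (k - l)) \<otimes>\<^bsub>S\<^esub> (u [^]\<^bsub>S\<^esub> k)) = (\<Oplus>\<^bsub>S\<^esub>k\<in>(\<lambda>n. l + n) ` I. h (g (k - l)) \<otimes>\<^bsub>S\<^esub> (u [^]\<^bsub>S\<^esub> k))"
    proof (rule S.finsum_sub[symmetric])
      fix m assume "m \<in> ?J - (\<lambda>n. l + n) ` I"
      then have "m \<notin> (\<lambda>n. l + n) ` I" by blast
      moreover have "m = l + (m - l)" by simp
      ultimately have "m - l \<notin> I" by (metis image_eqI)
      then have "g (m - l) = \<zero>" using I by auto
      then show "h (g (m - l)) \<otimes>\<^bsub>S\<^esub> (u [^]\<^bsub>S\<^esub> m) = \<zero>\<^bsub>S\<^esub>" by simp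
    qed (use l J in auto)
    also have "\<dots> = (\<Oplus>\<^bsub>S\<^esub>n\<in>I. h (g (l + n - l)) \<otimes>\<^bsub>S\<^esub> (u [^]\<^bsub>S\<^esub> (l + n)))"
      by (intro S.finsum_reindex) auto
    also have "\<dots> = (\<Oplus>\<^bsub>S\<^esub>n\<in>I. (u [^]\<^bsub>S\<^esub> l) \<otimes>\<^bsub>S\<^esub> (h (g n) \<otimes>\<^bsub>S\<^esub> (u [^]\<^bsub>S\<^esub> n)))"
      by (intro S.finsum_cong') (auto simp: S.int_pow_unit_add[OF u] S.m_ac)
    also have "\<dots> = (u [^]\<^bsub>S\<^esub> l) \<otimes>\<^bsub>S\<^esub> laurent_eval R S h u g"
      unfolding laurent_eval_eq[OF g I(1,3)] using I by (intro S.finsum_rdistr[symmetric]) auto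
    finally have "(\<Oplus>\<^bsub>S\<^esub>k\<in>?J. h (g (k - l)) \<otimes>\<^bsub>S\<^esub> (u [^]\<^bsub>S\<^esub> k)) = (u [^]\<^bsub>S\<^esub> l) \<otimes>\<^bsub>S\<^esub> laurent_eval R S h u g" .
    then show "h (f l) \<otimes>\<^bsub>S\<^esub> (\<Oplus>\<^bsub>S\<^esub>k\<in>?J. h (g (k - l)) \<otimes>\<^bsub>S\<^esub> (u [^]\<^bsub>S\<^esub> k))
        = (h (f l) \<otimes>\<^bsub>S\<^esub> (u [^]\<^bsub>S\<^esub> l)) \<otimes>\<^bsub>S\<^esub> laurent_eval R S h u g"
      unfolding laurent_eval_eq[OF g I(1,3)] by (simp add: S.m_assoc)
  qed (auto simp: laurent_eval_eq[OF g I(1,3)])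
  also have "\<dots> = laurent_eval R S h u f \<otimes>\<^bsub>S\<^esub> laurent_eval R S h u g"
    unfolding laurent_eval_eq[OF f I(1,2)] laurent_eval_eq[OF g I(1,3)] using I by (intro S.finsum_ldistr[symmetric]) auto
  finally show "laurent_eval R S h u (f \<otimes>\<^bsub>laurent R\<^esub> g) = laurent_eval R S h u f \<otimes>\<^bsub>S\<^esub> laurent_eval R S h u g" .
next
  interpret L: cring "laurent R" by (rule R.cring_laurent)
  show "laurent_eval R S h u \<one>\<^bsub>laurent R\<^esub> = \<one>\<^bsub>S\<^esub>"
    by (subst laurent_eval_eq[of _ "{0}"]) (use L.one_closed in \<open>auto simp: R.laurent_one\<close>)
qed

end

end

section \<open>The cocharacter evaluated at a unit\<close>

lemma mu_at_eq: "mu_at D A s u = mmap (rk D) (laurent_eval (BW D) A s u) (mu D)"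
  by (auto simp: mu_at_def mmap_def laurent_eval_def)

context
  fixes D :: "('w, 'i) group_datum" and A :: "('b, 'k) ring_scheme" and s
  assumes h: "ring_hom_cring (BW D) A s" and mu: "cocharacter D"
    and T: "integral_tensors D"
begin

interpretation h: ring_hom_cring "BW D" A s by (rule h)

lemma T0_closed: "t \<in> TI D \<Longrightarrow> T0 D t is js \<in> carrier (BW D)"
  using T by (auto simp: integral_tensors_def Zp_def)

text \<open>The cocharacter is a point of the group over the Laurent polynomials, so specializing
  the variable to a unit is functoriality of points.\<close>

lemma mu_at_grp:
  assumes u: "u \<in> Units A" shows "mu_at D A s u \<in> grp D A s"
  unfolding mu_at_eq
proof (rule grp_mmap[OF h.R.cring_laurent _ h.laurent_eval_hom[OF u]])
  show "mu D \<in> grp D (laurent (BW D)) (\<lambda>w k. if k = 0 then w else \<zero>\<^bsub>BW D\<^esub>)"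
    using mu by (simp add: cocharacter_def)
  have cl: "(\<lambda>k. if k = 0 then w else \<zero>\<^bsub>BW D\<^esub>) \<in> carrier (laurent (BW D))" if "w \<in> carrier (BW D)" for w
    using that by (auto simp: h.R.laurent_carrier intro: finite_subset[of _ "{0}"])
  then show "(\<lambda>k. if k = 0 then T0 D t is js else \<zero>\<^bsub>BW D\<^esub>) \<in> carrier (laurent (BW D))" if "t \<in> TI D" for t "is" js
    using T0_closed[OF that] by simp
  show "laurent_eval (BW D) A s u (\<lambda>k. if k = 0 then T0 D t is js else \<zero>\<^bsub>BW D\<^esub>) = s (T0 D t is js)"
    if "t \<in> TI D" for t "is" js
    using T0_closed[OF that] by (subst h.laurent_eval_eq[OF u cl, of _ "{0}"]) auto
qed

lemma mu_entry: "i < rk D \<Longrightarrow> j < rk D \<Longrightarrow> mu D (i, j) \<in> carrier (laurent (BW D))"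
  using mu by (auto simp: cocharacter_def grp_def GL_def mats_def)

text \<open>By the second clause of \<open>cocharacter\<close>, the coefficient matrices
  \<open>M_k\<close> of \<open>mu D\<close> satisfy \<open>M_k M_k = M_k\<close>, and
  \<open>M_k M_l = 0\<close> for distinct exponents. Hence the sums of \<open>u^k M_k\<close> and of
  \<open>v^l M_l\<close> multiply to the sum of \<open>(u v)^k M_k\<close>.\<close>

lemma mu_at_mult:
  assumes u: "u \<in> Units A" and v: "v \<in> Units A"
  shows "mu_at D A s (u \<otimes>\<^bsub>A\<^esub> v) = mmul (rk D) A (mu_at D A s u) (mu_at D A s v)"
proof (rule mats_eqI[of _ "rk D" A _ A])
  have cl: "mu_at D A s u \<in> mats (rk D) A" if "u \<in> Units A" for u
    using mu_at_grp[OF that] by (simp add: grp_def GL_def)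
  show "mu_at D A s (u \<otimes>\<^bsub>A\<^esub> v) \<in> mats (rk D) A" "mmul (rk D) A (mu_at D A s u) (mu_at D A s v) \<in> mats (rk D) A"
    using u v cl by auto
  fix i j assume ij: "i < rk D" "j < rk D"
  \<comment> \<open>One finite set of exponents that serves all entries of the matrix at
    once.\<close>
  define I where "I = (\<Union>a\<in>{..<rk D}. \<Union>b\<in>{..<rk D}. {k. mu D (a, b) k \<noteq> \<zero>\<^bsub>BW D\<^esub>})"
  have I: "finite I" "\<And>a b. a < rk D \<Longrightarrow> b < rk D \<Longrightarrow> {k. mu D (a, b) k \<noteq> \<zero>\<^bsub>BW D\<^esub>} \<subseteq> I"
    using mu_entry by (auto simp: I_def h.R.laurent_carrier)
  have [simp]: "mu D (a, b) k \<in> carrier (BW D)" if "a < rk D" "b < rk D" for a b k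
    using mu_entry[OF that] by (rule h.R.laurent_closed)
  note [simp] = h.u_pow_closed[OF u] h.u_pow_closed[OF v] h.u_pow_closed[OF h.S.Units_m_closed[OF u v]]
  have ev: "mu_at D A s w (a, b) = (\<Oplus>\<^bsub>A\<^esub>k\<in>I. s (mu D (a, b) k) \<otimes>\<^bsub>A\<^esub> (w [^]\<^bsub>A\<^esub> k))"
    if w: "w \<in> Units A" and ab: "a < rk D" "b < rk D" for w a b
    using h.laurent_eval_eq[OF w mu_entry[OF ab] I(1) I(2)[OF ab]] ab by (simp add: mu_at_eq mmap_app)
  have coeff: "(\<Oplus>\<^bsub>A\<^esub>r\<in>{..<rk D}. s (mu D (i, r) k) \<otimes>\<^bsub>A\<^esub> s (mu D (r, j) l)) = (if k = l then s (mu D (i, j) k) else \<zero>\<^bsub>A\<^esub>)"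
    for k l
  proof -
    have "finsum (BW D) (\<lambda>r. mu D (i, r) k \<otimes>\<^bsub>BW D\<^esub> mu D (r, j) l) {..<rk D}
      = (if k = l then mu D (i, j) k else \<zero>\<^bsub>BW D\<^esub>)"
      using mu ij unfolding cocharacter_def by blast
    then have "s (finsum (BW D) (\<lambda>r. mu D (i, r) k \<otimes>\<^bsub>BW D\<^esub> mu D (r, j) l) {..<rk D})
      = (if k = l then s (mu D (i, j) k) else \<zero>\<^bsub>A\<^esub>)" by simp
    moreover have "s (finsum (BW D) (\<lambda>r. mu D (i, r) k \<otimes>\<^bsub>BW D\<^esub> mu D (r, j) l) {..<rk D})
      = (\<Oplus>\<^bsub>A\<^esub>r\<in>{..<rk D}. s (mu D (i, r) k) \<otimes>\<^bsub>A\<^esub> s (mu D (r, j) l))"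
      using ij by (subst h.hom_finsum') (auto intro!: h.S.finsum_cong')
    ultimately show ?thesis by simp
  qed
  have "mmul (rk D) A (mu_at D A s u) (mu_at D A s v) (i, j) =
    (\<Oplus>\<^bsub>A\<^esub>r\<in>{..<rk D}. (\<Oplus>\<^bsub>A\<^esub>k\<in>I. (u [^]\<^bsub>A\<^esub> k) \<otimes>\<^bsub>A\<^esub> s (mu D (i, r) k)) \<otimes>\<^bsub>A\<^esub> (\<Oplus>\<^bsub>A\<^esub>l\<in>I. s (mu D (r, j) l) \<otimes>\<^bsub>A\<^esub> (v [^]\<^bsub>A\<^esub> l)))"
    unfolding h.S.mmul_app[OF ij] using ij u v
    by (intro h.S.finsum_cong' refl arg_cong2[where f = "monoid.mult A"]) (auto simp: ev h.S.m_comm intro!: h.S.finsum_cong' h.S.finsum_closed)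
  also have "\<dots> = (\<Oplus>\<^bsub>A\<^esub>k\<in>I. (u [^]\<^bsub>A\<^esub> k) \<otimes>\<^bsub>A\<^esub> (\<Oplus>\<^bsub>A\<^esub>r\<in>{..<rk D}. s (mu D (i, r) k) \<otimes>\<^bsub>A\<^esub> (\<Oplus>\<^bsub>A\<^esub>l\<in>I. s (mu D (r, j) l) \<otimes>\<^bsub>A\<^esub> (v [^]\<^bsub>A\<^esub> l))))"
    using ij I by (intro h.S.finsum_mult_assoc) auto
  also have "\<dots> = (\<Oplus>\<^bsub>A\<^esub>k\<in>I. (u [^]\<^bsub>A\<^esub> k) \<otimes>\<^bsub>A\<^esub> (\<Oplus>\<^bsub>A\<^esub>l\<in>I. (\<Oplus>\<^bsub>A\<^esub>r\<in>{..<rk D}. s (mu D (i, r) k) \<otimes>\<^bsub>A\<^esub> s (mu D (r, j) l)) \<otimes>\<^bsub>A\<^esub> (v [^]\<^bsub>A\<^esub> l)))"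
    using ij I by (intro h.S.finsum_cong'[OF refl] arg_cong2[where f = "monoid.mult A", OF refl] h.S.finsum_mult_assoc[symmetric])
      (auto intro!: h.S.finsum_closed)
  also have "\<dots> = (\<Oplus>\<^bsub>A\<^esub>k\<in>I. s (mu D (i, j) k) \<otimes>\<^bsub>A\<^esub> ((u \<otimes>\<^bsub>A\<^esub> v) [^]\<^bsub>A\<^esub> k))"
  proof (rule h.S.finsum_cong')
    fix k assume k: "k \<in> I"
    have "(\<Oplus>\<^bsub>A\<^esub>l\<in>I. (\<Oplus>\<^bsub>A\<^esub>r\<in>{..<rk D}. s (mu D (i, r) k) \<otimes>\<^bsub>A\<^esub> s (mu D (r, j) l)) \<otimes>\<^bsub>A\<^esub> (v [^]\<^bsub>A\<^esub> l))
      = (\<Oplus>\<^bsub>A\<^esub>l\<in>I. if l = k then s (mu D (i, j) l) \<otimes>\<^bsub>A\<^esub> (v [^]\<^bsub>A\<^esub> l) else \<zero>\<^bsub>A\<^esub>)"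
      using ij by (intro h.S.finsum_cong') (auto simp: coeff)
    also have "\<dots> = s (mu D (i, j) k) \<otimes>\<^bsub>A\<^esub> (v [^]\<^bsub>A\<^esub> k)"
      using h.S.finsum_delta[OF I(1) k, of "\<lambda>l. s (mu D (i, j) l) \<otimes>\<^bsub>A\<^esub> (v [^]\<^bsub>A\<^esub> l)"] ij by simp
    finally show "(u [^]\<^bsub>A\<^esub> k) \<otimes>\<^bsub>A\<^esub> (\<Oplus>\<^bsub>A\<^esub>l\<in>I. (\<Oplus>\<^bsub>A\<^esub>r\<in>{..<rk D}. s (mu D (i, r) k) \<otimes>\<^bsub>A\<^esub> s (mu D (r, j) l)) \<otimes>\<^bsub>A\<^esub> (v [^]\<^bsub>A\<^esub> l))
      = s (mu D (i, j) k) \<otimes>\<^bsub>A\<^esub> ((u \<otimes>\<^bsub>A\<^esub> v) [^]\<^bsub>A\<^esub> k)"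
      using ij by (simp add: h.S.int_pow_unit_distrib[OF u v] h.S.m_ac)
  qed (use ij in auto)
  also have "\<dots> = mu_at D A s (u \<otimes>\<^bsub>A\<^esub> v) (i, j)"
    using ev[of "u \<otimes>\<^bsub>A\<^esub> v" i j] u v ij by simp
  finally show "mu_at D A s (u \<otimes>\<^bsub>A\<^esub> v) (i, j) = mmul (rk D) A (mu_at D A s u) (mu_at D A s v) (i, j)" by simp
qed

lemma mu_at_hom:
  assumes f: "ring_hom_cring A C f" and u: "u \<in> Units A"
    and s': "\<And>w. w \<in> carrier (BW D) \<Longrightarrow> f (s w) = s' w"
  shows "mmap (rk D) f (mu_at D A s u) = mu_at D C s' (f u)"
  unfolding mu_at_eq mmap_mmap
proof (rule mmap_cong)
  interpret f: ring_hom_cring A C f by (rule f)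
  fix i j assume ij: "i < rk D" "j < rk D"
  have *: "mu D (i, j) k \<in> carrier (BW D)" for k
    using mu_entry[OF ij] by (rule h.R.laurent_closed)
  show "f (laurent_eval (BW D) A s u (mu D (i, j))) = laurent_eval (BW D) C s' (f u) (mu D (i, j))"
    unfolding laurent_eval_def using * u h.u_pow_closed[OF u]
    by (subst f.hom_finsum') (auto simp: f.hom_int_pow s'[symmetric] f.u_pow_closed[OF f.hom_Units[OF u]] intro!: f.S.finsum_cong')
qed

end

section \<open>The prism \<open>(R[[t]], (t + p))\<close>\<close>

context cring begin

lemma ps_carrier: "g \<in> carrier (pow_ser R) \<longleftrightarrow> (\<forall>k. g k \<in> carrier R)"
  by (auto simp: pow_ser_def)

lemma ps_mult: "(g \<otimes>\<^bsub>pow_ser R\<^esub> h) k = (\<Oplus>l\<in>{..k}. g l \<otimes> h (k - l))"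
  and ps_add: "(g \<oplus>\<^bsub>pow_ser R\<^esub> h) k = g k \<oplus> h k"
  and ps_one: "\<one>\<^bsub>pow_ser R\<^esub> k = (if k = 0 then \<one> else \<zero>)"
  and ps_zero: "\<zero>\<^bsub>pow_ser R\<^esub> k = \<zero>"
  by (simp_all add: pow_ser_def)

lemma ps_mult_assoc:
  assumes "f \<in> carrier (pow_ser R)" "g \<in> carrier (pow_ser R)" "h \<in> carrier (pow_ser R)"
  shows "f \<otimes>\<^bsub>pow_ser R\<^esub> g \<otimes>\<^bsub>pow_ser R\<^esub> h = f \<otimes>\<^bsub>pow_ser R\<^esub> (g \<otimes>\<^bsub>pow_ser R\<^esub> h)"
proof
  fix n
  have [simp]: "f k \<in> carrier R" "g k \<in> carrier R" "h k \<in> carrier R" for k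
    using assms by (auto simp: ps_carrier)
  \<comment> \<open>Extending \<open>g\<close> by zero to negative degrees turns the triangular
    double sum into a rectangular one, where \<open>finsum_mult_assoc\<close> applies.\<close>
  let ?y = "\<lambda>l k. if l \<le> k then g (k - l) else \<zero>"
  have "(f \<otimes>\<^bsub>pow_ser R\<^esub> g \<otimes>\<^bsub>pow_ser R\<^esub> h) n = (\<Oplus>k\<in>{..n}. (\<Oplus>l\<in>{..k}. f l \<otimes> ?y l k) \<otimes> h (n - k))"
    unfolding ps_mult by (intro finsum_cong' refl arg_cong2[where f = "monoid.mult R"]) auto
  also have "\<dots> = (\<Oplus>k\<in>{..n}. (\<Oplus>l\<in>{..n}. f l \<otimes> ?y l k) \<otimes> h (n - k))"
    by (intro finsum_cong'[OF refl] arg_cong2[where f = "monoid.mult R", OF _ refl] finsum_sub) auto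
  also have "\<dots> = (\<Oplus>l\<in>{..n}. f l \<otimes> (\<Oplus>k\<in>{..n}. ?y l k \<otimes> h (n - k)))"
    by (intro finsum_mult_assoc) auto
  also have "\<dots> = (\<Oplus>l\<in>{..n}. f l \<otimes> (g \<otimes>\<^bsub>pow_ser R\<^esub> h) (n - l))"
  proof (intro finsum_cong'[OF refl] arg_cong2[where f = "monoid.mult R", OF refl])
    fix l assume l: "l \<in> {..n}"
    have "(\<Oplus>k\<in>{..n}. ?y l k \<otimes> h (n - k)) = (\<Oplus>k\<in>(\<lambda>m. l + m) ` {..n - l}. ?y l k \<otimes> h (n - k))"
    proof (rule finsum_sub[symmetric])
      fix k assume k: "k \<in> {..n} - (\<lambda>m. l + m) ` {..n - l}"
      have "\<not> l \<le> k"
      proof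
        assume "l \<le> k"
        then have "k = l + (k - l)" "k - l \<in> {..n - l}" using k by auto
        then show False using k by blast
      qed
      then show "?y l k \<otimes> h (n - k) = \<zero>" by simp
    qed (use l in auto)
    also have "\<dots> = (\<Oplus>m\<in>{..n - l}. ?y l (l + m) \<otimes> h (n - (l + m)))"
      by (rule finsum_reindex) auto
    finally show "(\<Oplus>k\<in>{..n}. ?y l k \<otimes> h (n - k)) = (g \<otimes>\<^bsub>pow_ser R\<^esub> h) (n - l)"
      by (simp add: ps_mult)
  qed (auto simp: ps_mult intro!: finsum_closed)
  also have "\<dots> = (f \<otimes>\<^bsub>pow_ser R\<^esub> (g \<otimes>\<^bsub>pow_ser R\<^esub> h)) n"
    by (simp only: ps_mult[of f])
  finally show "(f \<otimes>\<^bsub>pow_ser R\<^esub> g \<otimes>\<^bsub>pow_ser R\<^esub> h) n = (f \<otimes>\<^bsub>pow_ser R\<^esub> (g \<otimes>\<^bsub>pow_ser R\<^esub> h)) n" .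
qed

lemma ps_mult_comm:
  assumes "f \<in> carrier (pow_ser R)" "g \<in> carrier (pow_ser R)"
  shows "f \<otimes>\<^bsub>pow_ser R\<^esub> g = g \<otimes>\<^bsub>pow_ser R\<^esub> f"
proof
  fix n :: nat
  have [simp]: "f k \<in> carrier R" "g k \<in> carrier R" for k
    using assms by (auto simp: ps_carrier)
  have eq: "{..n} = (\<lambda>l. n - l) ` {..n}"
  proof (intro equalityI subsetI)
    fix x assume "x \<in> {..n}"
    then show "x \<in> (\<lambda>l. n - l) ` {..n}" by (intro image_eqI[of _ _ "n - x"]) auto
  qed auto
  have "(f \<otimes>\<^bsub>pow_ser R\<^esub> g) n = (\<Oplus>l\<in>(\<lambda>l. n - l) ` {..n}. f l \<otimes> g (n - l))"
    unfolding ps_mult using eq by simp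
  also have "\<dots> = (\<Oplus>l\<in>{..n}. f (n - l) \<otimes> g (n - (n - l)))"
    by (rule finsum_reindex) (auto simp: inj_on_def)
  also have "\<dots> = (g \<otimes>\<^bsub>pow_ser R\<^esub> f) n"
    unfolding ps_mult by (intro finsum_cong') (auto simp: m_comm)
  finally show "(f \<otimes>\<^bsub>pow_ser R\<^esub> g) n = (g \<otimes>\<^bsub>pow_ser R\<^esub> f) n" .
qed

lemma ps_scalar:
  assumes c: "c \<in> carrier R" "g \<in> carrier (pow_ser R)"
  shows "((\<lambda>k. if k = 0 then c else \<zero>) \<otimes>\<^bsub>pow_ser R\<^esub> g) k = c \<otimes> g k"
proof -
  have "(\<Oplus>l\<in>{..k}. (if l = 0 then c else \<zero>) \<otimes> g (k - l)) = (\<Oplus>l\<in>{..k}. if l = 0 then c \<otimes> g (k - l) else \<zero>)"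
    using assms by (intro finsum_cong') (auto simp: ps_carrier)
  also have "\<dots> = c \<otimes> g k"
    using finsum_delta[of "{..k}" 0 "\<lambda>l. c \<otimes> g (k - l)"] assms by (simp add: ps_carrier)
  finally show ?thesis by (simp add: ps_mult)
qed

lemma cring_pow_ser: "cring (pow_ser R)"
proof (rule cringI)
  show "abelian_group (pow_ser R)"
  proof (rule abelian_groupI)
    fix f assume f: "f \<in> carrier (pow_ser R)"
    then have "(\<lambda>k. \<ominus> f k) \<in> carrier (pow_ser R)" by (auto simp: ps_carrier)
    moreover have "(\<lambda>k. \<ominus> f k) \<oplus>\<^bsub>pow_ser R\<^esub> f = \<zero>\<^bsub>pow_ser R\<^esub>"
      using f by (auto simp: ps_add ps_zero ps_carrier l_neg)
    ultimately show "\<exists>y\<in>carrier (pow_ser R). y \<oplus>\<^bsub>pow_ser R\<^esub> f = \<zero>\<^bsub>pow_ser R\<^esub>" by blast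
  qed (auto simp: ps_add ps_carrier ps_zero a_ac fun_eq_iff)
  show "comm_monoid (pow_ser R)"
  proof (rule comm_monoidI)
    fix f assume f: "f \<in> carrier (pow_ser R)"
    have "\<one>\<^bsub>pow_ser R\<^esub> = (\<lambda>k. if k = 0 then \<one> else \<zero>)" by (simp add: pow_ser_def)
    then show "\<one>\<^bsub>pow_ser R\<^esub> \<otimes>\<^bsub>pow_ser R\<^esub> f = f"
      using f by (intro ext) (simp only: ps_scalar[OF one_closed f], simp add: ps_carrier)
  qed (auto simp: ps_mult_assoc ps_carrier ps_mult ps_one intro: ps_mult_comm)
  fix f g h assume fgh: "f \<in> carrier (pow_ser R)" "g \<in> carrier (pow_ser R)" "h \<in> carrier (pow_ser R)"
  have [simp]: "f k \<in> carrier R" "g k \<in> carrier R" "h k \<in> carrier R" for k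
    using fgh by (auto simp: ps_carrier)
  show "(f \<oplus>\<^bsub>pow_ser R\<^esub> g) \<otimes>\<^bsub>pow_ser R\<^esub> h = (f \<otimes>\<^bsub>pow_ser R\<^esub> h) \<oplus>\<^bsub>pow_ser R\<^esub> (g \<otimes>\<^bsub>pow_ser R\<^esub> h)"
    by (auto simp: fun_eq_iff ps_mult ps_add l_distr finsum_addf)
qed

end

lemma same_ops_BK: "same_ops (pow_ser R) (BK D R)"
  by (simp add: same_ops_def BK_def)

lemma same_ops_truncate: "same_ops R (walg.truncate R)"
  by (simp add: same_ops_def walg.defs)

section \<open>The ring R[[t]] attached to a crystalline prism\<close>

locale bk =
  fixes D :: "('w, 'i) group_datum" and R :: "('a, 'w) cprism"
  assumes prime: "Factorial_Ring.prime (pp D)" and cp: "is_cprism D R"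
begin

abbreviation "p \<equiv> pp D"
abbreviation "A \<equiv> BK D R"

lemma p_pos: "p > 0" and p_ge_2: "p \<ge> 2"
  using prime by (auto simp: prime_gt_0_nat prime_ge_2_nat)

sublocale R: cring R
  using cp by (simp add: is_cprism_def complete_walg_def is_walg_def)

sublocale A: cring A
  by (rule same_ops_cring[OF same_ops_BK R.cring_pow_ser])

abbreviation "\<pi> \<equiv> rnat R p"

lemma carrier_iff: "g \<in> carrier A \<longleftrightarrow> (\<forall>k. g k \<in> carrier R)"
  by (simp add: same_ops_simps(1)[OF same_ops_BK] R.ps_carrier)

lemma coeff [simp]: "g \<in> carrier A \<Longrightarrow> g k \<in> carrier R"
  by (simp add: carrier_iff)

lemma coeff_mult: "(g \<otimes>\<^bsub>A\<^esub> h) k = (\<Oplus>\<^bsub>R\<^esub>l\<in>{..k}. g l \<otimes>\<^bsub>R\<^esub> h (k - l))"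
  and coeff_add: "(g \<oplus>\<^bsub>A\<^esub> h) k = g k \<oplus>\<^bsub>R\<^esub> h k"
  and coeff_one: "\<one>\<^bsub>A\<^esub> k = (if k = 0 then \<one>\<^bsub>R\<^esub> else \<zero>\<^bsub>R\<^esub>)"
  and coeff_zero: "\<zero>\<^bsub>A\<^esub> k = \<zero>\<^bsub>R\<^esub>"
  by (simp_all add: same_ops_simps[OF same_ops_BK] R.ps_mult R.ps_add R.ps_one R.ps_zero)

lemma coeff_neg: "g \<in> carrier A \<Longrightarrow> (\<ominus>\<^bsub>A\<^esub> g) k = \<ominus>\<^bsub>R\<^esub> g k"
proof -
  assume g: "g \<in> carrier A"
  have "\<ominus>\<^bsub>A\<^esub> g = (\<lambda>k. \<ominus>\<^bsub>R\<^esub> g k)"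
    by (rule A.minus_equality) (use g in \<open>auto simp: carrier_iff coeff_add coeff_zero R.l_neg\<close>)
  then show ?thesis by simp
qed

lemma coeff_minus: "g \<in> carrier A \<Longrightarrow> h \<in> carrier A \<Longrightarrow> (g \<ominus>\<^bsub>A\<^esub> h) k = g k \<ominus>\<^bsub>R\<^esub> h k"
  by (simp add: a_minus_def coeff_add coeff_neg)

definition const :: "'a \<Rightarrow> nat \<Rightarrow> 'a" where
  "const c = (\<lambda>k. if k = 0 then c else \<zero>\<^bsub>R\<^esub>)"

definition tt :: "nat \<Rightarrow> 'a" where
  "tt = (\<lambda>k. if k = 1 then \<one>\<^bsub>R\<^esub> else \<zero>\<^bsub>R\<^esub>)"

definition shift :: "nat \<Rightarrow> (nat \<Rightarrow> 'a) \<Rightarrow> nat \<Rightarrow> 'a" where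
  "shift n g = (\<lambda>k. g (n + k))"

abbreviation "E \<equiv> bk_E D R"

lemma const_closed [simp]: "c \<in> carrier R \<Longrightarrow> const c \<in> carrier A"
  and tt_closed [simp]: "tt \<in> carrier A"
  and shift_closed [simp]: "g \<in> carrier A \<Longrightarrow> shift n g \<in> carrier A"
  and E_closed [simp]: "E \<in> carrier A"
  by (auto simp: const_def tt_def shift_def bk_E_def carrier_iff)

lemma coeff_const_mult: "c \<in> carrier R \<Longrightarrow> g \<in> carrier A \<Longrightarrow> (const c \<otimes>\<^bsub>A\<^esub> g) k = c \<otimes>\<^bsub>R\<^esub> g k"
  using R.ps_scalar[of c g k] by (simp add: same_ops_simps[OF same_ops_BK] const_def)

lemma coeff_tt_mult:
  assumes g: "g \<in> carrier A"
  shows "(tt \<otimes>\<^bsub>A\<^esub> g) k = (case k of 0 \<Rightarrow> \<zero>\<^bsub>R\<^esub> | Suc k \<Rightarrow> g k)"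
proof (cases k)
  case 0
  then show ?thesis using g by (simp add: coeff_mult tt_def)
next
  case (Suc m)
  have "(tt \<otimes>\<^bsub>A\<^esub> g) k = (\<Oplus>\<^bsub>R\<^esub>l\<in>{..k}. if l = 1 then g (k - l) else \<zero>\<^bsub>R\<^esub>)"
    unfolding coeff_mult using g by (intro R.finsum_cong') (auto simp: tt_def)
  also have "\<dots> = g m"
    using R.finsum_delta[of "{..k}" 1 "\<lambda>l. g (k - l)"] g Suc by simp
  finally show ?thesis using Suc by simp
qed

lemma const_hom: "ring_hom_cring R A const"
proof (rule ring_hom_cringI[OF R.is_cring A.is_cring], rule ring_hom_memI)
  show "const (x \<otimes>\<^bsub>R\<^esub> y) = const x \<otimes>\<^bsub>A\<^esub> const y" if "x \<in> carrier R" "y \<in> carrier R" for x y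
    using that by (intro ext) (simp add: coeff_const_mult, simp add: const_def)
qed (auto simp: const_def coeff_add coeff_one carrier_iff)

sublocale C: ring_hom_cring R A const by (rule const_hom)

lemma rnat_A: "rnat A n = const (rnat R n)"
  by (rule C.hom_rnat[symmetric])

lemma E_eq: "E = const \<pi> \<oplus>\<^bsub>A\<^esub> tt"
  by (auto simp: bk_E_def const_def tt_def coeff_add)

text \<open>Removing the constant term and dividing by t is the recursion behind evaluation, the
  Frobenius congruence and the description of the powers of (p, t).\<close>

lemma decomp: assumes g: "g \<in> carrier A" shows "g = const (g 0) \<oplus>\<^bsub>A\<^esub> (tt \<otimes>\<^bsub>A\<^esub> shift 1 g)"
proof
  fix k show "g k = (const (g 0) \<oplus>\<^bsub>A\<^esub> (tt \<otimes>\<^bsub>A\<^esub> shift 1 g)) k"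
    unfolding coeff_add coeff_tt_mult[OF shift_closed[OF g]] using g by (cases k) (simp_all add: const_def shift_def)
qed

lemma tt_pow: "tt [^]\<^bsub>A\<^esub> n = (\<lambda>k. if k = n then \<one>\<^bsub>R\<^esub> else \<zero>\<^bsub>R\<^esub>)"
proof (induction n)
  case 0
  then show ?case by (auto simp: coeff_one)
next
  case (Suc n)
  have "tt [^]\<^bsub>A\<^esub> Suc n = tt \<otimes>\<^bsub>A\<^esub> (tt [^]\<^bsub>A\<^esub> n)" by (simp add: A.m_comm)
  then show ?case unfolding Suc by (auto simp: coeff_tt_mult carrier_iff split: nat.split)
qed

lemma coeff_tt_pow_mult: "g \<in> carrier A \<Longrightarrow> ((tt [^]\<^bsub>A\<^esub> n) \<otimes>\<^bsub>A\<^esub> g) k = (if k < n then \<zero>\<^bsub>R\<^esub> else g (k - n))"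
proof (induction n arbitrary: k)
  case (Suc n)
  have "(tt [^]\<^bsub>A\<^esub> Suc n) \<otimes>\<^bsub>A\<^esub> g = tt \<otimes>\<^bsub>A\<^esub> ((tt [^]\<^bsub>A\<^esub> n) \<otimes>\<^bsub>A\<^esub> g)" using Suc by (simp add: A.m_ac)
  then show ?case using Suc by (auto simp: coeff_tt_mult split: nat.split)
qed auto

lemma p_ideal_eq: "p_ideal p R = PIdl\<^bsub>R\<^esub> \<pi>"
  by (simp add: p_ideal_def)

lemma ipow_eq: "ipow R (p_ideal p R) k = PIdl\<^bsub>R\<^esub> (\<pi> [^]\<^bsub>R\<^esub> k)"
  by (simp add: p_ideal_eq R.ipow_PIdl)

abbreviation "P k \<equiv> PIdl\<^bsub>R\<^esub> (\<pi> [^]\<^bsub>R\<^esub> (k::nat))"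

lemma P_closed: "x \<in> P k \<Longrightarrow> x \<in> carrier R"
  by (auto simp: R.mem_PIdl)

lemma P_add: "x \<in> P k \<Longrightarrow> y \<in> P k \<Longrightarrow> x \<oplus>\<^bsub>R\<^esub> y \<in> P k"
  by (auto simp: R.mem_PIdl R.l_distr[symmetric] simp del: R.l_distr)

lemma P_neg: "x \<in> P k \<Longrightarrow> \<ominus>\<^bsub>R\<^esub> x \<in> P k"
  by (auto simp: R.mem_PIdl intro!: bexI[of _ "\<ominus>\<^bsub>R\<^esub> x" for x] simp: R.l_minus)

lemma P_minus: "x \<in> P k \<Longrightarrow> y \<in> P k \<Longrightarrow> x \<ominus>\<^bsub>R\<^esub> y \<in> P k"
  by (simp add: a_minus_def P_add P_neg)

lemma P_mult: "c \<in> carrier R \<Longrightarrow> x \<in> P k \<Longrightarrow> c \<otimes>\<^bsub>R\<^esub> x \<in> P k"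
  by (auto simp: R.mem_PIdl R.m_assoc[symmetric])

lemma P_mult2:
  assumes "x \<in> P k" "y \<in> P l" shows "x \<otimes>\<^bsub>R\<^esub> y \<in> P (k + l)"
proof -
  obtain a b where ab: "a \<in> carrier R" "x = a \<otimes>\<^bsub>R\<^esub> (\<pi> [^]\<^bsub>R\<^esub> k)" "b \<in> carrier R" "y = b \<otimes>\<^bsub>R\<^esub> (\<pi> [^]\<^bsub>R\<^esub> l)"
    using assms by (auto simp: R.mem_PIdl)
  show ?thesis unfolding R.mem_PIdl
    by (rule bexI[of _ "a \<otimes>\<^bsub>R\<^esub> b"]) (use ab in \<open>auto simp: R.nat_pow_mult[symmetric] R.m_ac\<close>)
qed

lemma P_zero [simp]: "\<zero>\<^bsub>R\<^esub> \<in> P k"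
  by (auto simp: R.mem_PIdl intro: bexI[of _ "\<zero>\<^bsub>R\<^esub>"])

lemma P_mono: "l \<le> k \<Longrightarrow> x \<in> P k \<Longrightarrow> x \<in> P l"
proof -
  assume lk: "l \<le> k" and "x \<in> P k"
  then obtain a where a: "a \<in> carrier R" "x = a \<otimes>\<^bsub>R\<^esub> (\<pi> [^]\<^bsub>R\<^esub> ((k - l) + l))" by (auto simp: R.mem_PIdl)
  then show ?thesis unfolding R.mem_PIdl
    by (intro bexI[of _ "a \<otimes>\<^bsub>R\<^esub> (\<pi> [^]\<^bsub>R\<^esub> (k - l))"]) (auto simp only: R.nat_pow_mult[symmetric] R.m_assoc R.m_closed R.nat_pow_closed R.rnat_closed)
qed

lemma P_finsum: "(\<And>i. i \<in> I \<Longrightarrow> f i \<in> P k) \<Longrightarrow> finsum R f I \<in> P k"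
proof (induction I rule: infinite_finite_induct)
  case (insert i I)
  then show ?case using P_closed[of "f _" k] by (subst R.finsum_insert) (auto intro: P_add)
qed auto

lemma R_complete:
  assumes "\<And>k. x k \<in> carrier R" "\<And>k. x (Suc k) \<ominus>\<^bsub>R\<^esub> x k \<in> P k"
  shows "\<exists>!y. y \<in> carrier R \<and> (\<forall>k. y \<ominus>\<^bsub>R\<^esub> x k \<in> P k)"
proof -
  have "adic_complete R (p_ideal p R)" using cp by (simp add: is_cprism_def complete_walg_def)
  then show ?thesis using assms unfolding adic_complete_def ipow_eq by blast
qed

lemma torsion_free: "a \<in> carrier R \<Longrightarrow> \<pi> \<otimes>\<^bsub>R\<^esub> a = \<zero>\<^bsub>R\<^esub> \<Longrightarrow> a = \<zero>\<^bsub>R\<^esub>"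
  using cp by (auto simp: is_cprism_def p_torsion_free_def)

subsection \<open>Evaluation at \<open>t = -p\<close>\<close>

abbreviation "pip \<equiv> \<ominus>\<^bsub>R\<^esub> \<pi>"

definition psum :: "(nat \<Rightarrow> 'a) \<Rightarrow> nat \<Rightarrow> 'a" where
  "psum g m = finsum R (\<lambda>k. g k \<otimes>\<^bsub>R\<^esub> (pip [^]\<^bsub>R\<^esub> k)) {..<m}"

lemma psum_closed [simp]: "g \<in> carrier A \<Longrightarrow> psum g m \<in> carrier R"
  unfolding psum_def by (intro R.finsum_closed) auto

lemma psum_Suc: "g \<in> carrier A \<Longrightarrow> psum g (Suc m) = psum g m \<oplus>\<^bsub>R\<^esub> g m \<otimes>\<^bsub>R\<^esub> (pip [^]\<^bsub>R\<^esub> m)"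
  unfolding psum_def lessThan_Suc by (subst R.finsum_insert) (auto simp: R.a_comm)

lemma psum_0: "psum g 0 = \<zero>\<^bsub>R\<^esub>"
  by (simp add: psum_def)

lemma pip_pow: "pip [^]\<^bsub>R\<^esub> k \<in> P k"
proof (induction k)
  case (Suc k)
  have "\<pi> \<in> P 1" by (auto simp: R.cgenideal_self)
  then have "pip \<in> P 1" by (rule P_neg)
  then show ?case using P_mult2[OF Suc, of pip 1] by simp
qed simp

text \<open>The value at t = -p as a p-adic limit, with \<open>psum g m\<close> as an approximation
  modulo p^m. This is the description by which \<open>BK\<close> defines
  \<open>proj\<close>.\<close>

definition ev :: "(nat \<Rightarrow> 'a) \<Rightarrow> 'a" where
  "ev g = (THE r. r \<in> carrier R \<and> (\<forall>m. r \<ominus>\<^bsub>R\<^esub> psum g m \<in> P m))"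

text \<open>The k-th term of the evaluated series carries the factor (-p)^k, so the partial sums
  form a Cauchy sequence and completeness of R applies.\<close>

lemma ev_ex1: "g \<in> carrier A \<Longrightarrow> \<exists>!r. r \<in> carrier R \<and> (\<forall>m. r \<ominus>\<^bsub>R\<^esub> psum g m \<in> P m)"
proof (rule R_complete)
  fix k assume g: "g \<in> carrier A"
  have "psum g (Suc k) \<ominus>\<^bsub>R\<^esub> psum g k = g k \<otimes>\<^bsub>R\<^esub> (pip [^]\<^bsub>R\<^esub> k)"
    using g R.add_minus_cancel[of "g k \<otimes>\<^bsub>R\<^esub> (pip [^]\<^bsub>R\<^esub> k)" "psum g k"] by (simp add: psum_Suc R.a_comm)
  then show "psum g (Suc k) \<ominus>\<^bsub>R\<^esub> psum g k \<in> P k" using g pip_pow by (simp add: P_mult)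
qed simp

lemma ev: assumes "g \<in> carrier A" shows ev_closed [simp]: "ev g \<in> carrier R" and ev_approx: "ev g \<ominus>\<^bsub>R\<^esub> psum g m \<in> P m"
  using theI'[OF ev_ex1[OF assms]] by (auto simp: ev_def)

lemma evI: "g \<in> carrier A \<Longrightarrow> r \<in> carrier R \<Longrightarrow> (\<And>m. r \<ominus>\<^bsub>R\<^esub> psum g m \<in> P m) \<Longrightarrow> ev g = r"
  unfolding ev_def by (rule the1_equality[OF ev_ex1]) auto

lemma proj_eq: "proj A = restrict ev (carrier A)"
  by (simp add: BK_def ev_def psum_def ipow_eq[symmetric] restrict_def fun_eq_iff same_ops_simps[OF same_ops_BK])

lemma ev_add: assumes g: "g \<in> carrier A" "h \<in> carrier A" shows "ev (g \<oplus>\<^bsub>A\<^esub> h) = ev g \<oplus>\<^bsub>R\<^esub> ev h"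
proof (rule evI)
  fix m
  have s: "psum (g \<oplus>\<^bsub>A\<^esub> h) m = psum g m \<oplus>\<^bsub>R\<^esub> psum h m"
    unfolding psum_def using g by (subst R.finsum_addf[symmetric]) (auto simp: coeff_add R.l_distr intro!: R.finsum_cong')
  have "(ev g \<oplus>\<^bsub>R\<^esub> ev h) \<ominus>\<^bsub>R\<^esub> psum (g \<oplus>\<^bsub>A\<^esub> h) m = (ev g \<ominus>\<^bsub>R\<^esub> psum g m) \<oplus>\<^bsub>R\<^esub> (ev h \<ominus>\<^bsub>R\<^esub> psum h m)"
    unfolding s using g by (simp add: a_minus_def R.minus_add R.a_ac)
  then show "(ev g \<oplus>\<^bsub>R\<^esub> ev h) \<ominus>\<^bsub>R\<^esub> psum (g \<oplus>\<^bsub>A\<^esub> h) m \<in> P m"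
    using ev_approx[OF g(1)] ev_approx[OF g(2)] P_add by simp
qed (use g in auto)

lemma ev_const_mult: assumes g: "c \<in> carrier R" "g \<in> carrier A" shows "ev (const c \<otimes>\<^bsub>A\<^esub> g) = c \<otimes>\<^bsub>R\<^esub> ev g"
proof (rule evI)
  fix m
  have s: "psum (const c \<otimes>\<^bsub>A\<^esub> g) m = c \<otimes>\<^bsub>R\<^esub> psum g m"
    unfolding psum_def using g by (subst R.finsum_rdistr) (auto simp: coeff_const_mult R.m_assoc intro!: R.finsum_cong')
  have "(c \<otimes>\<^bsub>R\<^esub> ev g) \<ominus>\<^bsub>R\<^esub> psum (const c \<otimes>\<^bsub>A\<^esub> g) m = c \<otimes>\<^bsub>R\<^esub> (ev g \<ominus>\<^bsub>R\<^esub> psum g m)"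
    unfolding s using g by (simp add: a_minus_def R.r_distr R.r_minus)
  then show "(c \<otimes>\<^bsub>R\<^esub> ev g) \<ominus>\<^bsub>R\<^esub> psum (const c \<otimes>\<^bsub>A\<^esub> g) m \<in> P m"
    using ev_approx[OF g(2)] g P_mult by simp
qed (use g in auto)

lemma ev_tt_mult: assumes g: "g \<in> carrier A" shows "ev (tt \<otimes>\<^bsub>A\<^esub> g) = pip \<otimes>\<^bsub>R\<^esub> ev g"
proof (rule evI)
  fix m
  \<comment> \<open>Multiplication by t moves every term up by one degree, hence the partial sum
    with one more term.\<close>
  have s: "psum (tt \<otimes>\<^bsub>A\<^esub> g) (Suc n) = pip \<otimes>\<^bsub>R\<^esub> psum g n" for n
  proof (induction n)
    case 0
    show ?case by (simp only: psum_Suc[OF A.m_closed[OF tt_closed g]] psum_0 coeff_tt_mult[OF g, of 0]) simp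
  next
    case (Suc n)
    have "psum (tt \<otimes>\<^bsub>A\<^esub> g) (Suc (Suc n)) = pip \<otimes>\<^bsub>R\<^esub> psum g n \<oplus>\<^bsub>R\<^esub> g n \<otimes>\<^bsub>R\<^esub> (pip [^]\<^bsub>R\<^esub> Suc n)"
      by (simp only: psum_Suc[OF A.m_closed[OF tt_closed g], of "Suc n"] Suc coeff_tt_mult[OF g, of "Suc n"] nat.case)
    then show ?case using g by (simp add: psum_Suc R.r_distr R.m_ac)
  qed
  have alg: "q \<otimes>\<^bsub>R\<^esub> a \<ominus>\<^bsub>R\<^esub> q \<otimes>\<^bsub>R\<^esub> b = (a \<ominus>\<^bsub>R\<^esub> b) \<otimes>\<^bsub>R\<^esub> q"
    if "q \<in> carrier R" "a \<in> carrier R" "b \<in> carrier R" for q a b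
    using that by (simp add: a_minus_def R.l_distr R.l_minus R.m_comm[of q])
  show "(pip \<otimes>\<^bsub>R\<^esub> ev g) \<ominus>\<^bsub>R\<^esub> psum (tt \<otimes>\<^bsub>A\<^esub> g) m \<in> P m"
  proof (cases m)
    case 0
    then show ?thesis using g by (simp add: psum_0)
  next
    case (Suc n)
    \<comment> \<open>With \<open>m = Suc n\<close>, the partial sum of \<open>g\<close> is accurate
      modulo p^n only; the factor -p supplies the missing power of p.\<close>
    have "(pip \<otimes>\<^bsub>R\<^esub> ev g) \<ominus>\<^bsub>R\<^esub> psum (tt \<otimes>\<^bsub>A\<^esub> g) m = (ev g \<ominus>\<^bsub>R\<^esub> psum g n) \<otimes>\<^bsub>R\<^esub> pip"
      unfolding Suc s using g by (intro alg) auto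
    then show ?thesis using P_mult2[OF ev_approx[OF g] pip_pow[of 1], of n] Suc by simp
  qed
qed (use g in auto)

lemma ev_const: assumes c: "c \<in> carrier R" shows "ev (const c) = c"
proof (rule evI)
  fix m
  have s: "psum (const c) (Suc n) = c" for n
    by (induction n) (use c in \<open>auto simp: psum_Suc psum_0, auto simp: const_def\<close>)
  show "c \<ominus>\<^bsub>R\<^esub> psum (const c) m \<in> P m"
    using c P_zero[of m] by (cases m) (auto simp: s psum_0 R.minus_self)
qed (use c in auto)

lemma ev_rec:
  assumes g: "g \<in> carrier A" shows "ev g = g 0 \<oplus>\<^bsub>R\<^esub> pip \<otimes>\<^bsub>R\<^esub> ev (shift 1 g)"
proof -
  have "ev g = ev (const (g 0) \<oplus>\<^bsub>A\<^esub> (tt \<otimes>\<^bsub>A\<^esub> shift 1 g))" by (rule arg_cong[OF decomp[OF g]])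
  then show ?thesis using g by (simp add: ev_add ev_const ev_tt_mult)
qed

lemma ev_E_mult: "g \<in> carrier A \<Longrightarrow> ev (E \<otimes>\<^bsub>A\<^esub> g) = \<zero>\<^bsub>R\<^esub>"
  by (simp add: E_eq A.l_distr ev_add ev_const_mult ev_tt_mult R.l_minus R.r_neg)

text \<open>Horner's scheme for division by t + p. The k-th coefficient of the quotient is the value
  at -p of the part of \<open>g\<close> that starts in degree k + 1, and \<open>ev_rec\<close> is
  the recursion between consecutive coefficients.\<close>

lemma E_division:
  assumes g: "g \<in> carrier A"
  obtains h where "h \<in> carrier A" "g = const (ev g) \<oplus>\<^bsub>A\<^esub> (E \<otimes>\<^bsub>A\<^esub> h)"
proof
  define h where "h = (\<lambda>k. ev (shift (Suc k) g))"
  show h: "h \<in> carrier A" unfolding carrier_iff h_def using ev_closed[OF shift_closed[OF g]] by blast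
  have sh: "shift 1 (shift n g) = shift (Suc n) g" for n
    by (auto simp: shift_def)
  have cancel: "\<pi> \<otimes>\<^bsub>R\<^esub> x \<oplus>\<^bsub>R\<^esub> (y \<oplus>\<^bsub>R\<^esub> pip \<otimes>\<^bsub>R\<^esub> x) = y" if "x \<in> carrier R" "y \<in> carrier R" for x y
    using that by (simp add: R.l_minus R.a_lcomm[of _ y] R.r_neg)
  show "g = const (ev g) \<oplus>\<^bsub>A\<^esub> (E \<otimes>\<^bsub>A\<^esub> h)"
  proof
    fix k
    have [simp]: "(E \<otimes>\<^bsub>A\<^esub> h) k = \<pi> \<otimes>\<^bsub>R\<^esub> h k \<oplus>\<^bsub>R\<^esub> (case k of 0 \<Rightarrow> \<zero>\<^bsub>R\<^esub> | Suc k \<Rightarrow> h k)" for k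
      using h by (simp add: E_eq A.l_distr coeff_add coeff_const_mult coeff_tt_mult)
    show "g k = (const (ev g) \<oplus>\<^bsub>A\<^esub> (E \<otimes>\<^bsub>A\<^esub> h)) k"
    proof (cases k)
      case 0
      have "(const (ev g) \<oplus>\<^bsub>A\<^esub> (E \<otimes>\<^bsub>A\<^esub> h)) k = \<pi> \<otimes>\<^bsub>R\<^esub> ev (shift 1 g) \<oplus>\<^bsub>R\<^esub> ev g"
        using 0 g h by (simp add: coeff_add const_def R.a_comm) (simp add: h_def R.a_comm)
      also have "\<dots> = g k" using 0 g cancel[of "ev (shift 1 g)" "g 0"] ev_rec[OF g] by simp
      finally show ?thesis by (rule sym)
    next
      case (Suc n)
      have "(const (ev g) \<oplus>\<^bsub>A\<^esub> (E \<otimes>\<^bsub>A\<^esub> h)) k = \<pi> \<otimes>\<^bsub>R\<^esub> ev (shift (Suc (Suc n)) g) \<oplus>\<^bsub>R\<^esub> ev (shift (Suc n) g)"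
        using Suc g h by (simp add: coeff_add const_def) (simp add: h_def)
      also have "ev (shift (Suc n) g) = g (Suc n) \<oplus>\<^bsub>R\<^esub> pip \<otimes>\<^bsub>R\<^esub> ev (shift (Suc (Suc n)) g)"
        using ev_rec[OF shift_closed[OF g, of "Suc n"]] unfolding sh by (simp add: shift_def[of "Suc n" g, THEN fun_cong])
      also have "\<pi> \<otimes>\<^bsub>R\<^esub> ev (shift (Suc (Suc n)) g) \<oplus>\<^bsub>R\<^esub> \<dots> = g k"
        unfolding Suc by (rule cancel) (use g in auto)
      finally show ?thesis by (rule sym)
    qed
  qed
qed

text \<open>Division by E takes the place of an estimate for products of partial sums: g h equals
  ev(g) h up to a multiple of E, and evaluation kills such multiples and is linear over
  constants.\<close>

lemma ev_mult: assumes g: "g \<in> carrier A" "h \<in> carrier A" shows "ev (g \<otimes>\<^bsub>A\<^esub> h) = ev g \<otimes>\<^bsub>R\<^esub> ev h"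
proof -
  obtain u where u: "u \<in> carrier A" "g = const (ev g) \<oplus>\<^bsub>A\<^esub> (E \<otimes>\<^bsub>A\<^esub> u)" using E_division[OF g(1)] .
  have "g \<otimes>\<^bsub>A\<^esub> h = (const (ev g) \<oplus>\<^bsub>A\<^esub> (E \<otimes>\<^bsub>A\<^esub> u)) \<otimes>\<^bsub>A\<^esub> h" using u(2) by simp
  also have "\<dots> = (const (ev g) \<otimes>\<^bsub>A\<^esub> h) \<oplus>\<^bsub>A\<^esub> (E \<otimes>\<^bsub>A\<^esub> (u \<otimes>\<^bsub>A\<^esub> h))"
    using g u(1) by (simp add: A.l_distr A.m_assoc)
  finally show ?thesis using g u(1) by (simp add: ev_add ev_const_mult ev_E_mult)
qed

lemma ev_hom: "ring_hom_cring A R ev"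
  by (rule ring_hom_cringI[OF A.is_cring R.is_cring], rule ring_hom_memI)
    (auto simp: ev_mult ev_add C.hom_one[symmetric] ev_const simp del: C.hom_one)

sublocale ev: ring_hom_cring A R ev by (rule ev_hom)

lemma rbar_A: "rbar A = walg.truncate R"
  by (simp add: BK_def)

text \<open>For a series in the kernel of evaluation the remainder of the division by E is
  zero.\<close>

lemma pI_A: "pI A = PIdl\<^bsub>A\<^esub> E"
proof -
  have "g \<in> carrier A \<and> ev g = \<zero>\<^bsub>R\<^esub> \<longleftrightarrow> (\<exists>h\<in>carrier A. g = h \<otimes>\<^bsub>A\<^esub> E)" for g
  proof
    assume g: "g \<in> carrier A \<and> ev g = \<zero>\<^bsub>R\<^esub>"
    then obtain h where "h \<in> carrier A" "g = const (ev g) \<oplus>\<^bsub>A\<^esub> (E \<otimes>\<^bsub>A\<^esub> h)" using E_division by blast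
    then show "\<exists>h\<in>carrier A. g = h \<otimes>\<^bsub>A\<^esub> E" using g by (auto simp: A.m_comm)
  qed (metis A.m_comm A.m_closed E_closed ev_E_mult)
  moreover have "pI A = {g. g \<in> carrier A \<and> ev g = \<zero>\<^bsub>R\<^esub>}"
    by (auto simp: pI_def proj_eq rbar_A same_ops_simps[OF same_ops_truncate])
  moreover have "PIdl\<^bsub>A\<^esub> E = {g. \<exists>h\<in>carrier A. g = h \<otimes>\<^bsub>A\<^esub> E}"
    by (auto simp: A.mem_PIdl)
  ultimately show ?thesis by simp
qed

lemma E_in_pI: "E \<in> pI A"
  by (simp add: pI_A A.cgenideal_self)

text \<open>The coefficients of E a are p a_0 and p a_(k+1) + a_k. Since R is p-torsion free, the
  coefficients of \<open>a\<close> vanish one after the other.\<close>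

lemma E_nonzerodivisor:
  assumes a: "a \<in> carrier A" and "E \<otimes>\<^bsub>A\<^esub> a = \<zero>\<^bsub>A\<^esub>" shows "a = \<zero>\<^bsub>A\<^esub>"
proof
  have e: "\<pi> \<otimes>\<^bsub>R\<^esub> a k \<oplus>\<^bsub>R\<^esub> (case k of 0 \<Rightarrow> \<zero>\<^bsub>R\<^esub> | Suc k \<Rightarrow> a k) = \<zero>\<^bsub>R\<^esub>" for k
    using a arg_cong[OF assms(2), of "\<lambda>g. g k"] by (simp add: E_eq A.l_distr coeff_add coeff_const_mult coeff_tt_mult coeff_zero)
  have "a k = \<zero>\<^bsub>R\<^esub>" for k
  proof (induction k)
    case 0
    then show ?case using e[of 0] a by (simp add: torsion_free)
  next
    case (Suc k)
    then show ?case using e[of "Suc k"] a by (simp add: torsion_free)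
  qed
  then show "a k = \<zero>\<^bsub>A\<^esub> k" for k by (simp add: coeff_zero)
qed

section \<open>The Frobenius lift and the \<delta>-structure of R[[t]]\<close>

abbreviation "\<Phi> \<equiv> bk_frob D R"

lemma fr_hom: "ring_hom_cring R R (fr R)"
  using cp by (intro ring_hom_cringI R.is_cring Rhom_ring_hom) (auto simp: is_cprism_def)

sublocale fr: ring_hom_cring R R "fr R" by (rule fr_hom)

lemma fr_lift: "a \<in> carrier R \<Longrightarrow> fr R a \<ominus>\<^bsub>R\<^esub> (a [^]\<^bsub>R\<^esub> p) \<in> P 1"
  using cp by (simp add: is_cprism_def p_ideal_eq)

lemma coeff_\<Phi>: "\<Phi> g k = (if p dvd k then fr R (g (k div p)) else \<zero>\<^bsub>R\<^esub>)"
  by (simp add: bk_frob_def)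

text \<open>The series \<open>\<Phi> g\<close> has only degrees divisible by p. In such a degree the
  convolution reduces to pairs of multiples of p; in any other degree the two indices cannot both be
  multiples of p, so the coefficient is zero.\<close>

lemma \<Phi>_mult:
  assumes g: "g \<in> carrier A" "h \<in> carrier A" shows "\<Phi> (g \<otimes>\<^bsub>A\<^esub> h) = \<Phi> g \<otimes>\<^bsub>A\<^esub> \<Phi> h"
proof
  fix k
  have [simp]: "\<Phi> g l \<in> carrier R" "\<Phi> h l \<in> carrier R" for l using g by (auto simp: coeff_\<Phi>)
  show "\<Phi> (g \<otimes>\<^bsub>A\<^esub> h) k = (\<Phi> g \<otimes>\<^bsub>A\<^esub> \<Phi> h) k"
  proof (cases "p dvd k")
    case True
    then obtain m where k: "k = p * m" by blast
    have "(\<Phi> g \<otimes>\<^bsub>A\<^esub> \<Phi> h) k = (\<Oplus>\<^bsub>R\<^esub>l\<in>(\<lambda>i. p * i) ` {..m}. \<Phi> g l \<otimes>\<^bsub>R\<^esub> \<Phi> h (k - l))"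
      unfolding coeff_mult
    proof (rule R.finsum_sub[symmetric])
      fix l assume l: "l \<in> {..k} - (\<lambda>i. p * i) ` {..m}"
      have "\<not> p dvd l" using l p_pos by (auto simp: k dvd_def)
      then show "\<Phi> g l \<otimes>\<^bsub>R\<^esub> \<Phi> h (k - l) = \<zero>\<^bsub>R\<^esub>" by (simp add: coeff_\<Phi>[of g])
    qed (auto simp: k)
    also have "\<dots> = (\<Oplus>\<^bsub>R\<^esub>i\<in>{..m}. \<Phi> g (p * i) \<otimes>\<^bsub>R\<^esub> \<Phi> h (k - p * i))"
      using p_pos by (intro R.finsum_reindex) (auto simp: inj_on_def)
    also have "\<dots> = (\<Oplus>\<^bsub>R\<^esub>i\<in>{..m}. fr R (g i \<otimes>\<^bsub>R\<^esub> h (m - i)))"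
    proof (rule R.finsum_cong')
      fix i assume "i \<in> {..m}"
      have "k - p * i = p * (m - i)" by (simp add: k right_diff_distrib')
      then show "\<Phi> g (p * i) \<otimes>\<^bsub>R\<^esub> \<Phi> h (k - p * i) = fr R (g i \<otimes>\<^bsub>R\<^esub> h (m - i))"
        using p_pos g by (simp add: coeff_\<Phi>)
    qed (use g in auto)
    also have "\<dots> = fr R ((g \<otimes>\<^bsub>A\<^esub> h) m)"
      unfolding coeff_mult using g by (intro fr.hom_finsum'[symmetric]) auto
    finally show ?thesis using p_pos by (simp add: coeff_\<Phi>[of "g \<otimes>\<^bsub>A\<^esub> h"] k)
  next
    case False
    have "(\<Phi> g \<otimes>\<^bsub>A\<^esub> \<Phi> h) k = \<zero>\<^bsub>R\<^esub>"
      unfolding coeff_mult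
    proof (rule R.add.finprod_one_eqI[folded finsum_def, simplified])
      fix l assume "l \<in> {..k}"
      then have "\<not> p dvd l \<or> \<not> p dvd (k - l)" using False by (metis atMost_iff dvd_diffD)
      then show "\<Phi> g l \<otimes>\<^bsub>R\<^esub> \<Phi> h (k - l) = \<zero>\<^bsub>R\<^esub>" using g by (auto simp: coeff_\<Phi>)
    qed
    then show ?thesis using False by (simp add: coeff_\<Phi>[of "g \<otimes>\<^bsub>A\<^esub> h"])
  qed
qed

lemma \<Phi>_hom: "ring_hom_cring A A \<Phi>"
proof (rule ring_hom_cringI[OF A.is_cring A.is_cring], rule ring_hom_memI)
  show "\<Phi> \<one>\<^bsub>A\<^esub> = \<one>\<^bsub>A\<^esub>" using p_pos by (auto simp: fun_eq_iff coeff_\<Phi> coeff_one)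
qed (auto simp: carrier_iff coeff_\<Phi> \<Phi>_mult fun_eq_iff coeff_add)

sublocale \<Phi>: ring_hom_cring A A \<Phi> by (rule \<Phi>_hom)

lemma \<Phi>_const: "c \<in> carrier R \<Longrightarrow> \<Phi> (const c) = const (fr R c)"
  using p_pos by (auto simp: fun_eq_iff coeff_\<Phi> const_def)

lemma \<Phi>_tt: "\<Phi> tt = tt [^]\<^bsub>A\<^esub> p"
proof
  fix k show "\<Phi> tt k = (tt [^]\<^bsub>A\<^esub> p) k"
    unfolding tt_pow coeff_\<Phi> using p_pos by (auto simp: tt_def dvd_def)
qed

abbreviation "\<pi>A \<equiv> rnat A p"

lemma coeff_\<pi>A_mult: "g \<in> carrier A \<Longrightarrow> (\<pi>A \<otimes>\<^bsub>A\<^esub> g) k = \<pi> \<otimes>\<^bsub>R\<^esub> g k"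
  by (simp add: rnat_A coeff_const_mult)

lemma mem_\<pi>A: "g \<in> carrier A \<Longrightarrow> (\<And>k. g k \<in> P 1) \<Longrightarrow> \<exists>d\<in>carrier A. g = \<pi>A \<otimes>\<^bsub>A\<^esub> d"
proof -
  assume g: "g \<in> carrier A" and gk: "\<And>k. g k \<in> P 1"
  have "\<forall>k. \<exists>b\<in>carrier R. g k = b \<otimes>\<^bsub>R\<^esub> \<pi>" using gk by (auto simp: R.mem_PIdl)
  then obtain d where d: "\<And>k. d k \<in> carrier R" "\<And>k. g k = d k \<otimes>\<^bsub>R\<^esub> \<pi>" by metis
  then have dA: "d \<in> carrier A" by (simp add: carrier_iff)
  have "g = \<pi>A \<otimes>\<^bsub>A\<^esub> d"
  proof
    fix k show "g k = (\<pi>A \<otimes>\<^bsub>A\<^esub> d) k"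
      unfolding coeff_\<pi>A_mult[OF dA] d(2) by (rule R.m_comm) (use d in auto)
  qed
  then show ?thesis using dA by blast
qed

lemma \<pi>A_cancel: "g \<in> carrier A \<Longrightarrow> h \<in> carrier A \<Longrightarrow> \<pi>A \<otimes>\<^bsub>A\<^esub> g = \<pi>A \<otimes>\<^bsub>A\<^esub> h \<Longrightarrow> g = h"
proof
  fix k
  assume g: "g \<in> carrier A" "h \<in> carrier A" and eq: "\<pi>A \<otimes>\<^bsub>A\<^esub> g = \<pi>A \<otimes>\<^bsub>A\<^esub> h"
  have "\<pi> \<otimes>\<^bsub>R\<^esub> g k = \<pi> \<otimes>\<^bsub>R\<^esub> h k" using g fun_cong[OF eq, of k] by (simp add: coeff_\<pi>A_mult)
  then have "\<pi> \<otimes>\<^bsub>R\<^esub> (g k \<ominus>\<^bsub>R\<^esub> h k) = \<zero>\<^bsub>R\<^esub>"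
    using g by (simp add: a_minus_def R.r_distr R.r_minus R.r_neg)
  then have "g k \<ominus>\<^bsub>R\<^esub> h k = \<zero>\<^bsub>R\<^esub>"
    by (rule torsion_free[OF R.minus_closed[OF coeff[OF g(1)] coeff[OF g(2)]]])
  then show "g k = h k" by (rule R.minus_eq_zeroD[OF coeff[OF g(1)] coeff[OF g(2)]])
qed

lemma coeff_\<pi>A_mult_P: "g \<in> carrier A \<Longrightarrow> (\<pi>A \<otimes>\<^bsub>A\<^esub> g) k \<in> P 1"
  by (auto simp: coeff_\<pi>A_mult R.mem_PIdl R.m_comm)

text \<open>Writing \<open>g = c + t h\<close>, the coefficients of \<open>\<phi>(g) - g\<^sup>p\<close> are, modulo \<open>p\<close>, those of
  \<open>\<phi>(h) - h\<^sup>p\<close> shifted by \<open>p\<close> places.\<close>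

lemma \<Phi>_lift_coeff: "g \<in> carrier A \<Longrightarrow> (\<Phi> g \<ominus>\<^bsub>A\<^esub> (g [^]\<^bsub>A\<^esub> p)) k \<in> P 1"
proof (induction k arbitrary: g rule: less_induct)
  case (less k)
  note g = less.prems
  define c where "c = g 0"
  define h where "h = shift 1 g"
  have [simp]: "c \<in> carrier R" "h \<in> carrier A" using g by (auto simp: c_def h_def)
  have gch: "g = const c \<oplus>\<^bsub>A\<^esub> (tt \<otimes>\<^bsub>A\<^esub> h)" unfolding c_def h_def by (rule decomp[OF g])
  define s where "s = A.delta_add_sum p (const c) (tt \<otimes>\<^bsub>A\<^esub> h)"
  have s [simp]: "s \<in> carrier A" by (simp add: s_def)
  let ?C = "const (fr R c \<ominus>\<^bsub>R\<^esub> (c [^]\<^bsub>R\<^esub> p))"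
  let ?H = "(tt [^]\<^bsub>A\<^esub> p) \<otimes>\<^bsub>A\<^esub> (\<Phi> h \<ominus>\<^bsub>A\<^esub> (h [^]\<^bsub>A\<^esub> p))"
  have gp: "g [^]\<^bsub>A\<^esub> p = (const (c [^]\<^bsub>R\<^esub> p) \<oplus>\<^bsub>A\<^esub> (tt [^]\<^bsub>A\<^esub> p) \<otimes>\<^bsub>A\<^esub> (h [^]\<^bsub>A\<^esub> p)) \<oplus>\<^bsub>A\<^esub> \<pi>A \<otimes>\<^bsub>A\<^esub> s"
    unfolding gch s_def using A.power_prime_add[OF prime, of "const c" "tt \<otimes>\<^bsub>A\<^esub> h"]
    by (simp add: C.hom_pow A.nat_pow_distrib)
  have \<Phi>g: "\<Phi> g = const (fr R c) \<oplus>\<^bsub>A\<^esub> (tt [^]\<^bsub>A\<^esub> p) \<otimes>\<^bsub>A\<^esub> \<Phi> h"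
    unfolding gch by (simp add: \<Phi>_const \<Phi>_tt)
  have eq: "\<Phi> g \<ominus>\<^bsub>A\<^esub> (g [^]\<^bsub>A\<^esub> p) = (?C \<oplus>\<^bsub>A\<^esub> ?H) \<ominus>\<^bsub>A\<^esub> \<pi>A \<otimes>\<^bsub>A\<^esub> s"
    unfolding gp \<Phi>g by (simp add: C.hom_minus a_minus_def A.r_distr A.r_minus A.minus_add A.a_ac)
  \<comment> \<open>For \<open>k < p\<close> this coefficient of \<open>?H\<close> is zero.
    Otherwise it is the coefficient of \<phi>(h) - h^p in degree k - p, which is below k because p
    is positive.\<close>
  have 1: "?H k \<in> P 1"
    using less.IH[of "k - p" h] p_pos P_zero[of 1] by (simp add: coeff_tt_pow_mult)
  have 2: "?C k \<in> P 1" using fr_lift[of c] P_zero[of 1] by (simp add: const_def)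
  have 3: "(\<pi>A \<otimes>\<^bsub>A\<^esub> s) k \<in> P 1" by (rule coeff_\<pi>A_mult_P) simp
  have "?C \<in> carrier A" "?H \<in> carrier A" "\<pi>A \<otimes>\<^bsub>A\<^esub> s \<in> carrier A" by simp_all
  then have "((?C \<oplus>\<^bsub>A\<^esub> ?H) \<ominus>\<^bsub>A\<^esub> \<pi>A \<otimes>\<^bsub>A\<^esub> s) k = (?C k \<oplus>\<^bsub>R\<^esub> ?H k) \<ominus>\<^bsub>R\<^esub> (\<pi>A \<otimes>\<^bsub>A\<^esub> s) k"
    by (simp only: coeff_minus A.a_closed coeff_add)
  then show ?case unfolding eq using P_minus[OF P_add[OF 2 1] 3] by (simp only:)
qed

text \<open>Resolves the definite description in \<open>BK\<close>: the quotient of \<phi>(g) - g^p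
  by p exists by the Frobenius congruence and is unique because p can be cancelled in
  R[[t]].\<close>

lemma dl_A:
  assumes g: "g \<in> carrier A"
  shows dl_closed [simp]: "dl A g \<in> carrier A" and \<pi>_dl: "\<pi>A \<otimes>\<^bsub>A\<^esub> dl A g = \<Phi> g \<ominus>\<^bsub>A\<^esub> (g [^]\<^bsub>A\<^esub> p)"
proof -
  note so = same_ops_BK[of R D]
  have dl: "dl A g = (THE d. d \<in> carrier A \<and> \<pi>A \<otimes>\<^bsub>A\<^esub> d = \<Phi> g \<ominus>\<^bsub>A\<^esub> (g [^]\<^bsub>A\<^esub> p))"
  proof -
    have "dl A g = (THE d. d \<in> carrier (pow_ser R) \<and>
        add_pow (pow_ser R) p d = \<Phi> g \<ominus>\<^bsub>pow_ser R\<^esub> (g [^]\<^bsub>pow_ser R\<^esub> p))"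
      by (simp only: BK_def prism.select_convs)
    also have "\<dots> = (THE d. d \<in> carrier A \<and> add_pow A p d = \<Phi> g \<ominus>\<^bsub>A\<^esub> (g [^]\<^bsub>A\<^esub> p))"
      by (simp only: same_ops_simps(1)[OF so] same_ops_minus[OF so] same_ops_pow[OF so] same_ops_add_pow[OF so])
    also have "\<dots> = (THE d. d \<in> carrier A \<and> \<pi>A \<otimes>\<^bsub>A\<^esub> d = \<Phi> g \<ominus>\<^bsub>A\<^esub> (g [^]\<^bsub>A\<^esub> p))"
      by (rule arg_cong[where f = The]) (auto simp: A.add_pow_rnat fun_eq_iff)
    finally show ?thesis .
  qed
  obtain d where d: "d \<in> carrier A" "\<Phi> g \<ominus>\<^bsub>A\<^esub> (g [^]\<^bsub>A\<^esub> p) = \<pi>A \<otimes>\<^bsub>A\<^esub> d"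
    using mem_\<pi>A[of "\<Phi> g \<ominus>\<^bsub>A\<^esub> (g [^]\<^bsub>A\<^esub> p)"] \<Phi>_lift_coeff[OF g] g by auto
  have "dl A g = d" unfolding dl by (rule the_equality) (use d in \<open>auto intro: \<pi>A_cancel\<close>)
  then show "dl A g \<in> carrier A" "\<pi>A \<otimes>\<^bsub>A\<^esub> dl A g = \<Phi> g \<ominus>\<^bsub>A\<^esub> (g [^]\<^bsub>A\<^esub> p)" using d by auto
qed

lemma dl_eqI: "g \<in> carrier A \<Longrightarrow> d \<in> carrier A \<Longrightarrow> \<pi>A \<otimes>\<^bsub>A\<^esub> d = \<Phi> g \<ominus>\<^bsub>A\<^esub> (g [^]\<^bsub>A\<^esub> p) \<Longrightarrow> dl A g = d"
  using \<pi>A_cancel[OF dl_closed, of g d] \<pi>_dl[of g] by simp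

lemma \<Phi>_eq: "g \<in> carrier A \<Longrightarrow> \<Phi> g = (g [^]\<^bsub>A\<^esub> p) \<oplus>\<^bsub>A\<^esub> \<pi>A \<otimes>\<^bsub>A\<^esub> dl A g"
  by (simp add: \<pi>_dl A.minus_add_cancel)

lemma phi_eq: "g \<in> carrier A \<Longrightarrow> phi p A g = \<Phi> g"
  unfolding phi_def by (subst \<Phi>_eq) (auto simp: A.add_pow_rnat)

text \<open>Since p can be cancelled, each axiom is verified after multiplication by p, where it
  expresses that \<phi> is multiplicative or additive.\<close>

lemma delta_ring_A: "delta_ring p A (dl A)"
  unfolding delta_ring_def
proof (intro conjI ballI)
  show "dl A \<zero>\<^bsub>A\<^esub> = \<zero>\<^bsub>A\<^esub>" "dl A \<one>\<^bsub>A\<^esub> = \<zero>\<^bsub>A\<^esub>"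
    using p_pos by (auto intro!: dl_eqI simp: A.nat_pow_zero A.minus_self)
  fix x y assume xy [simp]: "x \<in> carrier A" "y \<in> carrier A"
  let ?u = "\<pi>A \<otimes>\<^bsub>A\<^esub> dl A x" and ?v = "\<pi>A \<otimes>\<^bsub>A\<^esub> dl A y"
  have alg: "((a \<oplus>\<^bsub>A\<^esub> u) \<otimes>\<^bsub>A\<^esub> (b \<oplus>\<^bsub>A\<^esub> v)) \<ominus>\<^bsub>A\<^esub> (a \<otimes>\<^bsub>A\<^esub> b) = ((a \<otimes>\<^bsub>A\<^esub> v) \<oplus>\<^bsub>A\<^esub> (b \<otimes>\<^bsub>A\<^esub> u)) \<oplus>\<^bsub>A\<^esub> (u \<otimes>\<^bsub>A\<^esub> v)"
    if [simp]: "a \<in> carrier A" "u \<in> carrier A" "b \<in> carrier A" "v \<in> carrier A" for a b u v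
  proof -
    have "(a \<oplus>\<^bsub>A\<^esub> u) \<otimes>\<^bsub>A\<^esub> (b \<oplus>\<^bsub>A\<^esub> v) = (((a \<otimes>\<^bsub>A\<^esub> v) \<oplus>\<^bsub>A\<^esub> (b \<otimes>\<^bsub>A\<^esub> u)) \<oplus>\<^bsub>A\<^esub> (u \<otimes>\<^bsub>A\<^esub> v)) \<oplus>\<^bsub>A\<^esub> (a \<otimes>\<^bsub>A\<^esub> b)"
      by (simp add: A.l_distr A.r_distr A.m_comm[of b u] A.a_ac)
    then show ?thesis by (simp add: A.add_minus_cancel)
  qed
  show "dl A (x \<otimes>\<^bsub>A\<^esub> y) = ((x [^]\<^bsub>A\<^esub> p) \<otimes>\<^bsub>A\<^esub> dl A y) \<oplus>\<^bsub>A\<^esub> ((y [^]\<^bsub>A\<^esub> p) \<otimes>\<^bsub>A\<^esub> dl A x)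
          \<oplus>\<^bsub>A\<^esub> add_pow A p (dl A x \<otimes>\<^bsub>A\<^esub> dl A y)"
  proof (rule dl_eqI)
    have "\<pi>A \<otimes>\<^bsub>A\<^esub> (((x [^]\<^bsub>A\<^esub> p) \<otimes>\<^bsub>A\<^esub> dl A y) \<oplus>\<^bsub>A\<^esub> ((y [^]\<^bsub>A\<^esub> p) \<otimes>\<^bsub>A\<^esub> dl A x)
          \<oplus>\<^bsub>A\<^esub> add_pow A p (dl A x \<otimes>\<^bsub>A\<^esub> dl A y)) =
       (((x [^]\<^bsub>A\<^esub> p) \<otimes>\<^bsub>A\<^esub> ?v) \<oplus>\<^bsub>A\<^esub> ((y [^]\<^bsub>A\<^esub> p) \<otimes>\<^bsub>A\<^esub> ?u)) \<oplus>\<^bsub>A\<^esub> (?u \<otimes>\<^bsub>A\<^esub> ?v)"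
      by (simp add: A.add_pow_rnat A.r_distr A.m_ac)
    also have "\<dots> = (((x [^]\<^bsub>A\<^esub> p) \<oplus>\<^bsub>A\<^esub> ?u) \<otimes>\<^bsub>A\<^esub> ((y [^]\<^bsub>A\<^esub> p) \<oplus>\<^bsub>A\<^esub> ?v)) \<ominus>\<^bsub>A\<^esub> ((x [^]\<^bsub>A\<^esub> p) \<otimes>\<^bsub>A\<^esub> (y [^]\<^bsub>A\<^esub> p))"
      by (rule alg[symmetric]) auto
    also have "\<dots> = \<Phi> (x \<otimes>\<^bsub>A\<^esub> y) \<ominus>\<^bsub>A\<^esub> ((x \<otimes>\<^bsub>A\<^esub> y) [^]\<^bsub>A\<^esub> p)"
      by (simp only: \<Phi>_eq[OF xy(1), symmetric] \<Phi>_eq[OF xy(2), symmetric] \<Phi>_mult[OF xy] A.nat_pow_distrib[OF xy])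
    finally show "\<pi>A \<otimes>\<^bsub>A\<^esub> (((x [^]\<^bsub>A\<^esub> p) \<otimes>\<^bsub>A\<^esub> dl A y) \<oplus>\<^bsub>A\<^esub> ((y [^]\<^bsub>A\<^esub> p) \<otimes>\<^bsub>A\<^esub> dl A x)
          \<oplus>\<^bsub>A\<^esub> add_pow A p (dl A x \<otimes>\<^bsub>A\<^esub> dl A y)) = \<Phi> (x \<otimes>\<^bsub>A\<^esub> y) \<ominus>\<^bsub>A\<^esub> ((x \<otimes>\<^bsub>A\<^esub> y) [^]\<^bsub>A\<^esub> p)" .
  qed auto
  show "dl A (x \<oplus>\<^bsub>A\<^esub> y) = (dl A x \<oplus>\<^bsub>A\<^esub> dl A y) \<ominus>\<^bsub>A\<^esub>
          finsum A (\<lambda>i. add_pow A ((p choose i) div p) ((x [^]\<^bsub>A\<^esub> i) \<otimes>\<^bsub>A\<^esub> (y [^]\<^bsub>A\<^esub> (p - i)))) {1..<p}"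
    unfolding A.delta_add_sum_def[symmetric]
  proof (rule dl_eqI)
    have "\<pi>A \<otimes>\<^bsub>A\<^esub> ((dl A x \<oplus>\<^bsub>A\<^esub> dl A y) \<ominus>\<^bsub>A\<^esub> A.delta_add_sum p x y)
       = ((\<Phi> x \<ominus>\<^bsub>A\<^esub> (x [^]\<^bsub>A\<^esub> p)) \<oplus>\<^bsub>A\<^esub> (\<Phi> y \<ominus>\<^bsub>A\<^esub> (y [^]\<^bsub>A\<^esub> p))) \<ominus>\<^bsub>A\<^esub> \<pi>A \<otimes>\<^bsub>A\<^esub> A.delta_add_sum p x y"
      by (simp add: a_minus_def A.r_distr A.r_minus \<pi>_dl[unfolded a_minus_def])
    also have "\<dots> = \<Phi> (x \<oplus>\<^bsub>A\<^esub> y) \<ominus>\<^bsub>A\<^esub> ((x \<oplus>\<^bsub>A\<^esub> y) [^]\<^bsub>A\<^esub> p)"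
      unfolding A.power_prime_add[OF prime xy] by (simp add: a_minus_def A.minus_add A.a_ac)
    finally show "\<pi>A \<otimes>\<^bsub>A\<^esub> ((dl A x \<oplus>\<^bsub>A\<^esub> dl A y) \<ominus>\<^bsub>A\<^esub> A.delta_add_sum p x y)
       = \<Phi> (x \<oplus>\<^bsub>A\<^esub> y) \<ominus>\<^bsub>A\<^esub> ((x \<oplus>\<^bsub>A\<^esub> y) [^]\<^bsub>A\<^esub> p)" .
  qed auto
qed auto

subsection \<open>The \<open>(p, t)\<close>-adic topology\<close>

text \<open>The ideal (p, t)^k described by coefficients. In this form both its multiplicative
  behaviour and completeness can be read off degree by degree.\<close>

definition J :: "nat \<Rightarrow> (nat \<Rightarrow> 'a) set" where
  "J k = {g \<in> carrier A. \<forall>j<k. g j \<in> P (k - j)}"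

lemma J_coeff: "g \<in> J k \<Longrightarrow> j < k \<Longrightarrow> g j \<in> P (k - j)"
  by (simp add: J_def)

lemma J_mult:
  assumes g: "g \<in> J k" and h: "h \<in> J m" shows "g \<otimes>\<^bsub>A\<^esub> h \<in> J (k + m)"
proof -
  have c [simp]: "g \<in> carrier A" "h \<in> carrier A" using g h by (auto simp: J_def)
  have gP: "g l \<in> P (k - l)" for l using g by (cases "l < k") (auto simp: J_def)
  have hP: "h l \<in> P (m - l)" for l using h by (cases "l < m") (auto simp: J_def)
  have "(g \<otimes>\<^bsub>A\<^esub> h) j \<in> P (k + m - j)" for j
    unfolding coeff_mult
  proof (rule P_finsum)
    fix l assume "l \<in> {..j}"
    \<comment> \<open>Truncated differences are at least the true ones, so the exponents still add
      up to enough; a difference cut off at 0 stands for the empty condition.\<close>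
    then have "k + m - j \<le> (k - l) + (m - (j - l))" by auto
    then show "g l \<otimes>\<^bsub>R\<^esub> h (j - l) \<in> P (k + m - j)"
      by (rule P_mono[OF _ P_mult2[OF gP hP]])
  qed
  then show ?thesis by (simp add: J_def)
qed

lemma J_ideal: "ideal (J k) A"
proof (rule idealI[OF A.ring_axioms])
  show "subgroup (J k) (add_monoid A)"
    by (rule A.add.subgroupI)
      (auto simp: J_def coeff_add coeff_zero P_add coeff_neg P_neg a_inv_def[symmetric] intro!: exI[of _ "\<zero>\<^bsub>A\<^esub>"])
  \<comment> \<open>The whole ring is \<open>J 0\<close>, so absorption is \<open>J_mult\<close>
    with one index equal to 0.\<close>
  show "x \<otimes>\<^bsub>A\<^esub> a \<in> J k" if "a \<in> J k" "x \<in> carrier A" for a x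
    using J_mult[of x 0 a k] that by (simp add: J_def)
  then show "a \<otimes>\<^bsub>A\<^esub> x \<in> J k" if "a \<in> J k" "x \<in> carrier A" for a x
    using J_mult[of a k x 0] that by (simp add: J_def)
qed

lemma \<pi>_P1: "\<pi> \<in> P 1"
  by (simp add: R.cgenideal_self)

lemma pI_max_gens: "insert \<pi>A (pI A) \<subseteq> carrier A"
  by (auto simp: pI_A A.mem_PIdl)

lemma pI_max_subset_J: "pI_max p A \<subseteq> J 1"
  unfolding pI_max_def
proof (rule A.genideal_minimal[OF J_ideal])
  show "insert \<pi>A (pI A) \<subseteq> J 1"
  proof safe
    show "\<pi>A \<in> J 1" using \<pi>_P1 by (simp add: J_def rnat_A) (simp add: const_def)
    fix g assume "g \<in> pI A"
    then obtain h where h: "h \<in> carrier A" "g = h \<otimes>\<^bsub>A\<^esub> E" by (auto simp: pI_A A.mem_PIdl)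
    have "g 0 = h 0 \<otimes>\<^bsub>R\<^esub> \<pi>" using h by (simp add: coeff_mult bk_E_def)
    then show "g \<in> J 1" using h \<pi>_P1 P_mult[of "h 0" \<pi> 1] by (simp add: J_def)
  qed
qed

lemma ipow_subset_J: "ipow A (pI_max p A) k \<subseteq> J k"
proof (induction k)
  case (Suc k)
  have "x \<in> J (Suc k)" if "x \<in> ideal_prod A (pI_max p A) (ipow A (pI_max p A) k)" for x
    using that
  proof induction
    case (prod i j)
    then show ?case using J_mult[of i 1 j k] pI_max_subset_J Suc by auto
  next
    case (sum a b)
    then show ?case by (intro additive_subgroup.a_closed[OF ideal.axioms(1)[OF J_ideal]])
  qed
  then show ?case by auto
qed (auto simp: J_def)

lemma \<pi>A_pI_max: "\<pi>A \<in> pI_max p A" and tt_pI_max: "tt \<in> pI_max p A"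
proof -
  interpret I: ideal "pI_max p A" A unfolding pI_max_def by (rule A.genideal_ideal[OF pI_max_gens])
  have s: "insert \<pi>A (pI A) \<subseteq> pI_max p A" unfolding pI_max_def by (rule A.genideal_self[OF pI_max_gens])
  then show "\<pi>A \<in> pI_max p A" by blast
  then have "E \<ominus>\<^bsub>A\<^esub> \<pi>A \<in> pI_max p A" using s E_in_pI unfolding a_minus_def by (intro I.a_closed I.a_inv_closed) auto
  then show "tt \<in> pI_max p A" by (simp add: E_eq rnat_A A.a_comm A.add_minus_cancel)
qed

text \<open>An element of \<open>J (Suc k)\<close> is p times a constant divisible by p^k plus t
  times its shift. Both cofactors lie in \<open>J k\<close>, while p and t lie in (p, E), since t =
  E - p.\<close>

lemma J_subset_ipow: "J k \<subseteq> ipow A (pI_max p A) k"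
proof (induction k)
  case (Suc k)
  show ?case
  proof
    fix g assume g: "g \<in> J (Suc k)"
    then have gc [simp]: "g \<in> carrier A" by (simp add: J_def)
    have "g 0 \<in> P (Suc k)" using g by (auto simp: J_def)
    then obtain a where a: "a \<in> carrier R" "g 0 = a \<otimes>\<^bsub>R\<^esub> ((\<pi> [^]\<^bsub>R\<^esub> k) \<otimes>\<^bsub>R\<^esub> \<pi>)" by (auto simp: R.mem_PIdl)
    have "a \<otimes>\<^bsub>R\<^esub> (\<pi> [^]\<^bsub>R\<^esub> k) \<in> P k" using a by (auto simp: R.mem_PIdl)
    moreover have "const c \<in> J k" if "c \<in> P k" for c
      using that P_closed[OF that] by (simp add: J_def) (auto simp: const_def)
    ultimately have 1: "const (a \<otimes>\<^bsub>R\<^esub> (\<pi> [^]\<^bsub>R\<^esub> k)) \<in> J k" by blast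
    have 2: "shift 1 g \<in> J k" using g by (simp add: J_def) (auto simp: shift_def)
    have "g 0 = \<pi> \<otimes>\<^bsub>R\<^esub> (a \<otimes>\<^bsub>R\<^esub> (\<pi> [^]\<^bsub>R\<^esub> k))" using a by (simp add: R.m_ac)
    then have "g = (\<pi>A \<otimes>\<^bsub>A\<^esub> const (a \<otimes>\<^bsub>R\<^esub> (\<pi> [^]\<^bsub>R\<^esub> k))) \<oplus>\<^bsub>A\<^esub> (tt \<otimes>\<^bsub>A\<^esub> shift 1 g)"
      using decomp[OF gc] a by (simp add: rnat_A)
    moreover have "\<dots> \<in> ideal_prod A (pI_max p A) (ipow A (pI_max p A) k)"
      using 1 2 Suc by (intro ideal_prod.sum ideal_prod.prod \<pi>A_pI_max tt_pI_max) auto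
    ultimately show "g \<in> ipow A (pI_max p A) (Suc k)" by simp
  qed
qed (auto simp: J_def)

lemma ipow_J: "ipow A (pI_max p A) k = J k"
  using ipow_subset_J J_subset_ipow by (rule subset_antisym)

lemma adic_complete_A: "adic_complete A (pI_max p A)"
  unfolding adic_complete_def ipow_J
proof (intro allI impI)
  fix x assume x: "\<forall>k. x k \<in> carrier A \<and> x (Suc k) \<ominus>\<^bsub>A\<^esub> x k \<in> J k"
  have xc [simp]: "x k \<in> carrier A" for k using x by blast
  have xJ: "x (Suc k) j \<ominus>\<^bsub>R\<^esub> x k j \<in> P (k - j)" for k j
  proof (cases "j < k")
    case True
    have "x (Suc k) \<ominus>\<^bsub>A\<^esub> x k \<in> J k" using x by blast
    then show ?thesis using True by (simp add: J_def coeff_minus)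
  qed auto
  \<comment> \<open>The j-th coefficient of \<open>x k\<close> is controlled modulo p^(k - j) only.
    Passing to \<open>x (k + j)\<close> gives a sequence whose k-th step is divisible by p^k, as
    completeness of R requires.\<close>
  have ex1: "\<exists>!y. y \<in> carrier R \<and> (\<forall>k. y \<ominus>\<^bsub>R\<^esub> x (k + j) j \<in> P k)" for j
    by (rule R_complete) (use xJ[of "k + j" j for k] in auto)
  have iff: "(\<forall>k. y \<ominus>\<^bsub>A\<^esub> x k \<in> J k) \<longleftrightarrow> (\<forall>j k. y j \<ominus>\<^bsub>R\<^esub> x (k + j) j \<in> P k)" if y [simp]: "y \<in> carrier A" for y
  proof safe
    fix j k assume a: "\<forall>k. y \<ominus>\<^bsub>A\<^esub> x k \<in> J k"
    show "y j \<ominus>\<^bsub>R\<^esub> x (k + j) j \<in> P k"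
    proof (cases "k = 0")
      case False
      have "y \<ominus>\<^bsub>A\<^esub> x (k + j) \<in> J (k + j)" using a by blast
      then have "(y \<ominus>\<^bsub>A\<^esub> x (k + j)) j \<in> P (k + j - j)" by (rule J_coeff) (use False in simp)
      then show ?thesis by (simp add: coeff_minus)
    qed auto
  next
    fix k assume a: "\<forall>j k. y j \<ominus>\<^bsub>R\<^esub> x (k + j) j \<in> P k"
    have "(y \<ominus>\<^bsub>A\<^esub> x k) j \<in> P (k - j)" if "j < k" for j
      using a[rule_format, of j "k - j"] that by (simp add: coeff_minus)
    then show "y \<ominus>\<^bsub>A\<^esub> x k \<in> J k" by (simp add: J_def)
  qed
  define y where "y j = (THE y. y \<in> carrier R \<and> (\<forall>k. y \<ominus>\<^bsub>R\<^esub> x (k + j) j \<in> P k))" for j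
  have y: "y j \<in> carrier R" "\<forall>k. y j \<ominus>\<^bsub>R\<^esub> x (k + j) j \<in> P k" for j
    using theI'[OF ex1[of j]] by (auto simp: y_def)
  show "\<exists>!y. y \<in> carrier A \<and> (\<forall>k. y \<ominus>\<^bsub>A\<^esub> x k \<in> J k)"
  proof (rule ex1I[of _ y])
    show "y \<in> carrier A \<and> (\<forall>k. y \<ominus>\<^bsub>A\<^esub> x k \<in> J k)" using y iff[of y] by (simp add: carrier_iff)
    fix z assume z: "z \<in> carrier A \<and> (\<forall>k. z \<ominus>\<^bsub>A\<^esub> x k \<in> J k)"
    show "z = y"
    proof
      fix j
      have "z j \<in> carrier R \<and> (\<forall>k. z j \<ominus>\<^bsub>R\<^esub> x (k + j) j \<in> P k)" using z iff[of z] by auto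
      then show "z j = y j" using ex1[of j] y[of j] by blast
    qed
  qed
qed

subsection \<open>The axioms of a prism\<close>

text \<open>The inverse is the geometric series in -p b, obtained as the value at t = -p of the
  series with coefficients b^k.\<close>

lemma one_plus_\<pi>_unit:
  assumes b: "b \<in> carrier R" obtains v where "v \<in> carrier R" "(\<one>\<^bsub>R\<^esub> \<oplus>\<^bsub>R\<^esub> \<pi> \<otimes>\<^bsub>R\<^esub> b) \<otimes>\<^bsub>R\<^esub> v = \<one>\<^bsub>R\<^esub>"
proof
  define g where "g = (\<lambda>k::nat. b [^]\<^bsub>R\<^esub> k)"
  have g: "g \<in> carrier A" using b by (simp add: g_def carrier_iff)
  show v: "ev g \<in> carrier R" using g by simp
  have sh: "shift 1 g = const b \<otimes>\<^bsub>A\<^esub> g"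
  proof
    fix k show "shift 1 g k = (const b \<otimes>\<^bsub>A\<^esub> g) k"
      using b unfolding coeff_const_mult[OF b g] by (simp add: shift_def g_def R.m_comm)
  qed
  have "ev g = \<one>\<^bsub>R\<^esub> \<oplus>\<^bsub>R\<^esub> pip \<otimes>\<^bsub>R\<^esub> (b \<otimes>\<^bsub>R\<^esub> ev g)"
    using ev_rec[OF g] unfolding sh ev_const_mult[OF b g] by (simp add: g_def)
  then have "ev g \<oplus>\<^bsub>R\<^esub> \<pi> \<otimes>\<^bsub>R\<^esub> (b \<otimes>\<^bsub>R\<^esub> ev g) = (\<one>\<^bsub>R\<^esub> \<oplus>\<^bsub>R\<^esub> pip \<otimes>\<^bsub>R\<^esub> (b \<otimes>\<^bsub>R\<^esub> ev g)) \<oplus>\<^bsub>R\<^esub> \<pi> \<otimes>\<^bsub>R\<^esub> (b \<otimes>\<^bsub>R\<^esub> ev g)" by simp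
  also have "\<dots> = \<one>\<^bsub>R\<^esub>" using b v by (simp add: R.l_minus R.a_assoc R.l_neg)
  finally show "(\<one>\<^bsub>R\<^esub> \<oplus>\<^bsub>R\<^esub> \<pi> \<otimes>\<^bsub>R\<^esub> b) \<otimes>\<^bsub>R\<^esub> ev g = \<one>\<^bsub>R\<^esub>"
    using b v by (simp add: R.l_distr R.m_assoc)
qed

text \<open>\<phi>(E) = p + t^p takes the value p + (-p)^p at t = -p, which is p times a unit 1 + p
  b. Multiplied by the inverse of that unit, \<phi>(E) differs from p by a multiple of E.\<close>

lemma distinguished: "\<pi>A \<in> genideal A (pI A \<union> phi p A ` pI A)"
proof -
  have sub: "pI A \<union> phi p A ` pI A \<subseteq> carrier A"
    by (auto simp: pI_A A.mem_PIdl phi_eq)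
  let ?G = "genideal A (pI A \<union> phi p A ` pI A)"
  interpret I: ideal ?G A by (rule A.genideal_ideal[OF sub])
  have sup: "pI A \<union> phi p A ` pI A \<subseteq> ?G" by (rule A.genideal_self[OF sub])
  have \<Phi>E: "\<Phi> E \<in> ?G" using sup E_in_pI phi_eq[OF E_closed] by force
  have evt: "ev tt = pip" using ev_tt_mult[of "\<one>\<^bsub>A\<^esub>"] by simp
  \<comment> \<open>The exponent p - 2 leaves a factor p^2 in (-p)^p: one p is taken out of the
    value of \<phi>(E), and the other makes the cofactor congruent to 1 modulo p.\<close>
  define b where "b = pip [^]\<^bsub>R\<^esub> (p - 2)"
  have b [simp]: "b \<in> carrier R" by (simp add: b_def)
  have pp: "pip [^]\<^bsub>R\<^esub> p = \<pi> \<otimes>\<^bsub>R\<^esub> (\<pi> \<otimes>\<^bsub>R\<^esub> b)"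
  proof -
    have "p = Suc (Suc (p - 2))" using p_ge_2 by simp
    then have "pip [^]\<^bsub>R\<^esub> p = pip [^]\<^bsub>R\<^esub> (Suc (Suc (p - 2)))" by (rule arg_cong)
    then show ?thesis by (simp add: b_def R.l_minus R.r_minus R.m_ac)
  qed
  have "\<Phi> E = const \<pi> \<oplus>\<^bsub>A\<^esub> (tt [^]\<^bsub>A\<^esub> p)"
    by (simp add: E_eq \<Phi>_const \<Phi>_tt fr.hom_rnat)
  then have evE: "ev (\<Phi> E) = \<pi> \<otimes>\<^bsub>R\<^esub> (\<one>\<^bsub>R\<^esub> \<oplus>\<^bsub>R\<^esub> \<pi> \<otimes>\<^bsub>R\<^esub> b)"
    by (simp add: ev_const ev.hom_pow evt pp R.r_distr)
  obtain v where v: "v \<in> carrier R" "(\<one>\<^bsub>R\<^esub> \<oplus>\<^bsub>R\<^esub> \<pi> \<otimes>\<^bsub>R\<^esub> b) \<otimes>\<^bsub>R\<^esub> v = \<one>\<^bsub>R\<^esub>" using one_plus_\<pi>_unit[OF b] .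
  define z where "z = \<Phi> E \<otimes>\<^bsub>A\<^esub> const v"
  have z: "z \<in> carrier A" "z \<in> ?G" using v \<Phi>E by (auto simp: z_def intro: I.I_r_closed)
  have evz: "ev z = \<pi>"
    unfolding z_def using v by (simp add: evE ev_const R.m_assoc del: R.r_distr R.l_distr)
  obtain h where h: "h \<in> carrier A" "z = const (ev z) \<oplus>\<^bsub>A\<^esub> (E \<otimes>\<^bsub>A\<^esub> h)" using E_division[OF z(1)] .
  have "E \<otimes>\<^bsub>A\<^esub> h \<in> ?G" using sup E_in_pI h by (intro I.I_r_closed) auto
  then have "z \<ominus>\<^bsub>A\<^esub> (E \<otimes>\<^bsub>A\<^esub> h) \<in> ?G" unfolding a_minus_def by (intro I.a_closed I.a_inv_closed z)
  moreover have "z \<ominus>\<^bsub>A\<^esub> (E \<otimes>\<^bsub>A\<^esub> h) = \<pi>A"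
    using A.add_minus_cancel[of "const \<pi>" "E \<otimes>\<^bsub>A\<^esub> h"] h unfolding evz by (metis A.m_closed C.hom_closed E_closed R.rnat_closed rnat_A)
  ultimately show ?thesis by simp
qed

lemma strc_A: "strc A w = const (strc R w)"
  by (simp add: BK_def const_def)

lemma strc_hom: "strc R \<in> ring_hom (BW D) R"
  using cp by (simp add: is_cprism_def complete_walg_def is_walg_def)

lemma strc_closed [simp]: "w \<in> carrier (BW D) \<Longrightarrow> strc R w \<in> carrier R"
  using strc_hom by (rule ring_hom_closed)

lemma torsion_free_pow: "x \<in> carrier R \<Longrightarrow> add_pow R (p ^ k) x = \<zero>\<^bsub>R\<^esub> \<Longrightarrow> x = \<zero>\<^bsub>R\<^esub>"
proof (induction k)
  case (Suc k)
  have "\<pi> \<otimes>\<^bsub>R\<^esub> (rnat R (p ^ k) \<otimes>\<^bsub>R\<^esub> x) = \<zero>\<^bsub>R\<^esub>"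
    using Suc by (simp add: R.add_pow_rnat R.rnat_mult R.m_assoc)
  then show ?case using Suc torsion_free[of "rnat R (p ^ k) \<otimes>\<^bsub>R\<^esub> x"] by (simp add: R.add_pow_rnat)
qed (simp add: R.add_pow_rnat)

lemma complete_walg_truncate: "complete_walg D (walg.truncate R)"
proof -
  note so = same_ops_truncate[of R]
  have "strc (walg.truncate R) = strc R" by (simp add: walg.defs)
  moreover have "ring_hom (BW D) (walg.truncate R) = ring_hom (BW D) R"
    by (auto simp: ring_hom_def same_ops_simps[OF so])
  ultimately show ?thesis
    using cp same_ops_cring[OF so R.is_cring]
    by (simp add: is_cprism_def complete_walg_def is_walg_def same_ops_adic_complete[OF so] same_ops_p_ideal[OF so])
qed

lemma is_prism_A: "is_prism D A"
  unfolding is_prism_def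
proof (intro conjI)
  note so = same_ops_truncate[of R]
  show "is_walg D A"
    using ring_hom_trans[OF strc_hom C.homh] A.is_cring by (simp add: is_walg_def strc_A[abs_def] comp_def)
  show "complete_walg D (rbar A)" using complete_walg_truncate by (simp add: rbar_A)
  show "delta_ring p A (dl A)" by (rule delta_ring_A)
  show "\<forall>w\<in>carrier (BW D). phi p A (strc A w) = strc A (sg D w)"
    using cp by (auto simp: strc_A phi_eq \<Phi>_const is_cprism_def)
  show "proj A \<in> walg_hom D A (rbar A)"
    unfolding walg_hom_def Rhom_def
    by (auto simp: rbar_A proj_eq strc_A ev_const walg.defs ring_hom_def ev_mult ev_add
      intro: C.hom_one[symmetric] simp del: C.hom_one)
  show "proj A ` carrier A = carrier (rbar A)"
  proof -
    have "x \<in> ev ` carrier A" if "x \<in> carrier R" for x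
      using that by (intro image_eqI[of _ _ "const x"]) (simp_all add: ev_const)
    then show ?thesis by (auto simp: rbar_A proj_eq same_ops_simps[OF so])
  qed
  \<comment> \<open>E generates the ideal globally and is a nonzerodivisor, so the Zariski cover
    consists of 1 alone.\<close>
  show "cartier A (pI A)"
    unfolding cartier_def
    using E_in_pI E_nonzerodivisor A.genideal_one
    by (intro exI[of _ "{\<one>\<^bsub>A\<^esub>}"]) (auto simp: pI_A intro!: bexI[of _ E], auto simp: A.mem_PIdl intro!: exI[of _ 0])
  show "adic_complete A (pI_max p A)" by (rule adic_complete_A)
  show "rnat A p \<in> genideal A (pI A \<union> phi p A ` pI A)" by (rule distinguished)
  \<comment> \<open>The reduction R has no p-torsion, hence the exponent 0 is a bound.\<close>
  show "\<exists>m::nat. \<forall>x\<in>carrier (rbar A). \<forall>k::nat.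
        add_pow (rbar A) (p ^ k) x = \<zero>\<^bsub>rbar A\<^esub> \<longrightarrow> add_pow (rbar A) (p ^ m) x = \<zero>\<^bsub>rbar A\<^esub>"
    using torsion_free_pow
    by (intro exI[of _ 0]) (auto simp: rbar_A same_ops_simps[OF so] same_ops_add_pow[OF so] R.add_pow_rnat)
qed

end

section \<open>Functoriality of the Breuil--Kisin prism\<close>

lemma walg_hom_ring_hom_cring:
  "f \<in> walg_hom D A B \<Longrightarrow> cring A \<Longrightarrow> cring B \<Longrightarrow> ring_hom_cring A B f"
  by (auto simp: walg_hom_def intro: ring_hom_cringI Rhom_ring_hom)

lemma walg_hom_truncate: "walg_hom D (walg.truncate R) (walg.truncate S) = walg_hom D R S"
  by (auto simp: walg_hom_def Rhom_def ring_hom_def walg.defs)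

locale bk_map = R: bk D R + S: bk D S for D :: "('w, 'i) group_datum" and R S :: "('a, 'w) cprism" +
  fixes f assumes f: "f \<in> cp_hom D R S"
begin

sublocale f: ring_hom_cring R S f
  using f by (intro walg_hom_ring_hom_cring R.R.is_cring S.R.is_cring) (auto simp: cp_hom_def)

abbreviation "F \<equiv> BK_map R f"

lemma F_app: "g \<in> carrier R.A \<Longrightarrow> F g = (\<lambda>k. f (g k))"
  by (simp add: BK_map_def same_ops_simps(1)[OF same_ops_BK])

lemma F_closed: "g \<in> carrier R.A \<Longrightarrow> F g \<in> carrier S.A"
  by (auto simp: F_app S.carrier_iff)

lemma F_hom: "ring_hom_cring R.A S.A F"
proof (rule ring_hom_cringI[OF R.A.is_cring S.A.is_cring], rule ring_hom_memI)
  fix g h assume g: "g \<in> carrier R.A" "h \<in> carrier R.A"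
  show "F g \<in> carrier S.A" using g by (simp add: F_closed)
  show "F (g \<otimes>\<^bsub>R.A\<^esub> h) = F g \<otimes>\<^bsub>S.A\<^esub> F h"
  proof
    fix k
    have "f ((g \<otimes>\<^bsub>R.A\<^esub> h) k) = (\<Oplus>\<^bsub>S\<^esub>l\<in>{..k}. f (g l) \<otimes>\<^bsub>S\<^esub> f (h (k - l)))"
      unfolding R.coeff_mult using g by (subst f.hom_finsum') (auto intro!: S.R.finsum_cong')
    then show "F (g \<otimes>\<^bsub>R.A\<^esub> h) k = (F g \<otimes>\<^bsub>S.A\<^esub> F h) k"
      using g by (simp add: F_app S.coeff_mult)
  qed
  show "F (g \<oplus>\<^bsub>R.A\<^esub> h) = F g \<oplus>\<^bsub>S.A\<^esub> F h"
    using g by (intro ext) (simp add: F_app S.coeff_add R.coeff_add)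
next
  show "F \<one>\<^bsub>R.A\<^esub> = \<one>\<^bsub>S.A\<^esub>"
    by (intro ext) (simp add: F_app R.coeff_one S.coeff_one)
qed

sublocale F: ring_hom_cring R.A S.A F by (rule F_hom)

lemma F_const: "c \<in> carrier R \<Longrightarrow> F (R.const c) = S.const (f c)"
  by (intro ext) (simp add: F_app, simp add: R.const_def S.const_def)

lemma F_E: "F R.E = S.E"
  by (intro ext) (simp add: F_app, simp add: bk_E_def f.hom_rnat)

lemma f_fr: "a \<in> carrier R \<Longrightarrow> f (fr R a) = fr S (f a)"
  using f by (simp add: cp_hom_def)

lemma F_\<Phi>: "g \<in> carrier R.A \<Longrightarrow> F (R.\<Phi> g) = S.\<Phi> (F g)"
  by (intro ext) (simp add: F_app R.coeff_\<Phi> S.coeff_\<Phi> f_fr)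

lemma F_walg_hom: "F \<in> walg_hom D R.A S.A"
proof -
  have "F \<in> extensional (carrier R.A)"
    by (simp add: BK_map_def same_ops_simps(1)[OF same_ops_BK])
  moreover have "F (strc R.A w) = strc S.A w" if "w \<in> carrier (BW D)" for w
    using f that by (simp add: R.strc_A S.strc_A F_const cp_hom_def walg_hom_def)
  ultimately show ?thesis using F.homh by (auto simp: walg_hom_def Rhom_def)
qed

text \<open>On the target \<delta>(g) is determined by p \<delta>(g) = \<phi>(g) - g^p, and
  \<open>F\<close> is compatible with the right-hand side.\<close>

lemma F_dl: "g \<in> carrier R.A \<Longrightarrow> F (dl R.A g) = dl S.A (F g)"
proof (rule S.dl_eqI[symmetric])
  assume g: "g \<in> carrier R.A"
  have "S.\<pi>A \<otimes>\<^bsub>S.A\<^esub> F (dl R.A g) = F (R.\<pi>A \<otimes>\<^bsub>R.A\<^esub> dl R.A g)"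
    using g by (simp add: F.hom_rnat)
  also have "\<dots> = S.\<Phi> (F g) \<ominus>\<^bsub>S.A\<^esub> (F g [^]\<^bsub>S.A\<^esub> pp D)"
    using g by (simp only: R.\<pi>_dl F.hom_minus R.\<Phi>.hom_closed R.A.nat_pow_closed F_\<Phi> F.hom_pow)
  finally show "S.\<pi>A \<otimes>\<^bsub>S.A\<^esub> F (dl R.A g) = S.\<Phi> (F g) \<ominus>\<^bsub>S.A\<^esub> (F g [^]\<^bsub>S.A\<^esub> pp D)" .
qed auto

text \<open>\<open>F\<close> sends E to E, so the ideal generated by the image contains the
  generator of the target ideal and is contained in that ideal.\<close>

lemma F_phom: "F \<in> phom D R.A S.A"
proof -
  have sub: "F ` pI R.A \<subseteq> pI S.A"
    by (auto simp: R.pI_A S.pI_A R.A.mem_PIdl S.A.mem_PIdl F_E intro!: bexI[of _ "F b" for b])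
  have "genideal S.A (F ` pI R.A) \<subseteq> pI S.A"
    using sub unfolding S.pI_A by (intro S.A.genideal_minimal S.A.cgenideal_ideal) auto
  moreover have "S.E \<in> genideal S.A (F ` pI R.A)"
  proof -
    have "F ` pI R.A \<subseteq> carrier S.A" by (auto simp: R.pI_A R.A.mem_PIdl)
    then have "F ` pI R.A \<subseteq> genideal S.A (F ` pI R.A)" by (rule S.A.genideal_self)
    then show ?thesis using R.E_in_pI F_E by force
  qed
  then have "pI S.A \<subseteq> genideal S.A (F ` pI R.A)"
    unfolding S.pI_A
    by (intro S.A.cgenideal_minimal S.A.genideal_ideal) (auto simp: R.pI_A R.A.mem_PIdl)
  ultimately show ?thesis using F_walg_hom F_dl by (auto simp: phom_def)
qed

text \<open>Division by E is preserved by \<open>F\<close> and takes the place of a continuity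
  argument for the p-adic limits that define evaluation.\<close>

lemma ev_F:
  assumes g: "g \<in> carrier R.A" shows "S.ev (F g) = f (R.ev g)"
proof -
  obtain h where h: "h \<in> carrier R.A" "g = R.const (R.ev g) \<oplus>\<^bsub>R.A\<^esub> (R.E \<otimes>\<^bsub>R.A\<^esub> h)" using R.E_division[OF g] .
  have "F g = F (R.const (R.ev g) \<oplus>\<^bsub>R.A\<^esub> (R.E \<otimes>\<^bsub>R.A\<^esub> h))" using h(2) by simp
  also have "\<dots> = S.const (f (R.ev g)) \<oplus>\<^bsub>S.A\<^esub> (S.E \<otimes>\<^bsub>S.A\<^esub> F h)"
    using g h(1) by (simp add: F_const F_E)
  finally show ?thesis using g h(1) by (simp add: S.ev_add S.ev_const S.ev_E_mult[OF F_closed] del: S.ev.hom_mult)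
qed

text \<open>Constant series lift the elements of R, and \<open>ev_F\<close> shows that the choice of
  lift does not matter. Outside the carrier both sides are \<open>undefined\<close>; the equality of
  functions makes \<open>ppull\<close> along \<open>F\<close> literally the transition map of
  \<open>S_cp\<close>.\<close>

lemma rmap_F: "rmap R.A S.A F = f"
proof
  note so = same_ops_simps[OF same_ops_truncate]
  fix y
  show "rmap R.A S.A F y = f y"
  proof (cases "y \<in> carrier R")
    case True
    have "(THE z. \<exists>a\<in>carrier R.A. proj R.A a = y \<and> z = proj S.A (F a)) = f y"
    proof (rule the_equality)
      show "\<exists>a\<in>carrier R.A. proj R.A a = y \<and> f y = proj S.A (F a)"
        using True by (intro bexI[of _ "R.const y"]) (simp_all add: R.proj_eq S.proj_eq ev_F R.ev_const)
      show "z = f y" if "\<exists>a\<in>carrier R.A. proj R.A a = y \<and> z = proj S.A (F a)" for z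
        using that by (auto simp: R.proj_eq S.proj_eq ev_F)
    qed
    then show ?thesis using True by (simp add: rmap_def R.rbar_A so)
  next
    case False
    then have "f y = undefined" using f by (auto simp: cp_hom_def walg_hom_def Rhom_def extensional_def)
    then show ?thesis using False by (simp add: rmap_def R.rbar_A so)
  qed
qed

lemma ppull_F: "ppull Xf R.A S.A F x = tr (S_cp Xf) R S f x"
  by (simp add: ppull_def rmap_F S_cp_def R.rbar_A S.rbar_A)

end

section \<open>Modules with a basis and the matrix of Frobenius\<close>

lemma semilinearD:
  assumes "semilinear A f M N r"
  shows "u \<in> carrier M \<Longrightarrow> r u \<in> carrier N"
    and "u \<in> carrier M \<Longrightarrow> v \<in> carrier M \<Longrightarrow> r (u \<oplus>\<^bsub>M\<^esub> v) = r u \<oplus>\<^bsub>N\<^esub> r v"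
    and "a \<in> carrier A \<Longrightarrow> u \<in> carrier M \<Longrightarrow> r (a \<odot>\<^bsub>M\<^esub> u) = f a \<odot>\<^bsub>N\<^esub> r u"
  using assms by (auto simp: semilinear_def)

locale plain_module = module R M for R :: "('b, 'k) ring_scheme" (structure) and M :: "('b, 'm) module" (structure)
begin

lemma finsum_smult_rdistr:
  assumes "finite I" "x \<in> carrier M" "\<And>i. i \<in> I \<Longrightarrow> v i \<in> carrier R"
  shows "(\<Oplus>i\<in>I. v i) \<odot>\<^bsub>M\<^esub> x = (\<Oplus>\<^bsub>M\<^esub>i\<in>I. v i \<odot>\<^bsub>M\<^esub> x)"
  using assms(1,3) by (induction I) (auto simp: assms(2) smult_l_distr R.finsum_closed Pi_def)

lemma lincomb_closed:
  "(\<And>i. i < n \<Longrightarrow> \<beta> i \<in> carrier M) \<Longrightarrow> (\<And>i. i < n \<Longrightarrow> v i \<in> carrier R) \<Longrightarrow> lincomb n M \<beta> v \<in> carrier M"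
  unfolding lincomb_def by (intro M.finsum_closed) auto

lemma lincomb_cong:
  "(\<And>i. i < n \<Longrightarrow> \<beta> i \<in> carrier M) \<Longrightarrow> (\<And>i. i < n \<Longrightarrow> v i \<in> carrier R) \<Longrightarrow> (\<And>i. i < n \<Longrightarrow> w i = v i) \<Longrightarrow>
   lincomb n M \<beta> w = lincomb n M \<beta> v"
  unfolding lincomb_def by (intro M.finsum_cong') auto

lemma lincomb_lincomb:
  assumes b: "\<And>i. i < n \<Longrightarrow> \<beta> i \<in> carrier M" and I: "finite I"
    and w: "\<And>j. j \<in> I \<Longrightarrow> w j \<in> carrier R" and g: "\<And>i j. i < n \<Longrightarrow> j \<in> I \<Longrightarrow> g i j \<in> carrier R"
  shows "(\<Oplus>\<^bsub>M\<^esub>j\<in>I. w j \<odot>\<^bsub>M\<^esub> lincomb n M \<beta> (\<lambda>i. g i j)) = lincomb n M \<beta> (\<lambda>i. \<Oplus>j\<in>I. g i j \<otimes> w j)"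
proof -
  have "(\<Oplus>\<^bsub>M\<^esub>j\<in>I. w j \<odot>\<^bsub>M\<^esub> lincomb n M \<beta> (\<lambda>i. g i j)) = (\<Oplus>\<^bsub>M\<^esub>j\<in>I. \<Oplus>\<^bsub>M\<^esub>i\<in>{..<n}. (g i j \<otimes> w j) \<odot>\<^bsub>M\<^esub> \<beta> i)"
  proof (rule M.finsum_cong')
    fix j assume j: "j \<in> I"
    have "w j \<odot>\<^bsub>M\<^esub> lincomb n M \<beta> (\<lambda>i. g i j) = (\<Oplus>\<^bsub>M\<^esub>i\<in>{..<n}. w j \<odot>\<^bsub>M\<^esub> (g i j \<odot>\<^bsub>M\<^esub> \<beta> i))"
      unfolding lincomb_def using b w g j by (intro finsum_smult_ldistr) auto
    also have "\<dots> = (\<Oplus>\<^bsub>M\<^esub>i\<in>{..<n}. (g i j \<otimes> w j) \<odot>\<^bsub>M\<^esub> \<beta> i)"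
      using b w g j by (intro M.finsum_cong') (auto simp: smult_assoc1[symmetric] R.m_comm)
    finally show "w j \<odot>\<^bsub>M\<^esub> lincomb n M \<beta> (\<lambda>i. g i j) = (\<Oplus>\<^bsub>M\<^esub>i\<in>{..<n}. (g i j \<otimes> w j) \<odot>\<^bsub>M\<^esub> \<beta> i)" .
  qed (use b w g in \<open>auto intro!: M.finsum_closed\<close>)
  also have "\<dots> = (\<Oplus>\<^bsub>M\<^esub>i\<in>{..<n}. \<Oplus>\<^bsub>M\<^esub>j\<in>I. (g i j \<otimes> w j) \<odot>\<^bsub>M\<^esub> \<beta> i)"
    using b w g I by (intro M.finsum_swap) auto
  also have "\<dots> = lincomb n M \<beta> (\<lambda>i. \<Oplus>j\<in>I. g i j \<otimes> w j)"
    unfolding lincomb_def using b w g I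
    by (intro M.finsum_cong' finsum_smult_rdistr[symmetric]) (auto intro!: R.finsum_closed)
  finally show ?thesis .
qed

lemma lincomb_add:
  assumes "\<And>i. i < n \<Longrightarrow> \<beta> i \<in> carrier M" "\<And>i. i < n \<Longrightarrow> v i \<in> carrier R" "\<And>i. i < n \<Longrightarrow> w i \<in> carrier R"
  shows "lincomb n M \<beta> (\<lambda>i. v i \<oplus> w i) = lincomb n M \<beta> v \<oplus>\<^bsub>M\<^esub> lincomb n M \<beta> w"
proof -
  have "lincomb n M \<beta> (\<lambda>i. v i \<oplus> w i) = (\<Oplus>\<^bsub>M\<^esub>i\<in>{..<n}. v i \<odot>\<^bsub>M\<^esub> \<beta> i \<oplus>\<^bsub>M\<^esub> w i \<odot>\<^bsub>M\<^esub> \<beta> i)"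
    unfolding lincomb_def using assms by (intro M.finsum_cong') (auto simp: smult_l_distr)
  also have "\<dots> = lincomb n M \<beta> v \<oplus>\<^bsub>M\<^esub> lincomb n M \<beta> w"
    unfolding lincomb_def using assms by (intro M.finsum_addf) auto
  finally show ?thesis .
qed

lemma lincomb_smult:
  assumes "\<And>i. i < n \<Longrightarrow> \<beta> i \<in> carrier M" "\<And>i. i < n \<Longrightarrow> v i \<in> carrier R" "a \<in> carrier R"
  shows "lincomb n M \<beta> (\<lambda>i. a \<otimes> v i) = a \<odot>\<^bsub>M\<^esub> lincomb n M \<beta> v"
  unfolding lincomb_def using assms
  by (subst finsum_smult_ldistr) (auto simp: smult_assoc1 intro!: M.finsum_cong')

text \<open>Brings an equality of combinations into the shape of a vanishing sum, in which the
  kernel conditions of \<open>base_change\<close> and \<open>frobenius_structure\<close> are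
  stated.\<close>

lemma lincomb_eq_diff:
  assumes b: "\<And>i. i < n \<Longrightarrow> \<beta> i \<in> carrier M" and v: "\<And>i. i < n \<Longrightarrow> v i \<in> carrier R" and w: "\<And>i. i < n \<Longrightarrow> w i \<in> carrier R"
    and eq: "lincomb n M \<beta> v = lincomb n M \<beta> w"
  shows "finsum M (\<lambda>i. (v i \<ominus> w i) \<odot>\<^bsub>M\<^esub> \<beta> i) {..<n} = \<zero>\<^bsub>M\<^esub>"
proof -
  have "finsum M (\<lambda>i. (v i \<ominus> w i) \<odot>\<^bsub>M\<^esub> \<beta> i) {..<n} = lincomb n M \<beta> (\<lambda>i. v i \<oplus> (\<ominus> \<one>) \<otimes> w i)"
    unfolding lincomb_def using b v w by (intro M.finsum_cong') (auto simp: a_minus_def R.l_minus)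
  also have "\<dots> = lincomb n M \<beta> v \<oplus>\<^bsub>M\<^esub> (\<ominus> \<one>) \<odot>\<^bsub>M\<^esub> lincomb n M \<beta> w"
    using b v w by (subst lincomb_add; (subst lincomb_smult)?) auto
  also have "\<dots> = \<zero>\<^bsub>M\<^esub>"
    unfolding eq using lincomb_closed[of n \<beta> w] b w by (simp add: smult_l_minus M.r_neg)
  finally show ?thesis .
qed

lemma semilinear_lincomb:
  assumes r: "semilinear R f M N r" and N: "module B N" and f: "ring_hom_cring R B f"
    and b: "\<And>i. i < n \<Longrightarrow> \<beta> i \<in> carrier M" and v: "\<And>i. i < n \<Longrightarrow> v i \<in> carrier R"
  shows "r (lincomb n M \<beta> v) = lincomb n N (\<lambda>i. r (\<beta> i)) (\<lambda>i. f (v i))"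
proof -
  interpret N: plain_module B N by (rule plain_module.intro[OF N])
  interpret f: ring_hom_cring R B f by (rule f)
  note rD = semilinearD[OF r]
  have r0: "r \<zero>\<^bsub>M\<^esub> = \<zero>\<^bsub>N\<^esub>" using rD(3)[of \<zero> "\<zero>\<^bsub>M\<^esub>"] rD(1)[of "\<zero>\<^bsub>M\<^esub>"] by simp
  have "r (\<Oplus>\<^bsub>M\<^esub>i\<in>I. v i \<odot>\<^bsub>M\<^esub> \<beta> i) = (\<Oplus>\<^bsub>N\<^esub>i\<in>I. f (v i) \<odot>\<^bsub>N\<^esub> r (\<beta> i))" if "I \<subseteq> {..<n}" "finite I" for I
    using that(2,1)
  proof (induction I)
    case (insert i I)
    then show ?case using b v rD
      by (subst M.finsum_insert; (subst N.M.finsum_insert)?) (auto intro!: M.finsum_closed simp: subset_iff)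
  qed (simp add: r0)
  then show ?thesis by (simp add: lincomb_def)
qed

end

section \<open>Frames of a module and their coordinates\<close>

locale framed = plain_module A N for A :: "('b, 'k) ring_scheme" and N :: "('b, 'm) module" +
  fixes n :: nat and \<beta> :: "nat \<Rightarrow> 'm"
  assumes \<beta>_ext: "\<beta> \<in> {..<n} \<rightarrow>\<^sub>E carrier N"
    and \<beta>_bij: "bij_betw (lincomb n N \<beta>) ({..<n} \<rightarrow>\<^sub>E carrier A) (carrier N)"
begin

lemma \<beta>_closed [simp]: "i < n \<Longrightarrow> \<beta> i \<in> carrier N"
  using \<beta>_ext by auto

abbreviation "coord \<equiv> frame_coord n A N \<beta>"

lemma coord_ex1:
  assumes "m \<in> carrier N" shows "\<exists>!v. v \<in> {..<n} \<rightarrow>\<^sub>E carrier A \<and> lincomb n N \<beta> v = m"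
proof -
  have "m \<in> lincomb n N \<beta> ` ({..<n} \<rightarrow>\<^sub>E carrier A)" using \<beta>_bij assms by (simp only: bij_betw_def)
  then obtain v where v: "v \<in> {..<n} \<rightarrow>\<^sub>E carrier A" "m = lincomb n N \<beta> v" by (rule imageE)
  show ?thesis
  proof (rule ex1I[of _ v])
    fix w assume "w \<in> {..<n} \<rightarrow>\<^sub>E carrier A \<and> lincomb n N \<beta> w = m"
    then show "w = v" using v inj_onD[OF bij_betw_imp_inj_on[OF \<beta>_bij], of w v] by (simp only:)
  qed (simp only: v)
qed

lemma coord:
  assumes "m \<in> carrier N"
  shows coord_closed [simp]: "i < n \<Longrightarrow> coord i m \<in> carrier A" and coord_lincomb: "lincomb n N \<beta> (\<lambda>i. coord i m) = m"
proof -
  define v where "v = (THE v. v \<in> {..<n} \<rightarrow>\<^sub>E carrier A \<and> lincomb n N \<beta> v = m)"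
  have v: "v \<in> {..<n} \<rightarrow>\<^sub>E carrier A" "lincomb n N \<beta> v = m"
    using theI'[OF coord_ex1[OF assms]] by (auto simp: v_def)
  have c: "coord i m = v i" for i using assms by (simp add: frame_coord_def v_def)
  show "i < n \<Longrightarrow> coord i m \<in> carrier A" using v by (auto simp: c)
  show "lincomb n N \<beta> (\<lambda>i. coord i m) = m" using v by (simp add: c)
qed

lemma coord_unique:
  assumes v: "\<And>i. i < n \<Longrightarrow> v i \<in> carrier A" and i: "i < n"
  shows "coord i (lincomb n N \<beta> v) = v i"
proof -
  have m: "lincomb n N \<beta> v \<in> carrier N" using v by (intro lincomb_closed) auto
  have "lincomb n N \<beta> (restrict v {..<n}) = lincomb n N \<beta> v"
    using v by (intro lincomb_cong) auto
  then have "(THE w. w \<in> {..<n} \<rightarrow>\<^sub>E carrier A \<and> lincomb n N \<beta> w = lincomb n N \<beta> v) = restrict v {..<n}"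
    using v by (intro the1_equality[OF coord_ex1[OF m]]) auto
  then show ?thesis using m i by (simp add: frame_coord_def)
qed

lemma lincomb_inject:
  assumes "\<And>i. i < n \<Longrightarrow> v i \<in> carrier A" "\<And>i. i < n \<Longrightarrow> w i \<in> carrier A"
    "lincomb n N \<beta> v = lincomb n N \<beta> w" "i < n"
  shows "v i = w i"
  using coord_unique[of v i] coord_unique[of w i] assms by simp

lemma coord_add: "u \<in> carrier N \<Longrightarrow> v \<in> carrier N \<Longrightarrow> i < n \<Longrightarrow> coord i (u \<oplus>\<^bsub>N\<^esub> v) = coord i u \<oplus>\<^bsub>A\<^esub> coord i v"
  using lincomb_add[of n \<beta> "\<lambda>i. coord i u" "\<lambda>i. coord i v"] coord_unique[of "\<lambda>i. coord i u \<oplus>\<^bsub>A\<^esub> coord i v" i]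
  by (simp add: coord_lincomb)

lemma coord_smult: "u \<in> carrier N \<Longrightarrow> a \<in> carrier A \<Longrightarrow> i < n \<Longrightarrow> coord i (a \<odot>\<^bsub>N\<^esub> u) = a \<otimes>\<^bsub>A\<^esub> coord i u"
  using lincomb_smult[of n \<beta> "\<lambda>i. coord i u" a] coord_unique[of "\<lambda>i. a \<otimes>\<^bsub>A\<^esub> coord i u" i]
  by (simp add: coord_lincomb)

lemma coord_mdual: "i < n \<Longrightarrow> coord i \<in> mdual A N"
  by (auto simp: mdual_def coord_add coord_smult) (simp add: frame_coord_def)

text \<open>Frobenius invariance of a tensor quantifies over dual bases; this allows the frame
  itself to be used with its coordinate functionals.\<close>

lemma dual_basis_coord: "dual_basis A N n \<beta> coord"
  using coord_lincomb by (auto simp: dual_basis_def coord_mdual lincomb_def)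

lemma coord_finsum:
  assumes "finite I" "\<And>j. j \<in> I \<Longrightarrow> a j \<in> carrier A" "\<And>j. j \<in> I \<Longrightarrow> e j \<in> carrier N" "i < n"
  shows "coord i (\<Oplus>\<^bsub>N\<^esub>j\<in>I. a j \<odot>\<^bsub>N\<^esub> e j) = (\<Oplus>\<^bsub>A\<^esub>j\<in>I. a j \<otimes>\<^bsub>A\<^esub> coord i (e j))"
  using assms(1-3)
proof (induction I)
  case empty
  have "coord i (\<zero>\<^bsub>A\<^esub> \<odot>\<^bsub>N\<^esub> \<zero>\<^bsub>N\<^esub>) = \<zero>\<^bsub>A\<^esub>" using assms(4) by (subst coord_smult) auto
  then show ?case by simp
next
  case (insert j I)
  then show ?case using assms(4)
    by (subst M.finsum_insert; (subst R.finsum_insert)?) (auto simp: coord_add coord_smult intro!: M.finsum_closed)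
qed

lemma coord_\<beta>: "i < n \<Longrightarrow> j < n \<Longrightarrow> coord i (\<beta> j) = (if i = j then \<one>\<^bsub>A\<^esub> else \<zero>\<^bsub>A\<^esub>)"
proof -
  assume ij: "i < n" "j < n"
  have "lincomb n N \<beta> (\<lambda>i. if i = j then \<one>\<^bsub>A\<^esub> else \<zero>\<^bsub>A\<^esub>) = (\<Oplus>\<^bsub>N\<^esub>i\<in>{..<n}. if i = j then \<beta> i else \<zero>\<^bsub>N\<^esub>)"
    unfolding lincomb_def by (intro M.finsum_cong') auto
  also have "\<dots> = \<beta> j" using M.finsum_delta[of "{..<n}" j \<beta>] ij by simp
  finally show ?thesis using coord_unique[of "\<lambda>i. if i = j then \<one>\<^bsub>A\<^esub> else \<zero>\<^bsub>A\<^esub>" i] ij by simp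
qed

text \<open>The elements 1 \<otimes> \<open>\<beta> i\<close> are independent after base change. The
  criterion writes \<open>\<beta> i\<close> as the sum of \<open>a i j\<close> times
  \<open>e j\<close>; taking the k-th coordinate expresses the Kronecker symbol through the
  \<open>a i j\<close>. Contracting its image under \<open>f\<close> with \<open>b\<close> gives
  \<open>b k\<close>, while the relations of the criterion give zero.\<close>

lemma tensor_zero_frame:
  assumes f: "ring_hom_cring A B f" and b: "\<And>i. i < n \<Longrightarrow> b i \<in> carrier B"
    and tz: "tensor_zero A f B N n b \<beta>" and k: "k < n"
  shows "b k = \<zero>\<^bsub>B\<^esub>"
proof -
  interpret f: ring_hom_cring A B f by (rule f)
  obtain l :: nat and a e where e: "\<And>j. j < l \<Longrightarrow> e j \<in> carrier N" and a: "\<And>i j. i < n \<Longrightarrow> j < l \<Longrightarrow> a i j \<in> carrier A"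
    and \<beta>: "\<And>i. i < n \<Longrightarrow> \<beta> i = finsum N (\<lambda>j. a i j \<odot>\<^bsub>N\<^esub> e j) {..<l}"
    and z: "\<And>j. j < l \<Longrightarrow> finsum B (\<lambda>i. b i \<otimes>\<^bsub>B\<^esub> f (a i j)) {..<n} = \<zero>\<^bsub>B\<^esub>"
    using tz unfolding tensor_zero_def by blast
  have d: "(\<Oplus>\<^bsub>A\<^esub>j\<in>{..<l}. a i j \<otimes>\<^bsub>A\<^esub> coord k (e j)) = (if k = i then \<one>\<^bsub>A\<^esub> else \<zero>\<^bsub>A\<^esub>)" if "i < n" for i
    using coord_\<beta>[OF k that] \<beta>[OF that] coord_finsum[of "{..<l}" "a i" e k] a e that k by simp
  have fd: "(\<Oplus>\<^bsub>B\<^esub>j\<in>{..<l}. f (a i j) \<otimes>\<^bsub>B\<^esub> f (coord k (e j))) = (if k = i then \<one>\<^bsub>B\<^esub> else \<zero>\<^bsub>B\<^esub>)" if i: "i < n" for i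
  proof -
    have "(\<Oplus>\<^bsub>B\<^esub>j\<in>{..<l}. f (a i j) \<otimes>\<^bsub>B\<^esub> f (coord k (e j))) = f (\<Oplus>\<^bsub>A\<^esub>j\<in>{..<l}. a i j \<otimes>\<^bsub>A\<^esub> coord k (e j))"
      using a e i k by (subst f.hom_finsum') (auto intro!: f.S.finsum_cong')
    then show ?thesis unfolding d[OF i] by simp
  qed
  have "b k = (\<Oplus>\<^bsub>B\<^esub>i\<in>{..<n}. b i \<otimes>\<^bsub>B\<^esub> (if i = k then \<one>\<^bsub>B\<^esub> else \<zero>\<^bsub>B\<^esub>))"
    using k b by (intro f.S.finsum_if_mult_right[symmetric]) auto
  also have "\<dots> = (\<Oplus>\<^bsub>B\<^esub>i\<in>{..<n}. b i \<otimes>\<^bsub>B\<^esub> (\<Oplus>\<^bsub>B\<^esub>j\<in>{..<l}. f (a i j) \<otimes>\<^bsub>B\<^esub> f (coord k (e j))))"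
    using b by (intro f.S.finsum_cong') (auto simp: fd)
  also have "\<dots> = (\<Oplus>\<^bsub>B\<^esub>j\<in>{..<l}. (\<Oplus>\<^bsub>B\<^esub>i\<in>{..<n}. b i \<otimes>\<^bsub>B\<^esub> f (a i j)) \<otimes>\<^bsub>B\<^esub> f (coord k (e j)))"
    using a e b k by (intro f.S.finsum_mult_assoc[symmetric]) auto
  also have "\<dots> = \<zero>\<^bsub>B\<^esub>"
    using e k by (subst f.S.finsum_cong'[of _ "{..<l}" "\<lambda>_. \<zero>\<^bsub>B\<^esub>"]) (auto simp: z)
  finally show ?thesis .
qed

text \<open>The generation clause of \<open>base_change\<close> gives surjectivity; its kernel
  clause together with \<open>tensor_zero_frame\<close> gives injectivity. The formula for the
  coordinates then follows from their uniqueness.\<close>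

lemma frame_base_change:
  assumes f: "ring_hom_cring A B f" and N': "module B N'" and bc: "base_change A f B N N' r"
  shows "framed B N' n (\<lambda>i\<in>{..<n}. r (\<beta> i))"
    and "m \<in> carrier N \<Longrightarrow> i < n \<Longrightarrow> frame_coord n B N' (\<lambda>i\<in>{..<n}. r (\<beta> i)) i (r m) = f (coord i m)"
proof -
  interpret f: ring_hom_cring A B f by (rule f)
  interpret N': plain_module B N' by (rule plain_module.intro[OF N'])
  have r: "semilinear A f N N' r" using bc by (simp add: base_change_def)
  note rc = semilinearD(1)[OF r]
  let ?\<gamma> = "\<lambda>i\<in>{..<n}. r (\<beta> i)"
  have lc: "lincomb n N' ?\<gamma> v = lincomb n N' (\<lambda>i. r (\<beta> i)) v" if "\<And>i. i < n \<Longrightarrow> v i \<in> carrier B" for v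
    unfolding lincomb_def using rc that by (intro N'.M.finsum_cong') auto
  have surj: "\<exists>v\<in>{..<n} \<rightarrow>\<^sub>E carrier B. lincomb n N' ?\<gamma> v = u" if u: "u \<in> carrier N'" for u
  proof -
    have "\<exists>k b m. (\<forall>i<k. b i \<in> carrier B \<and> m i \<in> carrier N) \<and> u = finsum N' (\<lambda>i. b i \<odot>\<^bsub>N'\<^esub> r (m i)) {..<(k::nat)}"
      using bc u unfolding base_change_def by blast
    then obtain k :: nat and b m where bm: "\<And>i. i < k \<Longrightarrow> b i \<in> carrier B" "\<And>i. i < k \<Longrightarrow> m i \<in> carrier N"
      and ue: "u = finsum N' (\<lambda>i. b i \<odot>\<^bsub>N'\<^esub> r (m i)) {..<k}" by blast
    have "u = (\<Oplus>\<^bsub>N'\<^esub>i\<in>{..<k}. b i \<odot>\<^bsub>N'\<^esub> lincomb n N' (\<lambda>i. r (\<beta> i)) (\<lambda>j. f (coord j (m i))))"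
      unfolding ue
    proof (rule N'.M.finsum_cong')
      fix i assume i: "i \<in> {..<k}"
      have "r (m i) = r (lincomb n N \<beta> (\<lambda>j. coord j (m i)))" using bm i by (simp add: coord_lincomb)
      also have "\<dots> = lincomb n N' (\<lambda>i. r (\<beta> i)) (\<lambda>j. f (coord j (m i)))"
        using bm i by (intro semilinear_lincomb[OF r N' f]) auto
      finally show "b i \<odot>\<^bsub>N'\<^esub> r (m i) = b i \<odot>\<^bsub>N'\<^esub> lincomb n N' (\<lambda>i. r (\<beta> i)) (\<lambda>j. f (coord j (m i)))" by simp
    qed (use bm rc in \<open>auto intro!: N'.lincomb_closed\<close>)
    also have "\<dots> = lincomb n N' (\<lambda>i. r (\<beta> i)) (\<lambda>j. \<Oplus>\<^bsub>B\<^esub>i\<in>{..<k}. f (coord j (m i)) \<otimes>\<^bsub>B\<^esub> b i)"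
      using bm rc by (intro N'.lincomb_lincomb) auto
    also have "\<dots> = lincomb n N' ?\<gamma> (\<lambda>j\<in>{..<n}. \<Oplus>\<^bsub>B\<^esub>i\<in>{..<k}. f (coord j (m i)) \<otimes>\<^bsub>B\<^esub> b i)"
      unfolding lincomb_def using bm rc by (intro N'.M.finsum_cong') (auto intro!: N'.smult_closed f.S.finsum_closed)
    finally have ue': "u = lincomb n N' ?\<gamma> (\<lambda>j\<in>{..<n}. \<Oplus>\<^bsub>B\<^esub>i\<in>{..<k}. f (coord j (m i)) \<otimes>\<^bsub>B\<^esub> b i)" .
    have wc: "(\<lambda>j\<in>{..<n}. \<Oplus>\<^bsub>B\<^esub>i\<in>{..<k}. f (coord j (m i)) \<otimes>\<^bsub>B\<^esub> b i) \<in> {..<n} \<rightarrow>\<^sub>E carrier B"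
      using bm by (auto intro!: f.S.finsum_closed)
    show ?thesis by (rule rev_bexI[OF wc]) (rule ue'[symmetric])
  qed
  have bc3: "tensor_zero A f B N k b m" if "\<forall>i<k. b i \<in> carrier B \<and> m i \<in> carrier N"
    "finsum N' (\<lambda>i. b i \<odot>\<^bsub>N'\<^esub> r (m i)) {..<k} = \<zero>\<^bsub>N'\<^esub>" for k b m
    using bc that by (simp add: base_change_def)
  have inj: "v = w" if v: "v \<in> {..<n} \<rightarrow>\<^sub>E carrier B" and w: "w \<in> {..<n} \<rightarrow>\<^sub>E carrier B"
    and eq: "lincomb n N' ?\<gamma> v = lincomb n N' ?\<gamma> w" for v w
  proof
    fix i
    have cl: "v i \<in> carrier B" "w i \<in> carrier B" if "i < n" for i using v w that by auto
    let ?b = "\<lambda>i. v i \<ominus>\<^bsub>B\<^esub> w i"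
    have "lincomb n N' (\<lambda>i. r (\<beta> i)) v = lincomb n N' (\<lambda>i. r (\<beta> i)) w"
      using eq lc[OF cl(1)] lc[OF cl(2)] by simp
    then have "finsum N' (\<lambda>i. ?b i \<odot>\<^bsub>N'\<^esub> r (\<beta> i)) {..<n} = \<zero>\<^bsub>N'\<^esub>"
      using cl rc by (intro N'.lincomb_eq_diff) auto
    moreover have "\<forall>i<n. ?b i \<in> carrier B \<and> \<beta> i \<in> carrier N" using cl by auto
    ultimately have tz: "tensor_zero A f B N n ?b \<beta>" by (rule bc3[rotated])
    show "v i = w i"
    proof (cases "i < n")
      case True
      have "?b i = \<zero>\<^bsub>B\<^esub>" by (rule tensor_zero_frame[OF f _ tz True]) (use cl in auto)
      then show ?thesis by (rule f.S.minus_eq_zeroD[OF cl[OF True]])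
    next
      case False
      then show ?thesis using v w by (auto simp: PiE_def extensional_def)
    qed
  qed
  have "bij_betw (lincomb n N' ?\<gamma>) ({..<n} \<rightarrow>\<^sub>E carrier B) (carrier N')"
    unfolding bij_betw_def
  proof
    show "inj_on (lincomb n N' ?\<gamma>) ({..<n} \<rightarrow>\<^sub>E carrier B)" by (rule inj_onI) (rule inj)
    have "lincomb n N' ?\<gamma> v \<in> carrier N'" if "v \<in> {..<n} \<rightarrow>\<^sub>E carrier B" for v
      using that rc by (intro N'.lincomb_closed) auto
    then have "lincomb n N' ?\<gamma> ` ({..<n} \<rightarrow>\<^sub>E carrier B) \<subseteq> carrier N'" by blast
    moreover have "u \<in> lincomb n N' ?\<gamma> ` ({..<n} \<rightarrow>\<^sub>E carrier B)" if u: "u \<in> carrier N'" for u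
    proof -
      obtain v where "v \<in> {..<n} \<rightarrow>\<^sub>E carrier B" "lincomb n N' ?\<gamma> v = u" using surj[OF u] by (rule bexE)
      then show ?thesis by (intro image_eqI[of _ _ v]) (simp_all only:)
    qed
    ultimately show "lincomb n N' ?\<gamma> ` ({..<n} \<rightarrow>\<^sub>E carrier B) = carrier N'" by blast
  qed
  then show fr: "framed B N' n ?\<gamma>"
    using rc N' by (auto simp: framed_def framed_axioms_def plain_module_def)
  interpret F: framed B N' n ?\<gamma> by (rule fr)
  assume m: "m \<in> carrier N" and i: "i < n"
  have "r m = r (lincomb n N \<beta> (\<lambda>j. coord j m))" using m by (simp add: coord_lincomb)
  also have "\<dots> = lincomb n N' (\<lambda>i. r (\<beta> i)) (\<lambda>j. f (coord j m))"
    using m by (intro semilinear_lincomb[OF r N' f]) auto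
  also have "\<dots> = lincomb n N' ?\<gamma> (\<lambda>j. f (coord j m))" using m by (intro lc[symmetric]) auto
  finally show "frame_coord n B N' ?\<gamma> i (r m) = f (coord i m)"
    using F.coord_unique[of "\<lambda>j. f (coord j m)" i] m i by simp
qed

section \<open>The matrix of a semilinear endomorphism in a frame\<close>

definition frob_mat :: "('m \<Rightarrow> 'm) \<Rightarrow> nat \<times> nat \<Rightarrow> 'b" where
  "frob_mat F = (\<lambda>(i, j)\<in>{..<n} \<times> {..<n}. coord i (F (\<beta> j)))"

lemma frob_mat_app: "i < n \<Longrightarrow> j < n \<Longrightarrow> frob_mat F (i, j) = coord i (F (\<beta> j))"
  by (simp add: frob_mat_def)

lemma frob_mat_closed:
  assumes "semilinear A \<phi> N N F" shows "frob_mat F \<in> mats n A"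
  using semilinearD(1)[OF assms] by (intro matsI) (auto simp: frob_mat_app, simp add: frob_mat_def)

lemma lincomb_frob_mat:
  assumes F: "semilinear A \<phi> N N F" and j: "j < n"
  shows "lincomb n N \<beta> (\<lambda>i. frob_mat F (i, j)) = F (\<beta> j)"
proof -
  have "lincomb n N \<beta> (\<lambda>i. frob_mat F (i, j)) = lincomb n N \<beta> (\<lambda>i. coord i (F (\<beta> j)))"
    using j semilinearD(1)[OF F] by (intro lincomb_cong) (auto simp: frob_mat_app)
  then show ?thesis using semilinearD(1)[OF F] j by (simp add: coord_lincomb)
qed

lemma lincomb_mmul:
  assumes g: "g \<in> mats n A" and h: "h \<in> mats n A" and j: "j < n"
  shows "lincomb n N (\<lambda>k. lincomb n N \<beta> (\<lambda>i. g (i, k))) (\<lambda>k. h (k, j)) = lincomb n N \<beta> (\<lambda>i. mmul n A g h (i, j))"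
proof -
  have "lincomb n N (\<lambda>k. lincomb n N \<beta> (\<lambda>i. g (i, k))) (\<lambda>k. h (k, j)) = lincomb n N \<beta> (\<lambda>i. \<Oplus>\<^bsub>A\<^esub>k\<in>{..<n}. g (i, k) \<otimes>\<^bsub>A\<^esub> h (k, j))"
    unfolding lincomb_def[of n N "\<lambda>k. lincomb n N \<beta> (\<lambda>i. g (i, k))"]
    using g h j by (intro lincomb_lincomb) (auto simp: mats_app)
  also have "\<dots> = lincomb n N \<beta> (\<lambda>i. mmul n A g h (i, j))"
    using g h j by (intro lincomb_cong) (auto simp: R.mmul_app mats_app intro!: R.finsum_closed)
  finally show ?thesis .
qed

text \<open>\<open>F (\<gamma> j)\<close> is computed in the frame \<open>\<beta>\<close> in two
  ways: as \<open>g K\<close>, where \<open>K\<close> is the matrix in the frame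
  \<open>\<gamma>\<close>, and as \<open>H \<phi>(g)\<close> by semilinearity. Cancelling
  \<open>g\<close> gives \<phi>-conjugation.\<close>

lemma frob_mat_act:
  assumes F: "semilinear A \<phi> N N F" and \<phi>: "ring_hom_cring A A \<phi>" and g: "g \<in> GL n A"
    and fr: "framed A N n \<gamma>" and \<gamma>: "\<And>j. j < n \<Longrightarrow> \<gamma> j = lincomb n N \<beta> (\<lambda>i. g (i, j))"
  shows "framed.frob_mat A N n \<gamma> F = mmul n A (minv n A g) (mmul n A (frob_mat F) (mmap n \<phi> g))"
proof -
  interpret \<phi>: ring_hom_cring A A \<phi> by (rule \<phi>)
  interpret G: framed A N n \<gamma> by (rule fr)
  have gm: "g \<in> mats n A" by (rule R.GL_mats[OF g])
  have H: "frob_mat F \<in> mats n A" and K: "G.frob_mat F \<in> mats n A" using F frob_mat_closed G.frob_mat_closed by auto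
  have eq: "mmul n A g (G.frob_mat F) = mmul n A (frob_mat F) (mmap n \<phi> g)"
  proof (rule mats_eqI[of _ n A _ A])
    fix i j assume ij: "i < n" "j < n"
    have "F (\<gamma> j) = lincomb n N \<gamma> (\<lambda>k. G.frob_mat F (k, j))" using ij by (rule_tac G.lincomb_frob_mat[OF F, symmetric])
    also have "\<dots> = lincomb n N (\<lambda>k. lincomb n N \<beta> (\<lambda>i. g (i, k))) (\<lambda>k. G.frob_mat F (k, j))"
      unfolding lincomb_def[of n N \<gamma>] lincomb_def[of n N "\<lambda>k. lincomb n N \<beta> (\<lambda>i. g (i, k))"]
      using ij gm K by (intro M.finsum_cong') (auto simp: \<gamma> mats_app intro!: smult_closed lincomb_closed)
    also have "\<dots> = lincomb n N \<beta> (\<lambda>i. mmul n A g (G.frob_mat F) (i, j))" by (rule lincomb_mmul[OF gm K ij(2)])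
    finally have 1: "F (\<gamma> j) = lincomb n N \<beta> (\<lambda>i. mmul n A g (G.frob_mat F) (i, j))" .
    have "F (\<gamma> j) = lincomb n N (\<lambda>i. F (\<beta> i)) (\<lambda>i. \<phi> (g (i, j)))"
      unfolding \<gamma>[OF ij(2)] by (rule semilinear_lincomb[OF F _ \<phi>]) (use ij gm mats_app in \<open>auto simp: module_axioms\<close>)
    also have "\<dots> = lincomb n N (\<lambda>k. lincomb n N \<beta> (\<lambda>i. frob_mat F (i, k))) (\<lambda>k. mmap n \<phi> g (k, j))"
      unfolding lincomb_def[of n N "\<lambda>i. F (\<beta> i)"] lincomb_def[of n N "\<lambda>k. lincomb n N \<beta> (\<lambda>i. frob_mat F (i, k))"]
      using ij gm H semilinearD(1)[OF F]
      by (intro M.finsum_cong') (auto simp: lincomb_frob_mat[OF F] mmap_app mats_app)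
    also have "\<dots> = lincomb n N \<beta> (\<lambda>i. mmul n A (frob_mat F) (mmap n \<phi> g) (i, j))"
      by (rule lincomb_mmul[OF H \<phi>.mmap_closed[OF gm] ij(2)])
    finally have 2: "F (\<gamma> j) = lincomb n N \<beta> (\<lambda>i. mmul n A (frob_mat F) (mmap n \<phi> g) (i, j))" .
    show "mmul n A g (G.frob_mat F) (i, j) = mmul n A (frob_mat F) (mmap n \<phi> g) (i, j)"
      by (rule lincomb_inject[OF _ _ trans[OF 1[symmetric] 2] ij(1)])
        (use ij gm K H \<phi>.mmap_closed[OF gm] in \<open>auto intro!: mats_app R.mmul_closed\<close>)
  qed (use gm K H \<phi>.mmap_closed[OF gm] in auto)
  have "G.frob_mat F = mmul n A (mmul n A (minv n A g) g) (G.frob_mat F)"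
    using R.minv[OF g] K by (simp add: R.mmul_one_left)
  also have "\<dots> = mmul n A (minv n A g) (mmul n A g (G.frob_mat F))"
    using R.minv[OF g] K gm by (intro R.mmul_assoc) auto
  finally show ?thesis unfolding eq .
qed

lemma frob_mat_base_change:
  assumes f: "ring_hom_cring A B f" and N': "module B N'" and bc: "base_change A f B N N' r"
    and F: "semilinear A \<phi> N N F" and F': "\<And>u. u \<in> carrier N \<Longrightarrow> r (F u) = F' (r u)"
  shows "framed.frob_mat B N' n (\<lambda>i\<in>{..<n}. r (\<beta> i)) F' = mmap n f (frob_mat F)"
proof -
  interpret G: framed B N' n "\<lambda>i\<in>{..<n}. r (\<beta> i)" by (rule frame_base_change(1)[OF f N' bc])
  show ?thesis
    unfolding G.frob_mat_def mmap_def
  proof (rule restrict_ext)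
    fix ij assume "ij \<in> {..<n} \<times> {..<n}"
    then obtain i j where ij: "ij = (i, j)" "i < n" "j < n" by auto
    then show "(case ij of (i, j) \<Rightarrow> frame_coord n B N' (\<lambda>i\<in>{..<n}. r (\<beta> i)) i (F' ((\<lambda>i\<in>{..<n}. r (\<beta> i)) j))) = f (frob_mat F ij)"
      using frame_base_change(2)[OF f N' bc, of "F (\<beta> j)" i] semilinearD(1)[OF F, of "\<beta> j"] F'[of "\<beta> j"]
      by (simp add: frob_mat_app)
  qed
qed

end

text \<open>Applied with c = 1/E, this turns the relations \<open>H K = E\<close> and
  \<open>K H = E\<close> into the statement that \<open>K/E\<close> is inverse to
  \<open>H\<close>.\<close>

lemma (in cring) mmul_mmap_scale:
  assumes "g \<in> mats n R" "h \<in> mats n R" "c \<in> carrier R"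
  shows "mmul n R g (mmap n (\<lambda>x. c \<otimes> x) h) = mmap n (\<lambda>x. c \<otimes> x) (mmul n R g h)"
    and "mmul n R (mmap n (\<lambda>x. c \<otimes> x) g) h = mmap n (\<lambda>x. c \<otimes> x) (mmul n R g h)"
proof -
  have cl: "mmap n (\<lambda>x. c \<otimes> x) k \<in> mats n R" if "k \<in> mats n R" for k
    using that assms(3) by (intro matsI) (auto simp: mmap_app mats_app, simp add: mmap_def)
  show "mmul n R g (mmap n (\<lambda>x. c \<otimes> x) h) = mmap n (\<lambda>x. c \<otimes> x) (mmul n R g h)"
  proof (rule mats_eqI[of _ n R _ R])
    fix i j assume ij: "i < n" "j < n"
    have "mmul n R g (mmap n (\<lambda>x. c \<otimes> x) h) (i, j) = (\<Oplus>l\<in>{..<n}. c \<otimes> (g (i, l) \<otimes> h (l, j)))"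
      unfolding mmul_app[OF ij] using assms ij by (intro finsum_cong') (auto simp: mmap_app mats_app m_ac)
    also have "\<dots> = c \<otimes> (\<Oplus>l\<in>{..<n}. g (i, l) \<otimes> h (l, j))"
      using assms ij by (intro finsum_rdistr[symmetric]) (auto simp: mats_app)
    finally show "mmul n R g (mmap n (\<lambda>x. c \<otimes> x) h) (i, j) = mmap n (\<lambda>x. c \<otimes> x) (mmul n R g h) (i, j)"
      using ij by (simp add: mmap_app mmul_app)
  qed (use assms cl in auto)
  show "mmul n R (mmap n (\<lambda>x. c \<otimes> x) g) h = mmap n (\<lambda>x. c \<otimes> x) (mmul n R g h)"
  proof (rule mats_eqI[of _ n R _ R])
    fix i j assume ij: "i < n" "j < n"
    have "mmul n R (mmap n (\<lambda>x. c \<otimes> x) g) h (i, j) = (\<Oplus>l\<in>{..<n}. c \<otimes> (g (i, l) \<otimes> h (l, j)))"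
      unfolding mmul_app[OF ij] using assms ij by (intro finsum_cong') (auto simp: mmap_app mats_app m_ac)
    also have "\<dots> = c \<otimes> (\<Oplus>l\<in>{..<n}. g (i, l) \<otimes> h (l, j))"
      using assms ij by (intro finsum_rdistr[symmetric]) (auto simp: mats_app)
    finally show "mmul n R (mmap n (\<lambda>x. c \<otimes> x) g) h (i, j) = mmap n (\<lambda>x. c \<otimes> x) (mmul n R g h) (i, j)"
      using ij by (simp add: mmap_app mmul_app)
  qed (use assms cl in auto)
qed

context framed begin

lemma lincomb_F:
  assumes F: "semilinear A \<phi> N N F" and v: "\<And>k. k < n \<Longrightarrow> v k \<in> carrier A" and i: "i < n"
  shows "coord i (lincomb n N (\<lambda>k. F (\<beta> k)) v) = (\<Oplus>\<^bsub>A\<^esub>k\<in>{..<n}. frob_mat F (i, k) \<otimes>\<^bsub>A\<^esub> v k)"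
proof -
  note H = frob_mat_closed[OF F]
  have "lincomb n N (\<lambda>k. F (\<beta> k)) v = (\<Oplus>\<^bsub>N\<^esub>k\<in>{..<n}. v k \<odot>\<^bsub>N\<^esub> lincomb n N \<beta> (\<lambda>i. frob_mat F (i, k)))"
    unfolding lincomb_def[of n N "\<lambda>k. F (\<beta> k)"] using v H semilinearD(1)[OF F]
    by (intro M.finsum_cong') (auto simp: lincomb_frob_mat[OF F] mats_app)
  also have "\<dots> = lincomb n N \<beta> (\<lambda>i. \<Oplus>\<^bsub>A\<^esub>k\<in>{..<n}. frob_mat F (i, k) \<otimes>\<^bsub>A\<^esub> v k)"
    using v H by (intro lincomb_lincomb) (auto simp: mats_app)
  finally show ?thesis
    using coord_unique[of "\<lambda>i. \<Oplus>\<^bsub>A\<^esub>k\<in>{..<n}. frob_mat F (i, k) \<otimes>\<^bsub>A\<^esub> v k" i] v H i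
    by (simp add: mats_app R.finsum_closed Pi_def)
qed

lemma coord_eqI:
  assumes "u \<in> carrier N" "v \<in> carrier N" "\<And>i. i < n \<Longrightarrow> coord i u = coord i v" shows "u = v"
proof -
  have "lincomb n N \<beta> (\<lambda>i. coord i u) = lincomb n N \<beta> (\<lambda>i. coord i v)"
    using assms by (intro lincomb_cong) auto
  then show ?thesis using assms by (simp add: coord_lincomb)
qed

section \<open>Expansion of a mixed tensor in a frame\<close>

lemma mixed_tensor_lincomb:
  assumes \<tau>: "mixed_tensor A N \<tau>" and ls: "ls \<in> lists (mdual A N)" and ms: "pre \<in> lists (carrier N)" "post \<in> lists (carrier N)"
    and v: "\<And>i. i < k \<Longrightarrow> v i \<in> carrier A" and e: "\<And>i. i < k \<Longrightarrow> e i \<in> carrier N"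
  shows "\<tau> ls (pre @ lincomb k N e v # post) = (\<Oplus>\<^bsub>A\<^esub>i\<in>{..<k}. v i \<otimes>\<^bsub>A\<^esub> \<tau> ls (pre @ e i # post))"
proof -
  have cl: "\<tau> ls (pre @ u # post) \<in> carrier A" if "u \<in> carrier N" for u
    using \<tau> ls ms that unfolding mixed_tensor_def by auto
  have lin: "\<tau> ls (pre @ (a \<odot>\<^bsub>N\<^esub> u \<oplus>\<^bsub>N\<^esub> w) # post) = a \<otimes>\<^bsub>A\<^esub> \<tau> ls (pre @ u # post) \<oplus>\<^bsub>A\<^esub> \<tau> ls (pre @ w # post)"
    if "a \<in> carrier A" "u \<in> carrier N" "w \<in> carrier N" for a u w
  proof -
    let ?ms = "pre @ w # post"
    have "?ms \<in> lists (carrier N)" "length pre < length ?ms" using ms that by auto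
    then have "\<tau> ls (?ms[length pre := (a \<odot>\<^bsub>N\<^esub> u) \<oplus>\<^bsub>N\<^esub> w])
         = (a \<otimes>\<^bsub>A\<^esub> \<tau> ls (?ms[length pre := u])) \<oplus>\<^bsub>A\<^esub> \<tau> ls (?ms[length pre := w])"
      using \<tau> ls that unfolding mixed_tensor_def by blast
    then show ?thesis by simp
  qed
  \<comment> \<open>Linearity is given only for vectors of the form a u + w. The value at zero comes
    from writing 0 as 1 0 + 0 and cancelling.\<close>
  have "\<tau> ls (pre @ \<zero>\<^bsub>N\<^esub> # post) = \<tau> ls (pre @ \<zero>\<^bsub>N\<^esub> # post) \<oplus>\<^bsub>A\<^esub> \<tau> ls (pre @ \<zero>\<^bsub>N\<^esub> # post)"
    using lin[of "\<one>\<^bsub>A\<^esub>" "\<zero>\<^bsub>N\<^esub>" "\<zero>\<^bsub>N\<^esub>"] cl by simp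
  then have zero: "\<tau> ls (pre @ \<zero>\<^bsub>N\<^esub> # post) = \<zero>\<^bsub>A\<^esub>"
    using cl[of "\<zero>\<^bsub>N\<^esub>"] by (metis M.zero_closed R.add.l_cancel_one')
  have "\<tau> ls (pre @ (\<Oplus>\<^bsub>N\<^esub>i\<in>I. v i \<odot>\<^bsub>N\<^esub> e i) # post) = (\<Oplus>\<^bsub>A\<^esub>i\<in>I. v i \<otimes>\<^bsub>A\<^esub> \<tau> ls (pre @ e i # post))"
    if "I \<subseteq> {..<k}" "finite I" for I
    using that(2,1)
  proof (induction I)
    case (insert i I)
    then have s: "(\<Oplus>\<^bsub>N\<^esub>i\<in>I. v i \<odot>\<^bsub>N\<^esub> e i) \<in> carrier N" using v e by (intro M.finsum_closed) auto
    have "(\<Oplus>\<^bsub>N\<^esub>i\<in>insert i I. v i \<odot>\<^bsub>N\<^esub> e i) = v i \<odot>\<^bsub>N\<^esub> e i \<oplus>\<^bsub>N\<^esub> (\<Oplus>\<^bsub>N\<^esub>i\<in>I. v i \<odot>\<^bsub>N\<^esub> e i)"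
      using insert v e by (intro M.finsum_insert) auto
    moreover have "(\<Oplus>\<^bsub>A\<^esub>i\<in>insert i I. v i \<otimes>\<^bsub>A\<^esub> \<tau> ls (pre @ e i # post)) =
       v i \<otimes>\<^bsub>A\<^esub> \<tau> ls (pre @ e i # post) \<oplus>\<^bsub>A\<^esub> (\<Oplus>\<^bsub>A\<^esub>i\<in>I. v i \<otimes>\<^bsub>A\<^esub> \<tau> ls (pre @ e i # post))"
      using insert v e cl by (intro R.finsum_insert) auto
    ultimately show ?case using lin[of "v i" "e i", OF _ _ s] insert v e by simp
  qed (simp add: zero)
  then show ?thesis by (simp add: lincomb_def)
qed

text \<open>The vector slots are expanded one after the other. The list \<open>pre\<close> collects
  the slots that are already replaced by frame vectors, so that the induction is over the remaining
  ones.\<close>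

lemma mixed_tensor_expand:
  assumes \<tau>: "mixed_tensor A N \<tau>" and ls: "ls \<in> lists (mdual A N)" and H: "H \<in> mats n A"
  shows "pre \<in> lists (carrier N) \<Longrightarrow> js \<in> idxs n b \<Longrightarrow>
    \<tau> ls (pre @ map (\<lambda>j. lincomb n N \<beta> (\<lambda>k. H (k, j))) js) = (\<Oplus>\<^bsub>A\<^esub>ks\<in>idxs n b. tprod A H ks js \<otimes>\<^bsub>A\<^esub> \<tau> ls (pre @ map \<beta> ks))"
proof (induction b arbitrary: pre js)
  case 0
  then show ?case using \<tau> ls by (auto simp: idxs_0 mixed_tensor_def)
next
  case (Suc b)
  then obtain j js' where js: "js = j # js'" "j < n" "js' \<in> idxs n b" by (elim idxs_SucE)
  let ?L = "\<lambda>j. lincomb n N \<beta> (\<lambda>k. H (k, j))"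
  have Lc: "?L j \<in> carrier N" if "j < n" for j using H that by (intro lincomb_closed) (auto simp: mats_app)
  have post: "map ?L js' \<in> lists (carrier N)" using js(3) Lc by (auto simp: idxs_def subset_iff)
  have \<beta>s: "\<beta> x \<in> carrier N" if "ks \<in> idxs n c" "x \<in> set ks" for x ks c using that by (auto simp: idxs_def subset_iff)
  have cl: "\<tau> ls ms \<in> carrier A" if "ms \<in> lists (carrier N)" for ms using \<tau> ls that unfolding mixed_tensor_def by blast
  note tp = R.tprod_closed[OF H, of _ b]
  have "\<tau> ls (pre @ map ?L js) = \<tau> ls (pre @ ?L j # map ?L js')" by (simp add: js)
  also have "\<dots> = (\<Oplus>\<^bsub>A\<^esub>k\<in>{..<n}. H (k, j) \<otimes>\<^bsub>A\<^esub> \<tau> ls (pre @ \<beta> k # map ?L js'))"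
    using H js by (intro mixed_tensor_lincomb[OF \<tau> ls Suc.prems(1) post]) (auto simp: mats_app)
  also have "\<dots> = (\<Oplus>\<^bsub>A\<^esub>k\<in>{..<n}. \<Oplus>\<^bsub>A\<^esub>ks\<in>idxs n b. tprod A H (k # ks) js \<otimes>\<^bsub>A\<^esub> \<tau> ls (pre @ map \<beta> (k # ks)))"
  proof (rule R.finsum_cong')
    fix k assume k: "k \<in> {..<n}"
    have "\<tau> ls (pre @ \<beta> k # map ?L js') = (\<Oplus>\<^bsub>A\<^esub>ks\<in>idxs n b. tprod A H ks js' \<otimes>\<^bsub>A\<^esub> \<tau> ls (pre @ map \<beta> (k # ks)))"
      using Suc.IH[of "pre @ [\<beta> k]" js'] Suc.prems(1) js(3) k by simp
    also have "H (k, j) \<otimes>\<^bsub>A\<^esub> \<dots> = (\<Oplus>\<^bsub>A\<^esub>ks\<in>idxs n b. H (k, j) \<otimes>\<^bsub>A\<^esub> (tprod A H ks js' \<otimes>\<^bsub>A\<^esub> \<tau> ls (pre @ map \<beta> (k # ks))))"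
      using H js k tp[OF _ js(3)] \<beta>s Suc.prems(1) by (intro R.finsum_rdistr) (auto simp: mats_app intro!: cl R.m_closed)
    also have "\<dots> = (\<Oplus>\<^bsub>A\<^esub>ks\<in>idxs n b. tprod A H (k # ks) js \<otimes>\<^bsub>A\<^esub> \<tau> ls (pre @ map \<beta> (k # ks)))"
    proof (rule R.finsum_cong'[OF refl])
      have t: "\<tau> ls (pre @ map \<beta> (k # ks)) \<in> carrier A" if "ks \<in> idxs n b" for ks
        using \<beta>s[OF that] Suc.prems(1) k by (intro cl) auto
      show "(\<lambda>ks. tprod A H (k # ks) js \<otimes>\<^bsub>A\<^esub> \<tau> ls (pre @ map \<beta> (k # ks))) \<in> idxs n b \<rightarrow> carrier A"
        using t tp[OF _ js(3)] H js k by (auto simp: mats_app simp del: map_append list.map)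
      show "H (k, j) \<otimes>\<^bsub>A\<^esub> (tprod A H ks js' \<otimes>\<^bsub>A\<^esub> \<tau> ls (pre @ map \<beta> (k # ks))) =
        tprod A H (k # ks) js \<otimes>\<^bsub>A\<^esub> \<tau> ls (pre @ map \<beta> (k # ks))" if ks: "ks \<in> idxs n b" for ks
        unfolding js(1) tprod.simps using t[OF ks] tp[OF ks js(3)] mats_app[OF H, of k j] js(2) k
        by (intro R.m_assoc[symmetric]) auto
    qed
    finally show "H (k, j) \<otimes>\<^bsub>A\<^esub> \<tau> ls (pre @ \<beta> k # map ?L js') =
      (\<Oplus>\<^bsub>A\<^esub>ks\<in>idxs n b. tprod A H (k # ks) js \<otimes>\<^bsub>A\<^esub> \<tau> ls (pre @ map \<beta> (k # ks)))" .
  qed (use H js tp[OF _ js(3)] \<beta>s[of _ b] Suc.prems(1) in \<open>auto simp: mats_app intro!: R.finsum_closed R.m_closed cl\<close>)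
  also have "\<dots> = (\<Oplus>\<^bsub>A\<^esub>ks\<in>idxs n (Suc b). tprod A H ks js \<otimes>\<^bsub>A\<^esub> \<tau> ls (pre @ map \<beta> ks))"
    using Suc.prems \<beta>s[of _ "Suc b"] R.tprod_closed[OF H, of _ "Suc b" js]
    by (intro R.finsum_idxs_Suc[symmetric]) (auto intro!: R.m_closed cl)
  finally show ?case .
qed

end

text \<open>Since the cokernel of the linearized Frobenius, whose matrix is \<open>H\<close>, is killed by \<open>I\<close>, there is a matrix
  \<open>K\<close> with \<open>H K = E\<close>. Its kernel is \<open>E\<close>-power torsion,
  so \<open>H (K H - E) = 0\<close> gives \<open>K H = E\<close> over \<open>A[1/E]\<close>.\<close>

lemma frob_mat_loc_GL:
  fixes A :: "('b, 'w, 'a) prism" and N :: "('b, 'm) module"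
  assumes fr: "framed A N n \<beta>" and \<phi>: "ring_hom_cring A A (phi p A)" and F: "frobenius_structure p A N F"
    and E: "E \<in> pI A" "E \<in> carrier A"
  shows "mmap n (loc_in A E) (framed.frob_mat A N n \<beta> F) \<in> GL n (loc A E)"
proof -
  interpret framed A N n \<beta> by (rule fr)
  interpret \<phi>: ring_hom_cring A A "phi p A" by (rule \<phi>)
  interpret L: localization A E by unfold_locales (rule E)
  have sl: "semilinear A (phi p A) N N F" using F by (simp add: frobenius_structure_def)
  note Fc = semilinearD(1)[OF sl]
  have F\<beta>: "F (\<beta> k) \<in> carrier N" if "k < n" for k using Fc that by simp
  let ?H = "frob_mat F"
  note H = frob_mat_closed[OF sl]
  \<comment> \<open>The cokernel condition for E and the vector \<open>\<beta> j\<close>. Writing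
    the preimages in the frame and using semilinearity turns E times \<open>\<beta> j\<close> into a
    combination of the vectors \<open>F (\<beta> l)\<close>.\<close>
  have "\<exists>w. (\<forall>l<n. w l \<in> carrier A) \<and> E \<odot>\<^bsub>N\<^esub> \<beta> j = lincomb n N (\<lambda>l. F (\<beta> l)) w" if j: "j < n" for j
  proof -
    have "\<exists>k b m. (\<forall>i<k. b i \<in> carrier A \<and> m i \<in> carrier N) \<and>
        E \<odot>\<^bsub>N\<^esub> \<beta> j = finsum N (\<lambda>i. b i \<odot>\<^bsub>N\<^esub> F (m i)) {..<(k::nat)}"
      using F E j \<beta>_closed[OF j] unfolding frobenius_structure_def by blast
    then obtain k :: nat and b m where b: "\<And>i. i < k \<Longrightarrow> b i \<in> carrier A" and m: "\<And>i. i < k \<Longrightarrow> m i \<in> carrier N"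
      and e: "E \<odot>\<^bsub>N\<^esub> \<beta> j = finsum N (\<lambda>i. b i \<odot>\<^bsub>N\<^esub> F (m i)) {..<k}" by blast
    have Fm: "F (m i) = lincomb n N (\<lambda>l. F (\<beta> l)) (\<lambda>l. phi p A (coord l (m i)))" if i: "i < k" for i
    proof -
      have "F (m i) = F (lincomb n N \<beta> (\<lambda>l. coord l (m i)))" using m[OF i] by (simp add: coord_lincomb)
      also have "\<dots> = lincomb n N (\<lambda>l. F (\<beta> l)) (\<lambda>l. phi p A (coord l (m i)))"
        using m[OF i] by (intro semilinear_lincomb[OF sl module_axioms \<phi>]) auto
      finally show ?thesis .
    qed
    have "E \<odot>\<^bsub>N\<^esub> \<beta> j = (\<Oplus>\<^bsub>N\<^esub>i\<in>{..<k}. b i \<odot>\<^bsub>N\<^esub> lincomb n N (\<lambda>l. F (\<beta> l)) (\<lambda>l. phi p A (coord l (m i))))"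
      unfolding e using b m Fc by (intro M.finsum_cong') (auto simp: Fm[symmetric])
    also have "\<dots> = lincomb n N (\<lambda>l. F (\<beta> l)) (\<lambda>l. \<Oplus>\<^bsub>A\<^esub>i\<in>{..<k}. phi p A (coord l (m i)) \<otimes>\<^bsub>A\<^esub> b i)"
      using b m F\<beta> by (intro lincomb_lincomb) auto
    finally have "E \<odot>\<^bsub>N\<^esub> \<beta> j = lincomb n N (\<lambda>l. F (\<beta> l)) (\<lambda>l. \<Oplus>\<^bsub>A\<^esub>i\<in>{..<k}. phi p A (coord l (m i)) \<otimes>\<^bsub>A\<^esub> b i)" .
    moreover have "(\<Oplus>\<^bsub>A\<^esub>i\<in>{..<k}. phi p A (coord l (m i)) \<otimes>\<^bsub>A\<^esub> b i) \<in> carrier A" if "l < n" for l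
      using that b m by (intro R.finsum_closed) auto
    ultimately show ?thesis by (intro exI[of _ "\<lambda>l. \<Oplus>\<^bsub>A\<^esub>i\<in>{..<k}. phi p A (coord l (m i)) \<otimes>\<^bsub>A\<^esub> b i"]) simp
  qed
  then obtain w where w: "\<And>j l. j < n \<Longrightarrow> l < n \<Longrightarrow> w j l \<in> carrier A"
    and Ew: "\<And>j. j < n \<Longrightarrow> E \<odot>\<^bsub>N\<^esub> \<beta> j = lincomb n N (\<lambda>l. F (\<beta> l)) (w j)"
    by metis
  \<comment> \<open>The coefficients of E times \<open>\<beta> j\<close> along the vectors
    \<open>F (\<beta> l)\<close> form column \<open>j\<close>.\<close>
  define K where "K = (\<lambda>(l, j)\<in>{..<n} \<times> {..<n}. w j l)"
  have K: "K \<in> mats n A" using w by (intro matsI) (auto simp: K_def)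
  have Kapp: "K (l, j) = w j l" if "l < n" "j < n" for l j using that by (simp add: K_def)
  have HK: "mmul n A ?H K (i, j) = (if i = j then E else \<zero>\<^bsub>A\<^esub>)" if ij: "i < n" "j < n" for i j
  proof -
    have "mmul n A ?H K (i, j) = (\<Oplus>\<^bsub>A\<^esub>k\<in>{..<n}. ?H (i, k) \<otimes>\<^bsub>A\<^esub> w j k)"
      unfolding R.mmul_app[OF ij] using ij H w by (intro R.finsum_cong') (auto simp: Kapp mats_app)
    also have "\<dots> = coord i (E \<odot>\<^bsub>N\<^esub> \<beta> j)"
      unfolding Ew[OF ij(2)] using ij w by (intro lincomb_F[OF sl, symmetric]) auto
    also have "\<dots> = (if i = j then E else \<zero>\<^bsub>A\<^esub>)" using ij E by (simp add: coord_smult coord_\<beta>)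
    finally show ?thesis .
  qed
  have HKH: "(\<Oplus>\<^bsub>A\<^esub>k\<in>{..<n}. ?H (i, k) \<otimes>\<^bsub>A\<^esub> mmul n A K ?H (k, j)) = E \<otimes>\<^bsub>A\<^esub> ?H (i, j)" if ij: "i < n" "j < n" for i j
  proof -
    have "(\<Oplus>\<^bsub>A\<^esub>k\<in>{..<n}. ?H (i, k) \<otimes>\<^bsub>A\<^esub> mmul n A K ?H (k, j)) = mmul n A (mmul n A ?H K) ?H (i, j)"
      unfolding R.mmul_assoc[OF H K H] by (simp add: R.mmul_app ij)
    also have "\<dots> = (\<Oplus>\<^bsub>A\<^esub>k\<in>{..<n}. (if i = k then \<one>\<^bsub>A\<^esub> else \<zero>\<^bsub>A\<^esub>) \<otimes>\<^bsub>A\<^esub> (E \<otimes>\<^bsub>A\<^esub> ?H (k, j)))"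
      unfolding R.mmul_app[OF ij] using ij H E by (intro R.finsum_cong') (auto simp: HK mats_app)
    also have "\<dots> = E \<otimes>\<^bsub>A\<^esub> ?H (i, j)" using ij H E by (intro R.finsum_if_mult_left) (auto simp: mats_app)
    finally show ?thesis .
  qed
  let ?Z = "\<lambda>j i. mmul n A K ?H (i, j) \<ominus>\<^bsub>A\<^esub> (if i = j then E else \<zero>\<^bsub>A\<^esub>)"
  have Zc: "mmul n A K ?H (i, j) \<in> carrier A" "(if i = j then E else \<zero>\<^bsub>A\<^esub>) \<in> carrier A" if "i < n" "j < n" for i j
    using that K H E mats_app[OF R.mmul_closed[OF K H]] by auto
  \<comment> \<open>Column \<open>j\<close> of \<open>K H - E\<close> is a linear relation between
    the vectors \<open>F (\<beta> i)\<close>. The kernel condition and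
    \<open>tensor_zero_frame\<close> show that a power of E kills its entries, and E is a unit after
    localization.\<close>
  have Z0: "loc_in A E (?Z j i) = \<zero>\<^bsub>loc A E\<^esub>" if ij: "i < n" "j < n" for i j
  proof -
    have "lincomb n N (\<lambda>k. F (\<beta> k)) (\<lambda>i. mmul n A K ?H (i, j)) = lincomb n N (\<lambda>k. F (\<beta> k)) (\<lambda>i. if i = j then E else \<zero>\<^bsub>A\<^esub>)"
    proof (rule coord_eqI)
      show "lincomb n N (\<lambda>k. F (\<beta> k)) (\<lambda>i. mmul n A K ?H (i, j)) \<in> carrier N"
        using F\<beta> Zc(1) ij by (intro lincomb_closed) auto
      show "lincomb n N (\<lambda>k. F (\<beta> k)) (\<lambda>i. if i = j then E else \<zero>\<^bsub>A\<^esub>) \<in> carrier N"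
        using F\<beta> Zc(2) ij by (intro lincomb_closed) auto
      fix m assume m: "m < n"
      have "coord m (lincomb n N (\<lambda>k. F (\<beta> k)) (\<lambda>i. if i = j then E else \<zero>\<^bsub>A\<^esub>)) =
        (\<Oplus>\<^bsub>A\<^esub>k\<in>{..<n}. ?H (m, k) \<otimes>\<^bsub>A\<^esub> (if k = j then E else \<zero>\<^bsub>A\<^esub>))"
        using Zc(2) ij m by (intro lincomb_F[OF sl]) auto
      also have "\<dots> = (\<Oplus>\<^bsub>A\<^esub>k\<in>{..<n}. (E \<otimes>\<^bsub>A\<^esub> ?H (m, k)) \<otimes>\<^bsub>A\<^esub> (if k = j then \<one>\<^bsub>A\<^esub> else \<zero>\<^bsub>A\<^esub>))"
        using H E m by (intro R.finsum_cong') (auto simp: mats_app R.m_comm)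
      also have "\<dots> = E \<otimes>\<^bsub>A\<^esub> ?H (m, j)" using ij m H E by (intro R.finsum_if_mult_right) (auto simp: mats_app)
      also have "\<dots> = coord m (lincomb n N (\<lambda>k. F (\<beta> k)) (\<lambda>i. mmul n A K ?H (i, j)))"
        unfolding HKH[OF m ij(2), symmetric] using Zc(1) ij m by (intro lincomb_F[OF sl, symmetric]) auto
      finally show "coord m (lincomb n N (\<lambda>k. F (\<beta> k)) (\<lambda>i. mmul n A K ?H (i, j))) =
         coord m (lincomb n N (\<lambda>k. F (\<beta> k)) (\<lambda>i. if i = j then E else \<zero>\<^bsub>A\<^esub>))" by simp
    qed
    then have z: "finsum N (\<lambda>i. ?Z j i \<odot>\<^bsub>N\<^esub> F (\<beta> i)) {..<n} = \<zero>\<^bsub>N\<^esub>"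
      using F\<beta> Zc ij by (intro lincomb_eq_diff) auto
    have c: "\<forall>i<n. ?Z j i \<in> carrier A \<and> \<beta> i \<in> carrier N" using Zc[OF _ ij(2)] R.minus_closed by simp
    have ker: "\<forall>k b m. (\<forall>i<k. b i \<in> carrier A \<and> m i \<in> carrier N) \<and>
        finsum N (\<lambda>i. b i \<odot>\<^bsub>N\<^esub> F (m i)) {..<k} = \<zero>\<^bsub>N\<^esub> \<longrightarrow>
        (\<forall>x\<in>pI A. \<exists>l::nat. tensor_zero A (phi p A) A N k (\<lambda>i. (x [^]\<^bsub>A\<^esub> l) \<otimes>\<^bsub>A\<^esub> b i) m)"
      using F unfolding frobenius_structure_def by (rule conjunct2[THEN conjunct2])
    obtain l :: nat where tz: "tensor_zero A (phi p A) A N n (\<lambda>i. (E [^]\<^bsub>A\<^esub> l) \<otimes>\<^bsub>A\<^esub> ?Z j i) \<beta>"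
      using bspec[OF mp[OF spec[OF spec[OF spec[OF ker, of n], of "?Z j"], of \<beta>] conjI[OF c z]] E(1)] by (rule exE)
    have Zcl: "?Z j i \<in> carrier A" if "i < n" for i using Zc[OF that ij(2)] by simp
    have "(E [^]\<^bsub>A\<^esub> l) \<otimes>\<^bsub>A\<^esub> ?Z j i = \<zero>\<^bsub>A\<^esub>"
      by (rule tensor_zero_frame[OF \<phi> _ tz ij(1)]) (use Zcl E in auto)
    then have "loc_in A E (E [^]\<^bsub>A\<^esub> l) \<otimes>\<^bsub>loc A E\<^esub> loc_in A E (?Z j i) = \<zero>\<^bsub>loc A E\<^esub>"
      using Zcl[OF ij(1)] E by (metis L.I.hom_mult L.I.hom_zero R.nat_pow_closed)
    moreover have u: "loc_in A E (E [^]\<^bsub>A\<^esub> l) \<in> Units (loc A E)"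
      using L.L.Units_pow_closed[OF L.loc_in_E_unit] E by (simp add: L.I.hom_pow)
    ultimately show ?thesis
      using Zcl[OF ij(1)] L.L.Units_l_cancel[OF u, of "loc_in A E (?Z j i)" "\<zero>\<^bsub>loc A E\<^esub>"] L.I.hom_closed by simp
  qed
  let ?in = "loc_in A E"
  let ?e = "inv\<^bsub>loc A E\<^esub> (?in E)"
  have e: "?e \<in> carrier (loc A E)" "?e \<otimes>\<^bsub>loc A E\<^esub> ?in E = \<one>\<^bsub>loc A E\<^esub>"
    using L.loc_in_E_unit by (auto simp: L.L.Units_l_inv)
  have KH: "?in (mmul n A K ?H (i, j)) = ?in (if i = j then E else \<zero>\<^bsub>A\<^esub>)" if ij: "i < n" "j < n" for i j
  proof (rule L.L.minus_eq_zeroD)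
    show "?in (mmul n A K ?H (i, j)) \<ominus>\<^bsub>loc A E\<^esub> ?in (if i = j then E else \<zero>\<^bsub>A\<^esub>) = \<zero>\<^bsub>loc A E\<^esub>"
      unfolding L.I.hom_minus[OF Zc[OF ij], symmetric] by (rule Z0[OF ij])
  qed (rule L.I.hom_closed[OF Zc(1)[OF ij]], rule L.I.hom_closed[OF Zc(2)[OF ij]])
  let ?Hl = "mmap n ?in ?H" and ?Kl = "mmap n ?in K"
  have cl: "?Hl \<in> mats n (loc A E)" "?Kl \<in> mats n (loc A E)" using H K by (auto intro: L.I.mmap_closed)
  have scl: "mmap n (\<lambda>x. ?e \<otimes>\<^bsub>loc A E\<^esub> x) k \<in> mats n (loc A E)" if "k \<in> mats n (loc A E)" for k
    using that e by (intro matsI) (auto simp: mmap_app mats_app, simp add: mmap_def)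
  have sc: "mmap n (\<lambda>x. ?e \<otimes>\<^bsub>loc A E\<^esub> x) (mmap n ?in k) = mone n (loc A E)"
    if k: "k \<in> mats n A" "\<And>i j. i < n \<Longrightarrow> j < n \<Longrightarrow> ?in (k (i, j)) = ?in (if i = j then E else \<zero>\<^bsub>A\<^esub>)" for k
  proof (rule mats_eqI[of _ n "loc A E" _ "loc A E"])
    fix i j assume ij: "i < n" "j < n"
    show "mmap n (\<lambda>x. ?e \<otimes>\<^bsub>loc A E\<^esub> x) (mmap n ?in k) (i, j) = mone n (loc A E) (i, j)"
      using ij e by (simp add: mmap_app k(2) L.L.mone_app)
  qed (use scl L.I.mmap_closed[OF k(1)] in auto)
  \<comment> \<open>The inverse is \<open>K\<close> divided by E, that is, scaled by the inverse
    \<open>?e\<close> of E in A[1/E].\<close>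
  show ?thesis
  proof (rule L.L.GLI[OF cl(1) scl[OF cl(2)]])
    show "mmul n (loc A E) ?Hl (mmap n (\<lambda>x. ?e \<otimes>\<^bsub>loc A E\<^esub> x) ?Kl) = mone n (loc A E)"
      unfolding L.L.mmul_mmap_scale(1)[OF cl e(1)] L.I.mmap_mmul[OF H K, symmetric]
      by (rule sc) (use H K HK in auto)
    show "mmul n (loc A E) (mmap n (\<lambda>x. ?e \<otimes>\<^bsub>loc A E\<^esub> x) ?Kl) ?Hl = mone n (loc A E)"
      unfolding L.L.mmul_mmap_scale(2)[OF cl(2,1) e(1)] L.I.mmap_mmul[OF K H, symmetric]
      by (rule sc) (use H K KH in auto)
  qed
qed

text \<open>The invariance equation is evaluated at coordinate functionals and frame vectors. Its
  left side expands in the vector slots and its right side in the functional slots, which gives the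
  two sides of the intertwining relation for \<open>H\<close>, already over A.\<close>

lemma frob_mat_fixes_tensor:
  fixes A :: "('b, 'w, 'a) prism" and N :: "('b, 'm) module"
  assumes fr: "framed A N n \<beta>" and F: "semilinear A (phi p A) N N F"
    and \<tau>: "mixed_tensor A N \<tau>" and inv: "frobenius_invariant p A N F \<tau>"
    and T: "\<And>is js. set is \<subseteq> {..<n} \<Longrightarrow> set js \<subseteq> {..<n} \<Longrightarrow> \<tau> (map (frame_coord n A N \<beta>) is) (map \<beta> js) = T is js"
    and \<phi>T: "\<And>is js. phi p A (T is js) = T is js" and Tc: "\<And>is js. T is js \<in> carrier A"
  shows "fixes_tensor n A T (framed.frob_mat A N n \<beta> F) a b"
  unfolding fixes_tensor_def
proof safe
  interpret framed A N n \<beta> by (rule fr)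
  fix "is" js assume ij: "is \<in> idxs n a" "js \<in> idxs n b"
  let ?H = "frob_mat F"
  note H = frob_mat_closed[OF F]
  note [simp] = R.tprod_closed[OF H, of _ a] R.tprod_closed[OF H, of _ b] Tc ij
  have sub: "set is \<subseteq> {..<n}" "set js \<subseteq> {..<n}" "length is = a" using ij by (auto simp: idxs_def)
  have ls: "map coord is \<in> lists (mdual A N)" using sub coord_mdual by (auto simp: subset_iff)
  have ms: "map \<beta> js \<in> lists (carrier N)" using sub by (auto simp: subset_iff)
  have "map F (map \<beta> js) = map (\<lambda>j. lincomb n N \<beta> (\<lambda>k. ?H (k, j))) js"
    using sub(2) by (auto simp: lincomb_frob_mat[OF F])
  then have "\<tau> (map coord is) (map F (map \<beta> js)) = \<tau> (map coord is) ([] @ map (\<lambda>j. lincomb n N \<beta> (\<lambda>k. ?H (k, j))) js)"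
    by (simp only: append_Nil)
  also have "\<dots> = (\<Oplus>\<^bsub>A\<^esub>ks\<in>idxs n b. tprod A ?H ks js \<otimes>\<^bsub>A\<^esub> \<tau> (map coord is) ([] @ map \<beta> ks))"
    by (rule mixed_tensor_expand[OF \<tau> ls H _ ij(2)]) simp
  also have "\<dots> = (\<Oplus>\<^bsub>A\<^esub>ks\<in>idxs n b. T is ks \<otimes>\<^bsub>A\<^esub> tprod A ?H ks js)"
  proof (rule R.finsum_cong')
    fix ks assume ks: "ks \<in> idxs n b"
    then have "set ks \<subseteq> {..<n}" by (simp add: idxs_def)
    then have "\<tau> (map coord is) ([] @ map \<beta> ks) = T is ks" using T sub(1) by simp
    then show "tprod A ?H ks js \<otimes>\<^bsub>A\<^esub> \<tau> (map coord is) ([] @ map \<beta> ks) = T is ks \<otimes>\<^bsub>A\<^esub> tprod A ?H ks js"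
      using ks by (simp only: R.m_comm Tc R.tprod_closed[OF H ks ij(2)])
  qed auto
  finally have 1: "\<tau> (map coord is) (map F (map \<beta> js)) = (\<Oplus>\<^bsub>A\<^esub>ks\<in>idxs n b. T is ks \<otimes>\<^bsub>A\<^esub> tprod A ?H ks js)" .
  \<comment> \<open>On the functional side the expansion is part of the invariance condition itself,
    taken for the dual basis that the frame forms with its coordinates.\<close>
  have "\<tau> (map coord is) (map F (map \<beta> js)) =
      finsum A (\<lambda>ks. finprod A (\<lambda>q. (map coord is ! q) (F (\<beta> (ks ! q)))) {..<length (map coord is)} \<otimes>\<^bsub>A\<^esub>
                phi p A (\<tau> (map coord ks) (map \<beta> js))) (idxs n (length (map coord is)))"
    using inv dual_basis_coord ls ms unfolding frobenius_invariant_def by blast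
  also have "\<dots> = (\<Oplus>\<^bsub>A\<^esub>ks\<in>idxs n a. tprod A ?H is ks \<otimes>\<^bsub>A\<^esub> T ks js)"
    unfolding length_map sub(3)
  proof (rule R.finsum_cong')
    fix ks assume ks: "ks \<in> idxs n a"
    then have sk: "set ks \<subseteq> {..<n}" "length ks = a" by (auto simp: idxs_def)
    have "finprod A (\<lambda>q. (map coord is ! q) (F (\<beta> (ks ! q)))) {..<a} = finprod A (\<lambda>q. ?H (is ! q, ks ! q)) {..<a}"
    proof (rule R.finprod_cong')
      have lt: "is ! q < n" "ks ! q < n" if "q \<in> {..<a}" for q
        using subsetD[OF sub(1) nth_mem[of q "is"]] subsetD[OF sk(1) nth_mem[of q ks]] that sub(3) sk(2) by auto
      show "(map coord is ! q) (F (\<beta> (ks ! q))) = ?H (is ! q, ks ! q)" if "q \<in> {..<a}" for q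
        using lt[OF that] that sub(3) by (simp add: frob_mat_app)
      show "(\<lambda>q. ?H (is ! q, ks ! q)) \<in> {..<a} \<rightarrow> carrier A" using lt mats_app[OF H] by auto
    qed simp
    also have "\<dots> = tprod A ?H is ks" by (rule R.finprod_tprod[OF H ij(1) ks])
    finally show "finprod A (\<lambda>q. (map coord is ! q) (F (\<beta> (ks ! q)))) {..<a} \<otimes>\<^bsub>A\<^esub> phi p A (\<tau> (map coord ks) (map \<beta> js))
      = tprod A ?H is ks \<otimes>\<^bsub>A\<^esub> T ks js"
      using T[OF sk(1) sub(2)] \<phi>T by simp
  qed auto
  finally show "(\<Oplus>\<^bsub>A\<^esub>ks\<in>idxs n b. T is ks \<otimes>\<^bsub>A\<^esub> tprod A ?H ks js) = (\<Oplus>\<^bsub>A\<^esub>ks\<in>idxs n a. tprod A ?H is ks \<otimes>\<^bsub>A\<^esub> T ks js)"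
    unfolding 1 .
qed

section \<open>Prisms and double cosets\<close>

text \<open>Here p may be a zero divisor, so the axioms of \<delta> are used as they stand. The sum
  subtracted in \<delta>(x + y), multiplied by p, is exactly what (x + y)^p has beyond x^p +
  y^p.\<close>

lemma phi_hom:
  assumes p: "Factorial_Ring.prime p" and A: "cring A" and d: "delta_ring p A (dl A)"
  shows "ring_hom_cring A A (phi p A)"
proof (rule ring_hom_cringI[OF A A], rule ring_hom_memI)
  interpret cring A by (rule A)
  have dc [simp]: "dl A x \<in> carrier A" if "x \<in> carrier A" for x using d that by (auto simp: delta_ring_def)
  have phi: "phi p A x = (x [^]\<^bsub>A\<^esub> p) \<oplus>\<^bsub>A\<^esub> rnat A p \<otimes>\<^bsub>A\<^esub> dl A x" if "x \<in> carrier A" for x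
    using that by (simp add: phi_def add_pow_rnat)
  fix x assume x: "x \<in> carrier A"
  then show "phi p A x \<in> carrier A" by (simp add: phi)
  fix y assume y: "y \<in> carrier A"
  note [simp] = x y
  have "dl A (x \<otimes>\<^bsub>A\<^esub> y) = ((x [^]\<^bsub>A\<^esub> p) \<otimes>\<^bsub>A\<^esub> dl A y) \<oplus>\<^bsub>A\<^esub> ((y [^]\<^bsub>A\<^esub> p) \<otimes>\<^bsub>A\<^esub> dl A x)
          \<oplus>\<^bsub>A\<^esub> add_pow A p (dl A x \<otimes>\<^bsub>A\<^esub> dl A y)"
    using d x y by (simp add: delta_ring_def)
  then have m: "dl A (x \<otimes>\<^bsub>A\<^esub> y) = ((x [^]\<^bsub>A\<^esub> p) \<otimes>\<^bsub>A\<^esub> dl A y) \<oplus>\<^bsub>A\<^esub> ((y [^]\<^bsub>A\<^esub> p) \<otimes>\<^bsub>A\<^esub> dl A x)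
          \<oplus>\<^bsub>A\<^esub> rnat A p \<otimes>\<^bsub>A\<^esub> (dl A x \<otimes>\<^bsub>A\<^esub> dl A y)"
    by (simp add: add_pow_rnat)
  show "phi p A (x \<otimes>\<^bsub>A\<^esub> y) = phi p A x \<otimes>\<^bsub>A\<^esub> phi p A y"
    by (simp add: phi m nat_pow_distrib l_distr r_distr m_ac a_ac)
  have a: "dl A (x \<oplus>\<^bsub>A\<^esub> y) = (dl A x \<oplus>\<^bsub>A\<^esub> dl A y) \<ominus>\<^bsub>A\<^esub> delta_add_sum p x y"
    using d x y by (simp add: delta_ring_def delta_add_sum_def)
  have cancel: "(u \<oplus>\<^bsub>A\<^esub> s) \<oplus>\<^bsub>A\<^esub> (v \<oplus>\<^bsub>A\<^esub> \<ominus>\<^bsub>A\<^esub> s) = u \<oplus>\<^bsub>A\<^esub> v"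
    if "u \<in> carrier A" "v \<in> carrier A" "s \<in> carrier A" for u v s
  proof -
    have "(u \<oplus>\<^bsub>A\<^esub> s) \<oplus>\<^bsub>A\<^esub> (v \<oplus>\<^bsub>A\<^esub> \<ominus>\<^bsub>A\<^esub> s) = (u \<oplus>\<^bsub>A\<^esub> v) \<oplus>\<^bsub>A\<^esub> (s \<oplus>\<^bsub>A\<^esub> \<ominus>\<^bsub>A\<^esub> s)"
      using that by (simp add: a_ac)
    then show ?thesis using that by (simp add: r_neg)
  qed
  have "phi p A (x \<oplus>\<^bsub>A\<^esub> y) = (((x [^]\<^bsub>A\<^esub> p) \<oplus>\<^bsub>A\<^esub> (y [^]\<^bsub>A\<^esub> p)) \<oplus>\<^bsub>A\<^esub> rnat A p \<otimes>\<^bsub>A\<^esub> delta_add_sum p x y) \<oplus>\<^bsub>A\<^esub>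
     ((rnat A p \<otimes>\<^bsub>A\<^esub> dl A x \<oplus>\<^bsub>A\<^esub> rnat A p \<otimes>\<^bsub>A\<^esub> dl A y) \<oplus>\<^bsub>A\<^esub> \<ominus>\<^bsub>A\<^esub> (rnat A p \<otimes>\<^bsub>A\<^esub> delta_add_sum p x y))"
    by (simp add: phi a power_prime_add[OF p] a_minus_def r_distr r_minus)
  also have "\<dots> = ((x [^]\<^bsub>A\<^esub> p) \<oplus>\<^bsub>A\<^esub> (y [^]\<^bsub>A\<^esub> p)) \<oplus>\<^bsub>A\<^esub> (rnat A p \<otimes>\<^bsub>A\<^esub> dl A x \<oplus>\<^bsub>A\<^esub> rnat A p \<otimes>\<^bsub>A\<^esub> dl A y)"
    by (rule cancel) auto
  finally show "phi p A (x \<oplus>\<^bsub>A\<^esub> y) = phi p A x \<oplus>\<^bsub>A\<^esub> phi p A y"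
    by (simp add: phi a_ac)
next
  interpret cring A by (rule A)
  show "phi p A \<one>\<^bsub>A\<^esub> = \<one>\<^bsub>A\<^esub>" using d by (simp add: phi_def delta_ring_def add_pow_rnat)
qed

lemma is_prismD:
  assumes "is_prism D A"
  shows "cring A" "cring (rbar A)" "strc A \<in> ring_hom (BW D) A" "complete_walg D (rbar A)"
    "delta_ring (pp D) A (dl A)" "\<And>w. w \<in> carrier (BW D) \<Longrightarrow> phi (pp D) A (strc A w) = strc A (sg D w)"
    "proj A \<in> walg_hom D A (rbar A)" "proj A ` carrier A = carrier (rbar A)" "cartier A (pI A)"
  using assms by (auto simp: is_prism_def complete_walg_def is_walg_def)

lemma phomD:
  assumes "f \<in> phom D A B"
  shows "f \<in> walg_hom D A B" "a \<in> carrier A \<Longrightarrow> f (dl A a) = dl B (f a)" "genideal B (f ` pI A) = pI B"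
  using assms by (auto simp: phom_def)

lemma phom_ring_hom: "is_prism D A \<Longrightarrow> is_prism D B \<Longrightarrow> f \<in> phom D A B \<Longrightarrow> ring_hom_cring A B f"
  by (intro walg_hom_ring_hom_cring is_prismD phomD)

text \<open>The condition J = I B in \<open>phom\<close> shows that I is mapped into J. Hence the
  map descends to the quotients and the description in \<open>rmap\<close> has a unique
  solution.\<close>

lemma rmap_walg_hom:
  assumes A: "is_prism D A" and B: "is_prism D B" and f: "f \<in> phom D A B"
  shows "rmap A B f \<in> walg_hom D (rbar A) (rbar B)"
proof -
  interpret f: ring_hom_cring A B f by (rule phom_ring_hom[OF A B f])
  interpret pA: ring_hom_cring A "rbar A" "proj A" by (rule walg_hom_ring_hom_cring[OF is_prismD(7)[OF A] is_prismD(1,2)[OF A]])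
  interpret pB: ring_hom_cring B "rbar B" "proj B" by (rule walg_hom_ring_hom_cring[OF is_prismD(7)[OF B] is_prismD(1,2)[OF B]])
  have pI: "f ` pI A \<subseteq> pI B"
  proof -
    have "f ` pI A \<subseteq> carrier B" by (auto simp: pI_def)
    then show ?thesis using f.S.genideal_self phomD(3)[OF f] by metis
  qed
  have wd: "proj B (f a) = proj B (f a')" if a: "a \<in> carrier A" "a' \<in> carrier A" "proj A a = proj A a'" for a a'
  proof -
    have "a \<ominus>\<^bsub>A\<^esub> a' \<in> pI A" using a by (simp add: pI_def pA.hom_minus pA.S.minus_self)
    then have "f (a \<ominus>\<^bsub>A\<^esub> a') \<in> pI B" using pI by blast
    then have "f a \<ominus>\<^bsub>B\<^esub> f a' \<in> pI B" by (simp only: f.hom_minus[OF a(1,2)])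
    then have "proj B (f a \<ominus>\<^bsub>B\<^esub> f a') = \<zero>\<^bsub>rbar B\<^esub>" by (simp add: pI_def)
    then have "proj B (f a) \<ominus>\<^bsub>rbar B\<^esub> proj B (f a') = \<zero>\<^bsub>rbar B\<^esub>"
      by (simp only: pB.hom_minus f.hom_closed a(1,2))
    then show ?thesis by (rule pB.S.minus_eq_zeroD[rotated 2]) (simp_all add: a(1,2))
  qed
  have app: "rmap A B f (proj A a) = proj B (f a)" if a: "a \<in> carrier A" for a
  proof -
    have "(THE z. \<exists>a'\<in>carrier A. proj A a' = proj A a \<and> z = proj B (f a')) = proj B (f a)"
    proof (rule the_equality)
      show "\<exists>a'\<in>carrier A. proj A a' = proj A a \<and> proj B (f a) = proj B (f a')" using a by (intro bexI[of _ a]) simp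
      fix z assume "\<exists>a'\<in>carrier A. proj A a' = proj A a \<and> z = proj B (f a')"
      then obtain a' where a': "a' \<in> carrier A" "proj A a' = proj A a" "z = proj B (f a')" by (elim bexE conjE)
      show "z = proj B (f a)" unfolding a'(3) by (rule wd[OF a'(1) a a'(2)])
    qed
    then show ?thesis using a by (simp add: rmap_def)
  qed
  have surj: "\<exists>a\<in>carrier A. x = proj A a" if "x \<in> carrier (rbar A)" for x
    using is_prismD(8)[OF A] that by blast
  have "rmap A B f \<in> ring_hom (rbar A) (rbar B)"
  proof (rule ring_hom_memI)
    fix x assume "x \<in> carrier (rbar A)"
    then obtain a where a: "a \<in> carrier A" "x = proj A a" using surj by blast
    show "rmap A B f x \<in> carrier (rbar B)" using a by (simp add: app)
    fix y assume "y \<in> carrier (rbar A)"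
    then obtain b where b: "b \<in> carrier A" "y = proj A b" using surj by blast
    show "rmap A B f (x \<otimes>\<^bsub>rbar A\<^esub> y) = rmap A B f x \<otimes>\<^bsub>rbar B\<^esub> rmap A B f y"
      using a b app[of "a \<otimes>\<^bsub>A\<^esub> b"] by (simp add: app)
    show "rmap A B f (x \<oplus>\<^bsub>rbar A\<^esub> y) = rmap A B f x \<oplus>\<^bsub>rbar B\<^esub> rmap A B f y"
      using a b app[of "a \<oplus>\<^bsub>A\<^esub> b"] by (simp add: app)
  next
    show "rmap A B f \<one>\<^bsub>rbar A\<^esub> = \<one>\<^bsub>rbar B\<^esub>" using app[of "\<one>\<^bsub>A\<^esub>"] by simp
  qed
  moreover have "rmap A B f (strc (rbar A) w) = strc (rbar B) w" if w: "w \<in> carrier (BW D)" for w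
    using app[OF ring_hom_closed[OF is_prismD(3)[OF A] w]] is_prismD(7)[OF A] is_prismD(7)[OF B] phomD(1)[OF f] w
    by (simp add: walg_hom_def)
  ultimately show ?thesis by (auto simp: walg_hom_def Rhom_def rmap_def)
qed

lemma psite_ppull:
  assumes Xf: "is_functor D Xf" and x: "(A, x) \<in> psite D Xf" and B: "is_prism D B" and f: "f \<in> phom D A B"
  shows "(B, ppull Xf A B f x) \<in> psite D Xf"
  using Xf x B rmap_walg_hom[OF _ B f] is_prismD(4)[OF B] is_prismD(4)[of D A]
  unfolding psite_def is_functor_def ppull_def by blast

section \<open>The Frobenius on the p-adic integers\<close>

lemma (in ring_hom_cring) hom_add_pow_int: "x \<in> carrier R \<Longrightarrow> h (add_pow R (m::int) x) = add_pow S m (h x)"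
  by (cases "m \<ge> 0") (auto simp: add_pow_int_ge add_pow_int_lt hom_add_pow not_le)

text \<open>Modulo each p^k an element of \<open>Zp\<close> is an integer, and the Frobenius fixes
  integers and preserves the powers of (p). So \<open>sg D w - w\<close> lies in all these powers,
  and W is separated.\<close>

lemma sg_Zp:
  assumes W: "witt_base D" and w: "w \<in> carrier (Zp D)"
  shows "sg D w = w"
proof -
  interpret s: ring_hom_cring "BW D" "BW D" "sg D"
    using W by (intro ring_hom_cringI Rhom_ring_hom) (auto simp: witt_base_def)
  let ?I = "p_ideal (pp D) (BW D)"
  have I: "ideal ?I (BW D)" unfolding p_ideal_def by (rule s.R.cgenideal_ideal) simp
  have sI: "sg D ` ?I \<subseteq> ?I" "?I \<subseteq> carrier (BW D)"
    by (auto simp: p_ideal_def s.R.mem_PIdl s.hom_rnat intro!: bexI[of _ "sg D b" for b])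
  have wc: "w \<in> carrier (BW D)" using w by (simp add: Zp_def)
  show ?thesis
  proof (rule s.R.adic_separated[of ?I])
    show "adic_complete (BW D) ?I" using W by (simp add: witt_base_def)
    fix k
    interpret J: ideal "ipow (BW D) ?I k" "BW D" by (rule s.R.ipow_ideal[OF I])
    obtain m :: int where m: "w \<ominus>\<^bsub>BW D\<^esub> add_pow (BW D) m \<one>\<^bsub>BW D\<^esub> \<in> ipow (BW D) ?I k"
      using w by (auto simp: Zp_def)
    let ?m = "add_pow (BW D) m \<one>\<^bsub>BW D\<^esub>"
    have mc: "?m \<in> carrier (BW D)"
      by (cases "m \<ge> 0") (auto simp: add_pow_int_ge add_pow_int_lt not_le)
    have "sg D (w \<ominus>\<^bsub>BW D\<^esub> ?m) \<in> ipow (BW D) ?I k"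
      using s.hom_ipow[OF sI m] by simp
    then have sm: "sg D w \<ominus>\<^bsub>BW D\<^esub> ?m \<in> ipow (BW D) ?I k"
      using wc mc by (simp add: s.hom_minus s.hom_add_pow_int)
    have "sg D w \<ominus>\<^bsub>BW D\<^esub> w = (sg D w \<ominus>\<^bsub>BW D\<^esub> ?m) \<oplus>\<^bsub>BW D\<^esub> \<ominus>\<^bsub>BW D\<^esub> (w \<ominus>\<^bsub>BW D\<^esub> ?m)"
      using wc mc by (simp add: a_minus_def s.R.minus_add s.R.a_ac s.R.r_neg1 s.R.r_neg)
    then show "sg D w \<ominus>\<^bsub>BW D\<^esub> w \<in> ipow (BW D) ?I k"
      using sm m by (simp add: J.a_closed J.a_inv_closed)
  qed (use I wc in auto)
qed

text \<open>Multiplying \<open>a\<close> successively by high powers of the \<open>s \<in> S\<close> that do not kill it yet, one reaches an element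
  killed by all of \<open>S\<close>.\<close>

lemma (in cring) power_torsion_zero:
  assumes "finite S" "S \<subseteq> carrier R" "genideal R S = carrier R" and a: "a \<in> carrier R"
    and t: "\<And>s. s \<in> S \<Longrightarrow> \<exists>k::nat. (s [^] k) \<otimes> a = \<zero>"
  shows "a = \<zero>"
proof (rule ccontr)
  assume a0: "a \<noteq> \<zero>"
  have "\<exists>b\<in>carrier R. b \<noteq> \<zero> \<and> (\<forall>s\<in>S'. s \<otimes> b = \<zero>) \<and> (\<forall>s\<in>S. \<exists>k::nat. (s [^] k) \<otimes> b = \<zero>)" if "S' \<subseteq> S" "finite S'" for S'
    using that(2,1)
  proof (induction S')
    case empty
    then show ?case using a a0 t by auto
  next
    case (insert s S')
    then obtain b where b: "b \<in> carrier R" "b \<noteq> \<zero>" "\<forall>s\<in>S'. s \<otimes> b = \<zero>" "\<forall>s\<in>S. \<exists>k::nat. (s [^] k) \<otimes> b = \<zero>" by auto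
    have sc: "s \<in> carrier R" "s \<in> S" using insert assms(2) by auto
    \<comment> \<open>The least exponent for which \<open>s^k\<close> kills \<open>b\<close>. It is
      positive, so \<open>s^(k - 1) b\<close> is nonzero and killed by \<open>s\<close>; by
      commutativity it is still killed by the elements treated before.\<close>
    define k where "k = (LEAST k::nat. (s [^] k) \<otimes> b = \<zero>)"
    have k: "(s [^] k) \<otimes> b = \<zero>" unfolding k_def using b(4) sc(2) by (metis (mono_tags, lifting) LeastI_ex)
    have "k \<noteq> 0" using k b(1,2) by (auto intro: ccontr)
    then obtain m where m: "k = Suc m" using not0_implies_Suc by blast
    have c0: "(s [^] m) \<otimes> b \<noteq> \<zero>" using not_less_Least[of m "\<lambda>k. (s [^] k) \<otimes> b = \<zero>"] m by (auto simp: k_def[symmetric])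
    let ?c = "(s [^] m) \<otimes> b"
    have "s \<otimes> ?c = \<zero>" using k sc b(1) by (simp add: m m_ac)
    moreover have "s' \<otimes> ?c = \<zero>" if "s' \<in> S'" for s'
    proof -
      have "s' \<in> carrier R" using that insert assms(2) by auto
      then have "s' \<otimes> ?c = (s [^] m) \<otimes> (s' \<otimes> b)" using sc b(1) by (simp add: m_ac)
      then show ?thesis using b(3) that sc by simp
    qed
    moreover have "\<exists>k::nat. (s' [^] k) \<otimes> ?c = \<zero>" if s'S: "s' \<in> S" for s'
    proof -
      obtain k :: nat where "(s' [^] k) \<otimes> b = \<zero>" using bspec[OF b(4) s'S] by (rule exE)
      moreover have "s' \<in> carrier R" using s'S assms(2) by auto
      ultimately have "(s' [^] k) \<otimes> ?c = \<zero>" using sc b(1) by (simp add: m_lcomm[of "s' [^] k"])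
      then show ?thesis by blast
    qed
    ultimately show ?case using c0 sc b(1) by (intro bexI[of _ ?c]) auto
  qed
  from this[of S] obtain b where b: "b \<in> carrier R" "b \<noteq> \<zero>" "\<forall>s\<in>S. s \<otimes> b = \<zero>" using assms(1) by auto
  \<comment> \<open>The annihilator of \<open>b\<close> is an ideal that contains S, hence contains
    1, although \<open>b\<close> is nonzero.\<close>
  have "ideal {x \<in> carrier R. x \<otimes> b = \<zero>} R"
  proof (rule idealI[OF ring_axioms])
    show "subgroup {x \<in> carrier R. x \<otimes> b = \<zero>} (add_monoid R)"
      using b(1) by (intro add.subgroupI) (auto simp: l_distr l_minus a_inv_def[symmetric])
    fix a x assume "a \<in> {x \<in> carrier R. x \<otimes> b = \<zero>}" and x: "x \<in> carrier R"
    then have a: "a \<in> carrier R" "a \<otimes> b = \<zero>" by auto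
    show "x \<otimes> a \<in> {x \<in> carrier R. x \<otimes> b = \<zero>}" using a x b(1) by (simp add: m_assoc)
    then show "a \<otimes> x \<in> {x \<in> carrier R. x \<otimes> b = \<zero>}" using m_comm[OF a(1) x] by simp
  qed
  then have "genideal R S \<subseteq> {x \<in> carrier R. x \<otimes> b = \<zero>}"
    using b(3) assms(2) by (intro genideal_minimal) auto
  then have "\<one> \<otimes> b = \<zero>" using assms(3) by auto
  then show False using b by simp
qed

text \<open>The local generators in \<open>cartier\<close> are multiples of \<open>d\<close>. So
  \<open>d a = 0\<close> forces powers of every \<open>s\<close> in the cover to kill
  \<open>a\<close>, and these \<open>s\<close> generate the unit ideal.\<close>

lemma (in cring) cartier_generator_nonzerodivisor:
  assumes c: "cartier R (PIdl d)" and d: "d \<in> carrier R" and a: "a \<in> carrier R" "d \<otimes> a = \<zero>"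
  shows "a = \<zero>"
proof -
  obtain S where S: "finite S" "S \<subseteq> carrier R" "genideal R S = carrier R"
    and t: "\<forall>s\<in>S. \<exists>e\<in>PIdl d. (\<forall>x\<in>PIdl d. \<exists>k::nat. (s [^] k) \<otimes> x \<in> PIdl e) \<and>
        (\<forall>a\<in>carrier R. e \<otimes> a = \<zero> \<longrightarrow> (\<exists>k::nat. (s [^] k) \<otimes> a = \<zero>))"
    using c unfolding cartier_def by blast
  show ?thesis
  proof (rule power_torsion_zero[OF S a(1)])
    fix s assume "s \<in> S"
    then obtain e where e: "e \<in> PIdl d" "\<forall>a\<in>carrier R. e \<otimes> a = \<zero> \<longrightarrow> (\<exists>k::nat. (s [^] k) \<otimes> a = \<zero>)" using t by blast
    obtain b where "b \<in> carrier R" "e = b \<otimes> d" using e(1) by (auto simp: mem_PIdl)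
    then have "e \<otimes> a = \<zero>" using a d by (simp add: m_assoc)
    then show "\<exists>k::nat. (s [^] k) \<otimes> a = \<zero>" using e(2) a(1) by blast
  qed
qed

text \<open>Writing each generator as a multiple of the other gives d (1 - u v) = 0, and
  \<open>d\<close> is a nonzerodivisor.\<close>

lemma (in cring) same_PIdl_unit:
  assumes c: "cartier R (PIdl d)" and de: "d \<in> carrier R" "e \<in> carrier R" "PIdl d = PIdl e"
  obtains u where "u \<in> Units R" "d = u \<otimes> e"
proof -
  have "d \<in> PIdl e" "e \<in> PIdl d" using cgenideal_self de by auto
  then obtain u v where u: "u \<in> carrier R" "d = u \<otimes> e" and v: "v \<in> carrier R" "e = v \<otimes> d"
    by (auto simp: mem_PIdl)
  have "d \<otimes> (\<one> \<ominus> u \<otimes> v) = d \<ominus> u \<otimes> (v \<otimes> d)"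
    using de u(1) v(1) by (simp add: a_minus_def r_distr r_minus m_ac)
  also have "u \<otimes> (v \<otimes> d) = d" by (simp only: v(2)[symmetric] u(2)[symmetric])
  also have "d \<ominus> d = \<zero>" using de(1) by (rule minus_self)
  finally have "\<one> \<ominus> u \<otimes> v = \<zero>"
    by (rule cartier_generator_nonzerodivisor[OF c de(1) minus_closed[OF one_closed m_closed[OF u(1) v(1)]]])
  then have "u \<otimes> v = \<one>" using u(1) v(1) by (metis minus_eq_zeroD m_closed one_closed)
  then show thesis using that[OF UnitsI[OF u(1) v(1)] u(2)] by blast
qed

text \<open>Replacing a generator \<open>d\<close> of \<open>I\<close> by \<open>e = u\<^sup>-\<^sup>1 d\<close>: the isomorphism \<open>B[1/d] = B[1/e]\<close> maps
  \<open>\<mu>(d)\<close> to \<open>\<mu>(u) \<mu>(e)\<close>, and \<open>\<mu>(u) \<in> \<G>(B)\<close>.\<close>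

lemma double_coset_change_generator:
  fixes B :: "('b, 'w, 'k) walg_scheme"
  assumes W: "cring (BW D)" and B: "cring B" "strc B \<in> ring_hom (BW D) B" and mu: "cocharacter D" and T: "integral_tensors D"
    and u: "u \<in> Units B" and e: "e \<in> carrier B" and d: "d = u \<otimes>\<^bsub>B\<^esub> e"
    and N: "N \<in> mats (rk D) B" and dc: "mmap (rk D) (loc_in B d) N \<in> double_coset D B d"
  shows "mmap (rk D) (loc_in B e) N \<in> double_coset D B e"
proof -
  interpret B: cring B by (rule B)
  have dcl: "d \<in> carrier B" using u e d by auto
  interpret Ld: localization B d by unfold_locales (rule dcl)
  interpret Le: localization B e by unfold_locales (rule e)
  let ?n = "rk D" and ?s = "strc B" and ?Le = "loc B e" and ?i = "loc_in B e"
  let ?se = "\<lambda>w. ?i (?s w)" and ?sd = "\<lambda>w. loc_in B d (?s w)"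
  have s: "ring_hom_cring (BW D) B ?s" by (rule ring_hom_cringI[OF W B])
  have comp: "ring_hom_cring (BW D) C (\<lambda>w. f (?s w))" if "ring_hom_cring B C f" for C :: "('x, 'y) ring_scheme" and f
  proof -
    interpret f: ring_hom_cring B C f by fact
    show ?thesis using ring_hom_trans[OF B(2) f.homh] by (intro ring_hom_cringI W f.S.is_cring) (simp add: comp_def)
  qed
  note se = comp[OF Le.I.ring_hom_cring_axioms] and sd = comp[OF Ld.I.ring_hom_cring_axioms]
  have iu: "?i u \<in> Units ?Le" by (rule Le.I.hom_Units[OF u])
  have id: "?i d \<in> Units ?Le"
    using Le.L.Units_m_closed[OF iu Le.loc_in_E_unit] B.Units_closed[OF u] e by (simp add: d)
  \<comment> \<open>The image of d in B[1/e] is a product of two units, so the universal property of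
    B[1/d] applies and gives a map compatible with the maps from B.\<close>
  obtain \<psi> where \<psi>: "\<psi> \<in> ring_hom (loc B d) ?Le" "\<And>a. a \<in> carrier B \<Longrightarrow> \<psi> (loc_in B d a) = ?i a"
    by (rule Ld.loc_extend[OF Le.I.ring_hom_cring_axioms id]) blast
  interpret \<psi>: ring_hom_cring "loc B d" ?Le \<psi> by (rule ring_hom_cringI[OF Ld.cring_loc Le.cring_loc \<psi>(1)])
  have \<psi>m: "mmap ?n \<psi> (mmap ?n (loc_in B d) k) = mmap ?n ?i k" if "k \<in> mats ?n B" for k
    unfolding mmap_mmap using \<psi>(2) mats_app[OF that] by (intro mmap_cong) auto
  obtain g h where g: "g \<in> grp D B ?s" and h: "h \<in> grp D B ?s"
    and Ngh: "mmap ?n (loc_in B d) N = mmul ?n (loc B d) (mmul ?n (loc B d) (mmap ?n (loc_in B d) g) (mu_at D (loc B d) ?sd (loc_in B d d))) (mmap ?n (loc_in B d) h)"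
    using dc unfolding double_coset_def by blast
  have Tc: "strc B (T0 D t is js) \<in> carrier B" if "t \<in> TI D" for t "is" js
    using ring_hom_closed[OF B(2) T0_closed[OF s mu T that]] .
  have gm: "g \<in> mats ?n B" and hm: "h \<in> mats ?n B" using g h by (simp_all add: grp_def GL_def)
  define m where "m = mu_at D B ?s u"
  have m: "m \<in> grp D B ?s" unfolding m_def by (rule mu_at_grp[OF s mu T u])
  have mm: "m \<in> mats ?n B" using m by (simp add: grp_def GL_def)
  have mud: "mu_at D (loc B d) ?sd (loc_in B d d) \<in> mats ?n (loc B d)"
    using mu_at_grp[OF sd mu T Ld.loc_in_E_unit] by (simp add: grp_def GL_def)
  have mue: "mu_at D ?Le ?se (?i e) \<in> mats ?n ?Le"
    using mu_at_grp[OF se mu T Le.loc_in_E_unit] by (simp add: grp_def GL_def)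
  have "mmap ?n \<psi> (mu_at D (loc B d) ?sd (loc_in B d d)) = mu_at D ?Le ?se (\<psi> (loc_in B d d))"
    by (rule mu_at_hom[OF sd mu T \<psi>.ring_hom_cring_axioms Ld.loc_in_E_unit])
      (use \<psi>(2) ring_hom_closed[OF B(2)] in auto)
  also have "\<psi> (loc_in B d d) = ?i u \<otimes>\<^bsub>?Le\<^esub> ?i e"
    using \<psi>(2)[OF dcl] B.Units_closed[OF u] e by (simp add: d)
  also have "mu_at D ?Le ?se (?i u \<otimes>\<^bsub>?Le\<^esub> ?i e) = mmul ?n ?Le (mu_at D ?Le ?se (?i u)) (mu_at D ?Le ?se (?i e))"
    by (rule mu_at_mult[OF se mu T iu Le.loc_in_E_unit])
  also have "mu_at D ?Le ?se (?i u) = mmap ?n ?i m"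
    unfolding m_def by (rule mu_at_hom[OF s mu T Le.I.ring_hom_cring_axioms u, symmetric]) simp
  finally have \<psi>mu: "mmap ?n \<psi> (mu_at D (loc B d) ?sd (loc_in B d d)) = mmul ?n ?Le (mmap ?n ?i m) (mu_at D ?Le ?se (?i e))" .
  note cl = Ld.I.mmap_closed[OF gm] Ld.I.mmap_closed[OF hm] Le.I.mmap_closed[OF gm] Le.I.mmap_closed[OF mm]
  \<comment> \<open>\<open>\<psi>\<close> transports the factorization over B[1/d]; the factor
    \<mu>(u), which has entries in B, then joins \<open>g\<close>.\<close>
  have "mmap ?n ?i N = mmap ?n \<psi> (mmap ?n (loc_in B d) N)" by (rule \<psi>m[OF N, symmetric])
  also have "\<dots> = mmul ?n ?Le (mmul ?n ?Le (mmap ?n ?i g) (mmul ?n ?Le (mmap ?n ?i m) (mu_at D ?Le ?se (?i e)))) (mmap ?n ?i h)"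
    unfolding Ngh using cl mud
    by (simp add: \<psi>.mmap_mmul Ld.L.mmul_closed \<psi>m gm hm \<psi>mu)
  also have "mmul ?n ?Le (mmap ?n ?i g) (mmul ?n ?Le (mmap ?n ?i m) (mu_at D ?Le ?se (?i e))) =
     mmul ?n ?Le (mmap ?n ?i (mmul ?n B g m)) (mu_at D ?Le ?se (?i e))"
    unfolding Le.I.mmap_mmul[OF gm mm] using cl mue by (intro Le.L.mmul_assoc[symmetric])
  finally show ?thesis
    unfolding double_coset_def using grp_mmul[OF B(1) Tc g m] h by blast
qed

section \<open>The map to \<open>\<^bold>C\<close>\<close>

locale prismatic_setting =
  fixes D :: "('w, 'i) group_datum" and Xf :: "('a, 'w, 'x) space"
    and M :: "(nat \<Rightarrow> 'a, 'w, 'a, 'x, 'm) crystal"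
    and T :: "'i \<Rightarrow> (nat \<Rightarrow> 'a, 'w, 'a) prism \<Rightarrow> 'x \<Rightarrow> ('m \<Rightarrow> nat \<Rightarrow> 'a) list \<Rightarrow> 'm list \<Rightarrow> nat \<Rightarrow> 'a"
  assumes prime: "Factorial_Ring.prime (pp D)" and witt: "witt_base D" and tensors: "integral_tensors D"
    and cochar: "cocharacter D" and Xf: "is_functor D Xf"
    and crystal: "prismatic_F_crystal D Xf M" and ctensors: "crystal_tensors D Xf M T"
    and type_mu: "prismatic_torsor_of_type_mu D Xf M T"
begin

abbreviation "n \<equiv> rk D"

lemma W: "cring (BW D)"
  using witt by (simp add: witt_base_def)

lemma T0_Zp: "t \<in> TI D \<Longrightarrow> T0 D t is js \<in> carrier (Zp D)"
  using tensors by (simp add: integral_tensors_def)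

lemma T0_BW: "t \<in> TI D \<Longrightarrow> T0 D t is js \<in> carrier (BW D)"
  using T0_Zp[of t "is" js] by (simp add: Zp_def)

lemma psite_prism: "(A, x) \<in> psite D Xf \<Longrightarrow> is_prism D A"
  by (simp add: psite_def)

text \<open>\<phi> acts on the image of W through \<sigma>, and \<sigma> fixes the coordinates of
  the tensors because they lie in \<open>Zp\<close>.\<close>

lemma strc_T0:
  assumes "is_prism D A" "t \<in> TI D"
  shows "strc A (T0 D t is js) \<in> carrier A" "phi (pp D) A (strc A (T0 D t is js)) = strc A (T0 D t is js)"
  using is_prismD(3,6)[OF assms(1)] T0_BW[OF assms(2)] sg_Zp[OF witt T0_Zp[OF assms(2)]]
  by (auto intro: ring_hom_closed)

lemma phi_ring_hom: "is_prism D A \<Longrightarrow> ring_hom_cring A A (phi (pp D) A)"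
  by (intro phi_hom[OF prime] is_prismD)

section \<open>Trivializations over one prism and their pullbacks\<close>

context
  fixes A :: "(nat \<Rightarrow> 'a, 'w, 'a) prism" and x assumes Ax: "(A, x) \<in> psite D Xf"
begin

lemma crystal_at:
  "module A (Mdl M A x)" "frobenius_structure (pp D) A (Mdl M A x) (Frob M A x)"
  "semilinear A (phi (pp D) A) (Mdl M A x) (Mdl M A x) (Frob M A x)"
  using crystal Ax by (auto simp: prismatic_F_crystal_def frobenius_structure_def)

lemma crystal_base_change:
  assumes "is_prism D B" "f \<in> phom D A B"
  shows "base_change A f B (Mdl M A x) (Mdl M B (ppull Xf A B f x)) (bc M A x B f)"
    and "u \<in> carrier (Mdl M A x) \<Longrightarrow> bc M A x B f (Frob M A x u) = Frob M B (ppull Xf A B f x) (bc M A x B f u)"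
  using crystal Ax assms unfolding prismatic_F_crystal_def by blast+

lemma framed_isom:
  assumes \<beta>: "\<beta> \<in> isom_torsor D M T A x"
  shows "framed A (Mdl M A x) n \<beta>"
  using \<beta> crystal_at(1) by (auto simp: isom_torsor_def framed_def framed_axioms_def plain_module_def)

lemma trivialized_eq:
  assumes \<beta>: "\<beta> \<in> isom_torsor D M T A x"
  shows "trivialized_frobenius D M A x E \<beta> = mmap n (loc_in A E) (framed.frob_mat A (Mdl M A x) n \<beta> (Frob M A x))"
proof -
  interpret framed A "Mdl M A x" n \<beta> by (rule framed_isom[OF \<beta>])
  show ?thesis
    by (auto simp: trivialized_frobenius_def mmap_def frob_mat_def restrict_def fun_eq_iff)
qed

lemma frob_mat_mats:
  assumes \<beta>: "\<beta> \<in> isom_torsor D M T A x"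
  shows "framed.frob_mat A (Mdl M A x) n \<beta> (Frob M A x) \<in> mats n A"
  using framed.frob_mat_closed[OF framed_isom[OF \<beta>] crystal_at(3)] .

text \<open>The two conditions arise over different rings: the tensor relation holds over A and is
  carried to A[1/E], while invertibility is obtained after inverting E.\<close>

lemma trivialized_grp:
  assumes \<beta>: "\<beta> \<in> isom_torsor D M T A x" and E: "E \<in> pI A"
  shows "trivialized_frobenius D M A x E \<beta> \<in> grp D (loc A E) (\<lambda>w. loc_in A E (strc A w))"
proof -
  note A = psite_prism[OF Ax]
  interpret framed A "Mdl M A x" n \<beta> by (rule framed_isom[OF \<beta>])
  have Ec: "E \<in> carrier A" using E by (simp add: pI_def)
  interpret L: localization A E by unfold_locales (rule Ec)
  let ?H = "frob_mat (Frob M A x)"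
  have H: "?H \<in> mats n A" by (rule frob_mat_mats[OF \<beta>])
  have GL: "mmap n (loc_in A E) ?H \<in> GL n (loc A E)"
    by (rule frob_mat_loc_GL[OF framed_isom[OF \<beta>] phi_ring_hom[OF A] crystal_at(2) E Ec])
  have fx: "fixes_tensor n (loc A E) (\<lambda>is js. loc_in A E (strc A (T0 D t is js))) (mmap n (loc_in A E) ?H) a b"
    if t: "t \<in> TI D" for t a b
  proof -
    have ct: "mixed_tensor A (Mdl M A x) (T t A x)" "frobenius_invariant (pp D) A (Mdl M A x) (Frob M A x) (T t A x)"
      using ctensors Ax t unfolding crystal_tensors_def by blast+
    have "fixes_tensor n A (\<lambda>is js. strc A (T0 D t is js)) ?H a b"
      by (rule frob_mat_fixes_tensor[OF framed_isom[OF \<beta>] crystal_at(3) ct])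
        (use \<beta> t strc_T0[OF A t] in \<open>auto simp: isom_torsor_def\<close>)
    then show ?thesis using strc_T0[OF A t] by (intro L.I.hom_fixes_tensor H) auto
  qed
  have c: "loc_in A E (strc A (T0 D t is js)) \<in> carrier (loc A E)" if "t \<in> TI D" for t "is" js
    using strc_T0(1)[OF A that] by simp
  show ?thesis
    unfolding trivialized_eq[OF \<beta>] using GL fx grp_iff[OF L.cring_loc, of D "\<lambda>w. loc_in A E (strc A w)"] c by blast
qed

lemma isom_act:
  assumes \<beta>: "\<beta> \<in> isom_torsor D M T A x"
  shows "bij_betw (frame_act D (Mdl M A x) \<beta>) (grp D A (strc A)) (isom_torsor D M T A x)"
  using type_mu Ax \<beta> unfolding prismatic_torsor_of_type_mu_def by blast

lemma frob_mat_isom_act: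
  assumes \<beta>: "\<beta> \<in> isom_torsor D M T A x" and g: "g \<in> grp D A (strc A)"
  shows "framed.frob_mat A (Mdl M A x) n (frame_act D (Mdl M A x) \<beta> g) (Frob M A x) =
    mmul n A (minv n A g) (mmul n A (framed.frob_mat A (Mdl M A x) n \<beta> (Frob M A x)) (mmap n (phi (pp D) A) g))"
proof -
  have \<gamma>: "frame_act D (Mdl M A x) \<beta> g \<in> isom_torsor D M T A x"
    using isom_act[OF \<beta>] g by (auto simp: bij_betw_def)
  show ?thesis
    by (rule framed.frob_mat_act[OF framed_isom[OF \<beta>] crystal_at(3) phi_ring_hom[OF psite_prism[OF Ax]] _ framed_isom[OF \<gamma>]])
      (use g in \<open>auto simp: grp_def frame_act_def\<close>)
qed

text \<open>In the formula of \<phi>-conjugation, \<phi>(g) is formed over A and then mapped to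
  A[1/E]; this is how the twisted action makes sense although \<phi> need not extend to
  A[1/E].\<close>

lemma trivialized_act:
  assumes \<beta>: "\<beta> \<in> isom_torsor D M T A x" and g: "g \<in> grp D A (strc A)" and E: "E \<in> carrier A"
  shows "trivialized_frobenius D M A x E (frame_act D (Mdl M A x) \<beta> g) =
    mmul n (loc A E) (mmul n (loc A E) (mmap n (loc_in A E) (minv n A g)) (trivialized_frobenius D M A x E \<beta>))
      (mmap n (loc_in A E) (mmap n (phi (pp D) A) g))"
proof -
  note A = psite_prism[OF Ax]
  interpret localization A E using is_prismD(1)[OF A] E by (simp add: localization_def localization_axioms_def)
  interpret \<phi>: ring_hom_cring A A "phi (pp D) A" by (rule phi_ring_hom[OF A])
  have \<gamma>: "frame_act D (Mdl M A x) \<beta> g \<in> isom_torsor D M T A x"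
    using isom_act[OF \<beta>] g by (auto simp: bij_betw_def)
  have gG: "g \<in> GL n A" using g by (simp add: grp_def)
  note m = minv(1)[OF gG] frob_mat_mats[OF \<beta>] \<phi>.mmap_closed[OF GL_mats[OF gG]]
  show ?thesis
    unfolding trivialized_eq[OF \<beta>] trivialized_eq[OF \<gamma>] frob_mat_isom_act[OF \<beta> g]
    using m by (simp add: I.mmap_mmul I.mmap_closed L.mmul_assoc)
qed

context
  fixes B :: "(nat \<Rightarrow> 'a, 'w, 'a) prism" and f assumes B: "is_prism D B" and f: "f \<in> phom D A B"
begin

text \<open>The coordinates in the pulled back frame extend the original ones along
  \<open>f\<close>. This is the compatibility of functionals that \<open>crystal_tensors\<close>
  asks for when it compares the tensors over the two prisms.\<close>

lemma frame_pull_isom: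
  assumes \<beta>: "\<beta> \<in> isom_torsor D M T A x"
  shows "frame_pull D M A x B f \<beta> \<in> isom_torsor D M T B (ppull Xf A B f x)"
proof -
  note A = psite_prism[OF Ax]
  let ?x = "ppull Xf A B f x"
  let ?N = "Mdl M A x" and ?N' = "Mdl M B ?x" and ?r = "bc M A x B f"
  have Bx: "(B, ?x) \<in> psite D Xf" by (rule psite_ppull[OF Xf Ax B f])
  have mB: "module B ?N'" using crystal Bx by (auto simp: prismatic_F_crystal_def)
  interpret framed A ?N n \<beta> by (rule framed_isom[OF \<beta>])
  have fh: "ring_hom_cring A B f" by (rule phom_ring_hom[OF A B f])
  note bc = crystal_base_change[OF B f]
  let ?\<gamma> = "\<lambda>i\<in>{..<n}. ?r (\<beta> i)"
  have \<gamma>: "frame_pull D M A x B f \<beta> = ?\<gamma>" by (simp add: frame_pull_def)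
  interpret G: framed B ?N' n ?\<gamma> by (rule frame_base_change(1)[OF fh mB bc(1)])
  have "T t B ?x (map (frame_coord n B ?N' ?\<gamma>) is) (map ?\<gamma> js) = strc B (T0 D t is js)"
    if t: "t \<in> TI D" and s: "set is \<subseteq> {..<n}" "set js \<subseteq> {..<n}" for t "is" js
  proof -
    have ct: "\<forall>ls\<in>lists (mdual A ?N). \<forall>ls'\<in>lists (mdual B ?N'). \<forall>ms\<in>lists (carrier ?N).
           list_all2 (\<lambda>l l'. \<forall>u\<in>carrier ?N. l' (?r u) = f (l u)) ls ls' \<longrightarrow>
           T t B ?x ls' (map ?r ms) = f (T t A x ls ms)"
      using ctensors Ax t B f unfolding crystal_tensors_def by blast
    have "map ?\<gamma> js = map ?r (map \<beta> js)" using s by (auto simp: subset_iff)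
    then have "T t B ?x (map (frame_coord n B ?N' ?\<gamma>) is) (map ?\<gamma> js) = T t B ?x (map (frame_coord n B ?N' ?\<gamma>) is) (map ?r (map \<beta> js))"
      by (simp only:)
    also have "T t B ?x (map (frame_coord n B ?N' ?\<gamma>) is) (map ?r (map \<beta> js)) = f (T t A x (map coord is) (map \<beta> js))"
    proof (rule ct[rule_format])
      show "list_all2 (\<lambda>l l'. \<forall>u\<in>carrier ?N. l' (?r u) = f (l u)) (map coord is) (map (frame_coord n B ?N' ?\<gamma>) is)"
        using s frame_base_change(2)[OF fh mB bc(1)]
        by (auto simp: list_all2_map1 list_all2_map2 subset_iff intro!: list.rel_refl_strong)
    qed (use s coord_mdual G.coord_mdual in \<open>auto simp: subset_iff\<close>)
    also have "T t A x (map coord is) (map \<beta> js) = strc A (T0 D t is js)"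
      using \<beta> t s by (auto simp: isom_torsor_def)
    also have "f (strc A (T0 D t is js)) = strc B (T0 D t is js)"
      using phomD(1)[OF f] T0_BW[OF t] by (simp add: walg_hom_def)
    finally show ?thesis .
  qed
  then show ?thesis
    unfolding \<gamma> isom_torsor_def using G.\<beta>_ext G.\<beta>_bij by auto
qed

lemma frob_mat_pull:
  assumes \<beta>: "\<beta> \<in> isom_torsor D M T A x"
  shows "framed.frob_mat B (Mdl M B (ppull Xf A B f x)) n (frame_pull D M A x B f \<beta>) (Frob M B (ppull Xf A B f x))
     = mmap n f (framed.frob_mat A (Mdl M A x) n \<beta> (Frob M A x))"
proof -
  note A = psite_prism[OF Ax]
  have Bx: "(B, ppull Xf A B f x) \<in> psite D Xf" by (rule psite_ppull[OF Xf Ax B f])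
  have mB: "module B (Mdl M B (ppull Xf A B f x))" using crystal Bx by (auto simp: prismatic_F_crystal_def)
  have fh: "ring_hom_cring A B f" by (rule phom_ring_hom[OF A B f])
  show ?thesis
    unfolding frame_pull_def
    by (rule framed.frob_mat_base_change[OF framed_isom[OF \<beta>] fh mB crystal_base_change(1)[OF B f] crystal_at(3)
          crystal_base_change(2)[OF B f]])
qed

end

end

text \<open>All entries come from A, and on fractions a/1 the map \<open>loc_map\<close> is given by
  \<open>f\<close>; base change of the Frobenius matrix does the rest.\<close>

lemma trivialized_pull:
  assumes Ax: "(A, x) \<in> psite D Xf" and B: "is_prism D B" and f: "f \<in> phom D A B"
    and \<beta>: "\<beta> \<in> isom_torsor D M T A x" and E: "E \<in> carrier A"
  shows "trivialized_frobenius D M B (ppull Xf A B f x) (f E) (frame_pull D M A x B f \<beta>) =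
    mmap n (loc_map B (f E) f) (trivialized_frobenius D M A x E \<beta>)"
proof -
  note A = psite_prism[OF Ax]
  have Bx: "(B, ppull Xf A B f x) \<in> psite D Xf" by (rule psite_ppull[OF Xf Ax B f])
  have fh: "ring_hom_cring A B f" by (rule phom_ring_hom[OF A B f])
  interpret localization A E using is_prismD(1)[OF A] E by (simp add: localization_def localization_axioms_def)
  show ?thesis
    unfolding trivialized_eq[OF Bx frame_pull_isom[OF Ax B f \<beta>]] trivialized_eq[OF Ax \<beta>] frob_mat_pull[OF Ax B f \<beta>] mmap_mmap
    using loc_map_loc_in[OF fh] mats_app[OF frob_mat_mats[OF Ax \<beta>]] by (intro mmap_cong) simp
qed

lemma trivialized_locally_mu:
  assumes Ax: "(A, x) \<in> psite D Xf" and \<beta>: "\<beta> \<in> isom_torsor D M T A x" and E: "E \<in> carrier A" "pI A = PIdl\<^bsub>A\<^esub> E"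
  shows "\<exists>B f. flat_cover D A B f \<and>
    mmap n (loc_map B (f E) f) (trivialized_frobenius D M A x E \<beta>) \<in> double_coset D B (f E)"
proof -
  note A = psite_prism[OF Ax]
  obtain B f d where fc: "flat_cover D A B f" and d: "d \<in> carrier B" "pI B = PIdl\<^bsub>B\<^esub> d"
    and "\<exists>\<beta>\<in>isom_torsor D M T B (ppull Xf A B f x). trivialized_frobenius D M B (ppull Xf A B f x) d \<beta> \<in> double_coset D B d"
    using type_mu Ax unfolding prismatic_torsor_of_type_mu_def by blast
  then obtain \<gamma> where \<gamma>: "\<gamma> \<in> isom_torsor D M T B (ppull Xf A B f x)"
    and dc: "trivialized_frobenius D M B (ppull Xf A B f x) d \<gamma> \<in> double_coset D B d" by blast
  have B: "is_prism D B" and f: "f \<in> phom D A B" using fc by (auto simp: flat_cover_def)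
  let ?x = "ppull Xf A B f x"
  have Bx: "(B, ?x) \<in> psite D Xf" by (rule psite_ppull[OF Xf Ax B f])
  interpret f: ring_hom_cring A B f by (rule phom_ring_hom[OF A B f])
  have fE: "f E \<in> carrier B" using E by simp
  interpret L: localization B "f E" by unfold_locales (rule fE)
  \<comment> \<open>Since \<open>phom\<close> includes the equality of J with I B, the image of E
    generates J, just as d does.\<close>
  have pIB: "pI B = PIdl\<^bsub>B\<^esub> (f E)"
  proof
    have "f ` pI A \<subseteq> PIdl\<^bsub>B\<^esub> (f E)"
      using E by (auto simp: f.R.mem_PIdl f.S.mem_PIdl intro!: bexI[of _ "f b" for b])
    then show "pI B \<subseteq> PIdl\<^bsub>B\<^esub> (f E)"
      unfolding phomD(3)[OF f, symmetric] using fE by (intro f.S.genideal_minimal f.S.cgenideal_ideal)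
    have "f ` pI A \<subseteq> carrier B" by (auto simp: pI_def)
    then have "f ` pI A \<subseteq> pI B" using f.S.genideal_self phomD(3)[OF f] by metis
    moreover have "E \<in> pI A" using E f.R.cgenideal_self by simp
    ultimately have "f E \<in> pI B" by blast
    then show "PIdl\<^bsub>B\<^esub> (f E) \<subseteq> pI B" unfolding d(2) using d(1) by (intro f.S.cgenideal_minimal f.S.cgenideal_ideal)
  qed
  have "cartier B (PIdl\<^bsub>B\<^esub> d)" using is_prismD(9)[OF B] d(2) by simp
  then obtain u where u: "u \<in> Units B" "d = u \<otimes>\<^bsub>B\<^esub> f E"
    using f.S.same_PIdl_unit[OF _ d(1) fE] d(2) pIB by metis
  let ?s = "strc B" and ?i = "loc_in B (f E)" and ?L = "loc B (f E)"
  let ?F = "Frob M B ?x" and ?N = "Mdl M B ?x"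
  let ?H = "framed.frob_mat B ?N n \<gamma> ?F"
  have "mmap n ?i ?H \<in> double_coset D B (f E)"
    using dc unfolding trivialized_eq[OF Bx \<gamma>]
    by (intro double_coset_change_generator[OF W is_prismD(1)[OF B] is_prismD(3)[OF B] cochar tensors u(1) fE u(2) frob_mat_mats[OF Bx \<gamma>]])
  then obtain a b where a: "a \<in> grp D B ?s" and b: "b \<in> grp D B ?s"
    and H: "mmap n ?i ?H = mmul n ?L (mmul n ?L (mmap n ?i a) (mu_at D ?L (\<lambda>w. ?i (?s w)) (?i (f E)))) (mmap n ?i b)"
    unfolding double_coset_def by blast
  have "frame_pull D M A x B f \<beta> \<in> isom_torsor D M T B ?x" by (rule frame_pull_isom[OF Ax B f \<beta>])
  then obtain g where g: "g \<in> grp D B ?s" and pull: "frame_pull D M A x B f \<beta> = frame_act D ?N \<gamma> g"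
    using isom_act[OF Bx \<gamma>] unfolding bij_betw_def by blast
  note gr = is_prismD(1)[OF B] strc_T0(1)[OF B]
  have grm: "k \<in> mats n B" if "k \<in> grp D B ?s" for k using that by (simp add: grp_def GL_def)
  interpret \<phi>: ring_hom_cring B B "phi (pp D) B" by (rule phi_ring_hom[OF B])
  let ?\<phi>g = "mmap n (phi (pp D) B) g"
  \<comment> \<open>\<phi> is only \<sigma>-linear over W, but it fixes the coordinates of the
    tensors, so it maps \<G>(B) to itself.\<close>
  have \<phi>g: "?\<phi>g \<in> grp D B ?s"
    by (rule grp_mmap[OF gr \<phi>.ring_hom_cring_axioms _ g]) (use strc_T0(2)[OF B] in auto)
  have ig: "minv n B g \<in> grp D B ?s" by (rule grp_minv[OF gr g])
  have iga: "mmul n B (minv n B g) a \<in> grp D B ?s" by (rule grp_mmul[OF gr ig a])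
  have b\<phi>: "mmul n B b ?\<phi>g \<in> grp D B ?s" by (rule grp_mmul[OF gr b \<phi>g])
  have cl: "mmap n ?i k \<in> mats n ?L" if "k \<in> grp D B ?s" for k
    by (rule L.I.mmap_closed[OF grm[OF that]])
  have si: "ring_hom_cring (BW D) ?L (\<lambda>w. ?i (?s w))"
    using ring_hom_trans[OF is_prismD(3)[OF B] L.loc_in_hom] by (intro ring_hom_cringI W L.cring_loc) (simp add: comp_def)
  have mu: "mu_at D ?L (\<lambda>w. ?i (?s w)) (?i (f E)) \<in> mats n ?L"
    using mu_at_grp[OF si cochar tensors L.loc_in_E_unit] by (simp add: grp_def GL_def)
  have "mmap n (loc_map B (f E) f) (trivialized_frobenius D M A x E \<beta>) =
      trivialized_frobenius D M B ?x (f E) (frame_act D ?N \<gamma> g)"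
    by (simp only: trivialized_pull[OF Ax B f \<beta> E(1), symmetric] pull)
  also have "\<dots> = mmul n ?L (mmul n ?L (mmap n ?i (minv n B g)) (mmap n ?i ?H)) (mmap n ?i ?\<phi>g)"
    unfolding trivialized_act[OF Bx \<gamma> g fE] trivialized_eq[OF Bx \<gamma>] ..
  \<comment> \<open>Regrouping leaves the middle factor untouched: the inverse of \<open>g\<close>
    is absorbed by \<open>a\<close> on the left, and \<phi>(g) by \<open>b\<close> on the
    right.\<close>
  also have "\<dots> = mmul n ?L (mmul n ?L (mmul n ?L (mmap n ?i (minv n B g)) (mmap n ?i a)) (mu_at D ?L (\<lambda>w. ?i (?s w)) (?i (f E))))
       (mmul n ?L (mmap n ?i b) (mmap n ?i ?\<phi>g))"
    unfolding H using cl[OF ig] cl[OF a] cl[OF b] cl[OF \<phi>g] mu by (simp add: L.L.mmul_assoc)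
  also have "\<dots> = mmul n ?L (mmul n ?L (mmap n ?i (mmul n B (minv n B g) a)) (mu_at D ?L (\<lambda>w. ?i (?s w)) (?i (f E))))
       (mmap n ?i (mmul n B b ?\<phi>g))"
    by (simp only: L.I.mmap_mmul[OF grm[OF ig] grm[OF a]] L.I.mmap_mmul[OF grm[OF b] grm[OF \<phi>g]])
  finally have "mmap n (loc_map B (f E) f) (trivialized_frobenius D M A x E \<beta>) \<in> double_coset D B (f E)"
    unfolding double_coset_def using iga b\<phi> by blast
  then show ?thesis using fc by blast
qed

section \<open>Specialization to Breuil--Kisin prisms\<close>

lemma bkI: "is_cprism D R \<Longrightarrow> bk D R"
  by (simp add: bk_def prime)

lemma BK_psite:
  assumes "is_cprism D R" "x \<in> el (S_cp Xf) R" shows "(BK D R, x) \<in> psite D Xf"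
  using bk.is_prism_A[OF bkI[OF assms(1)]] bk.rbar_A[OF bkI[OF assms(1)]] assms(2) by (simp add: psite_def S_cp_def)

text \<open>The two halves of \<open>C_BK\<close>, namely being a point over R[[t]][1/E] and lying
  in the double coset flat locally, are the two general statements applied to R[[t]], whose ideal is
  generated by E.\<close>

lemma xi_sharp_C_BK:
  assumes R: "is_cprism D R" and x: "x \<in> el (S_cp Xf) R" and \<beta>: "\<beta> \<in> sec (J_BK D M T) R x"
  shows "xi_sharp D M R x \<beta> \<in> C_BK D R"
proof -
  interpret bk D R by (rule bkI[OF R])
  have \<beta>': "\<beta> \<in> isom_torsor D M T A x" using \<beta> by (simp add: J_BK_def)
  show ?thesis
    unfolding C_BK_def xi_sharp_def
    using trivialized_grp[OF BK_psite[OF R x] \<beta>' E_in_pI] trivialized_locally_mu[OF BK_psite[OF R x] \<beta>' E_closed pI_A]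
    by blast
qed

text \<open>The coefficientwise map is a map of prisms that sends E to E and reduces to
  \<open>f\<close>, so this is the pullback formula for trivialized Frobenii.\<close>

lemma xi_sharp_natural:
  assumes R: "is_cprism D R" "is_cprism D S" and f: "f \<in> cp_hom D R S" and x: "x \<in> el (S_cp Xf) R" and \<beta>: "\<beta> \<in> sec (J_BK D M T) R x"
  shows "xi_sharp D M S (tr (S_cp Xf) R S f x) (res (J_BK D M T) R S f x \<beta>) = C_map D R S f (xi_sharp D M R x \<beta>)"
proof -
  interpret bk_map D R S f using bkI[OF R(1)] bkI[OF R(2)] f by (simp add: bk_map_def bk_map_axioms_def)
  have \<beta>': "\<beta> \<in> isom_torsor D M T R.A x" using \<beta> by (simp add: J_BK_def)
  show ?thesis
    using trivialized_pull[OF BK_psite[OF R(1) x] S.is_prism_A F_phom \<beta>' R.E_closed]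
    by (simp add: xi_sharp_def C_map_def J_BK_def ppull_F F_E)
qed

lemma xi_sharp_equivariant:
  assumes R: "is_cprism D R" and x: "x \<in> el (S_cp Xf) R" and \<beta>: "\<beta> \<in> sec (J_BK D M T) R x" and g: "g \<in> LG D R"
  shows "xi_sharp D M R x (act (J_BK D M T) R x \<beta> g) = Ad_phi D R (xi_sharp D M R x \<beta>) g"
proof -
  interpret bk D R by (rule bkI[OF R])
  have \<beta>': "\<beta> \<in> isom_torsor D M T A x" using \<beta> by (simp add: J_BK_def)
  have g': "g \<in> grp D A (strc A)" using g by (simp add: LG_def)
  then have "g \<in> mats n A" by (simp add: grp_def GL_def)
  \<comment> \<open>\<open>Ad_phi\<close> twists by the explicit Frobenius \<open>bk_frob\<close>,
    whereas a prism has its Frobenius from \<delta>; both agree on R[[t]].\<close>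
  then have "mmap n (phi p A) g = mmap n \<Phi> g" by (intro mmap_cong phi_eq) (rule mats_app)
  then show ?thesis
    using trivialized_act[OF BK_psite[OF R x] \<beta>' g' E_closed] by (simp add: xi_sharp_def Ad_phi_def J_BK_def)
qed

end

section \<open>The morphism to the quotient stack\<close>

lemma torsor_yoneda:
  assumes P: "torsor D F P" and R: "is_cprism D R" and z: "z \<in> el F R"
    and F_closed: "\<And>R S f z. is_cprism D R \<Longrightarrow> is_cprism D S \<Longrightarrow> f \<in> cp_hom D R S \<Longrightarrow> z \<in> el F R \<Longrightarrow> tr F R S f z \<in> el F S"
    and F_comp: "\<And>R S S' f g z. is_cprism D R \<Longrightarrow> is_cprism D S \<Longrightarrow> is_cprism D S' \<Longrightarrow> f \<in> cp_hom D R S \<Longrightarrow>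
      g \<in> cp_hom D S S' \<Longrightarrow> z \<in> el F R \<Longrightarrow> tr F R S' (compose (carrier R) g f) z = tr F S S' g (tr F R S f z)"
    and Q: "sec Q = (\<lambda>S f. sec P S (tr F R S f z))" "res Q = (\<lambda>S S' g f. res P S S' g (tr F R S f z))"
      "act Q = (\<lambda>S f. act P S (tr F R S f z))"
  shows "torsor D (yoneda D R) Q"
proof -
  have y: "el (yoneda D R) S = cp_hom D R S" "tr (yoneda D R) S S' g f = compose (carrier R) g f" for S S' g f
    by (simp_all add: yoneda_def)
  have cl: "tr F R S f z \<in> el F S" if "is_cprism D S" "f \<in> cp_hom D R S" for S f
    by (rule F_closed[OF R that z])
  have comp: "tr F R S' (compose (carrier R) g f) z = tr F S S' g (tr F R S f z)"
    if "is_cprism D S" "is_cprism D S'" "f \<in> cp_hom D R S" "g \<in> cp_hom D S S'" for S S' f g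
    by (rule F_comp[OF R that z])
  have 1: "\<forall>S z s. is_cprism D S \<and> z \<in> el F S \<and> s \<in> sec P S z \<longrightarrow>
        res P S S (restrict id (carrier S)) z s = s \<and>
        act P S z s (mone (rk D) (BK D S)) = s \<and>
        (\<forall>g\<in>LG D S. act P S z s g \<in> sec P S z \<and>
           (\<forall>h\<in>LG D S. act P S z (act P S z s g) h = act P S z s (mmul (rk D) (BK D S) g h)))"
    and 2: "\<forall>R S f z s. is_cprism D R \<and> is_cprism D S \<and> f \<in> cp_hom D R S \<and> z \<in> el F R \<and> s \<in> sec P R z \<longrightarrow>
        res P R S f z s \<in> sec P S (tr F R S f z) \<and>
        (\<forall>g\<in>LG D R. res P R S f z (act P R z s g)
            = act P S (tr F R S f z) (res P R S f z s) (mmap (rk D) (BK_map R f) g)) \<and>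
        (\<forall>T f'. is_cprism D T \<and> f' \<in> cp_hom D S T \<longrightarrow>
           res P R T (compose (carrier R) f' f) z s
         = res P S T f' (tr F R S f z) (res P R S f z s))"
    and 3: "\<forall>R z s. is_cprism D R \<and> z \<in> el F R \<and> s \<in> sec P R z \<longrightarrow>
        bij_betw (act P R z s) (LG D R) (sec P R z)"
    and 4: "\<forall>R z. is_cprism D R \<and> z \<in> el F R \<longrightarrow>
        (\<exists>S f. cp_cover D R S f \<and> sec P S (tr F R S f z) \<noteq> {})"
    and 5: "\<forall>R z S f s. z \<in> el F R \<and> cp_cover D R S f \<and> s \<in> sec P S (tr F R S f z) \<and>
        (\<forall>T g h. is_cprism D T \<and> g \<in> cp_hom D S T \<and> h \<in> cp_hom D S T \<and>
           compose (carrier R) g f = compose (carrier R) h f \<longrightarrow>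
           res P S T g (tr F R S f z) s = res P S T h (tr F R S f z) s) \<longrightarrow>
        (\<exists>!s'. s' \<in> sec P R z \<and> res P R S f z s' = s)"
    using P unfolding torsor_def gpresheaf_def by - (elim conjE, assumption)+
  show ?thesis
    unfolding torsor_def gpresheaf_def y Q
  proof (intro conjI allI impI)
    fix S f s assume "is_cprism D S \<and> f \<in> cp_hom D R S \<and> s \<in> sec P S (tr F R S f z)"
    then have a: "is_cprism D S \<and> tr F R S f z \<in> el F S \<and> s \<in> sec P S (tr F R S f z)" using cl by blast
    note 11 = 1[rule_format, OF a]
    show "res P S S (restrict id (carrier S)) (tr F R S f z) s = s"
      "act P S (tr F R S f z) s (mone (rk D) (BK D S)) = s" using 11 by blast+
    show "\<forall>g\<in>LG D S. act P S (tr F R S f z) s g \<in> sec P S (tr F R S f z) \<and>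
       (\<forall>h\<in>LG D S. act P S (tr F R S f z) (act P S (tr F R S f z) s g) h = act P S (tr F R S f z) s (mmul (rk D) (BK D S) g h))"
      using 1[rule_format, OF a] by blast
    show "bij_betw (act P S (tr F R S f z) s) (LG D S) (sec P S (tr F R S f z))"
      by (rule 3[rule_format, OF a])
  next
    fix S S' g f s
    assume a: "is_cprism D S \<and> is_cprism D S' \<and> g \<in> cp_hom D S S' \<and> f \<in> cp_hom D R S \<and> s \<in> sec P S (tr F R S f z)"
    then have b: "is_cprism D S \<and> is_cprism D S' \<and> g \<in> cp_hom D S S' \<and> tr F R S f z \<in> el F S \<and> s \<in> sec P S (tr F R S f z)"
      using cl by blast
    have c: "tr F R S' (compose (carrier R) g f) z = tr F S S' g (tr F R S f z)" using comp a by blast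
    note 22 = 2[rule_format, OF b]
    show "res P S S' g (tr F R S f z) s \<in> sec P S' (tr F R S' (compose (carrier R) g f) z)"
      unfolding c using 22 by blast
    show "\<forall>h\<in>LG D S. res P S S' g (tr F R S f z) (act P S (tr F R S f z) s h) =
      act P S' (tr F R S' (compose (carrier R) g f) z) (res P S S' g (tr F R S f z) s) (mmap (rk D) (BK_map S g) h)"
      unfolding c using 2 b by blast
    fix S'' g' assume d: "is_cprism D S'' \<and> g' \<in> cp_hom D S' S''"
    show "res P S S'' (compose (carrier S) g' g) (tr F R S f z) s =
       res P S' S'' g' (tr F R S' (compose (carrier R) g f) z) (res P S S' g (tr F R S f z) s)"
      unfolding c using 2 b d by blast
  next
    fix S f assume a: "is_cprism D S \<and> f \<in> cp_hom D R S"
    then obtain S' g where g: "cp_cover D S S' g" "sec P S' (tr F S S' g (tr F R S f z)) \<noteq> {}"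
      using 4 cl by blast
    have "tr F R S' (compose (carrier R) g f) z = tr F S S' g (tr F R S f z)"
      using comp a g(1) by (simp add: cp_cover_def)
    then show "\<exists>S' g. cp_cover D S S' g \<and> sec P S' (tr F R S' (compose (carrier R) g f) z) \<noteq> {}"
      using g by (intro exI[of _ S'] exI[of _ g]) simp
  next
    fix S f S' g s
    assume a: "f \<in> cp_hom D R S \<and> cp_cover D S S' g \<and> s \<in> sec P S' (tr F R S' (compose (carrier R) g f) z) \<and>
       (\<forall>T h h'. is_cprism D T \<and> h \<in> cp_hom D S' T \<and> h' \<in> cp_hom D S' T \<and>
          compose (carrier S) h g = compose (carrier S) h' g \<longrightarrow>
          res P S' T h (tr F R S' (compose (carrier R) g f) z) s = res P S' T h' (tr F R S' (compose (carrier R) g f) z) s)"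
    then have S: "is_cprism D S" "is_cprism D S'" "g \<in> cp_hom D S S'" by (auto simp: cp_cover_def)
    have c: "tr F R S' (compose (carrier R) g f) z = tr F S S' g (tr F R S f z)" using comp S a by blast
    show "\<exists>!s'. s' \<in> sec P S (tr F R S f z) \<and> res P S S' g (tr F R S f z) s' = s"
      by (rule 5[rule_format]) (use a cl[OF S(1)] in \<open>simp add: c\<close>)
  qed
qed

section \<open>Objects of the quotient stack over points of the framed prismatization\<close>

context prismatic_setting
begin

lemma complete_walg_cprism: "is_cprism D R \<Longrightarrow> complete_walg D (walg.truncate R)"
  by (rule bk.complete_walg_truncate[OF bkI])

lemma cp_hom_truncate: "f \<in> cp_hom D R S \<Longrightarrow> f \<in> walg_hom D (walg.truncate R) (walg.truncate S)"
  by (simp add: cp_hom_def walg_hom_truncate)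

lemma S_cp_closed:
  assumes "is_cprism D R" "is_cprism D S" "f \<in> cp_hom D R S" "x \<in> el (S_cp Xf) R"
  shows "tr (S_cp Xf) R S f x \<in> el (S_cp Xf) S"
proof -
  have "x \<in> pts Xf (walg.truncate R)" using assms(4) by (simp add: S_cp_def)
  then have "pull Xf (walg.truncate R) (walg.truncate S) f x \<in> pts Xf (walg.truncate S)"
    using Xf complete_walg_cprism[OF assms(1)] complete_walg_cprism[OF assms(2)] cp_hom_truncate[OF assms(3)]
    unfolding is_functor_def by blast
  then show ?thesis by (simp add: S_cp_def)
qed

lemma S_cp_compose:
  assumes "is_cprism D R" "is_cprism D S" "is_cprism D S'" "f \<in> cp_hom D R S" "g \<in> cp_hom D S S'" "x \<in> el (S_cp Xf) R"
  shows "tr (S_cp Xf) R S' (compose (carrier R) g f) x = tr (S_cp Xf) S S' g (tr (S_cp Xf) R S f x)"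
proof -
  have c: "carrier (walg.truncate R) = carrier R" by (rule same_ops_simps(1)[OF same_ops_truncate])
  have "x \<in> pts Xf (walg.truncate R)" using assms(6) by (simp add: S_cp_def)
  then have "pull Xf (walg.truncate R) (walg.truncate S') (compose (carrier (walg.truncate R)) g f) x =
    pull Xf (walg.truncate S) (walg.truncate S') g (pull Xf (walg.truncate R) (walg.truncate S) f x)"
    using Xf complete_walg_cprism[OF assms(1)] complete_walg_cprism[OF assms(2)] complete_walg_cprism[OF assms(3)]
      cp_hom_truncate[OF assms(4)] cp_hom_truncate[OF assms(5)]
    unfolding is_functor_def by blast
  then show ?thesis by (simp add: S_cp_def c)
qed

abbreviation "J \<equiv> J_BK D M T"
abbreviation "pb R S f x \<equiv> tr (S_cp Xf) R S f x"

lemma xi_object_simps: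
  "sec (xi_object D Xf M T R x) = (\<lambda>S f. sec J S (pb R S f x))"
  "res (xi_object D Xf M T R x) = (\<lambda>S S' g f. res J S S' g (pb R S f x))"
  "act (xi_object D Xf M T R x) = (\<lambda>S f. act J S (pb R S f x))"
  "alp (xi_object D Xf M T R x) = (\<lambda>S f. xi_sharp D M S (pb R S f x))"
  by (simp_all add: xi_object_def)

context
  assumes torsor: "torsor D (S_cp Xf) J"
begin

lemma quot_object_xi:
  assumes R: "is_cprism D R" and x: "x \<in> el (S_cp Xf) R"
  shows "quot_object D R (xi_object D Xf M T R x)"
  unfolding quot_object_def
proof (intro conjI allI impI)
  show "torsor D (yoneda D R) (xi_object D Xf M T R x)"
    by (rule torsor_yoneda[OF torsor R x S_cp_closed S_cp_compose]) (simp_all add: xi_object_simps)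
next
  fix S f s assume a: "is_cprism D S \<and> f \<in> cp_hom D R S \<and> s \<in> sec (xi_object D Xf M T R x) S f"
  then have S: "is_cprism D S" "f \<in> cp_hom D R S" "s \<in> sec J S (pb R S f x)" by (simp_all add: xi_object_simps)
  have xS: "pb R S f x \<in> el (S_cp Xf) S" by (rule S_cp_closed[OF R S(1,2) x])
  show "alp (xi_object D Xf M T R x) S f s \<in> C_BK D S"
    unfolding xi_object_simps by (rule xi_sharp_C_BK[OF S(1) xS S(3)])
  show "\<forall>g\<in>LG D S. alp (xi_object D Xf M T R x) S f (act (xi_object D Xf M T R x) S f s g) =
     Ad_phi D S (alp (xi_object D Xf M T R x) S f s) g"
    unfolding xi_object_simps using xi_sharp_equivariant[OF S(1) xS S(3)] by blast
  fix S' g assume g: "is_cprism D S' \<and> g \<in> cp_hom D S S'"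
  then show "alp (xi_object D Xf M T R x) S' (compose (carrier R) g f) (res (xi_object D Xf M T R x) S S' g f s) =
     C_map D S S' g (alp (xi_object D Xf M T R x) S f s)"
    unfolding xi_object_simps using S_cp_compose[OF R S(1) _ S(2) _ x] xi_sharp_natural[OF S(1) _ _ xS S(3)] by simp
qed

text \<open>By functoriality of the points, the pullback of the object over \<open>z\<close> has the
  same sections and structure maps as the object over the pullback of \<open>z\<close>. The
  transition isomorphisms can therefore be identities, for which the cocycle condition is
  immediate.\<close>

lemma stack_morphism_xi: "stack_morphism D (S_cp Xf) (xi_object D Xf M T) (\<lambda>R R' f x R'' g \<beta>. \<beta>)"
  unfolding stack_morphism_def
proof (intro conjI allI impI)
  show "quot_object D R (xi_object D Xf M T R z)" if "is_cprism D R \<and> z \<in> el (S_cp Xf) R" for R z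
    using that quot_object_xi by blast
next
  fix R S f z assume "is_cprism D R \<and> is_cprism D S \<and> f \<in> cp_hom D R S \<and> z \<in> el (S_cp Xf) R"
  then have a: "is_cprism D R" "is_cprism D S" "f \<in> cp_hom D R S" "z \<in> el (S_cp Xf) R" by auto
  have c: "pb R S' (compose (carrier R) g f) z = pb S S' g (pb R S f z)" if "is_cprism D S'" "g \<in> cp_hom D S S'" for S' g
    by (rule S_cp_compose[OF a(1,2) that(1) a(3) that(2) a(4)])
  show "quot_morphism D S (quot_pull R f (xi_object D Xf M T R z)) (xi_object D Xf M T S (pb R S f z)) (\<lambda>R'' g \<beta>. \<beta>)"
    unfolding quot_morphism_def quot_pull_def by (auto simp: c xi_object_simps)
qed auto

text \<open>A section \<beta> trivializes the pulled back torsor by sending \<open>g\<close> to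
  \<beta> g. Compatibility with the maps to the target space is naturality at the restriction of
  \<beta> followed by equivariance.\<close>

lemma quot_morphism_xi:
  assumes R: "is_cprism D R" and x: "x \<in> el (S_cp Xf) R" and \<beta>: "\<beta> \<in> sec J R x"
  shows "quot_morphism D R (quot_proj D R (xi_sharp D M R x \<beta>)) (xi_object D Xf M T R x)
    (\<lambda>S f g. act J S (pb R S f x) (res J R S f x \<beta>) g)"
proof -
  have "gpresheaf D (S_cp Xf) J" using torsor by (simp add: torsor_def)
  then have 1: "\<forall>R z s. is_cprism D R \<and> z \<in> el (S_cp Xf) R \<and> s \<in> sec J R z \<longrightarrow>
        res J R R (restrict id (carrier R)) z s = s \<and>
        act J R z s (mone n (BK D R)) = s \<and>
        (\<forall>g\<in>LG D R. act J R z s g \<in> sec J R z \<and>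
           (\<forall>h\<in>LG D R. act J R z (act J R z s g) h = act J R z s (mmul n (BK D R) g h)))"
    and 2: "\<forall>R S f z s. is_cprism D R \<and> is_cprism D S \<and> f \<in> cp_hom D R S \<and> z \<in> el (S_cp Xf) R \<and> s \<in> sec J R z \<longrightarrow>
        res J R S f z s \<in> sec J S (pb R S f z) \<and>
        (\<forall>g\<in>LG D R. res J R S f z (act J R z s g)
            = act J S (pb R S f z) (res J R S f z s) (mmap n (BK_map R f) g)) \<and>
        (\<forall>T f'. is_cprism D T \<and> f' \<in> cp_hom D S T \<longrightarrow>
           res J R T (compose (carrier R) f' f) z s
         = res J S T f' (pb R S f z) (res J R S f z s))"
    unfolding gpresheaf_def by - (elim conjE, assumption)+
  show ?thesis
    unfolding quot_morphism_def
  proof (intro allI impI)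
    fix S f g assume "is_cprism D S \<and> f \<in> cp_hom D R S \<and> g \<in> sec (quot_proj D R (xi_sharp D M R x \<beta>)) S f"
    then have S: "is_cprism D S" "f \<in> cp_hom D R S" and g: "g \<in> LG D S" by (simp_all add: quot_proj_def)
    let ?\<beta> = "res J R S f x \<beta>"
    have xS: "pb R S f x \<in> el (S_cp Xf) S" by (rule S_cp_closed[OF R S x])
    note r = 2[rule_format, OF conjI[OF R conjI[OF S(1) conjI[OF S(2) conjI[OF x \<beta>]]]]]
    have s: "?\<beta> \<in> sec J S (pb R S f x)" using r by (rule conjunct1)
    note a = 1[rule_format, OF conjI[OF S(1) conjI[OF xS s]], THEN conjunct2, THEN conjunct2, rule_format, OF g]
    have alpha: "xi_sharp D M S (pb R S f x) (act J S (pb R S f x) ?\<beta> g) = Ad_phi D S (C_map D R S f (xi_sharp D M R x \<beta>)) g"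
      using xi_sharp_equivariant[OF S(1) xS s g] xi_sharp_natural[OF R S x \<beta>] by simp
    have assoc: "act J S (pb R S f x) ?\<beta> (mmul n (BK D S) g h) = act J S (pb R S f x) (act J S (pb R S f x) ?\<beta> g) h"
      if "h \<in> LG D S" for h using a that by simp
    \<comment> \<open>Restriction is compatible with the action and transitive, so restricting
      \<beta> g amounts to letting the restricted \<open>g\<close> act on the restricted
      \<beta>.\<close>
    have rest: "act J S' (pb R S' (compose (carrier R) k f) x) (res J R S' (compose (carrier R) k f) x \<beta>) (mmap n (BK_map S k) g)
       = res J S S' k (pb R S f x) (act J S (pb R S f x) ?\<beta> g)" if k: "is_cprism D S'" "k \<in> cp_hom D S S'" for S' k
    proof -
      note r' = 2[rule_format, OF conjI[OF S(1) conjI[OF k(1) conjI[OF k(2) conjI[OF xS s]]]]]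
      have "res J S S' k (pb R S f x) (act J S (pb R S f x) ?\<beta> g)
          = act J S' (pb S S' k (pb R S f x)) (res J S S' k (pb R S f x) ?\<beta>) (mmap n (BK_map S k) g)"
        by (rule bspec[OF conjunct1[OF conjunct2[OF r']] g])
      moreover have "res J R S' (compose (carrier R) k f) x \<beta> = res J S S' k (pb R S f x) ?\<beta>"
        using r k by blast
      ultimately show ?thesis using S_cp_compose[OF R S(1) k(1) S(2) k(2) x] by simp
    qed
    let ?P = "quot_proj D R (xi_sharp D M R x \<beta>)" and ?Q = "xi_object D Xf M T R x"
    let ?\<theta> = "\<lambda>S f g. act J S (pb R S f x) (res J R S f x \<beta>) g"
    have "?\<theta> S f g \<in> sec ?Q S f" unfolding xi_object_simps using a by (rule conjunct1)
    moreover have "alp ?Q S f (?\<theta> S f g) = alp ?P S f g"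
      unfolding xi_object_simps using alpha by (simp add: quot_proj_def)
    moreover have "\<forall>h\<in>LG D S. ?\<theta> S f (act ?P S f g h) = act ?Q S f (?\<theta> S f g) h"
      unfolding xi_object_simps using assoc by (simp add: quot_proj_def)
    moreover have "\<forall>S' k. is_cprism D S' \<and> k \<in> cp_hom D S S' \<longrightarrow>
        ?\<theta> S' (compose (carrier R) k f) (res ?P S S' k f g) = res ?Q S S' k f (?\<theta> S f g)"
      unfolding xi_object_simps using rest by (simp add: quot_proj_def)
    ultimately show "?\<theta> S f g \<in> sec ?Q S f \<and> alp ?Q S f (?\<theta> S f g) = alp ?P S f g \<and>
        (\<forall>h\<in>LG D S. ?\<theta> S f (act ?P S f g h) = act ?Q S f (?\<theta> S f g) h) \<and>
        (\<forall>S' k. is_cprism D S' \<and> k \<in> cp_hom D S S' \<longrightarrow>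
          ?\<theta> S' (compose (carrier R) k f) (res ?P S S' k f g) = res ?Q S S' k f (?\<theta> S f g))"
      by blast
  qed
qed

end

end

text \<open>The induced morphism of stacks is recorded by its objects together with identity
  transition maps. The last clause ties it to the map on the torsor: the two ways from
  \<open>J_BK\<close> to the quotient stack, through the points and through the target of
  \<open>xi_sharp\<close>, agree up to the isomorphism that sends \<open>g\<close> to \<beta>
  g.\<close>

theorem lemma9p2:
  fixes D :: "('w, 'i) group_datum"
    and S :: "('a, 'w, 'x) space"
    and \<A> :: "('a, 'w, 'y) space"
    and q :: "('a, 'w) walg \<Rightarrow> 'y \<Rightarrow> 'x"
    and M :: "(nat \<Rightarrow> 'a, 'w, 'a, 'x, (nat \<Rightarrow> 'a, 'w, 'a, 'y) h1class) crystal"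
    and T :: "'i \<Rightarrow> (nat \<Rightarrow> 'a, 'w, 'a) prism \<Rightarrow> 'x \<Rightarrow>
      ((nat \<Rightarrow> 'a, 'w, 'a, 'y) h1class \<Rightarrow> nat \<Rightarrow> 'a) list \<Rightarrow>
      (nat \<Rightarrow> 'a, 'w, 'a, 'y) h1class list \<Rightarrow> nat \<Rightarrow> 'a"
  assumes "admissible_datum TYPE(nat \<Rightarrow> 'a) D"
    and "formal_scheme D S" and "formal_scheme D \<A>" and "space_map D \<A> S q"
    and M_def: "M = H1_prismatic D S \<A> q"
    and "prismatic_F_crystal D S M"
    and "crystal_tensors D S M T"
    and "prismatic_torsor_of_type_mu D S M T"
    and "torsor D (S_cp S) (J_BK D M T)"
  shows "(\<forall>R x \<beta>. is_cprism D R \<and> x \<in> el (S_cp S) R \<and> \<beta> \<in> sec (J_BK D M T) R x \<longrightarrow>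
            xi_sharp D M R x \<beta> \<in> C_BK D R)
       \<and> (\<forall>R R' f x \<beta>. is_cprism D R \<and> is_cprism D R' \<and> f \<in> cp_hom D R R' \<and>
            x \<in> el (S_cp S) R \<and> \<beta> \<in> sec (J_BK D M T) R x \<longrightarrow>
            xi_sharp D M R' (tr (S_cp S) R R' f x) (res (J_BK D M T) R R' f x \<beta>)
          = C_map D R R' f (xi_sharp D M R x \<beta>))
       \<and> (\<forall>R x \<beta> g. is_cprism D R \<and> x \<in> el (S_cp S) R \<and> \<beta> \<in> sec (J_BK D M T) R x \<and> g \<in> LG D R \<longrightarrow>
            xi_sharp D M R x (act (J_BK D M T) R x \<beta> g) = Ad_phi D R (xi_sharp D M R x \<beta>) g)
       \<and> stack_morphism D (S_cp S) (xi_object D S M T) (\<lambda>R R' f x R'' g \<beta>. \<beta>)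
       \<and> (\<forall>R x \<beta>. is_cprism D R \<and> x \<in> el (S_cp S) R \<and> \<beta> \<in> sec (J_BK D M T) R x \<longrightarrow>
            quot_morphism D R (quot_proj D R (xi_sharp D M R x \<beta>)) (xi_object D S M T R x)
              (\<lambda>R' f g. act (J_BK D M T) R' (tr (S_cp S) R R' f x) (res (J_BK D M T) R R' f x \<beta>) g))"
proof -
  interpret prismatic_setting D S M T
    using assms by (simp add: prismatic_setting_def admissible_datum_def formal_scheme_def is_flat_sheaf_def)
  show ?thesis
    using xi_sharp_C_BK xi_sharp_natural xi_sharp_equivariant stack_morphism_xi[OF assms(9)] quot_morphism_xi[OF assms(9)]
    by (intro conjI allI impI) (simp_all only:)
qed

end
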